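(* Let $n\ge 2$ and let $\Omega_\gamma\subset\mathbb{R}^n$ be the outward cuspidal domain and $w$ the boundary weight described in the context. Consider the reduced linear weighted Schrödinger–Steklov eigenvalue problem $$-\Delta u+u=0\text{ in }\Omega_\gamma,\qquad \nabla u\cdot\nu=\lambda\,w\,u\text{ on }\partial\Omega_\gamma,\qquad \int_{\partial\Omega_\gamma}u\,w\,ds=0,$$ where $(\lambda,u)\in\mathbb{R}\times(W^{1,2}(\Omega_\gamma)\setminus\{0\})$ is called an eigenpair if $\int_{\partial\Omega_\gamma}u\,w\,ds=0$ and $$\int_{\Omega_\gamma}\nabla u\cdot\nabla v\,dx+\int_{\Omega_\gamma}u\,v\,dx=\lambda\int_{\partial\Omega_\gamma}u\,v\,w\,ds\quad\text{for every }v\in W^{1,2}(\Omega_\gamma).$$ Then the spectrum of this reduced problem is discrete and is given by a non-decreasing sequence $$0<\lambda_0\le\lambda_1\le\lambda_2\le\dots\le\lambda_k\le\dots,$$ where each eigenvalue is repeated according to its finite algebraic multiplicity, and $\lambda_k\to\infty$ as $k\to\infty$.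
   Context: Let $\gamma:[0,1]\to[0,\infty)$ be continuous, increasing and differentiable with $\gamma(0)=0$, $\gamma(1)=1$, $\gamma'$ increasing on $(0,1)$ and $\lim_{t\to0^+}\gamma'(t)=0$. Writing $x=(x',x_n)\in\mathbb{R}^{n-1}\times\mathbb{R}$, $$\Omega_\gamma=\{(x',x_n): |x'|<\gamma(x_n),\ 0<x_n\le 1\}\cup B^n\big((0,2),\sqrt2\big),$$ with $B^n((0,2),\sqrt2)$ the open ball of radius $\sqrt2$ centred at $(0,\dots,0,2)$. The continuous weight $w:\partial\Omega_\gamma\to\mathbb{R}$ is $w(x)=\gamma(x_n)$ at boundary points with $|x'|=\gamma(x_n)<1$, and $w(x)=1$ at the remaining boundary points. $ds$ is $(n-1)$-dimensional surface measure on $\partial\Omega_\gamma$, $\nu$ the unit outward normal; boundary integrals of Sobolev functions are understood via traces. *)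

theory Defs
  imports "HOL-Analysis.Analysis"
begin

definition hausdorff_normal :: "real \<Rightarrow> real" where
  "hausdorff_normal s = unit_ball_vol s / 2 powr s"

definition hausdorff_pre :: "real \<Rightarrow> real \<Rightarrow> 'a::euclidean_space set \<Rightarrow> ennreal" where
  "hausdorff_pre s \<delta> A =
     (INF C \<in> {C :: nat \<Rightarrow> 'a set. A \<subseteq> (\<Union>i. C i) \<and> (\<forall>i. bounded (C i) \<and> diameter (C i) \<le> \<delta>)}.
        (\<Sum>i. ennreal (hausdorff_normal s * diameter (C i) powr s)))"

text \<open>s-dimensional Hausdorff (outer) measure, normalised so that it agrees with
  Lebesgue measure for integer s.\<close>
definition hausdorff :: "real \<Rightarrow> 'a::euclidean_space set \<Rightarrow> ennreal" where
  "hausdorff s A = (SUP \<delta> \<in> {0<..}. hausdorff_pre s \<delta> A)"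

definition surf :: "'a::euclidean_space set \<Rightarrow> 'a measure" where
  "surf S = measure_of S (sets (restrict_space borel S)) (hausdorff (real (DIM('a)) - 1))"

fun Ck :: "nat \<Rightarrow> ('a::euclidean_space \<Rightarrow> real) \<Rightarrow> bool" where
  "Ck 0 f = continuous_on UNIV f"
| "Ck (Suc k) f = ((\<forall>x. f differentiable (at x)) \<and>
      (\<forall>b\<in>Basis. Ck k (\<lambda>x. frechet_derivative f (at x) b)))"

definition smooth_fun :: "('a::euclidean_space \<Rightarrow> real) \<Rightarrow> bool" where
  "smooth_fun f = (\<forall>k. Ck k f)"

definition test_fun :: "'a::euclidean_space set \<Rightarrow> ('a \<Rightarrow> real) \<Rightarrow> bool" where
  "test_fun \<Omega> \<phi> = (smooth_fun \<phi> \<and> compact (closure {x. \<phi> x \<noteq> 0}) \<and> closure {x. \<phi> x \<noteq> 0} \<subseteq> \<Omega>)"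

definition sq_int :: "'a::euclidean_space set \<Rightarrow> ('a \<Rightarrow> real) \<Rightarrow> bool" where
  "sq_int \<Omega> f = (f \<in> borel_measurable (lebesgue_on \<Omega>) \<and> integrable (lebesgue_on \<Omega>) (\<lambda>x. (f x)\<^sup>2))"

definition weak_grad :: "'a::euclidean_space set \<Rightarrow> ('a \<Rightarrow> real) \<Rightarrow> ('a \<Rightarrow> 'a) \<Rightarrow> bool" where
  "weak_grad \<Omega> u G = (sq_int \<Omega> u \<and> (\<forall>b\<in>Basis. sq_int \<Omega> (\<lambda>x. G x \<bullet> b)) \<and>
     (\<forall>\<phi>. test_fun \<Omega> \<phi> \<longrightarrow> (\<forall>b\<in>Basis.
        integral\<^sup>L (lebesgue_on \<Omega>) (\<lambda>x. u x * frechet_derivative \<phi> (at x) b)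
        = - integral\<^sup>L (lebesgue_on \<Omega>) (\<lambda>x. (G x \<bullet> b) * \<phi> x))))"

definition sobolev12 :: "'a::euclidean_space set \<Rightarrow> ('a \<Rightarrow> real) \<Rightarrow> bool" where
  "sobolev12 \<Omega> u = (\<exists>G. weak_grad \<Omega> u G)"

definition has_trace :: "'a::euclidean_space set \<Rightarrow> ('a \<Rightarrow> real) \<Rightarrow> ('a \<Rightarrow> real) \<Rightarrow> ('a \<Rightarrow> real) \<Rightarrow> bool" where
  "has_trace \<Omega> w u T = (T \<in> borel_measurable (surf (frontier \<Omega>)) \<and>
     (\<exists>\<phi> G\<phi> Gu. weak_grad \<Omega> u Gu \<and>
        (\<forall>k. weak_grad \<Omega> (\<phi> k) (G\<phi> k) \<and> continuous_on (closure \<Omega>) (\<phi> k)) \<and>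
        ((\<lambda>k. \<integral>\<^sup>+ x. ennreal ((\<phi> k x - u x)\<^sup>2) \<partial>(lebesgue_on \<Omega>)) \<longlonglongrightarrow> 0) \<and>
        ((\<lambda>k. \<integral>\<^sup>+ x. ennreal ((norm (G\<phi> k x - Gu x))\<^sup>2) \<partial>(lebesgue_on \<Omega>)) \<longlonglongrightarrow> 0) \<and>
        ((\<lambda>k. \<integral>\<^sup>+ x. ennreal (w x * (\<phi> k x - T x)\<^sup>2) \<partial>(surf (frontier \<Omega>))) \<longlonglongrightarrow> 0)))"

text \<open>e is the distinguished unit basis vector giving the last coordinate x_n = x \<bullet> e;
  x' corresponds to x - (x \<bullet> e) e.\<close>
definition cusp_dom :: "'a::euclidean_space \<Rightarrow> (real \<Rightarrow> real) \<Rightarrow> 'a set" where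
  "cusp_dom e \<gamma> = {x. norm (x - (x \<bullet> e) *\<^sub>R e) < \<gamma> (x \<bullet> e) \<and> 0 < x \<bullet> e \<and> x \<bullet> e \<le> 1}
                   \<union> ball (2 *\<^sub>R e) (sqrt 2)"

definition cusp_weight :: "'a::euclidean_space \<Rightarrow> (real \<Rightarrow> real) \<Rightarrow> 'a \<Rightarrow> real" where
  "cusp_weight e \<gamma> x = (if 0 \<le> x \<bullet> e \<and> x \<bullet> e \<le> 1 \<and> norm (x - (x \<bullet> e) *\<^sub>R e) = \<gamma> (x \<bullet> e)
                            \<and> \<gamma> (x \<bullet> e) < 1 then \<gamma> (x \<bullet> e) else 1)"

definition eigenpair :: "'a::euclidean_space set \<Rightarrow> ('a \<Rightarrow> real) \<Rightarrow> real \<Rightarrow> ('a \<Rightarrow> real) \<Rightarrow> bool" where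
  "eigenpair \<Omega> w lam u = (sobolev12 \<Omega> u \<and> \<not> (AE x in lebesgue_on \<Omega>. u x = 0) \<and>
     (\<exists>Gu Tu. weak_grad \<Omega> u Gu \<and> has_trace \<Omega> w u Tu \<and>
        integral\<^sup>L (surf (frontier \<Omega>)) (\<lambda>x. Tu x * w x) = 0 \<and>
        (\<forall>v Gv Tv. weak_grad \<Omega> v Gv \<and> has_trace \<Omega> w v Tv \<longrightarrow>
           integral\<^sup>L (lebesgue_on \<Omega>) (\<lambda>x. Gu x \<bullet> Gv x) + integral\<^sup>L (lebesgue_on \<Omega>) (\<lambda>x. u x * v x)
           = lam * integral\<^sup>L (surf (frontier \<Omega>)) (\<lambda>x. Tu x * Tv x * w x))))"

definition lin_indep_ae :: "'a::euclidean_space set \<Rightarrow> nat \<Rightarrow> (nat \<Rightarrow> 'a \<Rightarrow> real) \<Rightarrow> bool" where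
  "lin_indep_ae \<Omega> m U = (\<forall>c :: nat \<Rightarrow> real.
      (AE x in lebesgue_on \<Omega>. (\<Sum>i<m. c i * U i x) = 0) \<longrightarrow> (\<forall>i<m. c i = 0))"

end

theory Submission imports Defs "HOL-Library.Function_Algebras" begin

text \<open>Eigenpairs are critical points of a pencil of two quadratic forms on triples of a function, its
 weak gradient and its trace: the energy \<open>a = \<integral>|\<nabla>u|\<^sup>2 + u\<^sup>2\<close> and the weighted boundary form
 \<open>b = \<integral>u\<^sup>2 w\<close>. Discreteness follows once \<open>b\<close> is compact relative to \<open>a\<close>: for every \<open>\<epsilon>\<close> there
 are finitely many \<open>a\<close>-bounded functionals with \<open>b \<le> \<epsilon> a + \<Sum> l\<^sub>i\<^sup>2\<close>. To see this, integrate the derivative of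
 \<open>u\<close> along short segments entering the domain, which bounds \<open>b\<close> by the \<open>L\<^sup>2\<close> norm of \<open>u\<close> on a compact
 set and a small multiple of the energy. On the lateral surface the segments point along the axis, and
 the weight \<open>\<gamma>(x\<^sub>n) = |x'|\<close> compensates the slope of the surface as a graph over \<open>x\<^sub>n = 0\<close>. On compact sets
 a Poincare inequality on small cubes leaves finitely many averages.

 The constraint \<open>\<integral>u w = 0\<close> is imposed on \<open>u\<close> but not on the test functions. Infinitely many eigenpairs arise by
 maximising \<open>b/a\<close> among functions that are odd under a reflection orthogonal to the axis: they satisfy the
 constraint, and by parity their Euler-Lagrange equation extends to all test functions.\<close>

text \<open>The constraint is a real obstacle: testing the weak equation with v = 1 shows that an
  eigenfunction has zero integral over the domain besides zero weighted boundary mean. An extremal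
  function among all functions of zero boundary mean would in general solve the equation only up to
  a Lagrange multiplier; odd functions satisfy both conditions. They produce infinitely many
  eigenvalues, whereas the spectrum that is enumerated is that of the full problem: finiteness is
  shown for arbitrary boundary-orthonormal families of eigenvectors. Traces are defined through
  approximants continuous up to the boundary, so the form domain is the closure of such functions;
  estimates are proved for them and passed to the limit. Near the tip the lateral surface is almost
  parallel to the axis, and its slope as a graph over x_n = 0 blows up. Convexity gives \<gamma>'
  \<ge> \<gamma>, hence a slope of at most 1/|x'|, which is what the weight pays for. Its area is
  controlled separately, by viewing it sideways as a graph whose Lipschitz constant does not
  degenerate.\<close>

abbreviation leb :: "'a::euclidean_space set \<Rightarrow> 'a measure" where
 "leb \<equiv> lebesgue_on"

lemmas LINT_cong = Bochner_Integration.integral_cong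
 and LINT_nonneg = Bochner_Integration.integral_nonneg
 and LINT_sum = Bochner_Integration.integral_sum
 and integrable_dominated = Bochner_Integration.integrable_bound

section \<open>Pairs of quadratic forms\<close>

text \<open>Semidefinite and carried by a subspace of a type, since the vectors will be genuine
  functions: those vanishing almost everywhere are null without being zero.\<close>

locale psd_form =
 fixes H :: "'v::real_vector set" and f :: "'v \<Rightarrow> 'v \<Rightarrow> real"
 assumes sub: "subspace H"
  and add_left: "\<lbrakk>x \<in> H; y \<in> H; z \<in> H\<rbrakk> \<Longrightarrow> f (x + y) z = f x z + f y z"
  and scale_left: "\<lbrakk>x \<in> H; z \<in> H\<rbrakk> \<Longrightarrow> f (c *\<^sub>R x) z = c * f x z"
  and sym: "\<lbrakk>x \<in> H; y \<in> H\<rbrakk> \<Longrightarrow> f x y = f y x"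
  and nonneg: "x \<in> H \<Longrightarrow> 0 \<le> f x x"
begin

lemmas H_add = subspace_add[OF sub] and H_scale = subspace_scale[OF sub]
 and H_diff = subspace_diff[OF sub] and H_neg = subspace_neg[OF sub]
 and H_0 = subspace_0[OF sub] and H_sum = subspace_sum[OF sub]

lemma add_right: "\<lbrakk>x \<in> H; y \<in> H; z \<in> H\<rbrakk> \<Longrightarrow> f z (x + y) = f z x + f z y"
 using add_left sym H_add by metis

lemma scale_right: "\<lbrakk>x \<in> H; z \<in> H\<rbrakk> \<Longrightarrow> f z (c *\<^sub>R x) = c * f z x"
 using scale_left sym H_scale by metis

lemma minus_left: "\<lbrakk>x \<in> H; z \<in> H\<rbrakk> \<Longrightarrow> f (- x) z = - f x z"
 using scale_left[of x z "-1"] by simp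

lemma minus_right: "\<lbrakk>x \<in> H; z \<in> H\<rbrakk> \<Longrightarrow> f z (- x) = - f z x"
 using scale_right[of x z "-1"] by simp

lemma diff_left: "\<lbrakk>x \<in> H; y \<in> H; z \<in> H\<rbrakk> \<Longrightarrow> f (x - y) z = f x z - f y z"
 using add_left[of x "-y" z] minus_left[of y z] H_neg[of y] by simp

lemma diff_right: "\<lbrakk>x \<in> H; y \<in> H; z \<in> H\<rbrakk> \<Longrightarrow> f z (x - y) = f z x - f z y"
 using add_right[of x "-y" z] minus_right[of y z] H_neg[of y] by simp

lemma zero_left: "z \<in> H \<Longrightarrow> f 0 z = 0"
 using scale_left[of 0 z 0] H_0 by simp

lemma sum_left:
 assumes "finite I" "\<And>i. i \<in> I \<Longrightarrow> u i \<in> H" "z \<in> H"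
 shows "f (\<Sum>i\<in>I. c i *\<^sub>R u i) z = (\<Sum>i\<in>I. c i * f (u i) z)"
 using assms
proof (induction I)
 case empty
 then show ?case by (simp add: zero_left)
next
 case (insert i I)
 have "(\<Sum>i\<in>I. c i *\<^sub>R u i) \<in> H" using insert by (intro H_sum H_scale) auto
 then show ?case using insert by (simp add: add_left scale_left H_scale)
qed

lemma sum_right:
 assumes "finite I" "\<And>i. i \<in> I \<Longrightarrow> u i \<in> H" "z \<in> H"
 shows "f z (\<Sum>i\<in>I. c i *\<^sub>R u i) = (\<Sum>i\<in>I. c i * f z (u i))"
proof -
 have "(\<Sum>i\<in>I. c i *\<^sub>R u i) \<in> H" using assms by (intro H_sum H_scale) auto
 then have "f z (\<Sum>i\<in>I. c i *\<^sub>R u i) = f (\<Sum>i\<in>I. c i *\<^sub>R u i) z" using assms(3) sym by auto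
 also have "\<dots> = (\<Sum>i\<in>I. c i * f (u i) z)" by (rule sum_left[OF assms])
 also have "\<dots> = (\<Sum>i\<in>I. c i * f z (u i))" using assms sym by (intro sum.cong) auto
 finally show ?thesis .
qed

lemma square_add: "\<lbrakk>x \<in> H; y \<in> H\<rbrakk> \<Longrightarrow> f (x + y) (x + y) = f x x + 2 * f x y + f y y"
 by (simp add: add_left add_right H_add sym)

lemma square_diff: "\<lbrakk>x \<in> H; y \<in> H\<rbrakk> \<Longrightarrow> f (x - y) (x - y) = f x x - 2 * f x y + f y y"
 by (simp add: diff_left diff_right H_diff sym)

lemma square_scale: "x \<in> H \<Longrightarrow> f (c *\<^sub>R x) (c *\<^sub>R x) = c\<^sup>2 * f x x"
 by (simp add: scale_left scale_right H_scale power2_eq_square)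

text \<open>A null \<open>y\<close> needs an argument of its own: along \<open>x + c y\<close> the
  form is affine in c, and an affine function that stays nonnegative is constant.\<close>

lemma cauchy_schwarz:
 assumes "x \<in> H" "y \<in> H"
 shows "(f x y)\<^sup>2 \<le> f x x * f y y"
proof (cases "f y y = 0")
 case True
 have "f x y = 0"
 proof (rule ccontr)
  assume n: "f x y \<noteq> 0"
  \<comment> \<open>Any c that makes \<open>f x x + 2 c f x y\<close> negative would do; this one
    gives -1.\<close>
  let ?c = "- (f x x + 1) / (2 * f x y)"
  have "0 \<le> f (x + ?c *\<^sub>R y) (x + ?c *\<^sub>R y)" using assms by (intro nonneg H_add H_scale)
  also have "\<dots> = f x x + 2 * ?c * f x y" using assms True by (simp add: square_add H_scale scale_left scale_right)
  also have "\<dots> = -1" using n by (simp add: field_simps)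
  finally show False by simp
 qed
 then show ?thesis using True by simp
next
 case False
 then have p: "f y y > 0" using nonneg[OF assms(2)] by simp
 define c where "c = - f x y / f y y"
 have "0 \<le> f (x + c *\<^sub>R y) (x + c *\<^sub>R y)" using assms by (intro nonneg H_add H_scale)
 also have "\<dots> = f x x + 2 * c * f x y + c\<^sup>2 * f y y"
  using assms by (simp add: square_add H_scale scale_left scale_right power2_eq_square)
 also have "\<dots> = f x x - (f x y)\<^sup>2 / f y y" using p by (simp add: c_def field_simps power2_eq_square)
 finally show ?thesis using p by (simp add: field_simps)
qed

text \<open>Null vectors lie in the radical. Applied to \<mu> a - b this yields the Euler-Lagrange
  equation without differentiating along curves.\<close>

lemma null_right: "\<lbrakk>x \<in> H; y \<in> H; f y y = 0\<rbrakk> \<Longrightarrow> f x y = 0"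
 using cauchy_schwarz[of x y] by simp

lemma tendsto_pair:
 assumes "\<And>k. X k \<in> H" "x \<in> H" "z \<in> H" "(\<lambda>k. f (X k - x) (X k - x)) \<longlonglongrightarrow> 0"
 shows "(\<lambda>k. f (X k) z) \<longlonglongrightarrow> f x z"
proof -
 have "(\<lambda>k. sqrt (f (X k - x) (X k - x) * f z z)) \<longlonglongrightarrow> sqrt (0 * f z z)" by (intro tendsto_intros assms)
 then have *: "(\<lambda>k. sqrt (f (X k - x) (X k - x) * f z z)) \<longlonglongrightarrow> 0" by simp
 have "\<bar>f (X k - x) z\<bar> \<le> sqrt (f (X k - x) (X k - x) * f z z)" for k
  using cauchy_schwarz[of "X k - x" z] assms H_diff by (intro real_le_rsqrt) auto
 then have "(\<lambda>k. f (X k - x) z) \<longlonglongrightarrow> 0"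
  by (intro tendsto_rabs_zero_cancel[OF tendsto_sandwich[OF _ _ tendsto_const *]]) auto
 then have "(\<lambda>k. f (X k - x) z + f x z) \<longlonglongrightarrow> 0 + f x z" by (intro tendsto_intros)
 then show ?thesis using assms by (simp add: diff_left)
qed

lemma tendsto_square:
 assumes "\<And>k. X k \<in> H" "x \<in> H" "(\<lambda>k. f (X k - x) (X k - x)) \<longlonglongrightarrow> 0"
 shows "(\<lambda>k. f (X k) (X k)) \<longlonglongrightarrow> f x x"
proof -
 have "(\<lambda>k. f (X k - x) (X k - x) + 2 * f (X k) x - f x x) \<longlonglongrightarrow> 0 + 2 * f x x - f x x"
  by (intro tendsto_intros tendsto_pair assms)
 moreover have "f (X k - x) (X k - x) + 2 * f (X k) x - f x x = f (X k) (X k)" for k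
  using assms by (simp add: square_diff)
 ultimately show ?thesis by simp
qed

text \<open>The index type is free because families are indexed by numbers when multiplicities are
  counted and by the eigenvalues themselves when distinct eigenvalues are counted.\<close>

definition onormal :: "'i set \<Rightarrow> ('i \<Rightarrow> 'v) \<Rightarrow> bool" where
 "onormal I u \<longleftrightarrow> (\<forall>i\<in>I. u i \<in> H) \<and> (\<forall>i\<in>I. \<forall>j\<in>I. f (u i) (u j) = (if i = j then 1 else 0))"

lemma onormal_sum:
 assumes "finite I" "onormal I u" "j \<in> I"
 shows "f (\<Sum>i\<in>I. c i *\<^sub>R u i) (u j) = c j"
proof -
 have "f (\<Sum>i\<in>I. c i *\<^sub>R u i) (u j) = (\<Sum>i\<in>I. c i * f (u i) (u j))"
  using assms by (intro sum_left) (auto simp: onormal_def)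
 also have "\<dots> = (\<Sum>i\<in>I. if i = j then c i else 0)" using assms by (intro sum.cong) (auto simp: onormal_def)
 also have "\<dots> = c j" using assms by simp
 finally show ?thesis .
qed

text \<open>Pythagoras for the remainder of an orthogonal projection. The equality is kept besides
  Bessel's inequality: a null remainder makes the coefficients exhaust \<open>f x x\<close>.\<close>

lemma bessel_sum:
 assumes "finite I" "onormal I u" "x \<in> H"
 defines "y \<equiv> \<Sum>i\<in>I. f x (u i) *\<^sub>R u i"
 shows "f (x - y) (x - y) = f x x - (\<Sum>i\<in>I. (f x (u i))\<^sup>2)"
proof -
 have u: "u i \<in> H" if "i \<in> I" for i using assms(2) that by (auto simp: onormal_def)
 have y: "y \<in> H" unfolding y_def by (intro H_sum H_scale u)
 have 1: "f x y = (\<Sum>i\<in>I. (f x (u i))\<^sup>2)"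
  unfolding y_def using assms u by (subst sum_right) (auto simp: power2_eq_square)
 have "f y y = (\<Sum>i\<in>I. f x (u i) * f y (u i))" using assms u y by (subst (2) y_def, subst sum_right) auto
 also have "\<dots> = (\<Sum>i\<in>I. (f x (u i))\<^sup>2)"
  unfolding y_def by (intro sum.cong refl) (simp add: onormal_sum[OF assms(1,2)] power2_eq_square)
 finally show ?thesis using 1 assms(3) y by (simp add: square_diff)
qed

lemma bessel:
 assumes "finite I" "onormal I u" "x \<in> H"
 shows "(\<Sum>i\<in>I. (f x (u i))\<^sup>2) \<le> f x x"
proof -
 have "(\<Sum>i\<in>I. f x (u i) *\<^sub>R u i) \<in> H" using assms by (intro H_sum H_scale) (auto simp: onormal_def)
 then have "0 \<le> f (x - (\<Sum>i\<in>I. f x (u i) *\<^sub>R u i)) (x - (\<Sum>i\<in>I. f x (u i) *\<^sub>R u i))"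
  using assms by (intro nonneg H_diff)
 then show ?thesis using bessel_sum[OF assms] by simp
qed

text \<open>The second hypothesis is independence modulo null vectors, the right notion for a
  semidefinite form. The coefficients \<open>C\<close> are returned so that the new vectors inherit
  membership in any subspace containing the old ones.\<close>

lemma gram_schmidt:
 fixes u :: "nat \<Rightarrow> 'v"
 assumes "\<And>i. i < n \<Longrightarrow> u i \<in> H"
  and "\<And>c. f (\<Sum>i<n. c i *\<^sub>R u i) (\<Sum>i<n. c i *\<^sub>R u i) = 0 \<Longrightarrow> \<forall>i<n. c i = 0"
 shows "\<exists>v C. onormal {..<n} v \<and> (\<forall>j<n. v j = (\<Sum>i<n. C j i *\<^sub>R u i))"
 using assms
proof (induction n)
 case 0
 then show ?case by (auto simp: onormal_def)
next
 case (Suc n)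
 have ind: "\<forall>i<n. c i = 0" if c: "f (\<Sum>i<n. c i *\<^sub>R u i) (\<Sum>i<n. c i *\<^sub>R u i) = 0" for c
 proof -
  let ?c = "c(n := 0)"
  have "(\<Sum>i<Suc n. ?c i *\<^sub>R u i) = (\<Sum>i<n. c i *\<^sub>R u i)" by simp
  then have "\<forall>i<Suc n. ?c i = 0" using Suc.prems(2)[of ?c] c by simp
  then show ?thesis by (metis fun_upd_apply less_SucI nat_neq_iff)
 qed
 have "\<exists>v C. onormal {..<n} v \<and> (\<forall>j<n. v j = (\<Sum>i<n. C j i *\<^sub>R u i))"
  by (rule Suc.IH[OF _ ind]) (use Suc.prems(1) in auto)
 then obtain v C where v: "onormal {..<n} v" and C: "\<And>j. j < n \<Longrightarrow> v j = (\<Sum>i<n. C j i *\<^sub>R u i)" by blast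
 have un: "u n \<in> H" and vH: "\<And>j. j < n \<Longrightarrow> v j \<in> H" using Suc.prems(1) v by (auto simp: onormal_def)
 define y where "y = (\<Sum>j<n. f (u n) (v j) *\<^sub>R v j)"
 define x where "x = u n - y"
 have y: "y \<in> H" unfolding y_def by (intro H_sum H_scale vH) auto
 have x: "x \<in> H" unfolding x_def by (intro H_diff un y)
 \<comment> \<open>The coefficients of \<open>x\<close> in terms of the \<open>u i\<close>, found by
   substituting the combinations for the earlier \<open>v j\<close>.\<close>
 define d where "d i = (if i = n then 1 else - (\<Sum>j<n. f (u n) (v j) * C j i))" for i
 have yC: "y = (\<Sum>i<n. (\<Sum>j<n. f (u n) (v j) * C j i) *\<^sub>R u i)"
 proof -
  have "y = (\<Sum>j<n. \<Sum>i<n. (f (u n) (v j) * C j i) *\<^sub>R u i)"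
   unfolding y_def by (intro sum.cong refl) (auto simp: C scaleR_sum_right)
  also have "\<dots> = (\<Sum>i<n. \<Sum>j<n. (f (u n) (v j) * C j i) *\<^sub>R u i)" by (rule sum.swap)
  finally show ?thesis by (simp add: scaleR_sum_left)
 qed
 have xd: "x = (\<Sum>i<Suc n. d i *\<^sub>R u i)" by (simp add: x_def yC d_def sum_negf)
 \<comment> \<open>The coefficient of \<open>u n\<close> in \<open>x\<close> is 1, so
   \<open>x\<close> cannot be null and may be normalised.\<close>
 have "\<not> (\<forall>i<Suc n. d i = 0)" by (auto simp: d_def)
 then have "f x x \<noteq> 0" using Suc.prems(2)[of d] unfolding xd[symmetric] by blast
 then have pos: "f x x > 0" using nonneg[OF x] by simp
 have xv: "f x (v j) = 0" if "j < n" for j using onormal_sum[OF _ v, of j "\<lambda>j. f (u n) (v j)"] that un y vH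
  by (simp add: x_def diff_left y_def[symmetric])
 define r where "r = 1 / sqrt (f x x)"
 have r: "r\<^sup>2 * f x x = 1" using pos by (simp add: r_def power_divide)
 let ?v = "v(n := r *\<^sub>R x)"
 have "onormal {..<Suc n} ?v" unfolding onormal_def
 proof (intro conjI ballI)
  fix i assume "i \<in> {..<Suc n}"
  then show "?v i \<in> H" using vH x H_scale by auto
  fix j assume "j \<in> {..<Suc n}"
  then show "f (?v i) (?v j) = (if i = j then 1 else 0)" using \<open>i \<in> {..<Suc n}\<close> v x vH xv r sym[OF vH x]
   by (auto simp: onormal_def less_Suc_eq scale_left scale_right H_scale power2_eq_square mult.assoc)
 qed
 moreover have "\<forall>j<Suc n. ?v j = (\<Sum>i<Suc n. (if j = n then r * d i else if i = n then 0 else C j i) *\<^sub>R u i)"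
  by (auto simp: C xd scaleR_sum_right scaleR_add_right less_Suc_eq)
 ultimately show ?case
  by (intro exI[of _ ?v] exI[of _ "\<lambda>j i. if j = n then r * d i else if i = n then 0 else C j i"] conjI)
qed

end

section \<open>Subsequences, enumeration with multiplicity, and compact pairs of forms\<close>

lemma convergent_subsequences:
 fixes s :: "nat \<Rightarrow> nat \<Rightarrow> real"
 assumes "\<And>i. i < n \<Longrightarrow> bounded (range (s i))"
 shows "\<exists>r. strict_mono r \<and> (\<forall>i<n. convergent (\<lambda>k. s i (r k)))"
 using assms
proof (induction n)
 case 0
 then show ?case using strict_mono_id by auto
next
 case (Suc n)
 then obtain r where r: "strict_mono r" "\<And>i. i < n \<Longrightarrow> convergent (\<lambda>k. s i (r k))" by force
 have "bounded (range (\<lambda>k. s n (r k)))" by (rule bounded_subset[OF Suc.prems[of n]]) auto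
 then obtain l q where q: "strict_mono q" "((\<lambda>k. s n (r k)) \<circ> q) \<longlonglongrightarrow> l"
  using bounded_imp_convergent_subsequence by blast
 have "convergent (\<lambda>k. s i ((r \<circ> q) k))" if "i < Suc n" for i
 proof (cases "i = n")
  case True
  then show ?thesis using q by (auto simp: convergent_def o_def)
 next
  case False
  then have "convergent ((\<lambda>k. s i (r k)) \<circ> q)" using r(2)[of i] that q by (intro convergent_subseq_convergent) auto
  then show ?thesis by (simp add: o_def)
 qed
 then show ?case using strict_mono_o[OF r(1) q(1)] by blast
qed

text \<open>An element s occupies the block of indices from \<open>M s\<close> up to but excluding
  \<open>N s\<close>, where \<open>M s\<close> and \<open>N s\<close> count the elements below s and
  up to s with multiplicity. So the k-th term is the least s with \<open>k < N s\<close>.\<close>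

lemma enumerate_with_multiplicity:
 fixes S :: "real set" and d :: "real \<Rightarrow> nat"
 assumes inf: "infinite S" and fin: "\<And>x. finite {s \<in> S. s \<le> x}"
  and d: "\<And>s. s \<in> S \<Longrightarrow> d s > 0"
 shows "\<exists>lam :: nat \<Rightarrow> real. mono lam \<and> filterlim lam at_top sequentially \<and> range lam = S \<and>
      (\<forall>x. finite {k. lam k = x}) \<and> (\<forall>s\<in>S. card {k. lam k = s} = d s)"
proof -
 define N where "N x = (\<Sum>s\<in>{s \<in> S. s \<le> x}. d s)" for x
 define M where "M x = (\<Sum>s\<in>{s \<in> S. s < x}. d s)" for x
 have finl: "finite {s \<in> S. s < x}" for x by (rule finite_subset[OF _ fin[of x]]) auto
 have Nmono: "N x \<le> N y" if "x \<le> y" for x y unfolding N_def using that by (intro sum_mono2 fin) auto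
 have NM: "N s = M s + d s" if "s \<in> S" for s
 proof -
  have "{t \<in> S. t \<le> s} = insert s {t \<in> S. t < s}" using that by auto
  then show ?thesis unfolding N_def M_def using finl by simp
 qed
 have NlM: "N s \<le> M t" if "s < t" for s t unfolding N_def M_def using that by (intro sum_mono2 finl) auto
 have unb: "\<exists>s\<in>S. k < N s" for k
 proof -
  obtain T where T: "finite T" "card T = Suc k" "T \<subseteq> S" using infinite_arbitrarily_large[OF inf] by blast
  then have ne: "T \<noteq> {}" by auto
  let ?s = "Max T"
  have "Suc k = (\<Sum>s\<in>T. 1)" using T by simp
  also have "\<dots> \<le> (\<Sum>s\<in>T. d s)" using T d by (intro sum_mono) (auto simp: Suc_le_eq)
  also have "\<dots> \<le> N ?s" unfolding N_def using T by (intro sum_mono2 fin) auto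
  finally show ?thesis using Max_in[OF T(1) ne] T(3) by (intro bexI[of _ ?s]) auto
 qed
 \<comment> \<open>\<open>Min\<close> wants a finite set, so the candidates are cut off at an
   arbitrary element whose count exceeds k; the minimum does not depend on it.\<close>
 define lam where "lam k = Min {s \<in> S. s \<le> (SOME s. s \<in> S \<and> k < N s) \<and> k < N s}" for k
 have lam: "lam k \<in> S \<and> k < N (lam k) \<and> (\<forall>s\<in>S. k < N s \<longrightarrow> lam k \<le> s)" for k
 proof -
  define z where "z = (SOME s. s \<in> S \<and> k < N s)"
  have z: "z \<in> S \<and> k < N z" unfolding z_def by (rule someI_ex) (use unb in auto)
  let ?A = "{s \<in> S. s \<le> z \<and> k < N s}"
  have A: "finite ?A" "?A \<noteq> {}" using z by (auto intro: finite_subset[OF _ fin[of z]])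
  have "lam k = Min ?A" by (simp add: lam_def z_def)
  moreover have "Min ?A \<in> ?A" by (rule Min_in[OF A])
  moreover have "Min ?A \<le> s" if "s \<in> S" "k < N s" for s
  proof (cases "s \<le> z")
   case True
   then show ?thesis using A that by (intro Min_le) auto
  next
   case False
   have "Min ?A \<le> z" using A z by (intro Min_le) auto
   then show ?thesis using False by simp
  qed
  ultimately show ?thesis by auto
 qed
 have eq: "{k. lam k = s} = {M s..<N s}" if s: "s \<in> S" for s
 proof (intro set_eqI iffI)
  fix k assume "k \<in> {k. lam k = s}"
  then have k: "lam k = s" by simp
  have "M s \<le> k"
  proof (cases "{t \<in> S. t < s} = {}")
   case True
   then show ?thesis by (simp only: M_def sum.empty)
  next
   case False
   \<comment> \<open>The predecessor of s in \<open>S\<close>: its count \<open>N ?t\<close> is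
     \<open>M s\<close>, so an index below \<open>M s\<close> would already have been given to
     \<open>?t\<close> or to a smaller element.\<close>
   let ?t = "Max {t \<in> S. t < s}"
   have t: "?t \<in> {t \<in> S. t < s}" by (rule Max_in[OF finl False])
   have "{t \<in> S. t < s} = {t \<in> S. t \<le> ?t}" using t Max_ge[OF finl] by (auto intro: le_less_trans)
   then have "M s = N ?t" by (simp only: M_def N_def)
   moreover have "\<not> k < N ?t" using lam[of k] k t by force
   ultimately show ?thesis by simp
  qed
  then show "k \<in> {M s..<N s}" using lam[of k] k by auto
 next
  fix k assume k: "k \<in> {M s..<N s}"
  then have "lam k \<le> s" using lam[of k] s by auto
  moreover have "\<not> lam k < s" using NlM[of "lam k" s] lam[of k] k by auto
  ultimately show "k \<in> {k. lam k = s}" by auto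
 qed
 have mono: "mono lam"
 proof (rule monoI)
  fix j k :: nat assume "j \<le> k"
  then show "lam j \<le> lam k" using lam[of j] lam[of k] by auto
 qed
 have range: "range lam = S"
 proof
  show "range lam \<subseteq> S" using lam by auto
  show "S \<subseteq> range lam"
  proof
   fix s assume s: "s \<in> S"
   then have "M s \<in> {k. lam k = s}" unfolding eq[OF s] using NM[OF s] d[OF s] by auto
   then show "s \<in> range lam" by (metis (mono_tags) mem_Collect_eq rangeI)
  qed
 qed
 have "filterlim lam at_top sequentially" unfolding filterlim_at_top eventually_sequentially
 proof
  fix Z
  have "\<exists>s\<in>S. Z \<le> s"
  proof (rule ccontr)
   assume "\<not> ?thesis"
   then have "S = {s \<in> S. s \<le> Z}" by auto
   then show False using fin[of Z] inf by simp
  qed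
  then obtain s where s: "s \<in> S" "Z \<le> s" by auto
  then obtain k where k: "lam k = s" using range by auto
  show "\<exists>k. \<forall>n\<ge>k. Z \<le> lam n" by (rule exI[of _ k]) (use k s monoD[OF mono] in force)
 qed
 moreover have "finite {k. lam k = x}" for x
 proof (cases "x \<in> S")
  case False
  then have "{k. lam k = x} = {}" using lam by auto
  then show ?thesis by simp
 qed (simp add: eq)
 moreover have "card {k. lam k = s} = d s" if "s \<in> S" for s by (simp add: eq[OF that] NM[OF that])
 ultimately show ?thesis using mono range by blast
qed

text \<open>\<open>\<sigma>\<close> abstracts the reflection and \<open>m\<close> the boundary mean;
  \<open>m_\<sigma>\<close> forces mean zero on odd vectors, and \<open>many\<close> gives the odd
  part infinite dimension modulo b-null vectors. \<open>compact\<close> states relative compactness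
  as small plus finite rank, a form that passes to limits and takes the place of weak
  convergence.\<close>

locale compact_forms = a: psd_form H a + b: psd_form H b
 for H :: "'v::real_vector set" and a b :: "'v \<Rightarrow> 'v \<Rightarrow> real" +
 fixes \<sigma> :: "'v \<Rightarrow> 'v" and m :: "'v \<Rightarrow> real" and K :: real
 assumes b_le: "x \<in> H \<Longrightarrow> b x x \<le> K * a x x"
  and complete: "\<lbrakk>\<And>k. X k \<in> H; \<And>\<epsilon>. \<epsilon> > 0 \<Longrightarrow> \<exists>N. \<forall>k\<ge>N. \<forall>l\<ge>N. a (X k - X l) (X k - X l) < \<epsilon>\<rbrakk>
    \<Longrightarrow> \<exists>x\<in>H. (\<lambda>k. a (X k - x) (X k - x)) \<longlonglongrightarrow> 0"
  and compact: "\<epsilon> > 0 \<Longrightarrow> \<exists>(n::nat) l D. (\<forall>i<n. \<forall>x\<in>H. \<forall>y\<in>H. l i (x + y) = l i x + l i y) \<and>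
     (\<forall>i<n. \<forall>x\<in>H. \<forall>c. l i (c *\<^sub>R x) = c * l i x) \<and> (\<forall>i<n. \<forall>x\<in>H. (l i x)\<^sup>2 \<le> D * a x x) \<and>
     (\<forall>x\<in>H. b x x \<le> \<epsilon> * a x x + (\<Sum>i<n. (l i x)\<^sup>2))"
  and \<sigma>_H: "x \<in> H \<Longrightarrow> \<sigma> x \<in> H"
  and \<sigma>_add: "\<lbrakk>x \<in> H; y \<in> H\<rbrakk> \<Longrightarrow> \<sigma> (x + y) = \<sigma> x + \<sigma> y"
  and \<sigma>_scale: "x \<in> H \<Longrightarrow> \<sigma> (c *\<^sub>R x) = c *\<^sub>R \<sigma> x"
  and \<sigma>_\<sigma>: "x \<in> H \<Longrightarrow> \<sigma> (\<sigma> x) = x"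
  and a_\<sigma>: "\<lbrakk>x \<in> H; y \<in> H\<rbrakk> \<Longrightarrow> a (\<sigma> x) (\<sigma> y) = a x y"
  and b_\<sigma>: "\<lbrakk>x \<in> H; y \<in> H\<rbrakk> \<Longrightarrow> b (\<sigma> x) (\<sigma> y) = b x y"
  and m_\<sigma>: "x \<in> H \<Longrightarrow> m (\<sigma> x) = m x"
  and m_add: "\<lbrakk>x \<in> H; y \<in> H\<rbrakk> \<Longrightarrow> m (x + y) = m x + m y"
  and m_scale: "x \<in> H \<Longrightarrow> m (c *\<^sub>R x) = c * m x"
  and many: "\<exists>g. (\<forall>i<n. g i \<in> H \<and> \<sigma> (g i) = - g i) \<and>
     (\<forall>c. b (\<Sum>i<n. c i *\<^sub>R g i) (\<Sum>i<n. c i *\<^sub>R g i) = 0 \<longrightarrow> (\<forall>i<(n::nat). c i = 0))"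
begin

lemmas H_add = a.H_add and H_scale = a.H_scale and H_diff = a.H_diff and H_neg = a.H_neg
 and H_0 = a.H_0 and H_sum = a.H_sum

lemma compactE:
 assumes "\<epsilon> > 0"
 obtains n :: nat and l D where
  "\<And>i x y. \<lbrakk>i < n; x \<in> H; y \<in> H\<rbrakk> \<Longrightarrow> l i (x + y) = l i x + l i y"
  "\<And>i x c. \<lbrakk>i < n; x \<in> H\<rbrakk> \<Longrightarrow> l i (c *\<^sub>R x) = c * l i x"
  "\<And>i x. \<lbrakk>i < n; x \<in> H\<rbrakk> \<Longrightarrow> (l i x)\<^sup>2 \<le> D * a x x"
  "\<And>x. x \<in> H \<Longrightarrow> b x x \<le> \<epsilon> * a x x + (\<Sum>i<n. (l i x)\<^sup>2)" using compact[OF assms]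
 apply (elim exE conjE)
 subgoal for n l D by (rule that[of n l D]) blast+
 done

lemma b_null: "\<lbrakk>x \<in> H; a x x = 0\<rbrakk> \<Longrightarrow> b x x = 0"
 using b_le[of x] b.nonneg[of x] by simp

lemma tendsto_b:
 assumes "\<And>k. X k \<in> H" "x \<in> H" "(\<lambda>k. a (X k - x) (X k - x)) \<longlonglongrightarrow> 0"
 shows "(\<lambda>k. b (X k - x) (X k - x)) \<longlonglongrightarrow> 0"
proof (rule tendsto_sandwich[OF _ _ tendsto_const])
 show "(\<lambda>k. K * a (X k - x) (X k - x)) \<longlonglongrightarrow> 0" using tendsto_mult_right_zero[OF assms(3)] .
qed (use assms H_diff b_le b.nonneg in auto)

text \<open>A maximising sequence for the Rayleigh quotient is itself Cauchy: the parallelogram law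
 bounds the energy of differences by their \<open>b\<close>-norm, which compactness makes small.\<close>

lemma maximizer:
 assumes V: "subspace V" "V \<subseteq> H"
  and closed: "\<And>X x. \<lbrakk>\<And>k. X k \<in> V; x \<in> H; (\<lambda>k. a (X k - x) (X k - x)) \<longlonglongrightarrow> 0\<rbrakk>
    \<Longrightarrow> \<exists>y\<in>V. (\<lambda>k. a (X k - y) (X k - y)) \<longlonglongrightarrow> 0"
  and pos: "x0 \<in> V" "b x0 x0 > 0"
 shows "\<exists>u\<in>V. \<exists>\<mu>>0. a u u = 1 \<and> b u u = \<mu> \<and> (\<forall>x\<in>V. b x x \<le> \<mu> * a x x)"
proof -
 have VH: "x \<in> H" if "x \<in> V" for x using V that by auto
 define B where "B = {b x x | x. x \<in> V \<and> a x x = 1}"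
 define \<mu> where "\<mu> = Sup B"
 have bdd: "bdd_above B" unfolding B_def using b_le VH by (intro bdd_aboveI[of _ K]) force
 have norm1: "b x x / a x x \<in> B" if "x \<in> V" "a x x > 0" for x
 proof -
  let ?x = "(1 / sqrt (a x x)) *\<^sub>R x"
  have "?x \<in> V" by (intro subspace_scale V that)
  moreover have "a ?x ?x = 1" "b ?x ?x = b x x / a x x"
   using that VH by (auto simp: a.square_scale b.square_scale power_divide)
  ultimately show ?thesis unfolding B_def by (intro CollectI exI[of _ ?x] conjI) simp_all
 qed
 have le\<mu>: "b x x \<le> \<mu> * a x x" if x: "x \<in> V" for x
 proof (cases "a x x = 0")
  case True
  then show ?thesis using b_null VH x by simp
 next
  case False
  then have p: "a x x > 0" using a.nonneg[OF VH[OF x]] by simp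
  have "b x x / a x x \<le> \<mu>" unfolding \<mu>_def by (rule cSup_upper[OF norm1[OF x p] bdd])
  then show ?thesis using p by (simp add: field_simps)
 qed
 have a0: "a x0 x0 > 0" using b_null[OF VH[OF pos(1)]] a.nonneg[OF VH[OF pos(1)]] pos(2) by fastforce
 have \<mu>: "\<mu> > 0"
 proof -
  have "0 < b x0 x0 / a x0 x0" using pos a0 by simp
  also have "\<dots> \<le> \<mu>" unfolding \<mu>_def by (rule cSup_upper[OF norm1[OF pos(1) a0] bdd])
  finally show ?thesis .
 qed
 have "\<exists>x\<in>V. a x x = 1 \<and> \<mu> - 1 / real (Suc k) < b x x" for k
 proof -
  have "B \<noteq> {}" using norm1[OF pos(1) a0] by auto
  moreover have "\<mu> - 1 / real (Suc k) < Sup B" unfolding \<mu>_def by simp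
  ultimately obtain z where "z \<in> B" "\<mu> - 1 / real (Suc k) < z" by (meson less_cSupE)
  then show ?thesis unfolding B_def by auto
 qed
 then obtain X where X: "\<And>k. X k \<in> V" "\<And>k. a (X k) (X k) = 1" "\<And>k. \<mu> - 1 / real (Suc k) < b (X k) (X k)" by metis
 \<comment> \<open>Half of \<mu>, because \<open>b\<close> of a difference then costs at most half
   of the \<mu> \<open>a\<close> that the parallelogram law gains, and a positive multiple of
   \<open>a\<close> of the difference survives.\<close>
 obtain n l D where l_add: "\<And>i x y. \<lbrakk>i < n; x \<in> H; y \<in> H\<rbrakk> \<Longrightarrow> l i (x + y) = l i x + l i y"
  and l_scale: "\<And>i x c. \<lbrakk>i < n; x \<in> H\<rbrakk> \<Longrightarrow> l i (c *\<^sub>R x) = c * l i x"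
  and l_bound: "\<And>i x. \<lbrakk>i < n; x \<in> H\<rbrakk> \<Longrightarrow> (l i x)\<^sup>2 \<le> D * a x x"
  and b_l: "\<And>x. x \<in> H \<Longrightarrow> b x x \<le> \<mu> / 2 * a x x + (\<Sum>i<(n::nat). (l i x)\<^sup>2)"
  by (rule compactE[OF half_gt_zero[OF \<mu>]]) blast
 have "bounded (range (\<lambda>k. l i (X k)))" if "i < n" for i
 proof (rule boundedI)
  fix z assume "z \<in> range (\<lambda>k. l i (X k))"
  then obtain k where z: "z = l i (X k)" by auto
  have "z\<^sup>2 \<le> D" using l_bound[OF that VH[OF X(1)], of k] X(2) z by simp
  then show "norm z \<le> sqrt D" by (simp add: real_le_rsqrt)
 qed
 then obtain r where r: "strict_mono r" and conv: "\<And>i. i < n \<Longrightarrow> convergent (\<lambda>k. l i (X (r k)))"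
  using convergent_subsequences[of n "\<lambda>i k. l i (X k)"] by auto
 define Y where "Y k = X (r k)" for k
 have Y: "Y k \<in> V" "a (Y k) (Y k) = 1" "\<mu> - 1 / real (Suc k) < b (Y k) (Y k)" for k
 proof -
  have "k \<le> r k" by (rule seq_suble[OF r])
  then have "1 / real (Suc (r k)) \<le> 1 / real (Suc k)" by (intro divide_left_mono) auto
  then show "\<mu> - 1 / real (Suc k) < b (Y k) (Y k)" using X(3)[of "r k"] unfolding Y_def by linarith
 qed (auto simp: Y_def X)
 have YH: "Y k \<in> H" for k using Y VH by auto
 have l_diff: "l i (x - y) = l i x - l i y" if "i < n" "x \<in> H" "y \<in> H" for i x y
  using l_add[of i x "-y"] l_scale[of i y "-1"] that H_neg by simp
 have key: "a (Y k - Y j) (Y k - Y j) \<le>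
   2 / \<mu> * (2 / real (Suc k) + 2 / real (Suc j) + (\<Sum>i<n. (l i (Y k) - l i (Y j))\<^sup>2))" for k j
 proof -
  let ?d = "a (Y k - Y j) (Y k - Y j)" and ?s = "\<Sum>i<n. (l i (Y k) - l i (Y j))\<^sup>2"
  have "b (Y k - Y j) (Y k - Y j) \<le> \<mu> / 2 * ?d + ?s"
   using b_l[of "Y k - Y j"] H_diff[OF YH YH] YH by (simp add: l_diff)
  moreover have "b (Y k + Y j) (Y k + Y j) \<le> \<mu> * a (Y k + Y j) (Y k + Y j)" using Y V by (intro le\<mu> subspace_add) auto
  moreover have "a (Y k + Y j) (Y k + Y j) = 4 - ?d" using YH Y by (simp add: a.square_add a.square_diff)
  moreover have "b (Y k + Y j) (Y k + Y j) = 2 * b (Y k) (Y k) + 2 * b (Y j) (Y j) - b (Y k - Y j) (Y k - Y j)"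
   using YH by (simp add: b.square_add b.square_diff)
  ultimately have "2 * b (Y k) (Y k) + 2 * b (Y j) (Y j) - (\<mu> / 2 * ?d + ?s) \<le> \<mu> * (4 - ?d)" by simp
  then have "\<mu> / 2 * ?d \<le> 2 / real (Suc k) + 2 / real (Suc j) + ?s"
   using Y(3)[of k] Y(3)[of j] by (simp add: algebra_simps)
  then show ?thesis using \<mu> by (simp add: field_simps)
 qed
 have "\<exists>u\<in>H. (\<lambda>k. a (Y k - u) (Y k - u)) \<longlonglongrightarrow> 0"
 proof (rule complete[OF YH])
  fix \<epsilon> :: real assume \<epsilon>: "\<epsilon> > 0"
  \<comment> \<open>Three terms of size \<eta>, multiplied by 2 / \<mu>, add up to \<epsilon> /
    2.\<close>
  define \<eta> where "\<eta> = \<epsilon> * \<mu> / 12"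
  have \<eta>: "\<eta> > 0" using \<epsilon> \<mu> by (simp add: \<eta>_def)
  define \<delta> where "\<delta> = sqrt (\<eta> / (real n + 1))"
  have \<delta>: "\<delta> > 0" using \<eta> by (simp add: \<delta>_def)
  have "\<forall>\<^sub>F N in sequentially. \<forall>i<n. \<forall>k\<ge>N. \<forall>j\<ge>N. \<bar>l i (Y k) - l i (Y j)\<bar> < \<delta>"
  proof -
   have "\<forall>\<^sub>F N in sequentially. \<forall>i\<in>{..<n}. \<forall>k\<ge>N. \<forall>j\<ge>N. \<bar>l i (Y k) - l i (Y j)\<bar> < \<delta>"
   proof (rule eventually_ball_finite)
    show "\<forall>i\<in>{..<n}. \<forall>\<^sub>F N in sequentially. \<forall>k\<ge>N. \<forall>j\<ge>N. \<bar>l i (Y k) - l i (Y j)\<bar> < \<delta>"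
    proof
     fix i assume "i \<in> {..<n}"
     then have "Cauchy (\<lambda>k. l i (Y k))" using conv[of i] unfolding Y_def by (simp add: convergent_Cauchy)
     then obtain M where M: "\<forall>m\<ge>M. \<forall>n\<ge>M. norm (l i (Y m) - l i (Y n)) < \<delta>" using CauchyD[OF _ \<delta>] by blast
     show "\<forall>\<^sub>F N in sequentially. \<forall>k\<ge>N. \<forall>j\<ge>N. \<bar>l i (Y k) - l i (Y j)\<bar> < \<delta>" unfolding eventually_sequentially
      by (rule exI[of _ M]) (use M in auto)
    qed
   qed auto
   then show ?thesis by (rule eventually_mono) auto
  qed
  moreover have "\<forall>\<^sub>F N in sequentially. 2 / real (Suc N) < \<eta>"
  proof -
   have "(\<lambda>N. 2 / real (Suc N)) \<longlonglongrightarrow> 0" by (rule LIMSEQ_Suc[OF lim_const_over_n])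
   then show ?thesis using \<eta> by (rule order_tendstoD)
  qed
  ultimately have "\<forall>\<^sub>F N in sequentially. (\<forall>i<n. \<forall>k\<ge>N. \<forall>j\<ge>N. \<bar>l i (Y k) - l i (Y j)\<bar> < \<delta>) \<and> 2 / real (Suc N) < \<eta>"
   by (rule eventually_conj)
  then obtain N where N: "\<And>i k j. \<lbrakk>i < n; k \<ge> N; j \<ge> N\<rbrakk> \<Longrightarrow> \<bar>l i (Y k) - l i (Y j)\<bar> < \<delta>" "2 / real (Suc N) < \<eta>"
   unfolding eventually_sequentially by blast
  have "a (Y k - Y j) (Y k - Y j) < \<epsilon>" if "k \<ge> N" "j \<ge> N" for k j
  proof -
   have "(\<Sum>i<n. (l i (Y k) - l i (Y j))\<^sup>2) \<le> (\<Sum>i<n. \<delta>\<^sup>2)"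
   proof (rule sum_mono)
    fix i assume "i \<in> {..<n}"
    then have "\<bar>l i (Y k) - l i (Y j)\<bar> \<le> \<bar>\<delta>\<bar>" using N(1)[of i k j] that by simp
    then show "(l i (Y k) - l i (Y j))\<^sup>2 \<le> \<delta>\<^sup>2" by (simp only: abs_le_square_iff)
   qed
   also have "\<dots> = real n * (\<eta> / (real n + 1))" using \<eta> by (simp add: \<delta>_def)
   also have "\<dots> \<le> \<eta>" using \<eta> by (simp add: field_simps)
   finally have s: "(\<Sum>i<n. (l i (Y k) - l i (Y j))\<^sup>2) \<le> \<eta>" .
   have "2 / real (Suc k) \<le> 2 / real (Suc N)" "2 / real (Suc j) \<le> 2 / real (Suc N)"
    using that by (auto intro!: divide_left_mono)
   then have "2 / real (Suc k) + 2 / real (Suc j) + (\<Sum>i<n. (l i (Y k) - l i (Y j))\<^sup>2) \<le> 3 * \<eta>"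
    using s N(2) by linarith
   then have "2 / \<mu> * (2 / real (Suc k) + 2 / real (Suc j) + (\<Sum>i<n. (l i (Y k) - l i (Y j))\<^sup>2)) \<le> 2 / \<mu> * (3 * \<eta>)"
    using \<mu> by (intro mult_left_mono) auto
   also have "\<dots> < \<epsilon>" using \<mu> \<epsilon> by (simp add: \<eta>_def)
   finally show ?thesis using key[of k j] by linarith
  qed
  then show "\<exists>N. \<forall>k\<ge>N. \<forall>l\<ge>N. a (Y k - Y l) (Y k - Y l) < \<epsilon>" by blast
 qed
 \<comment> \<open>\<open>closed\<close> may return a limit other than the one from completeness:
   limits are unique only up to null vectors.\<close>
 then obtain u where u: "u \<in> V" and lim: "(\<lambda>k. a (Y k - u) (Y k - u)) \<longlonglongrightarrow> 0" using closed[of Y] Y(1) by blast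
 have uH: "u \<in> H" using u VH by auto
 have a1: "a u u = 1" using a.tendsto_square[OF YH uH lim] Y(2) by (simp add: LIMSEQ_const_iff)
 have "b u u \<ge> \<mu>"
 proof (rule LIMSEQ_le[OF _ b.tendsto_square[OF YH uH tendsto_b[OF YH uH lim]]])
  have "(\<lambda>k. \<mu> - 1 / real (Suc k)) \<longlonglongrightarrow> \<mu> - 0" by (intro tendsto_intros LIMSEQ_Suc[OF lim_const_over_n])
  then show "(\<lambda>k. \<mu> - 1 / real (Suc k)) \<longlonglongrightarrow> \<mu>" by simp
  show "\<exists>N. \<forall>n\<ge>N. \<mu> - 1 / real (Suc n) \<le> b (Y n) (Y n)" using Y(3) less_imp_le by blast
 qed
 then have "b u u = \<mu>" using le\<mu>[OF u] a1 by simp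
 then show ?thesis using u \<mu> a1 le\<mu> by blast
qed

text \<open>The form \<mu> a - b is semidefinite on \<open>V\<close> and \<open>u\<close> is null
  for it, hence in its radical.\<close>

lemma euler_lagrange:
 assumes V: "subspace V" "V \<subseteq> H" and u: "u \<in> V" "a u u = 1" "b u u = \<mu>" "\<And>x. x \<in> V \<Longrightarrow> b x x \<le> \<mu> * a x x"
  and v: "v \<in> V"
 shows "b u v = \<mu> * a u v"
proof -
 have VH: "x \<in> H" if "x \<in> V" for x using V that by auto
 interpret q: psd_form V "\<lambda>x y. \<mu> * a x y - b x y" using V u VH
  by unfold_locales (auto simp: a.add_left b.add_left a.scale_left b.scale_left algebra_simps a.sym b.sym)
 show ?thesis using q.null_right[OF v u(1)] u VH v a.sym[of u v] b.sym[of u v] by auto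
qed

definition eigenspace :: "real \<Rightarrow> 'v set" where
 "eigenspace \<mu> = {u \<in> H. m u = 0 \<and> (\<forall>v\<in>H. a u v = \<mu> * b u v)}"

lemma eigenspace_subspace: "subspace (eigenspace \<mu>)"
 using m_scale[OF H_0, of 0]
 by (auto simp: subspace_def eigenspace_def H_0 H_add H_scale a.zero_left b.zero_left m_add m_scale
   a.add_left b.add_left a.scale_left b.scale_left algebra_simps)

lemma eigen_orthogonal:
 assumes "u \<in> eigenspace \<mu>" "v \<in> eigenspace \<nu>" "\<mu> \<noteq> \<nu>"
 shows "b u v = 0"
proof -
 have "\<mu> * b u v = \<nu> * b u v" using assms a.sym[of u v] b.sym[of u v] by (auto simp: eigenspace_def)
 then show ?thesis using assms(3) by simp
qed

lemma eigenvalue_pos: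
 assumes "u \<in> eigenspace \<mu>" "a u u \<noteq> 0"
 shows "\<mu> > 0" "b u u > 0"
proof -
 have u: "u \<in> H" using assms by (auto simp: eigenspace_def)
 then have *: "a u u = \<mu> * b u u" "a u u > 0" "b u u \<ge> 0"
  using assms a.nonneg[OF u] b.nonneg[OF u] by (auto simp: eigenspace_def less_le simp del: mult_eq_0_iff)
 show "b u u > 0" using * by (cases "b u u = 0") auto
 then show "\<mu> > 0" using * by (metis zero_less_mult_pos2)
qed

text \<open>Compactness at \<epsilon> = 1/(2 \<Lambda>) bounds each \<open>b (u i) (u i) = 1\<close>
  by 1/2 plus finitely many squares of functionals, and each functional has a bounded sum of squares
  over the whole family; so the family has at most \<open>2 n \<Lambda> max D 0\<close> members.
  Different eigenvalues may be mixed, which gives finite multiplicities and finitely many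
  eigenvalues up to \<Lambda> at once.\<close>

lemma onormal_eigen_bounded:
 "\<exists>N::nat. \<forall>(I::'i set) u L. finite I \<and> b.onormal I u \<and> (\<forall>i\<in>I. u i \<in> eigenspace (L i) \<and> L i \<le> \<Lambda>) \<longrightarrow> card I \<le> N"
proof (cases "\<Lambda> > 0")
 case True
 then have \<Lambda>': "1 / (2 * \<Lambda>) > 0" by simp
 obtain n l D where l_add: "\<And>i x y. \<lbrakk>i < n; x \<in> H; y \<in> H\<rbrakk> \<Longrightarrow> l i (x + y) = l i x + l i y"
  and l_scale: "\<And>i x c. \<lbrakk>i < n; x \<in> H\<rbrakk> \<Longrightarrow> l i (c *\<^sub>R x) = c * l i x"
  and l_bound: "\<And>i x. \<lbrakk>i < n; x \<in> H\<rbrakk> \<Longrightarrow> (l i x)\<^sup>2 \<le> D * a x x"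
  and b_l: "\<And>x. x \<in> H \<Longrightarrow> b x x \<le> 1 / (2 * \<Lambda>) * a x x + (\<Sum>i<(n::nat). (l i x)\<^sup>2)" by (rule compactE[OF \<Lambda>']) blast
 have l0: "l i 0 = 0" if "i < n" for i using l_scale[OF that H_0, of 0] by simp
 have main: "real (card I) \<le> 2 * real n * \<Lambda> * max D 0"
  if I: "finite I" "b.onormal I u" "\<And>i. i \<in> I \<Longrightarrow> u i \<in> eigenspace (L i)" "\<And>i. i \<in> I \<Longrightarrow> L i \<le> \<Lambda>"
  for I :: "'i set" and u L
 proof -
  have uH: "u i \<in> H" if "i \<in> I" for i using I that by (auto simp: b.onormal_def)
  have au: "a (u i) (u j) = (if i = j then L i else 0)" if "i \<in> I" "j \<in> I" for i j
   using I(2,3) that by (auto simp: b.onormal_def eigenspace_def)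
  have Lpos: "L i > 0" if "i \<in> I" for i
   using eigenvalue_pos(1)[OF I(3)[OF that]] au[OF that that] a.nonneg[OF uH[OF that]]
    b_le[OF uH[OF that]] I(2) that by (cases "L i = 0") (auto simp: b.onormal_def)
  have lb: "(\<Sum>j\<in>I. (l i (u j))\<^sup>2) \<le> \<Lambda> * max D 0" if i: "i < n" for i
  proof -
   \<comment> \<open>The vectors \<open>u j\<close> are a-orthogonal with
     \<open>a (u j) (u j) = L j\<close>, so \<open>?x\<close> represents \<open>l i\<close> on their
     span for the form \<open>a\<close>. Both \<open>l i ?x\<close> and \<open>a ?x ?x\<close> equal
     \<open>s\<close>, and boundedness of \<open>l i\<close> reads
     \<open>s^2 \<le> D s\<close>.\<close>
   define c where "c j = l i (u j) / L j" for j
   define s where "s = (\<Sum>j\<in>I. c j * l i (u j))"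
   let ?x = "\<Sum>j\<in>I. c j *\<^sub>R u j"
   have x: "?x \<in> H" by (intro H_sum H_scale uH)
   have "l i (\<Sum>j\<in>J. c j *\<^sub>R u j) = (\<Sum>j\<in>J. c j * l i (u j))" if "finite J" "J \<subseteq> I" for J using that
   proof (induction J)
    case empty
    then show ?case using l0 i by simp
   next
    case (insert j J)
    have "(\<Sum>j\<in>J. c j *\<^sub>R u j) \<in> H" using insert by (intro H_sum H_scale uH) auto
    then show ?case using insert uH i by (simp add: l_add l_scale H_scale)
   qed
   then have lx: "l i ?x = s" using I(1) by (simp add: s_def)
   have "a ?x ?x = (\<Sum>j\<in>I. c j * a (u j) ?x)" using I(1) uH x by (intro a.sum_left)
   also have "\<dots> = (\<Sum>j\<in>I. c j * (\<Sum>k\<in>I. c k * a (u j) (u k)))"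
    using I(1) uH by (intro sum.cong refl arg_cong2[of _ _ _ _ "(*)"] a.sum_right) auto
   also have "\<dots> = (\<Sum>j\<in>I. c j * (c j * L j))"
   proof (intro sum.cong refl arg_cong2[of _ _ _ _ "(*)"])
    fix j assume j: "j \<in> I"
    have "(\<Sum>k\<in>I. c k * a (u j) (u k)) = (\<Sum>k\<in>I. if j = k then c k * L j else 0)" using au j by (intro sum.cong) auto
    also have "\<dots> = c j * L j" using I(1) j by simp
    finally show "(\<Sum>k\<in>I. c k * a (u j) (u k)) = c j * L j" .
   qed
   also have "\<dots> = s" unfolding s_def using Lpos by (intro sum.cong) (auto simp: c_def less_le)
   finally have ax: "a ?x ?x = s" .
   have s0: "s \<ge> 0" using a.nonneg[OF x] ax by simp
   have "s * s \<le> D * s" using l_bound[OF i x] lx ax by (simp add: power2_eq_square)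
   \<comment> \<open>\<open>D\<close> carries no sign and \<open>s\<close> may vanish, hence
     \<open>max D 0\<close>.\<close>
   then have sD: "s \<le> max D 0" using s0 by (cases "s = 0") auto
   have "(\<Sum>j\<in>I. (l i (u j))\<^sup>2) \<le> (\<Sum>j\<in>I. \<Lambda> * (c j * l i (u j)))"
   proof (rule sum_mono)
    fix j assume j: "j \<in> I"
    have "(l i (u j))\<^sup>2 * L j \<le> (l i (u j))\<^sup>2 * \<Lambda>" by (intro mult_left_mono I j) auto
    then show "(l i (u j))\<^sup>2 \<le> \<Lambda> * (c j * l i (u j))"
     using Lpos[OF j] by (simp add: c_def field_simps power2_eq_square)
   qed
   also have "\<dots> = \<Lambda> * s" by (simp add: s_def sum_distrib_left)
   also have "\<dots> \<le> \<Lambda> * max D 0" using True sD by (intro mult_left_mono) auto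
   finally show ?thesis .
  qed
  have "real (card I) = (\<Sum>j\<in>I. b (u j) (u j))" using I(2) by (simp add: b.onormal_def)
  also have "\<dots> \<le> (\<Sum>j\<in>I. 1 / 2 + (\<Sum>i<n. (l i (u j))\<^sup>2))"
  proof (rule sum_mono)
   fix j assume j: "j \<in> I"
   have "1 / (2 * \<Lambda>) * a (u j) (u j) \<le> 1 / 2" using au[OF j j] I(4)[OF j] True by (simp add: field_simps)
   then show "b (u j) (u j) \<le> 1 / 2 + (\<Sum>i<n. (l i (u j))\<^sup>2)" using b_l[OF uH[OF j]] by linarith
  qed
  also have "\<dots> = real (card I) / 2 + (\<Sum>i<n. \<Sum>j\<in>I. (l i (u j))\<^sup>2)" by (simp add: sum.distrib) (rule sum.swap)
  also have "\<dots> \<le> real (card I) / 2 + (\<Sum>i<n. \<Lambda> * max D 0)" by (intro add_left_mono sum_mono lb) auto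
  finally show ?thesis by simp
 qed
 show ?thesis
  by (rule exI[of _ "nat \<lceil>2 * real n * \<Lambda> * max D 0\<rceil>"]) (use main in \<open>force simp: le_nat_iff le_ceiling_iff\<close>)
next
 \<comment> \<open>Eigenvalues are positive, so only the empty family qualifies.\<close>
 case False
 have "card I = 0" if "finite I" "b.onormal I u" "\<forall>i\<in>I. u i \<in> eigenspace (L i) \<and> L i \<le> \<Lambda>"
  for I :: "'i set" and u L
 proof (rule ccontr)
  assume "card I \<noteq> 0"
  then obtain i where i: "i \<in> I" by fastforce
  then have "u i \<in> H" "b (u i) (u i) = 1" using that by (auto simp: b.onormal_def)
  then have "a (u i) (u i) \<noteq> 0" using b_null by fastforce
  then show False using eigenvalue_pos(1)[of "u i" "L i"] that i False by force
 qed
 then show ?thesis by (intro exI[of _ 0]) blast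
qed

text \<open>Each new eigenvector maximises \<open>b\<close> relative to \<open>a\<close> among the
  odd vectors that are b-orthogonal to the earlier ones. Its equation is then extended twice: to the
  earlier eigenvectors, which are orthogonal to it for \<open>a\<close> as well because they satisfy
  their own equation, and to even vectors, orthogonal to odd ones for both invariant forms.\<close>

lemma onormal_eigen_exist:
 "\<exists>u L. b.onormal {..<n::nat} u \<and> (\<forall>i<n. u i \<in> eigenspace (L i) \<and> \<sigma> (u i) = - u i)"
proof (induction n)
 case 0
 then show ?case by (auto simp: b.onormal_def)
next
 case (Suc n)
 then obtain u L where on: "b.onormal {..<n} u"
  and u: "\<And>i. i < n \<Longrightarrow> u i \<in> eigenspace (L i)" "\<And>i. i < n \<Longrightarrow> \<sigma> (u i) = - u i" by blast
 have uH: "u i \<in> H" if "i < n" for i using u that by (auto simp: eigenspace_def)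
 define W where "W = {x \<in> H. \<sigma> x = - x}"
 define V where "V = {x \<in> W. \<forall>i<n. b x (u i) = 0}"
 have \<sigma>0: "\<sigma> 0 = 0" using \<sigma>_scale[OF H_0, of 0] by simp
 have W: "subspace W" by (auto simp: W_def subspace_def H_0 H_add H_scale \<sigma>_add \<sigma>_scale \<sigma>0)
 have V: "subspace V" using W uH by (auto simp: V_def subspace_def b.zero_left W_def b.add_left b.scale_left)
 have VH: "V \<subseteq> H" by (auto simp: V_def W_def)
 have proj: "x - (\<Sum>i<n. b x (u i) *\<^sub>R u i) \<in> V" if x: "x \<in> W" for x
 proof -
  have xH: "x \<in> H" using x by (auto simp: W_def)
  have y: "(\<Sum>i<n. b x (u i) *\<^sub>R u i) \<in> W"
   using W uH u by (intro subspace_sum[OF W] subspace_scale[OF W]) (auto simp: W_def)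
  then have yH: "(\<Sum>i<n. b x (u i) *\<^sub>R u i) \<in> H" by (auto simp: W_def)
  show ?thesis unfolding V_def using x y subspace_diff[OF W] b.onormal_sum[OF _ on, of _ "\<lambda>i. b x (u i)"] xH yH uH
   by (auto simp: b.diff_left)
 qed
 \<comment> \<open>Dimension count. If \<open>b\<close> vanished on \<open>V\<close>, the n + 1
   orthonormal odd vectors \<open>v j\<close> would have null remainder over the n vectors
   \<open>u i\<close>; summing the squared coefficients both ways gives n + 1 \<le> n.\<close>
 have "\<exists>x\<in>V. b x x > 0"
 proof (rule ccontr)
  assume no: "\<not> ?thesis"
  obtain g where g: "\<And>i. i < Suc n \<Longrightarrow> g i \<in> W"
   "\<And>c. b (\<Sum>i<Suc n. c i *\<^sub>R g i) (\<Sum>i<Suc n. c i *\<^sub>R g i) = 0 \<Longrightarrow> \<forall>i<Suc n. c i = 0"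
   using many[of "Suc n"] unfolding W_def by blast
  then obtain v C where v: "b.onormal {..<Suc n} v" "\<And>j. j < Suc n \<Longrightarrow> v j = (\<Sum>i<Suc n. C j i *\<^sub>R g i)"
   using b.gram_schmidt[of "Suc n" g] unfolding W_def by blast
  have vW: "v j \<in> W" if "j < Suc n" for j
   unfolding v(2)[OF that] by (intro subspace_sum[OF W] subspace_scale[OF W] g) auto
  have eq: "b (v j) (v j) = (\<Sum>i<n. (b (v j) (u i))\<^sup>2)" if j: "j < Suc n" for j
  proof -
   let ?z = "v j - (\<Sum>i<n. b (v j) (u i) *\<^sub>R u i)"
   have "?z \<in> V" by (rule proj[OF vW[OF j]])
   then have "b ?z ?z = 0" using no b.nonneg[of ?z] VH by fastforce
   then show ?thesis using b.bessel_sum[OF _ on, of "v j"] vW[OF j] by (simp add: W_def)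
  qed
  have "real (Suc n) = (\<Sum>j<Suc n. b (v j) (v j))" using v(1) by (simp add: b.onormal_def)
  also have "\<dots> = (\<Sum>j<Suc n. \<Sum>i<n. (b (v j) (u i))\<^sup>2)" using eq by (intro sum.cong) auto
  also have "\<dots> = (\<Sum>i<n. \<Sum>j<Suc n. (b (v j) (u i))\<^sup>2)" by (rule sum.swap)
  also have "\<dots> = (\<Sum>i<n. \<Sum>j<Suc n. (b (u i) (v j))\<^sup>2)" using vW uH by (intro sum.cong refl) (auto simp: W_def b.sym)
  also have "\<dots> \<le> (\<Sum>i<n. b (u i) (u i))" using uH by (intro sum_mono b.bessel[OF _ v(1)]) auto
  also have "\<dots> = real n" using on by (simp add: b.onormal_def)
  finally show False by simp
 qed
 then obtain x0 where x0: "x0 \<in> V" "b x0 x0 > 0" by blast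
 have closed: "\<exists>y\<in>V. (\<lambda>k. a (X k - y) (X k - y)) \<longlonglongrightarrow> 0"
  if X: "\<And>k. X k \<in> V" and x: "x \<in> H" and lim: "(\<lambda>k. a (X k - x) (X k - x)) \<longlonglongrightarrow> 0" for X x
 proof -
  have XH: "X k \<in> H" and \<sigma>X: "\<sigma> (X k) = - X k" and bX: "i < n \<Longrightarrow> b (X k) (u i) = 0" for k i
   using X[of k] by (auto simp: V_def W_def)
  \<comment> \<open>The limit supplied by completeness is odd only up to a null vector. Its odd part
    is exactly odd, and projecting does not increase the energy of the error.\<close>
  define y where "y = (1/2) *\<^sub>R (x - \<sigma> x)"
  have \<sigma>x: "\<sigma> x \<in> H" by (rule \<sigma>_H[OF x])
  have y: "y \<in> H" unfolding y_def by (intro H_scale H_diff x \<sigma>x)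
  have \<sigma>_diff: "\<sigma> (p - q) = \<sigma> p - \<sigma> q" if "p \<in> H" "q \<in> H" for p q
   using \<sigma>_add[of p "-q"] \<sigma>_scale[of q "-1"] that H_neg by simp
  have "\<sigma> y = - y" unfolding y_def using x \<sigma>x by (simp add: \<sigma>_scale \<sigma>_diff \<sigma>_\<sigma> H_diff flip: scaleR_minus_right)
  then have yW: "y \<in> W" using y by (simp add: W_def)
  have le: "a (X k - y) (X k - y) \<le> a (X k - x) (X k - x)" for k
  proof -
   define z where "z = X k - x"
   have z: "z \<in> H" unfolding z_def by (intro H_diff XH x)
   have \<sigma>z: "\<sigma> z \<in> H" by (rule \<sigma>_H[OF z])
   have "X k - y = (1/2) *\<^sub>R (z - \<sigma> z)"
    unfolding z_def y_def using XH x by (simp add: \<sigma>_diff \<sigma>X algebra_simps flip: scaleR_left_distrib)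
   then have "a (X k - y) (X k - y) = 1/4 * a (z - \<sigma> z) (z - \<sigma> z)"
    using z \<sigma>z by (simp add: a.square_scale H_diff power2_eq_square)
   also have "\<dots> \<le> 1/4 * (a (z - \<sigma> z) (z - \<sigma> z) + a (z + \<sigma> z) (z + \<sigma> z))" using a.nonneg[OF H_add[OF z \<sigma>z]] by simp
   also have "\<dots> = a z z" using z \<sigma>z by (simp add: a.square_add a.square_diff a_\<sigma>)
   finally show ?thesis by (simp add: z_def)
  qed
  have lim': "(\<lambda>k. a (X k - y) (X k - y)) \<longlonglongrightarrow> 0"
   by (rule tendsto_sandwich[OF _ _ tendsto_const lim]) (use le a.nonneg H_diff XH y in auto)
  have "b y (u i) = 0" if "i < n" for i using b.tendsto_pair[OF XH y uH[OF that] tendsto_b[OF XH y lim']] bX[OF that]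
   by (simp add: LIMSEQ_const_iff)
  then have "y \<in> V" using yW by (simp add: V_def)
  then show ?thesis using lim' by blast
 qed
 obtain w \<mu> where w: "w \<in> V" "\<mu> > 0" "a w w = 1" "b w w = \<mu>" "\<And>x. x \<in> V \<Longrightarrow> b x x \<le> \<mu> * a x x"
  using maximizer[OF V VH _ x0] closed by blast
 have wH: "w \<in> H" and wW: "w \<in> W" and wb: "i < n \<Longrightarrow> b w (u i) = 0" for i using w(1) VH by (auto simp: V_def)
 have wa: "a w (u i) = 0" if "i < n" for i
  using u(1)[OF that] wH wb[OF that] a.sym[OF wH uH[OF that]] b.sym[OF wH uH[OF that]] by (auto simp: eigenspace_def)
 have eqW: "b w v = \<mu> * a w v" if v: "v \<in> W" for v
 proof -
  let ?y = "\<Sum>i<n. b v (u i) *\<^sub>R u i"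
  have vH: "v \<in> H" using v by (simp add: W_def)
  have yH: "?y \<in> H" using uH by (intro H_sum H_scale) auto
  have "b w (v - ?y) = \<mu> * a w (v - ?y)" by (rule euler_lagrange[OF V VH w(1,3,4,5) proj[OF v]])
  moreover have "b w ?y = 0" "a w ?y = 0"
   using b.sum_right[of "{..<n}" u w "\<lambda>i. b v (u i)"] a.sum_right[of "{..<n}" u w "\<lambda>i. b v (u i)"]
    wb wa uH wH by simp_all
  ultimately show ?thesis using wH vH yH by (simp add: a.diff_right b.diff_right)
 qed
 have eqH: "b w v = \<mu> * a w v" if v: "v \<in> H" for v
 proof -
  let ?o = "(1/2) *\<^sub>R (v - \<sigma> v)" and ?e = "(1/2) *\<^sub>R (v + \<sigma> v)"
  have \<sigma>v: "\<sigma> v \<in> H" by (rule \<sigma>_H[OF v])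
  have oe: "?o \<in> H" "?e \<in> H" using v \<sigma>v by (auto intro!: H_scale H_add H_diff)
  have \<sigma>m: "\<sigma> (- \<sigma> v) = - v" using \<sigma>_scale[OF \<sigma>v, of "-1"] \<sigma>_\<sigma>[OF v] by simp
  have "\<sigma> ?o = - ?o" using v \<sigma>v \<sigma>_add[OF v H_neg[OF \<sigma>v]] by (simp add: \<sigma>_scale H_diff \<sigma>m flip: scaleR_minus_right)
  then have oW: "?o \<in> W" using oe by (simp add: W_def)
  have \<sigma>e: "\<sigma> ?e = ?e" using v \<sigma>v by (simp add: \<sigma>_scale \<sigma>_add \<sigma>_\<sigma> H_add add.commute)
  have \<sigma>w: "\<sigma> w = - w" using wW by (simp add: W_def)
  have "a w ?e = 0" "b w ?e = 0" using a_\<sigma>[OF wH oe(2)] b_\<sigma>[OF wH oe(2)] oe wH unfolding \<sigma>e \<sigma>w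
   by (auto simp: a.minus_left b.minus_left)
  moreover have "v = ?o + ?e" by (simp add: algebra_simps flip: scaleR_left_distrib)
  ultimately show ?thesis using eqW[OF oW] oe wH a.add_right[OF oe wH] b.add_right[OF oe wH] by simp
 qed
 define r where "r = 1 / sqrt \<mu>"
 define x where "x = r *\<^sub>R w"
 have r: "r\<^sup>2 * \<mu> = 1" using w(2) by (simp add: r_def power_divide)
 have xH: "x \<in> H" unfolding x_def by (rule H_scale[OF wH])
 have \<sigma>x: "\<sigma> x = - x" using wW wH by (simp add: x_def W_def \<sigma>_scale)
 have mx: "m x = 0" using m_\<sigma>[OF xH] m_scale[OF xH, of "-1"] \<sigma>x by simp
 have xE: "x \<in> eigenspace (1 / \<mu>)"
  unfolding eigenspace_def using xH mx eqH wH w(2) by (auto simp: x_def a.scale_left b.scale_left)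
 have bxx: "b x x = 1" using wH w(4) r by (simp add: x_def b.square_scale)
 have bxu: "b x (u i) = 0" if "i < n" for i using wH uH[OF that] wb[OF that] by (simp add: x_def b.scale_left)
 have "b.onormal {..<Suc n} (u(n := x))"
  using on bxx bxu xH uH b.sym[OF xH uH] by (auto simp: b.onormal_def less_Suc_eq)
 moreover have "\<forall>i<Suc n. (u(n := x)) i \<in> eigenspace ((L(n := 1 / \<mu>)) i) \<and> \<sigma> ((u(n := x)) i) = - (u(n := x)) i"
  using u xE \<sigma>x by (auto simp: less_Suc_eq)
 ultimately show ?case by blast
qed

text \<open>On an eigenspace \<open>a = \<mu> b\<close>, so independence modulo a-null vectors
  amounts, by Gram-Schmidt, to a b-orthonormal family of the same size. The multiplicity of \<mu> is
  the largest such size, finite by \<open>onormal_eigen_bounded\<close>.\<close>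

theorem discrete_spectrum:
 "\<exists>lam :: nat \<Rightarrow> real. 0 < lam 0 \<and> mono lam \<and> filterlim lam at_top sequentially \<and>
   {l. \<exists>u\<in>eigenspace l. a u u \<noteq> 0} = range lam \<and>
   (\<forall>\<mu> (n::nat). (\<exists>U. (\<forall>i<n. U i \<in> eigenspace \<mu>) \<and>
     (\<forall>c. a (\<Sum>i<n. c i *\<^sub>R U i) (\<Sum>i<n. c i *\<^sub>R U i) = 0 \<longrightarrow> (\<forall>i<n. c i = 0)))
    \<longleftrightarrow> n \<le> card {k. lam k = \<mu>})"
proof -
 define S where "S = {l. \<exists>u\<in>eigenspace l. a u u \<noteq> 0}"
 define P where "P \<mu> n \<longleftrightarrow> (\<exists>u. b.onormal {..<n} u \<and> (\<forall>i<n. u i \<in> eigenspace \<mu>))" for \<mu> and n :: nat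
 have P_le: "P \<mu> n" if "P \<mu> k" "n \<le> k" for \<mu> n k
 proof -
  obtain u where "b.onormal {..<k} u" "\<forall>i<k. u i \<in> eigenspace \<mu>" using \<open>P \<mu> k\<close> by (auto simp: P_def)
  then show ?thesis unfolding P_def using \<open>n \<le> k\<close> by (intro exI[of _ u]) (auto simp: b.onormal_def)
 qed
 have indep_iff: "(\<exists>U. (\<forall>i<n. U i \<in> eigenspace \<mu>) \<and>
     (\<forall>c. a (\<Sum>i<n. c i *\<^sub>R U i) (\<Sum>i<n. c i *\<^sub>R U i) = 0 \<longrightarrow> (\<forall>i<n. c i = 0))) \<longleftrightarrow> P \<mu> n" for \<mu> n
 proof
  assume "\<exists>U. (\<forall>i<n. U i \<in> eigenspace \<mu>) \<and>
     (\<forall>c. a (\<Sum>i<n. c i *\<^sub>R U i) (\<Sum>i<n. c i *\<^sub>R U i) = 0 \<longrightarrow> (\<forall>i<n. c i = 0))"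
  then obtain U where U: "\<And>i. i < n \<Longrightarrow> U i \<in> eigenspace \<mu>"
   "\<And>c. a (\<Sum>i<n. c i *\<^sub>R U i) (\<Sum>i<n. c i *\<^sub>R U i) = 0 \<Longrightarrow> \<forall>i<n. c i = 0" by blast
  have UH: "U i \<in> H" if "i < n" for i using U that by (auto simp: eigenspace_def)
  have "\<forall>i<n. c i = 0" if "b (\<Sum>i<n. c i *\<^sub>R U i) (\<Sum>i<n. c i *\<^sub>R U i) = 0" for c
  proof (rule U(2))
   have "(\<Sum>i<n. c i *\<^sub>R U i) \<in> eigenspace \<mu>" using U by (intro subspace_sum subspace_scale eigenspace_subspace) auto
   then show "a (\<Sum>i<n. c i *\<^sub>R U i) (\<Sum>i<n. c i *\<^sub>R U i) = 0" using that by (simp add: eigenspace_def)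
  qed
  then obtain v C where v: "b.onormal {..<n} v" "\<And>j. j < n \<Longrightarrow> v j = (\<Sum>i<n. C j i *\<^sub>R U i)"
   using b.gram_schmidt[of n U] UH by blast
  have "v j \<in> eigenspace \<mu>" if "j < n" for j
   unfolding v(2)[OF that] using U by (intro subspace_sum subspace_scale eigenspace_subspace) auto
  then show "P \<mu> n" unfolding P_def using v(1) by blast
 next
  assume "P \<mu> n"
  then obtain u where on: "b.onormal {..<n} u" and u: "\<And>i. i < n \<Longrightarrow> u i \<in> eigenspace \<mu>" by (auto simp: P_def)
  have uH: "u i \<in> H" if "i < n" for i using u that by (auto simp: eigenspace_def)
  have "\<forall>i<n. c i = 0" if c: "a (\<Sum>i<n. c i *\<^sub>R u i) (\<Sum>i<n. c i *\<^sub>R u i) = 0" for c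
  proof (intro allI impI)
   fix i assume i: "i < n"
   let ?x = "\<Sum>i<n. c i *\<^sub>R u i"
   have xH: "?x \<in> H" using uH by (intro H_sum H_scale) auto
   have "b (u i) ?x = 0" using b.null_right[OF uH[OF i] xH] b_null[OF xH c] by simp
   then show "c i = 0" using b.onormal_sum[OF _ on, of i c] i b.sym[OF xH uH[OF i]] by simp
  qed
  then show "\<exists>U. (\<forall>i<n. U i \<in> eigenspace \<mu>) \<and>
     (\<forall>c. a (\<Sum>i<n. c i *\<^sub>R U i) (\<Sum>i<n. c i *\<^sub>R U i) = 0 \<longrightarrow> (\<forall>i<n. c i = 0))" using u by blast
 qed
 have P_bdd: "\<exists>N. \<forall>n. P \<mu> n \<longrightarrow> n \<le> N" for \<mu>
 proof -
  obtain N where N: "\<And>(I::nat set) u L. \<lbrakk>finite I; b.onormal I u; \<forall>i\<in>I. u i \<in> eigenspace (L i) \<and> L i \<le> \<mu>\<rbrakk> \<Longrightarrow> card I \<le> N"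
   using onormal_eigen_bounded[where ?'i=nat, of \<mu>] by blast
  have "n \<le> N" if "P \<mu> n" for n using that N[of "{..<n}" _ "\<lambda>_. \<mu>"] by (auto simp: P_def)
  then show ?thesis by blast
 qed
 define d where "d \<mu> = Max {n. P \<mu> n}" for \<mu>
 have P_d: "P \<mu> n \<longleftrightarrow> n \<le> d \<mu>" for \<mu> n
 proof -
  have "finite {n. P \<mu> n}" using P_bdd[of \<mu>] by (auto simp: finite_nat_set_iff_bounded_le)
  moreover have "P \<mu> 0" by (auto simp: P_def b.onormal_def)
  ultimately have "P \<mu> (d \<mu>)" "\<And>n. P \<mu> n \<Longrightarrow> n \<le> d \<mu>" using Max_in[of "{n. P \<mu> n}"] by (auto simp: d_def)
  then show ?thesis using P_le by blast
 qed
 have unit: "\<exists>u\<in>eigenspace \<mu>. b u u = 1" if \<mu>: "\<mu> \<in> S" for \<mu>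
 proof -
  obtain u where u: "u \<in> eigenspace \<mu>" "a u u \<noteq> 0" using \<mu> by (auto simp: S_def)
  have p: "b u u > 0" by (rule eigenvalue_pos[OF u])
  have uH: "u \<in> H" using u by (auto simp: eigenspace_def)
  have "b ((1 / sqrt (b u u)) *\<^sub>R u) ((1 / sqrt (b u u)) *\<^sub>R u) = 1"
   using p uH by (simp add: b.square_scale power_divide)
  then show ?thesis using subspace_scale[OF eigenspace_subspace u(1)] by blast
 qed
 have S_iff: "\<mu> \<in> S \<longleftrightarrow> P \<mu> 1" for \<mu>
 proof
  assume "\<mu> \<in> S"
  then obtain u where "u \<in> eigenspace \<mu>" "b u u = 1" using unit by blast
  then show "P \<mu> 1" unfolding P_def by (intro exI[of _ "\<lambda>_. u"]) (auto simp: b.onormal_def eigenspace_def)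
 next
  assume "P \<mu> 1"
  then obtain u where u: "u (0::nat) \<in> eigenspace \<mu>" "b (u 0) (u 0) = 1" by (auto simp: P_def b.onormal_def)
  then have "a (u 0) (u 0) \<noteq> 0" using b_null[of "u 0"] by (auto simp: eigenspace_def)
  then show "\<mu> \<in> S" using u by (auto simp: S_def)
 qed
 have fin: "finite {s \<in> S. s \<le> x}" for x
 proof -
  obtain N where N: "\<And>(I::real set) u L. \<lbrakk>finite I; b.onormal I u; \<forall>i\<in>I. u i \<in> eigenspace (L i) \<and> L i \<le> x\<rbrakk> \<Longrightarrow> card I \<le> N"
   using onormal_eigen_bounded[where ?'i=real, of x] by blast
  obtain w where w: "\<And>\<mu>. \<mu> \<in> S \<Longrightarrow> w \<mu> \<in> eigenspace \<mu>" "\<And>\<mu>. \<mu> \<in> S \<Longrightarrow> b (w \<mu>) (w \<mu>) = 1" using unit by metis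
  \<comment> \<open>Eigenvectors of distinct eigenvalues are b-orthogonal, so one unit vector for
    each gives an orthonormal family indexed by the eigenvalues.\<close>
  have "card F \<le> N" if F: "F \<subseteq> {s \<in> S. s \<le> x}" "finite F" for F
  proof (rule N[of F w "\<lambda>\<mu>. \<mu>"])
   show "b.onormal F w" unfolding b.onormal_def
   proof (intro conjI ballI)
    fix i assume i: "i \<in> F"
    then show "w i \<in> H" using w(1)[of i] F by (auto simp: eigenspace_def)
    fix j assume j: "j \<in> F"
    show "b (w i) (w j) = (if i = j then 1 else 0)"
     using eigen_orthogonal[OF w(1) w(1), of i j] w(2)[of i] F i j by auto
   qed
  qed (use F w in auto)
  then show ?thesis using finite_if_finite_subsets_card_bdd[of "{s \<in> S. s \<le> x}" N] by blast
 qed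
 have inf: "infinite S"
 proof
  assume fS: "finite S"
  define x where "x = Max (insert 0 S)"
  obtain N where N: "\<And>(I::nat set) u L. \<lbrakk>finite I; b.onormal I u; \<forall>i\<in>I. u i \<in> eigenspace (L i) \<and> L i \<le> x\<rbrakk> \<Longrightarrow> card I \<le> N"
   using onormal_eigen_bounded[where ?'i=nat, of x] by blast
  obtain u L where on: "b.onormal {..<Suc N} u" and u: "\<And>i. i < Suc N \<Longrightarrow> u i \<in> eigenspace (L i)"
   using onormal_eigen_exist[of "Suc N"] by blast
  have "L i \<le> x" if i: "i < Suc N" for i
  proof -
   have "b (u i) (u i) = 1" "u i \<in> H" using on i by (auto simp: b.onormal_def)
   then have "a (u i) (u i) \<noteq> 0" using b_null[of "u i"] by auto
   then have "L i \<in> S" using u[OF i] by (auto simp: S_def)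
   then show ?thesis unfolding x_def using fS by simp
  qed
  then have "card {..<Suc N} \<le> N" using N[of "{..<Suc N}" u L] on u by auto
  then show False by simp
 qed
 have dpos: "d s > 0" if "s \<in> S" for s using that S_iff P_d[of s 1] by auto
 obtain lam where lam: "mono lam" "filterlim lam at_top sequentially" "range lam = S"
   "\<And>x. finite {k. lam k = x}" "\<And>s. s \<in> S \<Longrightarrow> card {k. lam k = s} = d s"
  using enumerate_with_multiplicity[of S d, OF inf fin dpos] by blast
 have "lam 0 \<in> S" using lam by auto
 then have "0 < lam 0" using eigenvalue_pos by (auto simp: S_def)
 moreover have "P \<mu> n \<longleftrightarrow> n \<le> card {k. lam k = \<mu>}" for \<mu> n
 proof (cases "\<mu> \<in> S")
  case True
  then show ?thesis using lam P_d by simp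
 next
  case False
  then have "{k. lam k = \<mu>} = {}" using lam(3) by auto
  moreover have "d \<mu> = 0" using False S_iff P_d[of \<mu> 1] by auto
  ultimately show ?thesis using P_d by simp
 qed
 ultimately show ?thesis unfolding indep_iff S_def[symmetric] using lam(1-3) by (intro exI[of _ lam]) simp
qed

end

section \<open>Hausdorff measure\<close>

abbreviation hausdorff_surf :: "'a::euclidean_space set \<Rightarrow> ennreal" where
 "hausdorff_surf \<equiv> hausdorff (real (DIM('a)) - 1)"

lemma hausdorff_normal_pos: "s \<ge> 0 \<Longrightarrow> hausdorff_normal s > 0"
 by (simp add: hausdorff_normal_def)

lemma hausdorff_pre_mono: "A \<subseteq> B \<Longrightarrow> hausdorff_pre s \<delta> A \<le> hausdorff_pre s \<delta> B"
 unfolding hausdorff_pre_def by (rule INF_superset_mono) auto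

lemma hausdorff_pre_antimono: "\<delta> \<le> \<delta>' \<Longrightarrow> hausdorff_pre s \<delta>' A \<le> hausdorff_pre s \<delta> A"
 unfolding hausdorff_pre_def by (rule INF_superset_mono) (auto intro: order_trans)

lemma hausdorff_mono: "A \<subseteq> B \<Longrightarrow> hausdorff s A \<le> hausdorff s B"
 unfolding hausdorff_def by (rule SUP_mono) (use hausdorff_pre_mono in blast)

lemma hausdorff_pre_le_hausdorff: "\<delta> > 0 \<Longrightarrow> hausdorff_pre s \<delta> A \<le> hausdorff s A"
 unfolding hausdorff_def by (intro SUP_upper) auto

lemma hausdorff_pre_le_suminf:
 assumes "A \<subseteq> (\<Union>i. C i)" "\<And>i. bounded (C i)" "\<And>i. diameter (C i) \<le> \<delta>"
 shows "hausdorff_pre s \<delta> A \<le> (\<Sum>i::nat. ennreal (hausdorff_normal s * diameter (C i) powr s))"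
 unfolding hausdorff_pre_def by (rule INF_lower) (use assms in auto)

text \<open>The finite cover is padded with empty sets, whose terms vanish because
  \<open>0 powr s = 0\<close>.\<close>

lemma hausdorff_pre_le_sum:
 assumes "finite I" "A \<subseteq> (\<Union>i\<in>I. C i)" "\<And>i. i \<in> I \<Longrightarrow> bounded (C i)"
  "\<And>i. i \<in> I \<Longrightarrow> diameter (C i) \<le> D" "0 \<le> D" "D \<le> \<delta>" "s > 0"
 shows "hausdorff_pre s \<delta> A \<le> ennreal (real (card I) * (hausdorff_normal s * D powr s))"
proof -
 obtain h where h: "bij_betw h {..<card I} I"
  using ex_bij_betw_nat_finite[OF assms(1)] by (auto simp: atLeast0LessThan)
 have hI: "h j \<in> I" if "j < card I" for j using h that by (auto simp: bij_betw_def)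
 define C' where "C' j = (if j < card I then C (h j) else {})" for j
 have "hausdorff_pre s \<delta> A \<le> (\<Sum>j. ennreal (hausdorff_normal s * diameter (C' j) powr s))"
 proof (rule hausdorff_pre_le_suminf)
  show "A \<subseteq> (\<Union>j. C' j)"
  proof
   fix x assume "x \<in> A"
   then obtain i where i: "i \<in> I" "x \<in> C i" using assms(2) by auto
   then have "i \<in> h ` {..<card I}" using h by (simp add: bij_betw_def)
   then obtain j where "j < card I" "h j = i" by blast
   then show "x \<in> (\<Union>j. C' j)" using i by (auto simp: C'_def intro!: exI[of _ j])
  qed
  show "bounded (C' j)" for j using assms(3) hI by (auto simp: C'_def)
  show "diameter (C' j) \<le> \<delta>" for j using assms(4)[OF hI] assms(5,6) by (force simp: C'_def)
 qed
 also have "\<dots> = (\<Sum>j<card I. ennreal (hausdorff_normal s * diameter (C' j) powr s))"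
  using assms(7) by (intro suminf_finite) (auto simp: C'_def)
 also have "\<dots> \<le> (\<Sum>j<card I. ennreal (hausdorff_normal s * D powr s))"
 proof (intro sum_mono ennreal_leI mult_left_mono powr_mono2)
  fix j assume "j \<in> {..<card I}"
  then show "diameter (C' j) \<le> D" "0 \<le> diameter (C' j)" using assms(3,4)[OF hI] by (auto simp: C'_def diameter_ge_0)
 qed (use assms(7) hausdorff_normal_pos[of s] in auto)
 also have "\<dots> = ennreal (real (card I) * (hausdorff_normal s * D powr s))"
  using hausdorff_normal_pos[of s] assms(7) by (simp add: ennreal_mult' ennreal_of_nat_eq_real_of_nat)
 finally show ?thesis .
qed

text \<open>The cover of the i-th set is allowed an excess of \<open>e / 2^(i + 1)\<close>, and the
  pairing of natural numbers merges all covers into one sequence.\<close>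

lemma hausdorff_pre_countably_subadditive:
 fixes A :: "nat \<Rightarrow> 'a::euclidean_space set"
 shows "hausdorff_pre s \<delta> (\<Union>i. A i) \<le> (\<Sum>i. hausdorff_pre s \<delta> (A i))"
proof (rule ennreal_le_epsilon)
 fix e :: real assume fin: "(\<Sum>i. hausdorff_pre s \<delta> (A i)) < top" and e: "e > 0"
 define q where "q C = ennreal (hausdorff_normal s * diameter C powr s)" for C :: "'a set"
 have "\<exists>C. A i \<subseteq> (\<Union>j. C j) \<and> (\<forall>j. bounded (C j) \<and> diameter (C j) \<le> \<delta>) \<and>
   (\<Sum>j::nat. q (C j)) \<le> hausdorff_pre s \<delta> (A i) + ennreal (e * (1/2) ^ Suc i)" for i
 proof -
  have "hausdorff_pre s \<delta> (A i) < top" using fin ennreal_suminf_lessD by blast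
  then have "hausdorff_pre s \<delta> (A i) < hausdorff_pre s \<delta> (A i) + ennreal (e * (1/2) ^ Suc i)"
   using e by (simp add: ennreal_add_left_cancel_less[of _ 0, simplified])
  then show ?thesis unfolding hausdorff_pre_def[of s \<delta> "A i"] INF_less_iff q_def[symmetric]
   by (auto dest: less_imp_le)
 qed
 then obtain C where C: "\<And>i. A i \<subseteq> (\<Union>j. C i j)" "\<And>i j. bounded (C i j)" "\<And>i j. diameter (C i j) \<le> \<delta>"
   "\<And>i. (\<Sum>j::nat. q (C i j)) \<le> hausdorff_pre s \<delta> (A i) + ennreal (e * (1/2) ^ Suc i)" by metis
 have "hausdorff_pre s \<delta> (\<Union>i. A i) \<le> (\<Sum>k. q (case_prod C (prod_decode k)))" unfolding q_def
 proof (rule hausdorff_pre_le_suminf)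
  show "(\<Union>i. A i) \<subseteq> (\<Union>k. case_prod C (prod_decode k))"
  proof
   fix x assume "x \<in> (\<Union>i. A i)"
   then obtain i j where "x \<in> C i j" using C(1) by blast
   then show "x \<in> (\<Union>k. case_prod C (prod_decode k))" by (intro UN_I[of "prod_encode (i, j)"]) auto
  qed
 qed (use C in \<open>auto split: prod.split\<close>)
 also have "\<dots> = (\<Sum>i. \<Sum>j. q (C i j))" using suminf_ennreal_2dimen[of "\<lambda>i. \<Sum>j. q (C i j)" "\<lambda>(i, j). q (C i j)"]
  by (simp add: case_prod_unfold)
 also have "\<dots> \<le> (\<Sum>i. hausdorff_pre s \<delta> (A i) + ennreal (e * (1/2) ^ Suc i))" by (intro suminf_le C(4)) auto
 also have "\<dots> = (\<Sum>i. hausdorff_pre s \<delta> (A i)) + (\<Sum>i. ennreal (e * (1/2) ^ Suc i))"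
  by (rule suminf_add[symmetric]) auto
 also have "(\<Sum>i. ennreal (e * (1/2) ^ Suc i)) = ennreal e"
 proof (rule suminf_ennreal_eq)
  show "(\<lambda>i. e * (1/2) ^ Suc i) sums e" using sums_mult[OF power_half_series, of e] by simp
 qed (use e in simp)
 finally show "hausdorff_pre s \<delta> (\<Union>i. A i) \<le> (\<Sum>i. hausdorff_pre s \<delta> (A i)) + ennreal e" .
qed

lemma hausdorff_countably_subadditive:
 "hausdorff s (\<Union>i. A i) \<le> (\<Sum>i::nat. hausdorff s (A i))" unfolding hausdorff_def[of s "\<Union>i. A i"]
proof (rule SUP_least)
 fix \<delta> :: real assume "\<delta> \<in> {0<..}"
 then have "(\<Sum>i. hausdorff_pre s \<delta> (A i)) \<le> (\<Sum>i. hausdorff s (A i))"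
  by (intro suminf_le hausdorff_pre_le_hausdorff) auto
 then show "hausdorff_pre s \<delta> (\<Union>i. A i) \<le> (\<Sum>i. hausdorff s (A i))"
  using hausdorff_pre_countably_subadditive order_trans by blast
qed

lemma hausdorff_empty: "s > 0 \<Longrightarrow> hausdorff s {} = 0"
proof -
 assume s: "s > 0"
 have "hausdorff_pre s \<delta> ({}::'a set) \<le> 0" if "\<delta> > 0" for \<delta>
  using hausdorff_pre_le_suminf[of "{}::'a set" "\<lambda>_. {}" \<delta> s] s that by simp
 then show ?thesis unfolding hausdorff_def by (auto intro!: antisym SUP_least)
qed

lemma hausdorff_Un:
 assumes "s > 0"
 shows "hausdorff s (A \<union> B) \<le> hausdorff s A + hausdorff s B"
proof -
 have "hausdorff s (\<Union>i. binaryset A B i) \<le> (\<Sum>i. hausdorff s (binaryset A B i))"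
  by (rule hausdorff_countably_subadditive)
 then show ?thesis using suminf_binaryset_eq[of "hausdorff s" A B, OF hausdorff_empty[OF assms]]
  by (simp add: UN_binaryset_eq)
qed

lemma hausdorff_UN_le_sum:
 assumes "s > 0" "finite I"
 shows "hausdorff s (\<Union>i\<in>I. A i) \<le> (\<Sum>i\<in>I. hausdorff s (A i))"
 using assms(2)
proof induction
 case empty
 then show ?case using hausdorff_empty[OF assms(1)] by simp
next
 case (insert i I)
 then show ?case using hausdorff_Un[OF assms(1), of "A i" "\<Union>i\<in>I. A i"] by (auto intro: order_trans add_left_mono)
qed

text \<open>A set of diameter below \<eta> cannot meet both \<open>A\<close> and \<open>B\<close>,
  so a sufficiently fine cover of the union splits into two covers.\<close>

lemma hausdorff_separated:
 assumes s: "s > 0" and \<eta>: "\<eta> > 0" and sep: "\<And>x y. x \<in> A \<Longrightarrow> y \<in> B \<Longrightarrow> \<eta> \<le> dist x y"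
 shows "hausdorff s A + hausdorff s B \<le> hausdorff s (A \<union> B)"
proof -
 have pre: "hausdorff_pre s \<delta> A + hausdorff_pre s \<delta> B \<le> hausdorff_pre s \<delta> (A \<union> B)" if \<delta>: "0 < \<delta>" "\<delta> < \<eta>" for \<delta>
  unfolding hausdorff_pre_def[of s \<delta> "A \<union> B"]
 proof (rule INF_greatest)
  fix C :: "nat \<Rightarrow> 'a set"
  assume "C \<in> {C. A \<union> B \<subseteq> (\<Union>i. C i) \<and> (\<forall>i. bounded (C i) \<and> diameter (C i) \<le> \<delta>)}"
  then have C: "A \<union> B \<subseteq> (\<Union>i. C i)" "\<And>i. bounded (C i)" "\<And>i. diameter (C i) \<le> \<delta>" by auto
  define CA where "CA i = (if C i \<inter> A \<noteq> {} then C i else {})" for i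
  define CB where "CB i = (if C i \<inter> A \<noteq> {} then {} else C i)" for i
  have "hausdorff_pre s \<delta> A \<le> (\<Sum>i. ennreal (hausdorff_normal s * diameter (CA i) powr s))"
   by (rule hausdorff_pre_le_suminf) (use C \<delta> in \<open>auto simp: CA_def\<close>, blast)
  moreover have "hausdorff_pre s \<delta> B \<le> (\<Sum>i. ennreal (hausdorff_normal s * diameter (CB i) powr s))"
  proof (rule hausdorff_pre_le_suminf)
   show "B \<subseteq> (\<Union>i. CB i)"
   proof
    fix y assume y: "y \<in> B"
    then obtain i where i: "y \<in> C i" using C(1) by blast
    have "C i \<inter> A = {}"
    proof (rule ccontr)
     assume "C i \<inter> A \<noteq> {}"
     then obtain x where x: "x \<in> C i" "x \<in> A" by blast
     have "dist x y \<le> diameter (C i)" by (rule diameter_bounded_bound[OF C(2) x(1) i])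
     then show False using sep[OF x(2) y] C(3)[of i] \<delta> by linarith
    qed
    then show "y \<in> (\<Union>i. CB i)" using i by (auto simp: CB_def)
   qed
  qed (use C \<delta> in \<open>auto simp: CB_def\<close>)
  ultimately have "hausdorff_pre s \<delta> A + hausdorff_pre s \<delta> B \<le>
    (\<Sum>i. ennreal (hausdorff_normal s * diameter (CA i) powr s)) + (\<Sum>i. ennreal (hausdorff_normal s * diameter (CB i) powr s))"
   by (rule add_mono)
  also have "\<dots> = (\<Sum>i. ennreal (hausdorff_normal s * diameter (CA i) powr s) + ennreal (hausdorff_normal s * diameter (CB i) powr s))"
   by (rule suminf_add) auto
  also have "\<dots> = (\<Sum>i. ennreal (hausdorff_normal s * diameter (C i) powr s))"
   using s by (intro suminf_cong) (auto simp: CA_def CB_def)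
  finally show "hausdorff_pre s \<delta> A + hausdorff_pre s \<delta> B \<le> (\<Sum>i. ennreal (hausdorff_normal s * diameter (C i) powr s))" .
 qed
 \<comment> \<open>The two suprema are taken one after the other; replacing both scales by a common
   smaller one only increases the left side.\<close>
 have "hausdorff_pre s \<delta> A + hausdorff_pre s \<delta>' B \<le> hausdorff s (A \<union> B)" if "\<delta> > 0" "\<delta>' > 0" for \<delta> \<delta>'
 proof -
  define \<rho> where "\<rho> = min (\<eta> / 2) (min \<delta> \<delta>')"
  have \<rho>: "0 < \<rho>" "\<rho> < \<eta>" "\<rho> \<le> \<delta>" "\<rho> \<le> \<delta>'" using that \<eta> by (auto simp: \<rho>_def)
  have "hausdorff_pre s \<delta> A + hausdorff_pre s \<delta>' B \<le> hausdorff_pre s \<rho> A + hausdorff_pre s \<rho> B"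
   by (intro add_mono hausdorff_pre_antimono \<rho>)
  also have "\<dots> \<le> hausdorff_pre s \<rho> (A \<union> B)" by (rule pre[OF \<rho>(1,2)])
  also have "\<dots> \<le> hausdorff s (A \<union> B)" by (rule hausdorff_pre_le_hausdorff[OF \<rho>(1)])
  finally show ?thesis .
 qed
 then have "(SUP \<delta>'\<in>{0<..}. hausdorff_pre s \<delta> A + hausdorff_pre s \<delta>' B) \<le> hausdorff s (A \<union> B)" if "\<delta> > 0" for \<delta>
  using that by (intro SUP_least) auto
 then have "hausdorff_pre s \<delta> A + hausdorff s B \<le> hausdorff s (A \<union> B)" if "\<delta> > 0" for \<delta>
  unfolding hausdorff_def[of s B] using that by (subst ennreal_SUP_add_right) auto
 then have "(SUP \<delta>\<in>{0<..}. hausdorff_pre s \<delta> A + hausdorff s B) \<le> hausdorff s (A \<union> B)" by (intro SUP_least) auto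
 then show ?thesis unfolding hausdorff_def[of s A] by (subst ennreal_SUP_add_left[symmetric]) auto
qed

lemma ennreal_suminf_tail_tendsto_0:
 fixes f :: "nat \<Rightarrow> ennreal"
 assumes "(\<Sum>i. f i) < top"
 shows "(\<lambda>k. \<Sum>i. f (i + k)) \<longlonglongrightarrow> 0"
proof -
 define r where "r i = enn2real (f i)" for i
 have f: "f i = ennreal (r i)" for i
  unfolding r_def using ennreal_suminf_lessD[OF assms, of i] by (simp add: less_top)
 have r: "0 \<le> r i" for i by (simp add: r_def)
 have sm: "summable r" using assms r unfolding f by (intro summable_suminf_not_top) auto
 have "(\<lambda>k. \<Sum>i. r (i + k)) \<longlonglongrightarrow> 0" by (rule suminf_exist_split2[OF sm])
 then have "(\<lambda>k. ennreal (\<Sum>i. r (i + k))) \<longlonglongrightarrow> ennreal 0" by (intro tendsto_ennrealI)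
 moreover have "ennreal (\<Sum>i. r (i + k)) = (\<Sum>i. f (i + k))" for k
  unfolding f using r summable_ignore_initial_segment[OF sm] by (intro suminf_ennreal2[symmetric]) auto
 ultimately show ?thesis by simp
qed

text \<open>Caratheodory's criterion for metric outer measures: the part of a test set \<open>X\<close> near \<open>F\<close> is
 cut into shells, and shells of equal parity are separated.\<close>

lemma hausdorff_closed_caratheodory:
 fixes F X :: "'a::euclidean_space set"
 assumes s: "s > 0" and F: "closed F"
 shows "hausdorff s (F \<inter> X) + hausdorff s (X - F) \<le> hausdorff s X"
proof (cases "F = {} \<or> hausdorff s X = top")
 case True
 then show ?thesis by (auto simp: hausdorff_empty[OF s])
next
 case False
 then have ne: "F \<noteq> {}" and fin: "hausdorff s X < top" by (auto simp: less_top)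
 define g where "g y = infdist y F" for y
 have g_lip: "\<bar>g x - g y\<bar> \<le> dist x y" for x y unfolding g_def by (simp add: infdist_eq_setdist setdist_Lipschitz)
 have g_pos: "g y > 0" if "y \<notin> F" for y unfolding g_def using that F ne by (simp add: infdist_pos_not_in_closed)
 have g_0: "g y = 0" if "y \<in> F" for y unfolding g_def using that by simp
 define A where "A k = {y \<in> X. 1 / real (Suc k) \<le> g y}" for k
 define R where "R k = {y \<in> X. 1 / real (Suc (Suc k)) \<le> g y \<and> g y < 1 / real (Suc k)}" for k
 have Rsep: "dist x y \<ge> 1 / real (Suc (Suc j)) - 1 / real (Suc k)" if "x \<in> R j" "y \<in> R k" for x y j k
  using g_lip[of x y] that by (auto simp: R_def)
 have parity: "(\<Sum>i<n. hausdorff s (R (2 * i + p))) \<le> hausdorff s (\<Union>i<n. R (2 * i + p))" for n p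
 proof (induction n)
  case (Suc n)
  have sep: "hausdorff s (\<Union>i<n. R (2 * i + p)) + hausdorff s (R (2 * n + p)) \<le> hausdorff s ((\<Union>i<n. R (2 * i + p)) \<union> R (2 * n + p))"
  proof (cases "n = 0")
   case True
   then show ?thesis by (simp add: hausdorff_empty[OF s])
  next
   case False
   show ?thesis
   proof (rule hausdorff_separated[OF s])
    \<comment> \<open>The width of the shell of index 2n + p - 1 lying in between. For n = 0 the
      union is empty, and that case is treated apart.\<close>
    show "1 / real (2 * n + p) - 1 / real (Suc (2 * n + p)) \<le> dist x y"
     if x: "x \<in> (\<Union>i<n. R (2 * i + p))" and y: "y \<in> R (2 * n + p)" for x y
    proof -
     obtain i where i: "i < n" "x \<in> R (2 * i + p)" using x by auto
     have "1 / real (2 * n + p) \<le> 1 / real (Suc (Suc (2 * i + p)))" using i by (intro divide_left_mono) auto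
     then show ?thesis using Rsep[OF i(2) y] by linarith
    qed
    show "0 < 1 / real (2 * n + p) - 1 / real (Suc (2 * n + p))"
     unfolding diff_gt_0_iff_gt using False by (intro divide_strict_left_mono) auto
   qed
  qed
  have un: "(\<Union>i<Suc n. R (2 * i + p)) = (\<Union>i<n. R (2 * i + p)) \<union> R (2 * n + p)" by (auto simp: lessThan_Suc)
  have le: "(\<Sum>i<Suc n. hausdorff s (R (2 * i + p))) \<le> hausdorff s (\<Union>i<n. R (2 * i + p)) + hausdorff s (R (2 * n + p))"
   using add_right_mono[OF Suc] by simp
  show ?case unfolding un by (rule order_trans[OF le sep])
 qed (simp add: hausdorff_empty[OF s])
 have RX: "(\<Union>i\<in>I. R (h i)) \<subseteq> X" for I :: "nat set" and h by (auto simp: R_def)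
 have partial: "(\<Sum>i<n. hausdorff s (R i)) \<le> 2 * hausdorff s X" for n
 proof -
  have "(\<Sum>i<n. hausdorff s (R i)) \<le> (\<Sum>i<2 * n. hausdorff s (R i))" by (intro sum_mono2) auto
  also have "\<dots> = (\<Sum>i<n. hausdorff s (R (2 * i + 0))) + (\<Sum>i<n. hausdorff s (R (2 * i + 1)))"
   by (induction n) (auto simp: algebra_simps)
  also have "\<dots> \<le> hausdorff s (\<Union>i<n. R (2 * i + 0)) + hausdorff s (\<Union>i<n. R (2 * i + 1))" by (intro add_mono parity)
  also have "\<dots> \<le> hausdorff s X + hausdorff s X" by (intro add_mono hausdorff_mono RX)
  finally show ?thesis by (simp add: mult_2)
 qed
 have "(\<Sum>i. hausdorff s (R i)) \<le> 2 * hausdorff s X" by (intro suminf_le_const partial) auto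
 also have "\<dots> < top" using fin by (simp add: ennreal_mult_less_top)
 finally have tail: "(\<lambda>k. \<Sum>i. hausdorff s (R (i + k))) \<longlonglongrightarrow> 0" by (rule ennreal_suminf_tail_tendsto_0)
 have bound: "hausdorff s (F \<inter> X) + hausdorff s (X - F) \<le> hausdorff s X + (\<Sum>i. hausdorff s (R (i + k)))" for k
 proof -
  have "X - F \<subseteq> A k \<union> (\<Union>i. R (i + k))"
  proof
   fix y assume y: "y \<in> X - F"
   show "y \<in> A k \<union> (\<Union>i. R (i + k))"
   proof (cases "1 / real (Suc k) \<le> g y")
    case True
    then show ?thesis using y by (auto simp: A_def)
   next
    case False
    \<comment> \<open>The least index l with 1 / (l + 1) \<le> g y places y in the shell of index l
      - 1; since g y is below 1 / (k + 1), l exceeds k and the shell belongs to the tail.\<close>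
    define P where "P j \<longleftrightarrow> 1 / real (Suc j) \<le> g y" for j
    obtain j where "P j" using g_pos[of y] y nat_approx_posE[of "g y"] unfolding P_def by (metis DiffD2 less_imp_le)
    then have L: "P (LEAST j. P j)" by (rule LeastI)
    define l where "l = (LEAST j. P j)"
    have "l > k"
    proof (rule ccontr)
     assume "\<not> k < l"
     then have "1 / real (Suc k) \<le> 1 / real (Suc l)" by (intro divide_left_mono) auto
     then show False using L False by (simp add: P_def l_def)
    qed
    then obtain i where i: "l = Suc (i + k)" by (metis add.commute less_imp_Suc_add)
    have "\<not> P (i + k)" using not_less_Least[of "i + k" P] i by (simp add: l_def)
    then have "y \<in> R (i + k)" using L y i unfolding R_def l_def[symmetric] by (auto simp: P_def)
    then show ?thesis by blast
   qed
  qed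
  then have "hausdorff s (X - F) \<le> hausdorff s (A k \<union> (\<Union>i. R (i + k)))" by (rule hausdorff_mono)
  also have "\<dots> \<le> hausdorff s (A k) + hausdorff s (\<Union>i. R (i + k))" by (rule hausdorff_Un[OF s])
  also have "\<dots> \<le> hausdorff s (A k) + (\<Sum>i. hausdorff s (R (i + k)))"
   by (intro add_left_mono hausdorff_countably_subadditive)
  finally have "hausdorff s (F \<inter> X) + hausdorff s (X - F) \<le>
    (hausdorff s (F \<inter> X) + hausdorff s (A k)) + (\<Sum>i. hausdorff s (R (i + k)))" by (metis add.assoc add_left_mono)
  also have "hausdorff s (F \<inter> X) + hausdorff s (A k) \<le> hausdorff s ((F \<inter> X) \<union> A k)"
  proof (rule hausdorff_separated[OF s])
   show "1 / real (Suc k) \<le> dist x y" if "x \<in> F \<inter> X" "y \<in> A k" for x y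
    using g_lip[of x y] g_0[of x] that by (auto simp: A_def)
  qed simp
  also have "hausdorff s ((F \<inter> X) \<union> A k) \<le> hausdorff s X" by (rule hausdorff_mono) (auto simp: A_def)
  finally show ?thesis by (simp add: add_right_mono)
 qed
 have "(\<lambda>k. hausdorff s X + (\<Sum>i. hausdorff s (R (i + k)))) \<longlonglongrightarrow> hausdorff s X + 0"
  by (intro tendsto_add tail tendsto_const)
 then show ?thesis using bound by (intro LIMSEQ_le_const[of _ "hausdorff s X"]) auto
qed

text \<open>Closed sets satisfy Caratheodory's condition and generate the Borel sets, on which the
  outer measure is therefore a measure.\<close>

lemma measure_space_hausdorff:
 assumes s: "s > 0"
 shows "measure_space UNIV (sets borel) (hausdorff s :: 'a::euclidean_space set \<Rightarrow> ennreal)"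
proof -
 let ?L = "lambda_system UNIV UNIV (hausdorff s :: 'a set \<Rightarrow> ennreal)"
 interpret P: sigma_algebra "UNIV :: 'a set" "UNIV :: 'a set set" using sigma_algebra_Pow[of "UNIV :: 'a set"] by simp
 have "outer_measure_space UNIV (hausdorff s :: 'a set \<Rightarrow> ennreal)"
  unfolding outer_measure_space_def positive_def increasing_def countably_subadditive_def
  using hausdorff_empty[OF s] hausdorff_mono hausdorff_countably_subadditive by auto
 then have L: "measure_space UNIV ?L (hausdorff s :: 'a set \<Rightarrow> ennreal)" by (rule P.caratheodory_lemma)
 have closed_L: "F \<in> ?L" if "closed F" for F :: "'a set" unfolding lambda_system_def
 proof (intro CollectI conjI ballI antisym)
  fix X :: "'a set"
  show "hausdorff s (F \<inter> X) + hausdorff s ((UNIV - F) \<inter> X) \<le> hausdorff s X"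
   using hausdorff_closed_caratheodory[OF s that, of X] by (simp add: Int_commute Diff_eq)
  have "X = (F \<inter> X) \<union> ((UNIV - F) \<inter> X)" by auto
  then show "hausdorff s X \<le> hausdorff s (F \<inter> X) + hausdorff s ((UNIV - F) \<inter> X)"
   using hausdorff_Un[OF s, of "F \<inter> X" "(UNIV - F) \<inter> X"] by simp
 qed simp
 have "sigma_sets UNIV (Collect closed) \<subseteq> ?L"
  using L closed_L by (intro sigma_algebra.sigma_sets_subset) (auto simp: measure_space_def)
 then have "sets borel \<subseteq> ?L" by (simp add: borel_eq_closed)
 then show ?thesis by (intro measure_down[OF L]) (metis sets.sigma_algebra_axioms space_borel)
qed

lemma space_surf [simp]: "space (surf S) = S"
 and sets_surf [simp]: "sets (surf S) = sets (restrict_space borel S)"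
proof -
 have "sets (restrict_space borel S) \<subseteq> Pow S" using sets.sets_into_space by (fastforce simp: space_restrict_space)
 then show "space (surf S) = S" "sets (surf S) = sets (restrict_space borel S)"
  using sets.sigma_sets_eq[of "restrict_space borel S"] by (auto simp: surf_def space_restrict_space)
qed

lemma sets_surf_eq: "S \<in> sets borel \<Longrightarrow> A \<in> sets (surf S) \<longleftrightarrow> A \<in> sets borel \<and> A \<subseteq> S"
 by (auto simp: sets_restrict_space_iff)

text \<open>\<open>measure_of\<close> yields the zero measure unless its function is a measure on
  the generated algebra, so countable additivity on Borel sets is what makes \<open>surf\<close>
  carry the Hausdorff values.\<close>

lemma emeasure_surf:
 fixes S :: "'a::euclidean_space set"
 assumes "DIM('a) \<ge> 2" "S \<in> sets borel" "A \<in> sets borel" "A \<subseteq> S"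
 shows "emeasure (surf S) A = hausdorff_surf A"
proof -
 let ?M = "sets (restrict_space borel S)"
 have s: "real (DIM('a)) - 1 > 0" using assms(1) by linarith
 note H = measure_space_hausdorff[OF s, where ?'a='a]
 have M: "B \<in> ?M \<longleftrightarrow> B \<in> sets borel \<and> B \<subseteq> S" for B using assms(2) by (auto simp: sets_restrict_space_iff)
 show ?thesis unfolding surf_def
 proof (rule emeasure_measure_of_sigma)
  show "sigma_algebra S ?M"
   using sets.sigma_algebra_axioms[of "restrict_space borel S"] by (simp add: space_restrict_space)
  show "positive ?M (hausdorff_surf)" by (simp add: positive_def hausdorff_empty[OF s])
  show "countably_additive ?M (hausdorff_surf)"
   using H unfolding measure_space_def countably_additive_def by (auto simp: M image_subset_iff)
  show "A \<in> ?M" using assms M by blast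
 qed
qed

text \<open>The projection of the ball along \<open>b\<close> is covered by \<open>N^m\<close> cubes
  of side 2 r / N, with m = DIM('a) - 1. Over each cube the Lipschitz bound limits the diameter of
  \<open>G\<close> to K r / N, so N cancels in \<open>N^m (K r / N)^m\<close> and the estimate is
  uniform in \<delta>.\<close>

lemma hausdorff_graph_le:
 fixes G :: "'a::euclidean_space set"
 assumes dim: "DIM('a) \<ge> 2" and b: "b \<in> Basis" and L: "L \<ge> 0" and r: "r > 0"
  and lip: "\<And>x y. x \<in> G \<Longrightarrow> y \<in> G \<Longrightarrow> \<bar>(x - y) \<bullet> b\<bar> \<le> L * (\<Sum>i\<in>Basis - {b}. \<bar>(x - y) \<bullet> i\<bar>)"
 shows "hausdorff_surf (G \<inter> cball p r) \<le>
   ennreal (hausdorff_normal (real (DIM('a)) - 1) * (2 * (1 + L) * real (DIM('a))) ^ (DIM('a) - 1) * r ^ (DIM('a) - 1))"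
proof -
 define s where "s = real (DIM('a)) - 1"
 define m where "m = DIM('a) - 1"
 have s: "s > 0" "s = real m" using dim by (auto simp: s_def m_def of_nat_diff)
 define K where "K = 2 * (1 + L) * real (DIM('a))"
 have K: "K > 0" using L by (simp add: K_def)
 have "hausdorff_pre s \<delta> (G \<inter> cball p r) \<le> ennreal (hausdorff_normal s * K ^ m * r ^ m)" if \<delta>: "\<delta> > 0" for \<delta>
 proof -
  \<comment> \<open>Makes every piece have diameter at most \<delta>.\<close>
  obtain N :: nat where N: "K * r / \<delta> < real N" using reals_Archimedean2 by blast
  have N0: "N > 0" using N K r \<delta> by (metis divide_pos_pos gr0I less_asym mult_pos_pos of_nat_0)
  define a where "a = 2 * r / real N"
  have a: "a > 0" using r N0 by (simp add: a_def)
  define I where "I = PiE (Basis - {b}) (\<lambda>_::'a. {..<N})"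
  define C where "C k = {x \<in> G. \<forall>i\<in>Basis - {b}. (p \<bullet> i - r) + real (k i) * a \<le> x \<bullet> i \<and> x \<bullet> i \<le> (p \<bullet> i - r) + (real (k i) + 1) * a}" for k
  have cardI: "card I = N ^ m" using b by (simp add: I_def card_PiE m_def card_Diff_singleton)
  have "K * r / real N \<le> \<delta>" using N N0 \<delta> by (simp add: field_simps)
  have dist_C: "norm (x - y) \<le> K * r / real N" if "x \<in> C k" "y \<in> C k" for x y k
  proof -
   have i: "\<bar>(x - y) \<bullet> i\<bar> \<le> a" if "i \<in> Basis - {b}" for i
   proof -
    have "(p \<bullet> i - r) + real (k i) * a \<le> x \<bullet> i" "x \<bullet> i \<le> (p \<bullet> i - r) + (real (k i) + 1) * a"
     "(p \<bullet> i - r) + real (k i) * a \<le> y \<bullet> i" "y \<bullet> i \<le> (p \<bullet> i - r) + (real (k i) + 1) * a"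
     using \<open>x \<in> C k\<close> \<open>y \<in> C k\<close> that by (auto simp: C_def)
    then show ?thesis by (simp add: inner_diff_left algebra_simps abs_le_iff)
   qed
   then have S: "(\<Sum>i\<in>Basis - {b}. \<bar>(x - y) \<bullet> i\<bar>) \<le> real m * a"
    using sum_mono[of "Basis - {b}" "\<lambda>i. \<bar>(x - y) \<bullet> i\<bar>" "\<lambda>_. a"] b by (simp add: m_def card_Diff_singleton)
   have "norm (x - y) \<le> (\<Sum>i\<in>Basis. \<bar>(x - y) \<bullet> i\<bar>)" by (rule norm_le_l1)
   also have "\<dots> = \<bar>(x - y) \<bullet> b\<bar> + (\<Sum>i\<in>Basis - {b}. \<bar>(x - y) \<bullet> i\<bar>)" using b by (simp add: sum.remove)
   also have "\<dots> \<le> (1 + L) * (\<Sum>i\<in>Basis - {b}. \<bar>(x - y) \<bullet> i\<bar>)"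
    using lip[of x y] that by (auto simp: C_def algebra_simps)
   also have "\<dots> \<le> (1 + L) * (real m * a)" using L S by (intro mult_left_mono) auto
   also have "\<dots> \<le> (1 + L) * (real (DIM('a)) * a)" using L a by (intro mult_left_mono mult_right_mono) (auto simp: m_def)
   also have "\<dots> = K * r / real N" by (simp add: K_def a_def)
   finally show ?thesis .
  qed
  have "hausdorff_pre s \<delta> (G \<inter> cball p r) \<le> ennreal (real (card I) * (hausdorff_normal s * (K * r / real N) powr s))"
  proof (rule hausdorff_pre_le_sum)
   show "finite I" by (auto simp: I_def intro!: finite_PiE)
   show "G \<inter> cball p r \<subseteq> (\<Union>k\<in>I. C k)"
   proof
    fix x assume x: "x \<in> G \<inter> cball p r"
    \<comment> \<open>The minimum with N - 1 assigns points on the far faces, where the quotient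
      equals N, to the last cube.\<close>
    define k where "k = restrict (\<lambda>i. min (N - 1) (nat \<lfloor>(x \<bullet> i - p \<bullet> i + r) / a\<rfloor>)) (Basis - {b})"
    have "k \<in> I" using N0 by (auto simp: I_def k_def)
    moreover have "(p \<bullet> i - r) + real (k i) * a \<le> x \<bullet> i \<and> x \<bullet> i \<le> (p \<bullet> i - r) + (real (k i) + 1) * a"
     if i: "i \<in> Basis - {b}" for i
    proof -
     define z where "z = (x \<bullet> i - p \<bullet> i + r) / a"
     have "\<bar>(x - p) \<bullet> i\<bar> \<le> norm (x - p)" using i by (intro Basis_le_norm) auto
     then have "\<bar>x \<bullet> i - p \<bullet> i\<bar> \<le> r" using x by (simp add: dist_norm inner_diff_left norm_minus_commute)
     then have xp: "0 \<le> x \<bullet> i - p \<bullet> i + r" "x \<bullet> i - p \<bullet> i + r \<le> 2 * r" by linarith+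
     have z: "0 \<le> z" unfolding z_def using xp(1) a by simp
     have "z \<le> 2 * r / a" unfolding z_def using xp(2) a by (intro divide_right_mono) auto
     also have "2 * r / a = real N" using r N0 by (simp add: a_def)
     finally have z: "0 \<le> z" "z \<le> real N" using z by auto
     have k: "k i = min (N - 1) (nat \<lfloor>z\<rfloor>)" using i by (simp add: k_def z_def)
     have "real (k i) \<le> z \<and> z \<le> real (k i) + 1"
     proof (cases "nat \<lfloor>z\<rfloor> \<le> N - 1")
      case True
      then have "real (k i) = of_int \<lfloor>z\<rfloor>" using z(1) by (simp add: k)
      then show ?thesis by linarith
     next
      case False
      then have "k i = N - 1" by (simp add: k)
      moreover have "real N \<le> of_int \<lfloor>z\<rfloor>" using False z N0 by linarith
      moreover have "real (N - 1) = real N - 1" using N0 by (simp add: of_nat_diff)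
      ultimately show ?thesis using z of_int_floor_le[of z] by linarith
     qed
     then have "real (k i) * a \<le> z * a" "z * a \<le> (real (k i) + 1) * a" using a by (auto intro!: mult_right_mono)
     moreover have "z * a = x \<bullet> i - p \<bullet> i + r" using a by (simp add: z_def)
     ultimately show ?thesis by linarith
    qed
    ultimately show "x \<in> (\<Union>k\<in>I. C k)" using x by (auto simp: C_def)
   qed
   show "bounded (C k)" for k unfolding bounded_two_points using dist_C by (auto simp: dist_norm)
   show "diameter (C k) \<le> K * r / real N" for k by (rule diameter_le) (use dist_C K r in auto)
   show "K * r / real N \<le> \<delta>" by fact
  qed (use K r s in auto)
  also have "real (card I) * (hausdorff_normal s * (K * r / real N) powr s) = hausdorff_normal s * K ^ m * r ^ m"
   using K r N0 by (simp add: cardI s(2) powr_realpow power_divide power_mult_distrib)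
  finally show ?thesis .
 qed
 then have "hausdorff s (G \<inter> cball p r) \<le> ennreal (hausdorff_normal s * K ^ m * r ^ m)"
  unfolding hausdorff_def by (intro SUP_least) auto
 then show ?thesis by (simp add: s_def m_def K_def)
qed

text \<open>Thickening a set of diameter D \<le> 1 by unit segments along \<open>d\<close> stays in
  a box with one side 2 D + 1 and m sides 2 D. A cover of \<open>A\<close> with small sum of
  \<open>D^m\<close> thus becomes a cover of \<open>U\<close> with small volume; if \<open>A\<close>
  were null, so would be the nonempty open set \<open>U\<close>.\<close>

lemma hausdorff_pos_of_shadow:
 fixes A :: "'a::euclidean_space set"
 assumes dim: "DIM('a) \<ge> 2" and d: "d \<in> Basis" and U: "open U" "U \<noteq> {}"
  and sub: "\<And>y. y \<in> U \<Longrightarrow> \<exists>x\<in>A. \<exists>t\<in>{0..1}. y = x + t *\<^sub>R d"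
 shows "hausdorff_surf A > 0"
proof (rule ccontr)
 define s where "s = real (DIM('a)) - 1"
 define m where "m = DIM('a) - 1"
 have s: "s > 0" "s = real m" using dim by (auto simp: s_def m_def of_nat_diff)
 have m: "m > 0" using dim by (simp add: m_def)
 assume "\<not> ?thesis"
 then have H0: "hausdorff s A = 0" by (simp add: s_def)
 define c where "c = hausdorff_normal s"
 have c: "c > 0" using hausdorff_normal_pos[of s] s by (simp add: c_def)
 define q where "q C = ennreal (c * diameter C powr s)" for C :: "'a set"
 \<comment> \<open>3 bounds the side 2 D + 1, \<open>2^m\<close> comes from the other sides, and c
   removes the normalisation of the Hausdorff measure.\<close>
 define k where "k = 3 * 2 ^ m / c"
 have k: "k > 0" using c by (simp add: k_def)
 have le: "emeasure lborel U \<le> ennreal k * ennreal \<eta>" if \<eta>: "\<eta> > 0" for \<eta>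
 proof -
  have "hausdorff_pre s 1 A < ennreal \<eta>" using hausdorff_pre_le_hausdorff[of 1 s A] H0 \<eta> by (simp add: le_less_trans)
  then obtain C where C: "A \<subseteq> (\<Union>i. C i)" "\<And>i. bounded (C i)" "\<And>i. diameter (C i) \<le> 1"
   "(\<Sum>i::nat. q (C i)) < ennreal \<eta>" unfolding hausdorff_pre_def INF_less_iff q_def c_def by auto
  have "\<exists>B\<in>sets borel. (\<forall>x\<in>C i. \<forall>t\<in>{0..1}. x + t *\<^sub>R d \<in> B) \<and> emeasure lborel B \<le> ennreal k * q (C i)" for i
  proof (cases "C i = {}")
   case True
   then show ?thesis by (intro bexI[of _ "{}"]) auto
  next
   case False
   then obtain p where p: "p \<in> C i" by blast
   define D where "D = diameter (C i)"
   have D: "0 \<le> D" "D \<le> 1" using C(2,3) by (auto simp: D_def diameter_ge_0)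
   define B where "B = cbox (p - D *\<^sub>R One) (p + D *\<^sub>R One + d)"
   have di: "d \<bullet> i = (if i = d then 1 else 0)" if "i \<in> Basis" for i using that d by (simp add: inner_Basis eq_commute)
   have "x + t *\<^sub>R d \<in> B" if "x \<in> C i" "t \<in> {0..1}" for x t
   proof -
    have "\<bar>(x - p) \<bullet> j\<bar> \<le> D" if "j \<in> Basis" for j
    proof -
     have "dist x p \<le> D" unfolding D_def by (rule diameter_bounded_bound[OF C(2) \<open>x \<in> C i\<close> p])
     then show ?thesis using Basis_le_norm[OF that, of "x - p"] by (simp add: dist_norm)
    qed
    then show ?thesis using \<open>t \<in> {0..1}\<close>
     by (fastforce simp: B_def mem_box inner_diff_left inner_add_left di abs_le_iff)
   qed
   moreover have "emeasure lborel B \<le> ennreal k * q (C i)"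
   proof -
    have "emeasure lborel B = ennreal (\<Prod>j\<in>Basis. (p + D *\<^sub>R One + d - (p - D *\<^sub>R One)) \<bullet> j)"
     unfolding B_def using D by (intro emeasure_lborel_cbox) (auto simp: inner_diff_left inner_add_left di)
    also have "(\<Prod>j\<in>Basis. (p + D *\<^sub>R One + d - (p - D *\<^sub>R One)) \<bullet> j) = (\<Prod>j\<in>Basis. 2 * D + (if j = d then 1 else 0))"
     by (intro prod.cong) (auto simp: inner_diff_left inner_add_left di)
    also have "\<dots> = (2 * D + 1) * (\<Prod>j\<in>Basis - {d}. 2 * D)" using d by (subst prod.remove[of _ d]) auto
    also have "\<dots> = (2 * D + 1) * (2 * D) ^ m" using d by (simp add: m_def card_Diff_singleton)
    also have "ennreal \<dots> \<le> ennreal (k * (c * D ^ m))"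
    proof (rule ennreal_leI)
     have "(2 * D + 1) * (2 * D) ^ m \<le> 3 * (2 * D) ^ m" using D by (intro mult_right_mono) auto
     also have "\<dots> = k * (c * D ^ m)" using c by (simp add: k_def power_mult_distrib)
     finally show "(2 * D + 1) * (2 * D) ^ m \<le> k * (c * D ^ m)" .
    qed
    also have "D ^ m = D powr s" using D m by (cases "D = 0") (auto simp: s(2) powr_realpow)
    finally show ?thesis using k by (simp add: q_def D_def ennreal_mult')
   qed
   ultimately show ?thesis by (intro bexI[of _ B]) (auto simp: B_def)
  qed
  then have "\<exists>B. \<forall>i. B i \<in> sets borel \<and> (\<forall>x\<in>C i. \<forall>t\<in>{0..1}. x + t *\<^sub>R d \<in> B i) \<and>
    emeasure lborel (B i) \<le> ennreal k * q (C i)" by (intro choice) blast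
  then obtain B where B': "\<forall>i. B i \<in> sets borel \<and> (\<forall>x\<in>C i. \<forall>t\<in>{0..1}. x + t *\<^sub>R d \<in> B i) \<and>
    emeasure lborel (B i) \<le> ennreal k * q (C i)" by (elim exE)
  have B: "\<And>i. B i \<in> sets borel" "\<And>i x t. x \<in> C i \<Longrightarrow> t \<in> {0..1} \<Longrightarrow> x + t *\<^sub>R d \<in> B i"
   "\<And>i. emeasure lborel (B i) \<le> ennreal k * q (C i)" using B' by auto
  have "U \<subseteq> (\<Union>i. B i)"
  proof
   fix y assume "y \<in> U"
   then obtain x t where x: "x \<in> A" "t \<in> {0..1}" "y = x + t *\<^sub>R d" using sub by meson
   then obtain i where "x \<in> C i" using C(1) by (meson UN_E subsetD)
   then show "y \<in> (\<Union>i. B i)" using B(2)[of x i t] x by (intro UN_I[of i]) auto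
  qed
  then have "emeasure lborel U \<le> emeasure lborel (\<Union>i. B i)" using B(1) by (intro emeasure_mono) auto
  also have "\<dots> \<le> (\<Sum>i. emeasure lborel (B i))" using B(1) by (intro emeasure_subadditive_countably) auto
  also have "\<dots> \<le> (\<Sum>i. ennreal k * q (C i))" by (intro suminf_le B(3)) auto
  also have "\<dots> = ennreal k * (\<Sum>i. q (C i))" by simp
  also have "\<dots> \<le> ennreal k * ennreal \<eta>" using C(4) by (intro mult_left_mono) auto
  finally show ?thesis .
 qed
 have "emeasure lborel U \<le> 0"
 proof (rule ennreal_le_epsilon)
  fix e :: real assume "e > 0"
  then have "emeasure lborel U \<le> ennreal k * ennreal (e / k)" using k by (intro le) auto
  then show "emeasure lborel U \<le> 0 + ennreal e" using k \<open>e > 0\<close> by (simp flip: ennreal_mult')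
 qed
 moreover have "emeasure lborel U > 0"
 proof -
  obtain x \<epsilon> where "\<epsilon> > 0" "ball x \<epsilon> \<subseteq> U" using U by (meson ex_in_conv openE)
  then show ?thesis using U emeasure_mono[of "ball x \<epsilon>" U lborel]
   by (auto simp: emeasure_ball intro: less_le_trans[rotated])
 qed
 ultimately show False by simp
qed

lemma hausdorff_image_isometry:
 fixes h :: "'a::euclidean_space \<Rightarrow> 'a"
 assumes s: "s > 0" and iso: "\<And>x y. dist (h x) (h y) = dist x y"
 shows "hausdorff s (h ` A) \<le> hausdorff s A"
 unfolding hausdorff_def
proof (rule SUP_mono)
 fix \<delta> :: real assume "\<delta> \<in> {0<..}"
 have bd: "bounded (h ` C)" if "bounded C" for C using that unfolding bounded_two_points by (auto simp: iso)
 have dm: "diameter (h ` C) \<le> diameter C" if "bounded C" for C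
  using diameter_bounded_bound[OF that] diameter_ge_0[OF that]
  by (intro diameter_le) (auto simp: iso simp flip: dist_norm)
 have "hausdorff_pre s \<delta> (h ` A) \<le> hausdorff_pre s \<delta> A" unfolding hausdorff_pre_def[of s \<delta> A]
 proof (rule INF_greatest)
  fix C :: "nat \<Rightarrow> 'a set"
  assume "C \<in> {C. A \<subseteq> (\<Union>i. C i) \<and> (\<forall>i. bounded (C i) \<and> diameter (C i) \<le> \<delta>)}"
  then have C: "A \<subseteq> (\<Union>i. C i)" "\<And>i. bounded (C i)" "\<And>i. diameter (C i) \<le> \<delta>" by auto
  have "hausdorff_pre s \<delta> (h ` A) \<le> (\<Sum>i. ennreal (hausdorff_normal s * diameter (h ` C i) powr s))"
  proof (rule hausdorff_pre_le_suminf)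
   show "h ` A \<subseteq> (\<Union>i. h ` C i)" using C(1) by blast
   show "bounded (h ` C i)" for i by (rule bd[OF C(2)])
   show "diameter (h ` C i) \<le> \<delta>" for i using dm[OF C(2)] C(3) by (rule order_trans)
  qed
  also have "\<dots> \<le> (\<Sum>i. ennreal (hausdorff_normal s * diameter (C i) powr s))" using hausdorff_normal_pos[of s] s C(2)
   by (intro suminf_le ennreal_leI mult_left_mono powr_mono2 dm) (auto simp: diameter_ge_0 bd)
  finally show "hausdorff_pre s \<delta> (h ` A) \<le> (\<Sum>i. ennreal (hausdorff_normal s * diameter (C i) powr s))" .
 qed
 then show "\<exists>m\<in>{0<..}. hausdorff_pre s \<delta> (h ` A) \<le> hausdorff_pre s m A" using \<open>\<delta> \<in> {0<..}\<close> by blast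
qed

section \<open>Test functions\<close>

abbreviation pd :: "('a::euclidean_space \<Rightarrow> real) \<Rightarrow> 'a \<Rightarrow> 'a \<Rightarrow> real" where
 "pd \<phi> b x \<equiv> frechet_derivative \<phi> (at x) b"

lemma poly_times_exp_minus_tendsto_0:
 "((\<lambda>s::real. poly q s * exp (- s)) \<longlongrightarrow> 0) at_top"
proof -
 have "((\<lambda>s. \<Sum>i\<le>degree q. coeff q i * (s ^ i / exp s)) \<longlongrightarrow> (\<Sum>i\<le>degree q. coeff q i * 0)) at_top"
  by (intro tendsto_intros tendsto_power_div_exp_0)
 moreover have "(\<Sum>i\<le>degree q. coeff q i * (s ^ i / exp s)) = poly q s * exp (- s)" for s
  by (simp add: poly_altdef sum_distrib_right exp_minus field_simps sum_divide_distrib)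
 ultimately show ?thesis by simp
qed

text \<open>The family \<open>p(1/t) exp(-1/t)\<close>, extended by zero to \<open>t \<le> 0\<close>, is closed under
 differentiation; this makes \<open>exp(-1/t)\<close> smooth.\<close>

definition flat :: "real poly \<Rightarrow> real \<Rightarrow> real" where
 "flat p t = (if t > 0 then poly p (1 / t) * exp (- 1 / t) else 0)"

text \<open>With s = 1/t the derivative of p(s) exp(-s) in t is s^2 (p - p')(s) exp(-s), and
  \<open>[:0, 0, 1:]\<close> is the polynomial s^2. At t = 0 the right difference quotient is s p(s)
  exp(-s) with s tending to infinity.\<close>

lemma flat_has_derivative:
 "(flat p has_real_derivative flat ([:0, 0, 1:] * (p - pderiv p)) t) (at t)"
proof -
 consider "t > 0" | "t < 0" | "t = 0" by linarith
 then show ?thesis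
 proof cases
  case 1
  have "((\<lambda>t. poly p (1 / t) * exp (- 1 / t)) has_real_derivative flat ([:0, 0, 1:] * (p - pderiv p)) t) (at t)"
   using 1 by (auto intro!: derivative_eq_intros poly_DERIV DERIV_chain2[of "poly p"]
     simp: flat_def field_simps power2_eq_square)
  moreover have "\<forall>\<^sub>F x in nhds t. flat p x = poly p (1 / x) * exp (- 1 / x)"
   using eventually_nhds_in_open[of "{0<..}" t] 1 by (auto elim!: eventually_mono simp: flat_def)
  ultimately show ?thesis by (subst DERIV_cong_ev) auto
 next
  case 2
  have "\<forall>\<^sub>F x in nhds t. flat p x = 0" using eventually_nhds_in_open[of "{..<0}" t] 2
   by (auto elim!: eventually_mono simp: flat_def)
  then show ?thesis using 2 by (subst DERIV_cong_ev) (auto simp: flat_def)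
 next
  case 3
  have "((\<lambda>h. flat p h / h) \<longlongrightarrow> 0) (at_right 0)"
  proof -
   have "((\<lambda>h. poly ([:0, 1:] * p) (inverse h) * exp (- inverse h)) \<longlongrightarrow> 0) (at_right (0::real))"
    by (rule filterlim_compose[OF poly_times_exp_minus_tendsto_0 filterlim_inverse_at_top_right])
   moreover have "\<forall>\<^sub>F h in at_right 0. poly ([:0, 1:] * p) (inverse h) * exp (- inverse h) = flat p h / h"
    unfolding eventually_at_right_field by (intro exI[of _ 1]) (auto simp: flat_def field_simps)
   ultimately show ?thesis by (rule Lim_transform_eventually)
  qed
  moreover have "((\<lambda>h. flat p h / h) \<longlongrightarrow> 0) (at_left 0)"
  proof (rule tendsto_eventually)
   show "\<forall>\<^sub>F h in at_left 0. flat p h / h = 0"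
    unfolding eventually_at_left_field by (intro exI[of _ "-1"]) (auto simp: flat_def)
  qed
  ultimately have "((\<lambda>h. flat p h / h) \<longlongrightarrow> 0) (at 0)" by (simp add: filterlim_split_at)
  then show ?thesis using 3 by (simp add: has_field_derivative_iff flat_def)
 qed
qed

lemma frechet_derivative_eqI: "(f has_derivative f') (at x) \<Longrightarrow> pd f b x = f' b"
 by (metis frechet_derivative_at)

lemma Ck_imp_continuous: "Ck k f \<Longrightarrow> continuous_on UNIV f"
 by (cases k) (auto simp: continuous_on_eq_continuous_at differentiable_imp_continuous_within)

lemma Ck_SucD: "Ck (Suc k) f \<Longrightarrow> Ck k f"
proof (induction k arbitrary: f)
 case 0
 then show ?case using Ck_imp_continuous by fastforce
next
 case (Suc k)
 then show ?case by (metis Ck.simps(2))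
qed

lemma Ck_const: "Ck k (\<lambda>_. c)"
 by (induction k arbitrary: c) (auto simp: frechet_derivative_const)

lemma Ck_add: "Ck k f \<Longrightarrow> Ck k g \<Longrightarrow> Ck k (\<lambda>x. f x + g x)"
proof (induction k arbitrary: f g)
 case 0
 then show ?case by (auto intro: continuous_intros)
next
 case (Suc k)
 have "pd (\<lambda>x. f x + g x) b x = pd f b x + pd g b x" for x b
  using Suc.prems by (intro frechet_derivative_eqI has_derivative_add) (auto simp flip: frechet_derivative_works)
 then show ?case using Suc by simp
qed

lemma Ck_mult: "Ck k f \<Longrightarrow> Ck k g \<Longrightarrow> Ck k (\<lambda>x. f x * g x)"
proof (induction k arbitrary: f g)
 case 0
 then show ?case by (auto intro: continuous_intros)
next
 case (Suc k)
 have "pd (\<lambda>x. f x * g x) b x = f x * pd g b x + pd f b x * g x" for x b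
  using Suc.prems by (intro frechet_derivative_eqI has_derivative_mult) (auto simp flip: frechet_derivative_works)
 then show ?case using Suc Ck_SucD[OF Suc.prems(1)] Ck_SucD[OF Suc.prems(2)] by (simp add: Ck_add)
qed

lemma Ck_prod:
 assumes "finite I" "\<And>i. i \<in> I \<Longrightarrow> Ck k (f i)"
 shows "Ck k (\<lambda>x. \<Prod>i\<in>I. f i x)"
 using assms by (induction I) (auto simp: Ck_const Ck_mult)

lemma Ck_flat: "Ck k (\<lambda>x::'a::euclidean_space. flat p (x \<bullet> v + c))"
proof (induction k arbitrary: p)
 case 0
 have "continuous_on UNIV (flat p)" using flat_has_derivative DERIV_isCont by (metis continuous_at_imp_continuous_on)
 then show ?case by (auto intro!: continuous_intros intro: continuous_on_compose2)
next
 case (Suc k)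
 let ?q = "[:0, 0, 1:] * (p - pderiv p)"
 have d: "((\<lambda>x::'a. flat p (x \<bullet> v + c)) has_derivative (\<lambda>b. flat ?q (x \<bullet> v + c) * (b \<bullet> v))) (at x)" for x
 proof -
  have "((\<lambda>x::'a. x \<bullet> v + c) has_derivative (\<lambda>b. b \<bullet> v)) (at x)" by (auto intro!: derivative_eq_intros)
  from has_derivative_compose[OF this flat_has_derivative[unfolded has_field_derivative_def]]
  show ?thesis by (simp add: mult.commute)
 qed
 have "pd (\<lambda>x::'a. flat p (x \<bullet> v + c)) b x = flat ?q (x \<bullet> v + c) * (b \<bullet> v)" for x b
  by (rule frechet_derivative_eqI[OF d])
 then show ?case using d Suc by (auto simp: differentiable_def Ck_mult Ck_const simp del: mult_pCons_left)
qed

text \<open>\<open>Ck\<close> only sees partial derivatives along \<open>Basis\<close>. A diagonal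
  derivative keeps each of them a multiple of a single partial derivative of \<phi>, so the
  induction closes; translations and coordinate reflections are of this kind.\<close>

lemma Ck_affine:
 fixes h :: "'a::euclidean_space \<Rightarrow> 'a"
 assumes "\<And>x. (h has_derivative L) (at x)" "\<And>i. i \<in> Basis \<Longrightarrow> L i = c i *\<^sub>R i"
 shows "Ck k \<phi> \<Longrightarrow> Ck k (\<lambda>x. \<phi> (h x))"
proof (induction k arbitrary: \<phi>)
 case 0
 have "continuous_on UNIV h" using assms(1) by (metis continuous_at_imp_continuous_on has_derivative_continuous)
 then show ?case using 0 by (auto intro: continuous_on_compose2)
next
 case (Suc k)
 have d: "((\<lambda>x. \<phi> (h x)) has_derivative (\<lambda>b. pd \<phi> (L b) (h x))) (at x)" for x
  using Suc.prems by (intro has_derivative_compose[OF assms(1)]) (auto simp flip: frechet_derivative_works)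
 have "pd (\<lambda>x. \<phi> (h x)) i x = c i * pd \<phi> i (h x)" if i: "i \<in> Basis" for x i
 proof -
  have "linear (frechet_derivative \<phi> (at (h x)))" using Suc.prems by (simp add: linear_frechet_derivative)
  then show ?thesis using frechet_derivative_eqI[OF d] assms(2)[OF i] by (simp add: linear_cmul)
 qed
 moreover have "Ck k (\<lambda>x. c i * pd \<phi> i (h x))" if "i \<in> Basis" for i
  using Suc.prems that by (intro Ck_mult Ck_const Suc.IH) auto
 moreover have "\<forall>x. (\<lambda>x. \<phi> (h x)) differentiable (at x)" using d by (metis differentiable_def)
 ultimately show ?case by simp
qed

lemma smooth_fun_has_derivative:
 "smooth_fun \<phi> \<Longrightarrow> (\<phi> has_derivative frechet_derivative \<phi> (at x)) (at x)"
 unfolding smooth_fun_def by (metis Ck.simps(2) frechet_derivative_works)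

lemma smooth_fun_continuous: "smooth_fun \<phi> \<Longrightarrow> continuous_on UNIV \<phi>"
 unfolding smooth_fun_def using Ck_imp_continuous by blast

lemma smooth_fun_deriv_continuous:
 "smooth_fun \<phi> \<Longrightarrow> b \<in> Basis \<Longrightarrow> continuous_on UNIV (pd \<phi> b)" unfolding smooth_fun_def by (metis Ck.simps)

lemma frechet_derivative_euclidean:
 fixes \<phi> :: "'a::euclidean_space \<Rightarrow> real"
 assumes "\<phi> differentiable (at x)"
 shows "pd \<phi> z x = (\<Sum>i\<in>Basis. (z \<bullet> i) * pd \<phi> i x)"
proof -
 have l: "linear (frechet_derivative \<phi> (at x))" using assms by (rule linear_frechet_derivative)
 have "pd \<phi> z x = pd \<phi> (\<Sum>i\<in>Basis. (z \<bullet> i) *\<^sub>R i) x" by (simp add: euclidean_representation)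
 also have "\<dots> = (\<Sum>i\<in>Basis. (z \<bullet> i) * pd \<phi> i x)" using l by (simp add: linear_sum linear_cmul)
 finally show ?thesis .
qed

lemma test_funD:
 assumes "test_fun \<Omega> \<phi>"
 obtains S where "compact S" "S \<subseteq> \<Omega>" "\<And>x. x \<notin> S \<Longrightarrow> \<phi> x = 0"
  "\<And>x b. x \<notin> S \<Longrightarrow> pd \<phi> b x = 0"
proof -
 define S where "S = closure {x. \<phi> x \<noteq> 0}"
 have S: "compact S" "S \<subseteq> \<Omega>" using assms by (auto simp: test_fun_def S_def)
 have 0: "\<phi> x = 0" if "x \<notin> S" for x using that closure_subset[of "{x. \<phi> x \<noteq> 0}"] by (auto simp: S_def)
 have "pd \<phi> b x = 0" if x: "x \<notin> S" for x b
 proof -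
  have "open (- S)" using S(1) by (simp add: compact_imp_closed open_Compl)
  then have "(\<phi> has_derivative (\<lambda>_. 0)) (at x)"
   using x 0 by (intro has_derivative_transform_within_open[of "\<lambda>_. 0" "\<lambda>_. 0" x UNIV "- S" \<phi>]) auto
  then show ?thesis by (rule frechet_derivative_eqI)
 qed
 then show ?thesis using that S 0 by blast
qed

lemma continuous_compact_support_bounded:
 fixes f :: "'a::euclidean_space \<Rightarrow> real"
 assumes "continuous_on UNIV f" "compact S" "\<And>x. x \<notin> S \<Longrightarrow> f x = 0"
 shows "\<exists>B\<ge>0. \<forall>x. \<bar>f x\<bar> \<le> B"
proof -
 have "bounded (f ` S)"
  using assms by (intro compact_imp_bounded compact_continuous_image) (auto intro: continuous_on_subset)
 then obtain B where B: "\<And>x. x \<in> S \<Longrightarrow> \<bar>f x\<bar> \<le> B" by (auto simp: bounded_iff)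
 have "\<bar>f x\<bar> \<le> max B 0" for x using B[of x] assms(3)[of x] by (cases "x \<in> S") auto
 then show ?thesis by (intro exI[of _ "max B 0"]) auto
qed

lemma test_fun_bounded:
 assumes "test_fun \<Omega> \<phi>"
 shows "\<exists>B\<ge>0. \<forall>x. \<bar>\<phi> x\<bar> \<le> B" and "b \<in> Basis \<Longrightarrow> \<exists>B\<ge>0. \<forall>x. \<bar>pd \<phi> b x\<bar> \<le> B"
proof -
 have s: "smooth_fun \<phi>" using assms by (simp add: test_fun_def)
 obtain S where S: "compact S" "\<And>x. x \<notin> S \<Longrightarrow> \<phi> x = 0"
  "\<And>x b. x \<notin> S \<Longrightarrow> pd \<phi> b x = 0" using test_funD[OF assms] by metis
 show "\<exists>B\<ge>0. \<forall>x. \<bar>\<phi> x\<bar> \<le> B" using continuous_compact_support_bounded[OF smooth_fun_continuous[OF s] S(1,2)] .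
 show "\<exists>B\<ge>0. \<forall>x. \<bar>pd \<phi> b x\<bar> \<le> B" if "b \<in> Basis"
  using continuous_compact_support_bounded[OF smooth_fun_deriv_continuous[OF s that] S(1,3)] .
qed

lemma test_fun_translate:
 fixes z :: "'a::euclidean_space"
 assumes "test_fun D \<phi>" "\<And>x. x \<in> D \<Longrightarrow> x + z \<in> \<Omega>"
 shows "test_fun \<Omega> (\<lambda>x. \<phi> (x - z))"
  and "pd (\<lambda>x. \<phi> (x - z)) b x = pd \<phi> b (x - z)"
proof -
 have s: "smooth_fun \<phi>" using assms(1) by (simp add: test_fun_def)
 have h: "((\<lambda>x. x - z) has_derivative (\<lambda>b. b)) (at x)" for x by (auto intro!: derivative_eq_intros)
 have "smooth_fun (\<lambda>x. \<phi> (x - z))"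
  unfolding smooth_fun_def using s Ck_affine[OF h, of "\<lambda>_. 1"] by (simp add: smooth_fun_def)
 moreover have "{x. \<phi> (x - z) \<noteq> 0} = (\<lambda>x. z + x) ` {x. \<phi> x \<noteq> 0}"
  by (auto simp: image_iff) (metis add_diff_cancel_left' diff_add_cancel add.commute)
 then have cl: "closure {x. \<phi> (x - z) \<noteq> 0} = (\<lambda>x. z + x) ` closure {x. \<phi> x \<noteq> 0}" by (simp add: closure_translation)
 ultimately show "test_fun \<Omega> (\<lambda>x. \<phi> (x - z))"
  using assms compact_translation[of "closure {x. \<phi> x \<noteq> 0}" z] unfolding test_fun_def cl by (auto simp: add.commute)
 have "((\<lambda>x. \<phi> (x - z)) has_derivative (\<lambda>b. pd \<phi> b (x - z))) (at x)"
  by (rule has_derivative_compose[OF h smooth_fun_has_derivative[OF s]])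
 then show "pd (\<lambda>x. \<phi> (x - z)) b x = pd \<phi> b (x - z)" by (rule frechet_derivative_eqI)
qed

lemma test_fun_reflect:
 fixes R :: "'a::euclidean_space \<Rightarrow> 'a"
 assumes "test_fun \<Omega> \<phi>" "linear R" "\<And>i. i \<in> Basis \<Longrightarrow> R i = c i *\<^sub>R i" "\<And>x. R (R x) = x" "R ` \<Omega> \<subseteq> \<Omega>"
 shows "test_fun \<Omega> (\<lambda>x. \<phi> (R x))"
  and "i \<in> Basis \<Longrightarrow> pd (\<lambda>x. \<phi> (R x)) i x = c i * pd \<phi> i (R x)"
proof -
 have s: "smooth_fun \<phi>" using assms(1) by (simp add: test_fun_def)
 have h: "(R has_derivative R) (at x)" for x using assms(2) by (simp add: linear_imp_has_derivative)
 have cR: "continuous_on A R" for A using assms(2) by (simp add: linear_continuous_on linear_conv_bounded_linear)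
 let ?S = "closure {x. \<phi> x \<noteq> 0}"
 have S: "compact ?S" "?S \<subseteq> \<Omega>" using assms(1) by (auto simp: test_fun_def)
 have sm: "smooth_fun (\<lambda>x. \<phi> (R x))"
  using s Ck_affine[where h = R and L = R and c = c, OF h assms(3)] by (simp add: smooth_fun_def)
 have RS: "compact (R ` ?S)" by (intro compact_continuous_image cR S)
 have "x \<in> R ` ?S" if "\<phi> (R x) \<noteq> 0" for x
 proof (rule image_eqI[of _ _ "R x"])
  show "R x \<in> ?S" using closure_subset[of "{x. \<phi> x \<noteq> 0}"] that by auto
 qed (simp add: assms(4))
 then have sub: "{x. \<phi> (R x) \<noteq> 0} \<subseteq> R ` ?S" by blast
 have "closure {x. \<phi> (R x) \<noteq> 0} \<subseteq> R ` ?S" by (rule closure_minimal[OF sub compact_imp_closed[OF RS]])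
 moreover have "compact (closure {x. \<phi> (R x) \<noteq> 0})"
  unfolding compact_closure by (rule bounded_subset[OF compact_imp_bounded[OF RS] sub])
 moreover have "R ` ?S \<subseteq> \<Omega>" using assms(5) S(2) by blast
 ultimately show "test_fun \<Omega> (\<lambda>x. \<phi> (R x))" using sm unfolding test_fun_def by blast
 assume i: "i \<in> Basis"
 have "((\<lambda>x. \<phi> (R x)) has_derivative (\<lambda>b. pd \<phi> (R b) (R x))) (at x)"
  by (rule has_derivative_compose[OF h smooth_fun_has_derivative[OF s]])
 then have "pd (\<lambda>x. \<phi> (R x)) i x = pd \<phi> (R i) (R x)" by (rule frechet_derivative_eqI)
 also have "\<dots> = c i * pd \<phi> i (R x)"
  using smooth_fun_has_derivative[OF s, THEN has_derivative_linear] assms(3)[OF i] by (simp add: linear_cmul)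
 finally show "pd (\<lambda>x. \<phi> (R x)) i x = c i * pd \<phi> i (R x)" .
qed

text \<open>The scaling by m + 1 makes the one-dimensional profile exp(-1/((m + 1) t)) increase to 1
  for t > 0, so the bumps converge to the indicator of the open box. Inner products with scaled
  basis vectors fit the affine argument of \<open>Ck_flat\<close>.\<close>

definition bump :: "nat \<Rightarrow> 'a::euclidean_space \<Rightarrow> 'a \<Rightarrow> 'a \<Rightarrow> real" where
 "bump m a b x = (\<Prod>i\<in>Basis. flat 1 (x \<bullet> (real (Suc m) *\<^sub>R i) + - real (Suc m) * (a \<bullet> i)) *
    flat 1 (x \<bullet> (- real (Suc m) *\<^sub>R i) + real (Suc m) * (b \<bullet> i)))"

lemma flat_1: "flat 1 t = (if t > 0 then exp (- 1 / t) else 0)"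
 by (simp add: flat_def)

lemma bump_eq: "bump m a b x = (\<Prod>i\<in>Basis. flat 1 (real (Suc m) * (x \<bullet> i - a \<bullet> i)) * flat 1 (real (Suc m) * (b \<bullet> i - x \<bullet> i)))"
 unfolding bump_def by (intro prod.cong) (auto simp: algebra_simps)

lemma bump_bounds: "0 \<le> bump m a b x" "bump m a b x \<le> 1"
 unfolding bump_eq by (auto intro!: prod_nonneg prod_le_1 mult_le_one simp: flat_1)

lemma bump_outside: "x \<notin> box a b \<Longrightarrow> bump m a b x = 0"
proof -
 assume "x \<notin> box a b"
 then obtain i where "i \<in> Basis" "x \<bullet> i \<le> a \<bullet> i \<or> b \<bullet> i \<le> x \<bullet> i" by (auto simp: mem_box not_less)
 then show ?thesis unfolding bump_eq by (intro prod_zero) (auto intro!: bexI[of _ i] simp: flat_1 zero_less_mult_iff)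
qed

lemma bump_tendsto: "(\<lambda>m. bump m a b x) \<longlonglongrightarrow> indicator (box a b) x"
proof (cases "x \<in> box a b")
 case True
 have *: "(\<lambda>m. flat 1 (real (Suc m) * t)) \<longlonglongrightarrow> 1" if "t > 0" for t
 proof -
  have "(\<lambda>m. exp (- (1 / t) * (1 / real (Suc m)))) \<longlonglongrightarrow> exp (- (1 / t) * 0)"
   by (intro tendsto_intros LIMSEQ_Suc[OF lim_const_over_n])
  moreover have "flat 1 (real (Suc m) * t) = exp (- (1 / t) * (1 / real (Suc m)))" for m
   using that by (simp add: flat_1 zero_less_mult_iff)
  ultimately show ?thesis by simp
 qed
 have "(\<lambda>m. bump m a b x) \<longlonglongrightarrow> (\<Prod>i\<in>(Basis::'a set). 1 * 1)"
  unfolding bump_eq using True by (intro tendsto_prod tendsto_mult *) (auto simp: mem_box)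
 then show ?thesis using True by simp
qed (simp add: bump_outside)

lemma test_fun_bump:
 assumes "cbox a b \<subseteq> \<Omega>"
 shows "test_fun \<Omega> (bump m a b)"
proof -
 have "smooth_fun (bump m a b)" unfolding smooth_fun_def bump_def by (intro allI Ck_prod Ck_mult Ck_flat) auto
 moreover have "{x. bump m a b x \<noteq> 0} \<subseteq> cbox a b" using bump_outside box_subset_cbox by blast
 then have cl: "closure {x. bump m a b x \<noteq> 0} \<subseteq> cbox a b" by (rule closure_minimal[OF _ closed_cbox])
 then have "compact (closure {x. bump m a b x \<noteq> 0})"
  by (meson bounded_cbox bounded_subset closed_closure compact_eq_bounded_closed)
 ultimately show ?thesis using cl assms by (auto simp: test_fun_def)
qed

text \<open>Bumps approximate indicators of boxes boundedly, so \<open>F\<close> has zero integral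
  over every closed box inside \<open>D\<close>, and Lebesgue differentiation along shrinking cubes
  recovers \<open>F\<close> almost everywhere.\<close>

lemma fundamental_lemma:
 fixes F :: "'a::euclidean_space \<Rightarrow> real"
 assumes F: "integrable lborel F" and D: "open D"
  and zero: "\<And>\<phi>. test_fun D \<phi> \<Longrightarrow> (LINT x|lborel. F x * \<phi> x) = 0"
 shows "AE x in lborel. x \<in> D \<longrightarrow> F x = 0"
proof -
 have [measurable]: "F \<in> borel_measurable borel" using F by auto
 have box: "(LINT x|lborel. F x * indicator (box a b) x) = 0" if ab: "cbox a b \<subseteq> D" for a b
 proof -
  have meas: "bump m a b \<in> borel_measurable borel" for m using test_fun_bump[of a b UNIV m]
   by (intro borel_measurable_continuous_onI smooth_fun_continuous) (simp add: test_fun_def)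
  have "(\<lambda>m. LINT x|lborel. F x * bump m a b x) \<longlonglongrightarrow> (LINT x|lborel. F x * indicator (box a b) x)"
  proof (rule integral_dominated_convergence[of _ _ _ "\<lambda>x. \<bar>F x\<bar>"])
   show "AE x in lborel. (\<lambda>m. F x * bump m a b x) \<longlonglongrightarrow> F x * indicator (box a b) x"
    by (intro AE_I2 tendsto_mult tendsto_const bump_tendsto)
   show "AE x in lborel. norm (F x * bump m a b x) \<le> \<bar>F x\<bar>" for m
    using bump_bounds[of m a b] by (intro AE_I2) (auto simp: abs_mult mult_left_le)
  qed (use F meas in \<open>auto intro: integrable_abs\<close>)
  then show ?thesis using zero[OF test_fun_bump[OF ab]] by (simp add: LIMSEQ_const_iff)
 qed
 have si: "set_integrable lborel S F" if "S \<in> sets borel" for S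
  using F that unfolding set_integrable_def by (intro integrable_mult_indicator) auto
 have int0: "integral (cbox a b) F = 0" if "cbox a b \<subseteq> D" for a b
 proof -
  have "(LINT x:box a b|lborel. F x) = integral (box a b) F" by (rule set_borel_integral_eq_integral[OF si]) auto
  then show ?thesis using box[OF that] by (simp add: set_lebesgue_integral_def mult.commute integral_open_interval)
 qed
 have "F integrable_on cbox a b" for a b by (rule set_borel_integral_eq_integral[OF si]) auto
 then obtain N where N: "negligible N" and lim: "\<And>x e. \<lbrakk>x \<notin> N; 0 < e\<rbrakk> \<Longrightarrow>
   \<exists>d>0. \<forall>h. 0 < h \<and> h < d \<longrightarrow> norm (integral (cbox x (x + h *\<^sub>R One)) F /\<^sub>R h ^ DIM('a) - F x) < e"
  using integrable_ccontinuous_explicit[of F] by blast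
 have "F x = 0" if x: "x \<notin> N" "x \<in> D" for x
 proof (rule ccontr)
  assume "F x \<noteq> 0"
  then obtain d where d: "d > 0" "\<And>h. 0 < h \<Longrightarrow> h < d \<Longrightarrow> norm (integral (cbox x (x + h *\<^sub>R One)) F /\<^sub>R h ^ DIM('a) - F x) < \<bar>F x\<bar>"
   using lim[OF x(1), of "\<bar>F x\<bar>"] by auto
  obtain r where r: "r > 0" "ball x r \<subseteq> D" using D x(2) by (meson openE)
  \<comment> \<open>Small enough for the differentiation estimate and for the cube of side h at
    \<open>x\<close> to stay in the ball of radius r.\<close>
  define h where "h = min (d / 2) (r / (2 * (norm (One::'a) + 1)))"
  have h: "0 < h" "h < d" using d r by (auto simp: h_def intro!: divide_pos_pos add_nonneg_pos)
  have "cbox x (x + h *\<^sub>R One) \<subseteq> ball x r"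
  proof
   fix y assume y: "y \<in> cbox x (x + h *\<^sub>R One)"
   have "norm (y - x) \<le> norm (h *\<^sub>R (One::'a))"
    by (rule norm_le_componentwise) (use y h in \<open>auto simp: mem_box inner_diff_left inner_add_left\<close>)
   also have "\<dots> = h * norm (One::'a)" using h by simp
   also have "\<dots> \<le> h * (norm (One::'a) + 1)" using h by (intro mult_left_mono) auto
   also have "\<dots> \<le> r / (2 * (norm (One::'a) + 1)) * (norm (One::'a) + 1)" by (intro mult_right_mono) (auto simp: h_def)
   also have "\<dots> = r / 2" using add_nonneg_pos[OF norm_ge_zero[of "One::'a"] zero_less_one] by (simp add: field_simps)
   also have "\<dots> < r" using r by simp
   finally show "y \<in> ball x r" by (simp add: dist_norm norm_minus_commute)
  qed
  then have "integral (cbox x (x + h *\<^sub>R One)) F = 0" using r by (intro int0) auto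
  then show False using d(2)[OF h] by simp
 qed
 then have "AE x in lebesgue. x \<in> D \<longrightarrow> F x = 0" using N by (intro AE_I'[of N]) (auto simp: negligible_iff_null_sets)
 then show ?thesis by (simp add: AE_completion_iff)
qed

section \<open>Weak gradients\<close>

lemma nn_integral_lborel_translate:
 fixes f :: "'a::euclidean_space \<Rightarrow> ennreal"
 assumes [measurable]: "f \<in> borel_measurable borel"
 shows "(\<integral>\<^sup>+x. f (x + c) \<partial>lborel) = (\<integral>\<^sup>+x. f x \<partial>lborel)"
proof -
 have "(\<integral>\<^sup>+x. f x \<partial>lborel) = (\<integral>\<^sup>+x. f x \<partial>distr lborel borel ((+) c))" by (simp add: lborel_distr_plus)
 also have "\<dots> = (\<integral>\<^sup>+x. f (x + c) \<partial>lborel)" by (subst nn_integral_distr) (auto simp: add.commute)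
 finally show ?thesis by simp
qed

lemma integral_lborel_translate:
 fixes f :: "'a::euclidean_space \<Rightarrow> real"
 assumes [measurable]: "f \<in> borel_measurable borel"
 shows "(LINT x|lborel. f (x + c)) = (LINT x|lborel. f x)"
  and "integrable lborel (\<lambda>x. f (x + c)) \<longleftrightarrow> integrable lborel f"
proof -
 have "(LINT x|lborel. f x) = (LINT x|distr lborel borel ((+) c). f x)" by (simp add: lborel_distr_plus)
 also have "\<dots> = (LINT x|lborel. f (x + c))" by (subst integral_distr) (auto simp: add.commute)
 finally show "(LINT x|lborel. f (x + c)) = (LINT x|lborel. f x)" by simp
 have "integrable lborel f \<longleftrightarrow> integrable (distr lborel borel ((+) c)) f" by (simp add: lborel_distr_plus)
 also have "\<dots> \<longleftrightarrow> integrable lborel (\<lambda>x. f (x + c))" by (subst integrable_distr_eq) (auto simp: add.commute)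
 finally show "integrable lborel (\<lambda>x. f (x + c)) \<longleftrightarrow> integrable lborel f" by simp
qed

lemma integral_lebesgue_on_eq_lborel:
 fixes g :: "'a::euclidean_space \<Rightarrow> real"
 assumes "\<Omega> \<in> sets borel" "g \<in> borel_measurable borel" "\<And>x. x \<notin> \<Omega> \<Longrightarrow> g x = 0"
 shows "integral\<^sup>L (leb \<Omega>) g = integral\<^sup>L lborel g"
  and "integrable (leb \<Omega>) g \<longleftrightarrow> integrable lborel g"
proof -
 have \<Omega>: "\<Omega> \<inter> space lebesgue \<in> sets lebesgue" using assms(1) by auto
 have "indicator \<Omega> x *\<^sub>R g x = g x" for x by (cases "x \<in> \<Omega>") (simp_all add: assms(3))
 then have "(\<lambda>x. indicator \<Omega> x *\<^sub>R g x) = g" by (rule ext)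
 then show "integral\<^sup>L (leb \<Omega>) g = integral\<^sup>L lborel g"
  "integrable (leb \<Omega>) g \<longleftrightarrow> integrable lborel g"
  using assms(2) by (simp_all add: integral_restrict_space[OF \<Omega>] integrable_restrict_space[OF \<Omega>]
    integral_completion integrable_completion)
qed

lemma AE_lebesgue_on_iff:
 assumes "\<Omega> \<in> sets borel"
 shows "(AE x in leb \<Omega>. P x) \<longleftrightarrow> (AE x in lborel. x \<in> \<Omega> \<longrightarrow> P x)"
proof -
 have \<Omega>: "\<Omega> \<inter> space lebesgue \<in> sets lebesgue" using assms by auto
 show ?thesis by (simp add: AE_restrict_space_iff[OF \<Omega>] AE_completion_iff)
qed

lemma borel_imp_measurable_lebesgue_on:
 "f \<in> borel_measurable borel \<Longrightarrow> f \<in> borel_measurable (leb \<Omega>)"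
 by (intro measurable_restrict_space1 measurable_completion) simp

lemma borel_representative:
 fixes f :: "'a::euclidean_space \<Rightarrow> real"
 assumes "\<Omega> \<in> sets borel" "f \<in> borel_measurable (leb \<Omega>)"
 obtains g where "g \<in> borel_measurable borel" "\<And>x. x \<notin> \<Omega> \<Longrightarrow> g x = 0" "AE x in leb \<Omega>. f x = g x"
proof -
 have \<Omega>: "\<Omega> \<inter> space lebesgue \<in> sets lebesgue" using assms(1) by auto
 have "(\<lambda>x. indicator \<Omega> x *\<^sub>R f x) \<in> borel_measurable lebesgue"
  using assms(2) by (simp only: borel_measurable_restrict_space_iff[OF \<Omega>])
 then obtain g where g: "g \<in> borel_measurable lborel" "AE x in lborel. indicator \<Omega> x *\<^sub>R f x = g x"
  using completion_ex_borel_measurable_real by blast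
 show ?thesis
 proof
  show "(\<lambda>x. indicator \<Omega> x * g x) \<in> borel_measurable borel"
   using g(1) assms(1) by (intro borel_measurable_times borel_measurable_indicator) auto
  show "AE x in leb \<Omega>. f x = indicator \<Omega> x * g x"
   unfolding AE_lebesgue_on_iff[OF assms(1)] using g(2) by eventually_elim auto
 qed auto
qed

lemma borel_representative_vec:
 fixes G :: "'a::euclidean_space \<Rightarrow> 'b::euclidean_space"
 assumes "\<Omega> \<in> sets borel" "\<And>b. b \<in> Basis \<Longrightarrow> (\<lambda>x. G x \<bullet> b) \<in> borel_measurable (leb \<Omega>)"
 obtains g where "g \<in> borel_measurable borel" "\<And>x. x \<notin> \<Omega> \<Longrightarrow> g x = 0" "AE x in leb \<Omega>. G x = g x"
proof -
 have "\<exists>h. h \<in> borel_measurable borel \<and> (\<forall>x. x \<notin> \<Omega> \<longrightarrow> h x = 0) \<and> (AE x in leb \<Omega>. G x \<bullet> b = h x)"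
  if "b \<in> Basis" for b using borel_representative[OF assms(1) assms(2)[OF that]] by metis
 then obtain h where h: "\<And>b. b \<in> Basis \<Longrightarrow> h b \<in> borel_measurable borel"
  "\<And>b x. b \<in> Basis \<Longrightarrow> x \<notin> \<Omega> \<Longrightarrow> h b x = 0" "\<And>b. b \<in> Basis \<Longrightarrow> AE x in leb \<Omega>. G x \<bullet> b = h b x" by metis
 show ?thesis
 proof
  show "(\<lambda>x. \<Sum>b\<in>Basis. h b x *\<^sub>R b) \<in> borel_measurable borel"
   using h(1) by (intro borel_measurable_sum borel_measurable_scaleR) auto
  show "AE x in leb \<Omega>. G x = (\<Sum>b\<in>Basis. h b x *\<^sub>R b)"
  proof -
   have "AE x in leb \<Omega>. \<forall>b\<in>Basis. G x \<bullet> b = h b x" using h(3) by (intro AE_finite_allI) auto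
   then show ?thesis
   proof eventually_elim
    case (elim x)
    have "G x = (\<Sum>b\<in>Basis. (G x \<bullet> b) *\<^sub>R b)" by (simp add: euclidean_representation)
    then show ?case using elim by simp
   qed
  qed
 qed (use h(2) in auto)
qed

text \<open>Borel representatives, extended by zero, of the pairs related by \<^const>\<open>weak_grad\<close>.\<close>

definition sob :: "'a::euclidean_space set \<Rightarrow> ('a \<Rightarrow> real) \<Rightarrow> ('a \<Rightarrow> 'a) \<Rightarrow> bool" where
 "sob \<Omega> u G \<longleftrightarrow> u \<in> borel_measurable borel \<and> G \<in> borel_measurable borel \<and>
   (\<forall>x. x \<notin> \<Omega> \<longrightarrow> u x = 0 \<and> G x = 0) \<and> integrable lborel (\<lambda>x. (u x)\<^sup>2) \<and> integrable lborel (\<lambda>x. (norm (G x))\<^sup>2) \<and>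
   (\<forall>\<phi>. test_fun \<Omega> \<phi> \<longrightarrow> (\<forall>b\<in>Basis. (LINT x|lborel. u x * pd \<phi> b x)
    = - (LINT x|lborel. (G x \<bullet> b) * \<phi> x)))"

lemma norm_square_Basis: "(norm (v::'a::euclidean_space))\<^sup>2 = (\<Sum>b\<in>Basis. (v \<bullet> b)\<^sup>2)"
 by (simp add: norm_eq_sqrt_inner euclidean_inner[of v v] power2_eq_square sum_nonneg)

lemma test_fun_measurable:
 assumes "test_fun \<Omega> \<phi>"
 shows "\<phi> \<in> borel_measurable borel"
  and "b \<in> Basis \<Longrightarrow> (pd \<phi> b) \<in> borel_measurable borel" using assms smooth_fun_continuous smooth_fun_deriv_continuous
 by (auto simp: test_fun_def intro!: borel_measurable_continuous_onI)

text \<open>Translation and Fubini arguments run on products of Borel spaces, where composition with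
  maps such as (x, s) \<mapsto> x + s z preserves measurability; this equivalence moves them away
  from Lebesgue measurable functions on \<Omega>.\<close>

lemma weak_grad_iff_sob:
 fixes u u' :: "'a::euclidean_space \<Rightarrow> real"
 assumes \<Omega>: "\<Omega> \<in> sets borel"
  and u': "u' \<in> borel_measurable borel" "\<And>x. x \<notin> \<Omega> \<Longrightarrow> u' x = 0" "AE x in leb \<Omega>. u x = u' x"
  and G': "G' \<in> borel_measurable borel" "\<And>x. x \<notin> \<Omega> \<Longrightarrow> G' x = 0" "AE x in leb \<Omega>. G x = G' x"
  and mu: "u \<in> borel_measurable (leb \<Omega>)" "\<And>b. b \<in> Basis \<Longrightarrow> (\<lambda>x. G x \<bullet> b) \<in> borel_measurable (leb \<Omega>)"
 shows "weak_grad \<Omega> u G \<longleftrightarrow> sob \<Omega> u' G'"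
proof -
 note [measurable] = u'(1) G'(1) mu
 have [measurable]: "u' \<in> borel_measurable (leb \<Omega>)" "G' \<in> borel_measurable (leb \<Omega>)"
  by (rule borel_imp_measurable_lebesgue_on[OF u'(1)], rule borel_imp_measurable_lebesgue_on[OF G'(1)])
 have "integrable (leb \<Omega>) (\<lambda>x. (u x)\<^sup>2) \<longleftrightarrow> integrable (leb \<Omega>) (\<lambda>x. (u' x)\<^sup>2)"
  by (intro integrable_cong_AE) (use u'(3) in \<open>auto elim!: eventually_mono\<close>)
 also have "\<dots> \<longleftrightarrow> integrable lborel (\<lambda>x. (u' x)\<^sup>2)" by (intro integral_lebesgue_on_eq_lborel \<Omega>) (auto simp: u')
 finally have 1: "sq_int \<Omega> u \<longleftrightarrow> integrable lborel (\<lambda>x. (u' x)\<^sup>2)" using mu by (simp add: sq_int_def)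
 have 2: "sq_int \<Omega> (\<lambda>x. G x \<bullet> b) \<longleftrightarrow> integrable lborel (\<lambda>x. (G' x \<bullet> b)\<^sup>2)" if b: "b \<in> Basis" for b
 proof -
  note [measurable] = mu(2)[OF b]
  have "integrable (leb \<Omega>) (\<lambda>x. (G x \<bullet> b)\<^sup>2) \<longleftrightarrow> integrable (leb \<Omega>) (\<lambda>x. (G' x \<bullet> b)\<^sup>2)"
   by (intro integrable_cong_AE) (use G'(3) in \<open>auto elim!: eventually_mono\<close>)
  also have "\<dots> \<longleftrightarrow> integrable lborel (\<lambda>x. (G' x \<bullet> b)\<^sup>2)" by (intro integral_lebesgue_on_eq_lborel \<Omega>) (auto simp: G')
  finally show ?thesis using mu b by (simp add: sq_int_def)
 qed
 have 3: "(\<forall>b\<in>Basis. integrable lborel (\<lambda>x. (G' x \<bullet> b)\<^sup>2)) \<longleftrightarrow> integrable lborel (\<lambda>x. (norm (G' x))\<^sup>2)"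
 proof
  assume "\<forall>b\<in>Basis. integrable lborel (\<lambda>x. (G' x \<bullet> b)\<^sup>2)"
  then show "integrable lborel (\<lambda>x. (norm (G' x))\<^sup>2)"
   unfolding norm_square_Basis by (intro Bochner_Integration.integrable_sum) auto
 next
  assume i: "integrable lborel (\<lambda>x. (norm (G' x))\<^sup>2)"
  have "integrable lborel (\<lambda>x. (G' x \<bullet> b)\<^sup>2)" if "b \<in> Basis" for b
  proof (rule integrable_dominated[OF i])
   show "AE x in lborel. norm ((G' x \<bullet> b)\<^sup>2) \<le> norm ((norm (G' x))\<^sup>2)"
    using Basis_le_norm[OF that] by (intro AE_I2) (simp add: power_mono abs_le_square_iff[symmetric])
  qed simp
  then show "\<forall>b\<in>Basis. integrable lborel (\<lambda>x. (G' x \<bullet> b)\<^sup>2)" by blast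
 qed
 have 4: "integral\<^sup>L (leb \<Omega>) (\<lambda>x. u x * pd \<phi> b x) = (LINT x|lborel. u' x * pd \<phi> b x)"
   "integral\<^sup>L (leb \<Omega>) (\<lambda>x. (G x \<bullet> b) * \<phi> x) = (LINT x|lborel. (G' x \<bullet> b) * \<phi> x)"
  if \<phi>: "test_fun \<Omega> \<phi>" and b: "b \<in> Basis" for \<phi> b
 proof -
  have [measurable]: "\<phi> \<in> borel_measurable borel" "(pd \<phi> b) \<in> borel_measurable borel"
   using test_fun_measurable[OF \<phi>] b by auto
  have [measurable]: "\<phi> \<in> borel_measurable (leb \<Omega>)" "(pd \<phi> b) \<in> borel_measurable (leb \<Omega>)"
   by (rule borel_imp_measurable_lebesgue_on, measurable)+
  note [measurable] = mu(2)[OF b]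
  have "integral\<^sup>L (leb \<Omega>) (\<lambda>x. u x * pd \<phi> b x) = integral\<^sup>L (leb \<Omega>) (\<lambda>x. u' x * pd \<phi> b x)"
   by (intro integral_cong_AE) (use u'(3) in \<open>auto elim!: eventually_mono\<close>)
  also have "\<dots> = (LINT x|lborel. u' x * pd \<phi> b x)" by (intro integral_lebesgue_on_eq_lborel \<Omega>) (auto simp: u')
  finally show "integral\<^sup>L (leb \<Omega>) (\<lambda>x. u x * pd \<phi> b x) = (LINT x|lborel. u' x * pd \<phi> b x)" .
  have "integral\<^sup>L (leb \<Omega>) (\<lambda>x. (G x \<bullet> b) * \<phi> x) = integral\<^sup>L (leb \<Omega>) (\<lambda>x. (G' x \<bullet> b) * \<phi> x)"
   by (intro integral_cong_AE) (use G'(3) in \<open>auto elim!: eventually_mono\<close>)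
  also have "\<dots> = (LINT x|lborel. (G' x \<bullet> b) * \<phi> x)" by (intro integral_lebesgue_on_eq_lborel \<Omega>) (auto simp: G')
  finally show "integral\<^sup>L (leb \<Omega>) (\<lambda>x. (G x \<bullet> b) * \<phi> x) = (LINT x|lborel. (G' x \<bullet> b) * \<phi> x)" .
 qed
 show ?thesis unfolding weak_grad_def sob_def using 1 2 3 4 u'(1,2) G'(1,2) by simp
qed

lemma weak_grad_measurable:
 assumes "weak_grad \<Omega> u G"
 shows "u \<in> borel_measurable (leb \<Omega>)" "b \<in> Basis \<Longrightarrow> (\<lambda>x. G x \<bullet> b) \<in> borel_measurable (leb \<Omega>)"
 using assms by (auto simp: weak_grad_def sq_int_def)

lemma weak_grad_sobE:
 assumes \<Omega>: "\<Omega> \<in> sets borel" and w: "weak_grad \<Omega> u G"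
 obtains u' G' where "sob \<Omega> u' G'" "AE x in leb \<Omega>. u x = u' x" "AE x in leb \<Omega>. G x = G' x"
proof -
 obtain u' where u': "u' \<in> borel_measurable borel" "\<And>x. x \<notin> \<Omega> \<Longrightarrow> u' x = 0" "AE x in leb \<Omega>. u x = u' x"
  using borel_representative[OF \<Omega> weak_grad_measurable(1)[OF w]] by metis
 obtain G' where G': "G' \<in> borel_measurable borel" "\<And>x. x \<notin> \<Omega> \<Longrightarrow> G' x = 0" "AE x in leb \<Omega>. G x = G' x"
  using borel_representative_vec[OF \<Omega> weak_grad_measurable(2)[OF w]] by metis
 have "sob \<Omega> u' G'" using weak_grad_iff_sob[OF \<Omega> u' G' weak_grad_measurable[OF w]] w by simp
 then show ?thesis using that u' G' by blast
qed

lemma integrable_bounded_support: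
 fixes f :: "'a::euclidean_space \<Rightarrow> 'b::euclidean_space"
 assumes "\<Omega> \<in> sets borel" "bounded \<Omega>" "f \<in> borel_measurable borel" "\<And>x. x \<notin> \<Omega> \<Longrightarrow> f x = 0"
  "integrable lborel (\<lambda>x. (norm (f x))\<^sup>2)"
 shows "integrable lborel f"
proof (rule integrable_dominated)
 have "emeasure lborel \<Omega> < \<infinity>" using assms(2) by (rule emeasure_bounded_finite)
 then have "integrable lborel (indicator \<Omega> :: 'a \<Rightarrow> real)" using assms(1) by (simp add: integrable_indicator_iff)
 then show "integrable lborel (\<lambda>x. indicator \<Omega> x + (norm (f x))\<^sup>2)"
  using assms(5) by (rule Bochner_Integration.integrable_add)
 show "AE x in lborel. norm (f x) \<le> norm (indicator \<Omega> x + (norm (f x))\<^sup>2)"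
 proof (rule AE_I2)
  fix x
  have "2 * norm (f x) \<le> 1 + (norm (f x))\<^sup>2"
   using zero_le_power2[of "norm (f x) - 1"] by (simp add: power2_eq_square algebra_simps)
  then show "norm (f x) \<le> norm (indicator \<Omega> x + (norm (f x))\<^sup>2)"
   using assms(4)[of x] norm_ge_zero[of "f x"] by (cases "x \<in> \<Omega>") (auto simp del: norm_ge_zero)
 qed
qed (use assms in auto)

lemma sob_integrable:
 assumes "sob \<Omega> u G" "\<Omega> \<in> sets borel" "bounded \<Omega>"
 shows "integrable lborel u" "integrable lborel G"
proof -
 show "integrable lborel u"
  by (rule integrable_bounded_support[OF assms(2,3)]) (use assms(1) in \<open>simp_all add: sob_def\<close>)
 show "integrable lborel G"
  by (rule integrable_bounded_support[OF assms(2,3)]) (use assms(1) in \<open>simp_all add: sob_def\<close>)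
qed

lemma integrable_mult_bounded:
 fixes f g :: "'b \<Rightarrow> real"
 assumes "integrable M f" "g \<in> borel_measurable M" "\<And>x. \<bar>g x\<bar> \<le> c"
 shows "integrable M (\<lambda>x. f x * g x)"
proof (rule integrable_dominated)
 show "integrable M (\<lambda>x. c * \<bar>f x\<bar>)" using assms(1) by auto
 show "AE x in M. norm (f x * g x) \<le> norm (c * \<bar>f x\<bar>)"
 proof (rule AE_I2)
  fix x
  have "\<bar>f x\<bar> * \<bar>g x\<bar> \<le> \<bar>f x\<bar> * c" using assms(3) by (intro mult_left_mono) auto
  also have "\<dots> \<le> \<bar>c * \<bar>f x\<bar>\<bar>" by (simp add: mult.commute)
  finally show "norm (f x * g x) \<le> norm (c * \<bar>f x\<bar>)" by (simp add: abs_mult)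
 qed
qed (use assms in auto)

text \<open>A segment is compact, so balls of one common radius around its points stay in
  \<Omega>.\<close>

lemma open_segment_domain:
 fixes \<Omega> :: "'a::euclidean_space set"
 assumes "open \<Omega>"
 shows "open {x. \<forall>s\<in>{0..1}. x + s *\<^sub>R z \<in> \<Omega>}"
 unfolding open_contains_ball
proof
 fix x assume x: "x \<in> {x. \<forall>s\<in>{0..1}. x + s *\<^sub>R z \<in> \<Omega>}"
 have "compact ((\<lambda>s. x + s *\<^sub>R z) ` {0..1})" by (intro compact_continuous_image continuous_intros compact_Icc)
 moreover have "(\<lambda>s. x + s *\<^sub>R z) ` {0..1} \<subseteq> \<Omega>" using x by auto
 ultimately obtain \<epsilon> where \<epsilon>: "\<epsilon> > 0" "(\<Union>p\<in>(\<lambda>s. x + s *\<^sub>R z) ` {0..1}. ball p \<epsilon>) \<subseteq> \<Omega>"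
  using compact_subset_open_imp_ball_epsilon_subset[OF _ assms] by metis
 have "y + s *\<^sub>R z \<in> \<Omega>" if "y \<in> ball x \<epsilon>" "s \<in> {0..1}" for y s
 proof -
  have "y + s *\<^sub>R z \<in> ball (x + s *\<^sub>R z) \<epsilon>" using that by (simp add: dist_norm)
  then show ?thesis using \<epsilon>(2) that(2) by blast
 qed
 then show "\<exists>e>0. ball x e \<subseteq> {x. \<forall>s\<in>{0..1}. x + s *\<^sub>R z \<in> \<Omega>}" using \<epsilon>(1) by blast
qed

text \<open>Testing against translates of a test function and integrating over the translation
 parameter turns the weak derivative into a difference along the segment from \<open>x\<close> to \<open>x + z\<close>.\<close>

lemma sob_line_integral:
 fixes z :: "'a::euclidean_space"
 assumes \<Omega>: "open \<Omega>" "bounded \<Omega>" and sob: "sob \<Omega> u G"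
 shows "AE x in lborel. (\<forall>s\<in>{0..1}. x + s *\<^sub>R z \<in> \<Omega>) \<longrightarrow>
   u (x + z) - u x = (LINT s|lborel. indicator {0..1} s * (G (x + s *\<^sub>R z) \<bullet> z))"
proof -
 have \<Omega>b: "\<Omega> \<in> sets borel" using \<Omega> by simp
 note [measurable] = sob[unfolded sob_def, THEN conjunct1] sob[unfolded sob_def, THEN conjunct2, THEN conjunct1]
 note int = sob_integrable[OF sob \<Omega>b \<Omega>(2)]
 have intz: "integrable lborel (\<lambda>x. G x \<bullet> z)" using int(2) by (rule integrable_inner_left)
 define D where "D = {x. \<forall>s\<in>{0..1}. x + s *\<^sub>R z \<in> \<Omega>}"
 define I where "I x = (LINT s|lborel. indicator {0..1} s * (G (x + s *\<^sub>R z) \<bullet> z))" for x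
 define F where "F x = u (x + z) - u x - I x" for x
 \<comment> \<open>Justifies Fubini for integrands containing \<open>h (x + s z)\<close>: for fixed
   s the integral over x is translation invariant, so the double integral is at most B times the L1
   norm of \<open>h\<close>.\<close>
 have pint: "integrable (lborel \<Otimes>\<^sub>M lborel) (\<lambda>(x, s). indicator {0..1} s * (h (x + s *\<^sub>R z) * k (x, s)))"
  if h[measurable]: "h \<in> borel_measurable borel" and hi: "integrable lborel h"
   and k[measurable]: "k \<in> borel_measurable (borel \<Otimes>\<^sub>M borel)" and kB: "\<And>p. \<bar>k p\<bar> \<le> B" "B \<ge> 0"
  for h :: "'a \<Rightarrow> real" and k B
 proof (rule integrableI_bounded)
  have "(\<integral>\<^sup>+p. ennreal (norm (case p of (x, s) \<Rightarrow> indicator {0..1} s * (h (x + s *\<^sub>R z) * k (x, s)))) \<partial>(lborel \<Otimes>\<^sub>M lborel))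
    \<le> (\<integral>\<^sup>+p. (case p of (x, s) \<Rightarrow> ennreal B * indicator {0..1} s * ennreal \<bar>h (x + s *\<^sub>R z)\<bar>) \<partial>(lborel \<Otimes>\<^sub>M lborel))"
  proof (intro nn_integral_mono, clarify)
   fix x :: 'a and s :: real
   have "indicator {0..1} s * (\<bar>h (x + s *\<^sub>R z)\<bar> * \<bar>k (x, s)\<bar>) \<le> B * (indicator {0..1} s * \<bar>h (x + s *\<^sub>R z)\<bar>)"
    using kB(1)[of "(x, s)"] by (auto simp: indicator_def mult.commute[of _ "\<bar>k _\<bar>"] mult_right_mono)
   then show "ennreal (norm (indicator {0..1} s * (h (x + s *\<^sub>R z) * k (x, s)))) \<le> ennreal B * indicator {0..1} s * ennreal \<bar>h (x + s *\<^sub>R z)\<bar>"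
    using kB(2) by (auto simp: abs_mult indicator_def ennreal_mult'[symmetric] intro!: ennreal_leI)
  qed
  also have "\<dots> = (\<integral>\<^sup>+s. \<integral>\<^sup>+x. ennreal B * indicator {0..1} s * ennreal \<bar>h (x + s *\<^sub>R z)\<bar> \<partial>lborel \<partial>lborel)"
   by (subst lborel_pair.nn_integral_snd[symmetric]) auto
  also have "\<dots> = (\<integral>\<^sup>+s. ennreal B * indicator {0..1::real} s * (\<integral>\<^sup>+x. ennreal \<bar>h x\<bar> \<partial>lborel) \<partial>lborel)"
  proof (rule nn_integral_cong)
   fix s :: real
   have "(\<integral>\<^sup>+x. ennreal B * indicator {0..1} s * ennreal \<bar>h (x + s *\<^sub>R z)\<bar> \<partial>lborel) =
    ennreal B * indicator {0..1} s * (\<integral>\<^sup>+x. ennreal \<bar>h (x + s *\<^sub>R z)\<bar> \<partial>lborel)" by (rule nn_integral_cmult) auto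
   then show "(\<integral>\<^sup>+x. ennreal B * indicator {0..1} s * ennreal \<bar>h (x + s *\<^sub>R z)\<bar> \<partial>lborel) =
    ennreal B * indicator {0..1} s * (\<integral>\<^sup>+x. ennreal \<bar>h x\<bar> \<partial>lborel)"
    using nn_integral_lborel_translate[of "\<lambda>x. ennreal \<bar>h x\<bar>" "s *\<^sub>R z"] by simp
  qed
  also have "\<dots> = ennreal B * (\<integral>\<^sup>+x. ennreal \<bar>h x\<bar> \<partial>lborel)"
   by (subst nn_integral_multc) (auto simp: nn_integral_cmult)
  also have "\<dots> < \<infinity>" using hi by (auto simp: integrable_iff_bounded ennreal_mult_less_top)
  finally show "(\<integral>\<^sup>+p. ennreal (norm (case p of (x, s) \<Rightarrow> indicator {0..1} s * (h (x + s *\<^sub>R z) * k (x, s)))) \<partial>(lborel \<Otimes>\<^sub>M lborel)) < \<infinity>" .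
 qed measurable
 have p1: "integrable (lborel \<Otimes>\<^sub>M lborel) (\<lambda>(x, s). indicator {0..1} s * (G (x + s *\<^sub>R z) \<bullet> z))"
  using pint[of "\<lambda>x. G x \<bullet> z" "\<lambda>_. 1" 1] intz by simp
 have intI: "integrable lborel I" unfolding I_def using lborel_pair.integrable_fst'[OF p1] by simp
 have ut: "integrable lborel (\<lambda>x. u (x + z))" using integral_lborel_translate(2)[of u z] int(1) by simp
 have intF: "integrable lborel F" unfolding F_def using ut int(1) intI by auto
 \<comment> \<open>For \<phi> supported in \<open>D\<close>, all translates by s z with s between 0
   and 1 are test functions of \<Omega>.\<close>
 have "(LINT x|lborel. F x * \<phi> x) = 0" if \<phi>: "test_fun D \<phi>" for \<phi>
 proof -
  have sm: "smooth_fun \<phi>" using \<phi> by (simp add: test_fun_def)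
  have [measurable]: "\<phi> \<in> borel_measurable borel" by (rule test_fun_measurable[OF \<phi>])
  obtain B where B: "\<And>x. \<bar>\<phi> x\<bar> \<le> B" "B \<ge> 0" using test_fun_bounded(1)[OF \<phi>] by blast
  define d where "d x = pd \<phi> z x" for x
  have d_eq: "d x = (\<Sum>i\<in>Basis. (z \<bullet> i) * pd \<phi> i x)" for x unfolding d_def using smooth_fun_has_derivative[OF sm]
   by (intro frechet_derivative_euclidean) (auto simp: differentiable_def)
  have d_cont: "continuous_on UNIV d"
   unfolding d_eq[abs_def] using smooth_fun_deriv_continuous[OF sm] by (intro continuous_intros)
  have [measurable]: "d \<in> borel_measurable borel" by (rule borel_measurable_continuous_onI[OF d_cont])
  obtain S where S: "compact S" "\<And>x. x \<notin> S \<Longrightarrow> d x = 0" using test_funD[OF \<phi>] unfolding d_def by metis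
  obtain B' where B': "\<And>x. \<bar>d x\<bar> \<le> B'" "B' \<ge> 0" using continuous_compact_support_bounded[OF d_cont S] by blast
  note bm = integrable_mult_bounded
  have D_sub: "x \<in> D \<Longrightarrow> s \<in> {0..1} \<Longrightarrow> x + s *\<^sub>R z \<in> \<Omega>" for x s by (auto simp: D_def)
  have ftc: "(LINT s|lborel. indicator {0..1} s * d (x - s *\<^sub>R z)) = \<phi> x - \<phi> (x - z)" for x
  proof -
   have "((\<lambda>s. - \<phi> (x - s *\<^sub>R z)) has_vector_derivative d (x - s *\<^sub>R z)) (at s within {0..1})" for s
   proof -
    have "((\<lambda>s. x - s *\<^sub>R z) has_derivative (\<lambda>h. - (h *\<^sub>R z))) (at s within {0..1})"
     by (auto intro!: derivative_eq_intros)
    then have "((\<lambda>s. \<phi> (x - s *\<^sub>R z)) has_derivative (\<lambda>h. pd \<phi> (- (h *\<^sub>R z)) (x - s *\<^sub>R z))) (at s within {0..1})"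
     by (rule has_derivative_compose[OF _ smooth_fun_has_derivative[OF sm]])
    moreover have "pd \<phi> (- (h *\<^sub>R z)) (x - s *\<^sub>R z) = - (h * d (x - s *\<^sub>R z))" for h
     using smooth_fun_has_derivative[OF sm, of "x - s *\<^sub>R z", THEN has_derivative_linear]
     by (simp add: d_def linear_neg linear_cmul)
    ultimately have "((\<lambda>s. \<phi> (x - s *\<^sub>R z)) has_derivative (\<lambda>h. - (h * d (x - s *\<^sub>R z)))) (at s within {0..1})"
     by simp
    from has_derivative_minus[OF this] show ?thesis by (simp add: has_vector_derivative_def mult.commute)
   qed
   then have "(LINT s|lborel. indicator {0..1} s *\<^sub>R d (x - s *\<^sub>R z)) = - \<phi> (x - 1 *\<^sub>R z) - (- \<phi> (x - 0 *\<^sub>R z))"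
    by (intro integral_FTC_Icc continuous_on_compose2[OF d_cont] continuous_intros) auto
   then show ?thesis by simp
  qed
  \<comment> \<open>The weak gradient is tested along basis vectors only, so z is expanded in the
    basis before the identity is applied to the translated test function.\<close>
  have shift: "(LINT x|lborel. u x * d (x - s *\<^sub>R z)) = - (LINT x|lborel. (G (x + s *\<^sub>R z) \<bullet> z) * \<phi> x)"
   if s: "s \<in> {0..1}" for s
  proof -
   have tf: "test_fun \<Omega> (\<lambda>x. \<phi> (x - s *\<^sub>R z))" and
    td: "\<And>x b. pd (\<lambda>x. \<phi> (x - s *\<^sub>R z)) b x = pd \<phi> b (x - s *\<^sub>R z)"
    using test_fun_translate[OF \<phi>, of "s *\<^sub>R z" \<Omega>] D_sub s by auto
   have ti: "integrable lborel (\<lambda>x. u x * pd (\<lambda>x. \<phi> (x - s *\<^sub>R z)) i x)" if i: "i \<in> Basis" for i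
   proof -
    obtain C where "\<And>x. \<bar>pd (\<lambda>x. \<phi> (x - s *\<^sub>R z)) i x\<bar> \<le> C" using test_fun_bounded(2)[OF tf i] by blast
    then show ?thesis using test_fun_measurable(2)[OF tf i] by (intro bm[OF int(1)]) auto
   qed
   have tg: "integrable lborel (\<lambda>x. (G x \<bullet> i) * \<phi> (x - s *\<^sub>R z))" for i using int(2) B by (intro bm[where c = B]) auto
   have "(LINT x|lborel. u x * d (x - s *\<^sub>R z)) = (LINT x|lborel. (\<Sum>i\<in>Basis. (z \<bullet> i) * (u x * pd (\<lambda>x. \<phi> (x - s *\<^sub>R z)) i x)))"
    by (intro LINT_cong refl) (simp add: d_eq td sum_distrib_left algebra_simps)
   also have "\<dots> = (\<Sum>i\<in>Basis. (z \<bullet> i) * (LINT x|lborel. u x * pd (\<lambda>x. \<phi> (x - s *\<^sub>R z)) i x))"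
    using ti by (subst LINT_sum) auto
   also have "\<dots> = (\<Sum>i\<in>Basis. (z \<bullet> i) * - (LINT x|lborel. (G x \<bullet> i) * \<phi> (x - s *\<^sub>R z)))"
    using sob tf by (intro sum.cong refl) (simp add: sob_def)
   also have "\<dots> = - (\<Sum>i\<in>Basis. LINT x|lborel. (z \<bullet> i) * ((G x \<bullet> i) * \<phi> (x - s *\<^sub>R z)))" by (simp add: sum_negf)
   also have "\<dots> = - (LINT x|lborel. (\<Sum>i\<in>Basis. (z \<bullet> i) * ((G x \<bullet> i) * \<phi> (x - s *\<^sub>R z))))"
    using tg by (subst LINT_sum) auto
   also have "(\<lambda>x. \<Sum>i\<in>Basis. (z \<bullet> i) * ((G x \<bullet> i) * \<phi> (x - s *\<^sub>R z))) = (\<lambda>x. (G x \<bullet> z) * \<phi> (x - s *\<^sub>R z))"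
    by (intro ext) (simp add: euclidean_inner[of _ z] sum_distrib_right sum_distrib_left mult_ac)
   also have "(LINT x|lborel. (G x \<bullet> z) * \<phi> (x - s *\<^sub>R z)) = (LINT x|lborel. (G (x + s *\<^sub>R z) \<bullet> z) * \<phi> x)"
    using integral_lborel_translate(1)[of "\<lambda>x. (G x \<bullet> z) * \<phi> (x - s *\<^sub>R z)" "s *\<^sub>R z"] by simp
   finally show ?thesis .
  qed
  have q1: "integrable (lborel \<Otimes>\<^sub>M lborel) (\<lambda>(x, s). indicator {0..1} s * (u x * d (x - s *\<^sub>R z)))"
  proof -
   have "integrable (lborel \<Otimes>\<^sub>M lborel) (\<lambda>(x::'a, s). indicator {0..1::real} s * B' * u x)"
   proof (rule lborel_pair.Fubini_integrable)
    show "integrable lborel (\<lambda>x. LINT y|lborel. norm (case (x, y) of (x::'a, s) \<Rightarrow> indicator {0..1::real} s * B' * u x))"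
     using integrable_mult_right[OF integrable_abs[OF int(1)], of B'] B'(2) by (simp add: abs_mult mult.assoc)
   qed auto
   moreover have "\<bar>u x\<bar> * \<bar>d y\<bar> \<le> \<bar>B'\<bar> * \<bar>u x\<bar>" for x y
    using mult_left_mono[OF order_trans[OF B'(1)[of y] abs_ge_self], of "\<bar>u x\<bar>"] by (simp add: mult.commute)
   ultimately show ?thesis by (elim integrable_dominated) (auto simp: abs_mult indicator_def intro!: AE_I2)
  qed
  have q2: "integrable (lborel \<Otimes>\<^sub>M lborel) (\<lambda>(x, s). indicator {0..1} s * ((G (x + s *\<^sub>R z) \<bullet> z) * \<phi> x))"
   using pint[of "\<lambda>x. G x \<bullet> z" "\<lambda>p. \<phi> (fst p)" B] intz B by simp
  have "(LINT x|lborel. u x * (\<phi> x - \<phi> (x - z))) = (LINT x|lborel. LINT s|lborel. indicator {0..1} s * (u x * d (x - s *\<^sub>R z)))"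
  proof (intro LINT_cong refl)
   fix x
   have "(LINT s|lborel. indicator {0..1} s * (u x * d (x - s *\<^sub>R z))) = (LINT s|lborel. u x * (indicator {0..1} s * d (x - s *\<^sub>R z)))"
    by (intro LINT_cong) auto
   then show "u x * (\<phi> x - \<phi> (x - z)) = (LINT s|lborel. indicator {0..1} s * (u x * d (x - s *\<^sub>R z)))"
    using ftc by simp
  qed
  also have "\<dots> = (LINT s|lborel. LINT x|lborel. indicator {0..1} s * (u x * d (x - s *\<^sub>R z)))"
   using lborel_pair.Fubini_integral[OF q1] by simp
  also have "\<dots> = (LINT s|lborel. - (LINT x|lborel. indicator {0..1} s * ((G (x + s *\<^sub>R z) \<bullet> z) * \<phi> x)))"
   using shift by (intro LINT_cong refl) (auto simp: indicator_def)
  also have "\<dots> = - (LINT x|lborel. LINT s|lborel. indicator {0..1} s * ((G (x + s *\<^sub>R z) \<bullet> z) * \<phi> x))"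
   using lborel_pair.Fubini_integral[OF q2] by simp
  also have "(\<lambda>x. LINT s|lborel. indicator {0..1} s * ((G (x + s *\<^sub>R z) \<bullet> z) * \<phi> x)) = (\<lambda>x. I x * \<phi> x)"
   by (auto simp: I_def simp flip: mult.assoc)
  finally have 1: "(LINT x|lborel. u x * (\<phi> x - \<phi> (x - z))) = - (LINT x|lborel. I x * \<phi> x)" .
  have i1: "integrable lborel (\<lambda>x. u x * \<phi> x)" "integrable lborel (\<lambda>x. u x * \<phi> (x - z))"
   "integrable lborel (\<lambda>x. u (x + z) * \<phi> x)" "integrable lborel (\<lambda>x. I x * \<phi> x)"
   using B by (intro bm[where c = B] int ut intI; measurable)+
  have "(LINT x|lborel. u x * \<phi> (x - z)) = (LINT x|lborel. u (x + z) * \<phi> x)"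
   using integral_lborel_translate(1)[of "\<lambda>x. u x * \<phi> (x - z)" z] by simp
  then show ?thesis using 1 i1 by (simp add: F_def algebra_simps)
 qed
 then have "AE x in lborel. x \<in> D \<longrightarrow> F x = 0"
  by (intro fundamental_lemma intF) (auto simp: D_def intro: open_segment_domain \<Omega>)
 then show ?thesis by eventually_elim (auto simp: D_def F_def I_def)
qed

text \<open>Nonnegativity of the variance over the unit interval. An infinite right side leaves
  nothing to show; a finite one supplies the integrability.\<close>

lemma square_integral_unit_interval_le:
 fixes g :: "real \<Rightarrow> real"
 assumes [measurable]: "g \<in> borel_measurable borel"
 shows "ennreal ((LINT s|lborel. indicator {0..1} s * g s)\<^sup>2) \<le> (\<integral>\<^sup>+s. indicator {0..1} s * ennreal ((g s)\<^sup>2) \<partial>lborel)"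
proof (cases "(\<integral>\<^sup>+s. indicator {0..1} s * ennreal ((g s)\<^sup>2) \<partial>lborel) = \<infinity>")
 case False
 have eq: "indicator {0..1} s * ennreal ((g s)\<^sup>2) = ennreal (indicator {0..1} s * (g s)\<^sup>2)" for s
  by (auto simp: indicator_def)
 have i2: "integrable lborel (\<lambda>s. indicator {0..1} s * (g s)\<^sup>2)"
  using False by (intro integrableI_nonneg) (auto simp: eq less_top)
 have i0: "integrable lborel (indicator {0..1} :: real \<Rightarrow> real)" by simp
 have i1: "integrable lborel (\<lambda>s. indicator {0..1} s * g s)"
 proof (rule integrable_dominated[OF Bochner_Integration.integrable_add[OF i0 i2]])
  show "AE s in lborel. norm (indicator {0..1} s * g s) \<le> norm (indicator {0..1} s + indicator {0..1} s * (g s)\<^sup>2)"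
  proof (rule AE_I2)
   fix s
   have "2 * \<bar>g s\<bar> \<le> 1 + (g s)\<^sup>2" using zero_le_power2[of "\<bar>g s\<bar> - 1"] by (simp add: power2_diff)
   then show "norm (indicator {0..1} s * g s) \<le> norm (indicator {0..1} s + indicator {0..1} s * (g s)\<^sup>2)"
    by (auto simp: indicator_def)
  qed
 qed simp
 define m where "m = (LINT s|lborel. indicator {0..1} s * g s)"
 have "0 \<le> (LINT s|lborel. indicator {0..1} s * (g s - m)\<^sup>2)" by (intro LINT_nonneg) auto
 also have "(\<lambda>s. indicator {0..1} s * (g s - m)\<^sup>2) =
   (\<lambda>s. indicator {0..1} s * (g s)\<^sup>2 - 2 * m * (indicator {0..1} s * g s) + m\<^sup>2 * indicator {0..1} s)"
  by (auto simp: power2_eq_square algebra_simps)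
 also have "(LINT s|lborel. indicator {0..1} s * (g s)\<^sup>2 - 2 * m * (indicator {0..1} s * g s) + m\<^sup>2 * indicator {0..1} s)
   = (LINT s|lborel. indicator {0..1} s * (g s)\<^sup>2) - 2 * m * m + m\<^sup>2" using i0 i1 i2 by (simp add: m_def[symmetric])
 finally have "m\<^sup>2 \<le> (LINT s|lborel. indicator {0..1} s * (g s)\<^sup>2)" by (simp add: power2_eq_square)
 also have "ennreal \<dots> = (\<integral>\<^sup>+s. indicator {0..1} s * ennreal ((g s)\<^sup>2) \<partial>lborel)"
  unfolding eq by (rule nn_integral_eq_integral[symmetric, OF i2]) auto
 finally show ?thesis unfolding m_def by (simp add: ennreal_leI)
qed simp

lemma sob_line_inequality:
 fixes z :: "'a::euclidean_space"
 assumes \<Omega>: "open \<Omega>" "bounded \<Omega>" and sob: "sob \<Omega> u G"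
 shows "AE x in lborel. (\<forall>s\<in>{0..1}. x + s *\<^sub>R z \<in> \<Omega>) \<longrightarrow>
   ennreal ((u (x + z) - u x)\<^sup>2) \<le> (\<integral>\<^sup>+s. indicator {0..1} s * ennreal ((G (x + s *\<^sub>R z) \<bullet> z)\<^sup>2) \<partial>lborel)"
 using sob_line_integral[OF assms, of z]
proof eventually_elim
 case (elim x)
 have [measurable]: "G \<in> borel_measurable borel" using sob by (simp add: sob_def)
 show ?case using elim square_integral_unit_interval_le[of "\<lambda>s. G (x + s *\<^sub>R z) \<bullet> z"] by auto
qed

lemma sob_unique:
 assumes \<Omega>: "open \<Omega>" "bounded \<Omega>" and "sob \<Omega> u G" "sob \<Omega> v H" "AE x in lborel. u x = v x"
 shows "AE x in lborel. G x = H x"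
proof -
 have \<Omega>b: "\<Omega> \<in> sets borel" using \<Omega> by simp
 have [measurable]: "u \<in> borel_measurable borel" "v \<in> borel_measurable borel"
   "G \<in> borel_measurable borel" "H \<in> borel_measurable borel" using assms by (auto simp: sob_def)
 note int = sob_integrable[OF assms(3) \<Omega>b \<Omega>(2)] sob_integrable[OF assms(4) \<Omega>b \<Omega>(2)]
 have Gb: "AE x in lborel. x \<in> \<Omega> \<longrightarrow> (G x - H x) \<bullet> b = 0" if b: "b \<in> Basis" for b
 proof (rule fundamental_lemma)
  show "integrable lborel (\<lambda>x. (G x - H x) \<bullet> b)" using int by auto
  fix \<phi> assume \<phi>: "test_fun \<Omega> \<phi>"
  have [measurable]: "\<phi> \<in> borel_measurable borel" "(pd \<phi> b) \<in> borel_measurable borel"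
   using test_fun_measurable[OF \<phi>] b by auto
  obtain B where B: "\<And>x. \<bar>\<phi> x\<bar> \<le> B" "B \<ge> 0" using test_fun_bounded(1)[OF \<phi>] by blast
  have i: "integrable lborel (\<lambda>x. (g x \<bullet> b) * \<phi> x)" if "integrable lborel g" "g \<in> borel_measurable borel" for g
  proof (rule integrable_dominated[OF integrable_mult_right[OF integrable_norm[OF that(1)], of B]])
   show "AE x in lborel. norm ((g x \<bullet> b) * \<phi> x) \<le> norm (B * norm (g x))"
   proof (rule AE_I2)
    fix x
    have "\<bar>g x \<bullet> b\<bar> * \<bar>\<phi> x\<bar> \<le> norm (g x) * B" using Basis_le_norm[OF b, of "g x"] B by (intro mult_mono) auto
    then show "norm ((g x \<bullet> b) * \<phi> x) \<le> norm (B * norm (g x))" using B(2) by (simp add: abs_mult mult.commute)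
   qed
  qed (use that in auto)
  have "(LINT x|lborel. u x * pd \<phi> b x) = (LINT x|lborel. v x * pd \<phi> b x)"
   by (intro integral_cong_AE) (use assms(5) in \<open>auto elim!: eventually_mono\<close>)
  then have "(LINT x|lborel. (G x \<bullet> b) * \<phi> x) = (LINT x|lborel. (H x \<bullet> b) * \<phi> x)"
   using assms(3,4) \<phi> b by (auto simp: sob_def)
  then show "(LINT x|lborel. ((G x - H x) \<bullet> b) * \<phi> x) = 0"
   using i[OF int(2)] i[OF int(4)] by (simp add: inner_diff_left left_diff_distrib)
 qed (use \<Omega> in auto)
 have "AE x in lborel. \<forall>b\<in>Basis. x \<in> \<Omega> \<longrightarrow> (G x - H x) \<bullet> b = 0" by (rule AE_finite_allI[OF finite_Basis]) (rule Gb)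
 then show ?thesis
 proof eventually_elim
  case (elim x)
  show ?case
  proof (cases "x \<in> \<Omega>")
   case True
   then have "(G x - H x) \<bullet> b = 0" if "b \<in> Basis" for b using elim that by blast
   then show ?thesis by (intro euclidean_eqI[of "G x" "H x"]) (simp add: inner_diff_left)
  next
   case False
   then show ?thesis using assms(3,4) by (simp add: sob_def)
  qed
 qed
qed

lemma weak_grad_unique:
 assumes \<Omega>: "open \<Omega>" "bounded \<Omega>" and "weak_grad \<Omega> u G" "weak_grad \<Omega> v H" "AE x in leb \<Omega>. u x = v x"
 shows "AE x in leb \<Omega>. G x = H x"
proof -
 have \<Omega>b: "\<Omega> \<in> sets borel" using \<Omega> by simp
 obtain u' G' where 1: "sob \<Omega> u' G'" "AE x in leb \<Omega>. u x = u' x" "AE x in leb \<Omega>. G x = G' x"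
  using weak_grad_sobE[OF \<Omega>b assms(3)] by blast
 obtain v' H' where 2: "sob \<Omega> v' H'" "AE x in leb \<Omega>. v x = v' x" "AE x in leb \<Omega>. H x = H' x"
  using weak_grad_sobE[OF \<Omega>b assms(4)] by blast
 have "AE x in leb \<Omega>. u' x = v' x" using 1(2) 2(2) assms(5) by eventually_elim simp
 then have "AE x in lborel. u' x = v' x"
  unfolding AE_lebesgue_on_iff[OF \<Omega>b] by eventually_elim (use 1(1) 2(1) in \<open>auto simp: sob_def\<close>)
 from sob_unique[OF \<Omega> 1(1) 2(1) this] have "AE x in leb \<Omega>. G' x = H' x"
  unfolding AE_lebesgue_on_iff[OF \<Omega>b] by eventually_elim simp
 then show ?thesis using 1(3) 2(3) by eventually_elim simp
qed

section \<open>Completeness of square integrable functions\<close>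

text \<open>Riesz-Fischer for values in a Banach space: a rapidly Cauchy subsequence converges
  almost everywhere, and Fatou's lemma turns the Cauchy bound into a bound for the limit.\<close>

lemma L2_complete:
 fixes f :: "nat \<Rightarrow> 'a \<Rightarrow> 'b::{banach, second_countable_topology}"
 assumes [measurable]: "\<And>k. f k \<in> borel_measurable M"
  and cauchy: "\<And>\<epsilon>. \<epsilon> > 0 \<Longrightarrow> \<exists>N. \<forall>k\<ge>N. \<forall>l\<ge>N. (\<integral>\<^sup>+x. ennreal ((norm (f k x - f l x))\<^sup>2) \<partial>M) \<le> ennreal \<epsilon>"
 shows "\<exists>g\<in>borel_measurable M. (\<lambda>k. \<integral>\<^sup>+x. ennreal ((norm (f k x - g x))\<^sup>2) \<partial>M) \<longlonglongrightarrow> 0"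
proof -
 have "\<exists>N. \<forall>k\<ge>N. \<forall>l\<ge>N. (\<integral>\<^sup>+x. ennreal ((norm (f k x - f l x))\<^sup>2) \<partial>M) \<le> ennreal ((1/8) ^ j)" for j :: nat
  by (intro cauchy) simp
 then obtain N where N: "\<And>j k l. k \<ge> N j \<Longrightarrow> l \<ge> N j \<Longrightarrow> (\<integral>\<^sup>+x. ennreal ((norm (f k x - f l x))\<^sup>2) \<partial>M) \<le> ennreal ((1/8) ^ j)"
  by metis
 \<comment> \<open>A sum rather than \<open>N j\<close> alone, so that r is nondecreasing, tends to
   infinity and dominates \<open>N j\<close>.\<close>
 define r where "r j = (\<Sum>i\<le>j. N i) + j" for j
 have rN: "N j \<le> r j" for j
 proof -
  have "N j \<le> (\<Sum>i\<le>j. N i)" by (intro member_le_sum) auto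
  then show ?thesis by (simp add: r_def)
 qed
 have rS: "r j \<le> r (Suc j)" for j by (simp add: r_def)
 have rj: "j \<le> r j" for j by (simp add: r_def)
 define h where "h j x = norm (f (r (Suc j)) x - f (r j) x)" for j x
 have [measurable]: "h j \<in> borel_measurable M" for j unfolding h_def by measurable
 have hint: "(\<integral>\<^sup>+x. ennreal ((h j x)\<^sup>2) \<partial>M) \<le> ennreal ((1/8) ^ j)" for j
  unfolding h_def by (intro N order_trans[OF rN rS] rN)
 have "(\<integral>\<^sup>+x. (\<Sum>j. ennreal (2 ^ j * (h j x)\<^sup>2)) \<partial>M) = (\<Sum>j. \<integral>\<^sup>+x. ennreal (2 ^ j * (h j x)\<^sup>2) \<partial>M)"
  by (intro nn_integral_suminf) auto
 also have "\<dots> \<le> (\<Sum>j. ennreal ((1/4) ^ j))"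
 proof (intro suminf_le)
  fix j
  have "(\<integral>\<^sup>+x. ennreal (2 ^ j * (h j x)\<^sup>2) \<partial>M) = ennreal (2 ^ j) * (\<integral>\<^sup>+x. ennreal ((h j x)\<^sup>2) \<partial>M)"
   by (subst nn_integral_cmult[symmetric]) (auto simp: ennreal_mult')
  also have "\<dots> \<le> ennreal (2 ^ j) * ennreal ((1/8) ^ j)" by (intro mult_left_mono hint) auto
  also have "\<dots> = ennreal ((1/4) ^ j)" by (simp add: ennreal_mult'[symmetric] power_mult_distrib[symmetric])
  finally show "(\<integral>\<^sup>+x. ennreal (2 ^ j * (h j x)\<^sup>2) \<partial>M) \<le> ennreal ((1/4) ^ j)" .
 qed auto
 also have "\<dots> < \<infinity>" by (subst suminf_ennreal2) (auto intro: summable_geometric)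
 finally have "(\<integral>\<^sup>+x. (\<Sum>j. ennreal (2 ^ j * (h j x)\<^sup>2)) \<partial>M) \<noteq> \<infinity>" by simp
 then have "AE x in M. (\<Sum>j. ennreal (2 ^ j * (h j x)\<^sup>2)) \<noteq> \<infinity>" by (intro nn_integral_PInf_AE) auto
 then have conv: "AE x in M. convergent (\<lambda>j. f (r j) x)"
 proof eventually_elim
  case (elim x)
  have s2: "summable (\<lambda>j. 2 ^ j * (h j x)\<^sup>2)" using elim by (intro summable_suminf_not_top) auto
  have "summable (\<lambda>j. (1/2) ^ j + 2 ^ j * (h j x)\<^sup>2)" by (intro summable_add s2 summable_geometric) simp
  \<comment> \<open>The weights \<open>2^j\<close> in the series above convert square summability
    into absolute summability through this inequality, while the integrals 2^j (1/8)^j remain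
    summable.\<close>
  moreover have "norm (f (r (Suc j)) x - f (r j) x) \<le> (1/2) ^ j + 2 ^ j * (h j x)\<^sup>2" for j
  proof -
   have h0: "0 \<le> h j x" by (simp add: h_def)
   have "0 \<le> (1 - 2 ^ j * h j x)\<^sup>2" by simp
   then have "2 * (2 ^ j * h j x) \<le> 1 + (2 ^ j)\<^sup>2 * (h j x)\<^sup>2" by (simp add: power2_diff power_mult_distrib)
   then have "2 ^ j * h j x \<le> 1 + (2 ^ j)\<^sup>2 * (h j x)\<^sup>2" using h0 by (smt (verit) mult_nonneg_nonneg zero_le_power)
   also have "\<dots> = 2 ^ j * ((1/2) ^ j + 2 ^ j * (h j x)\<^sup>2)"
    by (simp add: algebra_simps power2_eq_square power_one_over)
   finally show ?thesis unfolding h_def[symmetric] by simp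
  qed
  ultimately have "summable (\<lambda>j. f (r (Suc j)) x - f (r j) x)" by (rule summable_comparison_test')
  then have "convergent (\<lambda>n. \<Sum>j<n. f (r (Suc j)) x - f (r j) x)" by (simp add: summable_iff_convergent)
  then have "convergent (\<lambda>n. (f (r n) x - f (r 0) x) + f (r 0) x)"
   using sum_lessThan_telescope[of "\<lambda>j. f (r j) x"] by (simp only: convergent_add_const_right_iff)
  then show ?case by simp
 qed
 define g where "g x = lim (\<lambda>j. f (r j) x)" for x
 have [measurable]: "g \<in> borel_measurable M" unfolding g_def by measurable
 have lim: "AE x in M. (\<lambda>j. f (r j) x) \<longlonglongrightarrow> g x" using conv by eventually_elim (auto simp: g_def convergent_LIMSEQ_iff)
 have bound: "(\<integral>\<^sup>+x. ennreal ((norm (f k x - g x))\<^sup>2) \<partial>M) \<le> ennreal ((1/8) ^ j)" if k: "k \<ge> N j" for k j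
 proof -
  have "(\<integral>\<^sup>+x. ennreal ((norm (f k x - g x))\<^sup>2) \<partial>M) = (\<integral>\<^sup>+x. liminf (\<lambda>i. ennreal ((norm (f k x - f (r i) x))\<^sup>2)) \<partial>M)"
  proof (intro nn_integral_cong_AE)
   show "AE x in M. ennreal ((norm (f k x - g x))\<^sup>2) = liminf (\<lambda>i. ennreal ((norm (f k x - f (r i) x))\<^sup>2))" using lim
   proof eventually_elim
    case (elim x)
    have "(\<lambda>i. ennreal ((norm (f k x - f (r i) x))\<^sup>2)) \<longlonglongrightarrow> ennreal ((norm (f k x - g x))\<^sup>2)"
     by (intro tendsto_ennrealI tendsto_intros elim)
    from lim_imp_Liminf[OF _ this] show ?case by simp
   qed
  qed
  also have "\<dots> \<le> liminf (\<lambda>i. \<integral>\<^sup>+x. ennreal ((norm (f k x - f (r i) x))\<^sup>2) \<partial>M)" by (intro nn_integral_liminf) auto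
  also have "\<dots> \<le> limsup (\<lambda>i. \<integral>\<^sup>+x. ennreal ((norm (f k x - f (r i) x))\<^sup>2) \<partial>M)" by (intro Liminf_le_Limsup) simp
  also have "\<dots> \<le> ennreal ((1/8) ^ j)"
  proof (rule Limsup_bounded)
   show "\<forall>\<^sub>F i in sequentially. (\<integral>\<^sup>+x. ennreal ((norm (f k x - f (r i) x))\<^sup>2) \<partial>M) \<le> ennreal ((1/8) ^ j)"
    unfolding eventually_sequentially by (intro exI[of _ "N j"] allI impI N k) (use rj order_trans in blast)
  qed
  finally show ?thesis .
 qed
 have "(\<lambda>k. \<integral>\<^sup>+x. ennreal ((norm (f k x - g x))\<^sup>2) \<partial>M) \<longlonglongrightarrow> 0"
 proof (rule order_tendstoI)
  fix e :: ennreal assume e: "e > 0"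
  have "(\<lambda>j. ennreal ((1/8) ^ j)) \<longlonglongrightarrow> ennreal 0" by (intro tendsto_ennrealI LIMSEQ_realpow_zero) auto
  then have "\<forall>\<^sub>F j in sequentially. ennreal ((1/8) ^ j) < e" using e by (intro order_tendstoD) auto
  then obtain j where j: "ennreal ((1/8) ^ j) < e" unfolding eventually_sequentially by blast
  show "\<forall>\<^sub>F k in sequentially. (\<integral>\<^sup>+x. ennreal ((norm (f k x - g x))\<^sup>2) \<partial>M) < e" unfolding eventually_sequentially
  proof (intro exI[of _ "N j"] allI impI)
   fix k assume "N j \<le> k"
   from bound[OF this] j show "(\<integral>\<^sup>+x. ennreal ((norm (f k x - g x))\<^sup>2) \<partial>M) < e" by (rule le_less_trans)
  qed
 qed simp
 then show ?thesis by (intro bexI[of _ g]) simp_all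
qed

section \<open>Trace inequality along a direction\<close>

lemma nn_integral_le_of_emeasure_le:
 fixes f :: "'b \<Rightarrow> ennreal"
 assumes sets: "sets M = sets N" and le: "\<And>A. A \<in> sets N \<Longrightarrow> emeasure M A \<le> c * emeasure N A"
  and f: "f \<in> borel_measurable N"
 shows "(\<integral>\<^sup>+x. f x \<partial>M) \<le> c * (\<integral>\<^sup>+x. f x \<partial>N)"
 using f
proof (induction rule: borel_measurable_induct)
 case (cong f g)
 have "space M = space N" using sets by (rule sets_eq_imp_space_eq)
 then have "(\<integral>\<^sup>+x. f x \<partial>M) = (\<integral>\<^sup>+x. g x \<partial>M)" "(\<integral>\<^sup>+x. f x \<partial>N) = (\<integral>\<^sup>+x. g x \<partial>N)"
  using cong by (auto intro!: nn_integral_cong)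
 then show ?case using cong by simp
next
 case (set A)
 then show ?case using le[of A] sets by simp
next
 case (mult u v)
 have "u \<in> borel_measurable M" using mult sets by (simp cong: measurable_cong_sets)
 moreover have "v * (\<integral>\<^sup>+x. u x \<partial>M) \<le> v * (c * (\<integral>\<^sup>+x. u x \<partial>N))" by (intro mult_left_mono mult) simp
 ultimately show ?case using mult by (simp add: nn_integral_cmult mult.left_commute[of c v])
next
 case (add u v)
 have "u \<in> borel_measurable M" "v \<in> borel_measurable M" using add sets by (simp_all cong: measurable_cong_sets)
 then show ?case using add by (simp add: nn_integral_add distrib_left add_mono)
next
 case (seq U)
 have m: "\<And>i. U i \<in> borel_measurable M" using seq sets by (simp cong: measurable_cong_sets)
 have "(\<integral>\<^sup>+x. (SUP i. U i x) \<partial>M) = (SUP i. \<integral>\<^sup>+x. U i x \<partial>M)" by (intro nn_integral_monotone_convergence_SUP m seq)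
 also have "\<dots> \<le> (SUP i. c * (\<integral>\<^sup>+x. U i x \<partial>N))" by (rule SUP_mono) (use seq in blast)
 also have "\<dots> = c * (SUP i. \<integral>\<^sup>+x. U i x \<partial>N)" by (simp add: SUP_mult_left_ennreal)
 also have "(SUP i. \<integral>\<^sup>+x. U i x \<partial>N) = (\<integral>\<^sup>+x. (SUP i. U i x) \<partial>N)"
  by (intro nn_integral_monotone_convergence_SUP[symmetric] seq)
 finally show ?case by (simp add: SUP_apply image_comp)
qed

text \<open>The image of \<open>N \<otimes> dt\<close> under \<open>(x, t) \<mapsto> x + t d\<close>, \<open>0 \<le> t \<le> h\<close>, is at most \<open>c\<close> times
 Lebesgue measure.\<close>

definition shadow_le :: "'a::euclidean_space measure \<Rightarrow> 'a \<Rightarrow> real \<Rightarrow> real \<Rightarrow> bool" where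
 "shadow_le N d h c \<longleftrightarrow> (\<forall>f \<in> borel_measurable borel.
   (\<integral>\<^sup>+x. (\<integral>\<^sup>+t. indicator {0..h} t * f (x + t *\<^sub>R d) \<partial>lborel) \<partial>N) \<le> ennreal c * (\<integral>\<^sup>+x. f x \<partial>lborel))"

lemma shadow_leD:
 "shadow_le N d h c \<Longrightarrow> f \<in> borel_measurable borel \<Longrightarrow>
  (\<integral>\<^sup>+x. (\<integral>\<^sup>+t. indicator {0..h} t * f (x + t *\<^sub>R d) \<partial>lborel) \<partial>N) \<le> ennreal c * (\<integral>\<^sup>+x. f x \<partial>lborel)"
 by (simp add: shadow_le_def)

text \<open>\<open>A\<close> is covered, up to small excess, by countably many nonoverlapping dyadic
  cubes. \<open>M\<close> may charge their faces, but the closed cube is bounded by the Lebesgue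
  measure of its interior, and the interiors are disjoint.\<close>

lemma emeasure_le_of_cubes:
 fixes M :: "'a::euclidean_space measure"
 assumes sets: "sets M = sets borel" and c: "c \<ge> 0"
  and cube: "\<And>p r. r > 0 \<Longrightarrow> emeasure M (cbox p (p + r *\<^sub>R One)) \<le> ennreal (c * r ^ DIM('a))"
  and A: "A \<in> sets borel"
 shows "emeasure M A \<le> ennreal c * emeasure lborel A"
proof -
 have bounded_case: "emeasure M A \<le> ennreal c * emeasure lborel A"
  if A: "A \<in> sets borel" and k: "k > 0" and sub: "A \<subseteq> cbox (- k *\<^sub>R One) (k *\<^sub>R One)" for A k
 proof (rule ennreal_le_epsilon)
  fix e :: real assume e: "e > 0"
  have Al: "A \<in> lmeasurable"
   by (rule bounded_set_imp_lmeasurable[OF bounded_subset[OF bounded_cbox sub]]) (use A in simp)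
  \<comment> \<open>c + 1 because c may be 0.\<close>
  define e' where "e' = e / (c + 1)"
  have e': "e' > 0" using e c by (simp add: e'_def)
  obtain \<D> :: "'a set set" where D: "countable \<D>" "\<And>K. K \<in> \<D> \<Longrightarrow> K \<subseteq> cbox (- k *\<^sub>R One) (k *\<^sub>R One) \<and> K \<noteq> {} \<and> (\<exists>c d. K = cbox c d)"
    "pairwise (\<lambda>A B. interior A \<inter> interior B = {}) \<D>"
    "\<And>u v. cbox u v \<in> \<D> \<Longrightarrow> \<exists>n. \<forall>i \<in> Basis. v \<bullet> i - u \<bullet> i = ((k *\<^sub>R One) \<bullet> i - (- k *\<^sub>R One) \<bullet> i)/2^n"
    "A \<subseteq> \<Union>\<D>" "\<Union>\<D> \<in> lmeasurable" "measure lebesgue (\<Union>\<D>) \<le> measure lebesgue A + e'"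
   apply (rule measurable_outer_intervals_bounded[OF Al sub e'])
   subgoal premises p for \<D> by (rule that) (fact p)+
   done
  \<comment> \<open>An enumeration by natural numbers that also serves a finite family: indices
    outside the range of the numbering receive the empty set.\<close>
  define E where "E i = (if i \<in> to_nat_on \<D> ` \<D> then from_nat_into \<D> i else {})" for i
  have E_eq: "\<exists>K\<in>\<D>. E i = K \<and> to_nat_on \<D> K = i" if ne: "E i \<noteq> {}" for i
  proof -
   have i: "i \<in> to_nat_on \<D> ` \<D>" using ne unfolding E_def by (metis (full_types))
   then obtain K where K: "K \<in> \<D>" "i = to_nat_on \<D> K" by (rule imageE)
   have "E i = from_nat_into \<D> i" unfolding E_def using i by (rule if_P)
   also have "\<dots> = K" unfolding K(2) by (rule from_nat_into_to_nat_on[OF D(1) K(1)])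
   finally show ?thesis using K by (intro bexI[of _ K] conjI) simp_all
  qed
  have E_D: "E i \<in> \<D>" if "E i \<noteq> {}" for i using E_eq[OF that] by (elim bexE conjE) simp
  have E_inj: "i = j" if ne: "E i = E j" "E i \<noteq> {}" for i j
  proof -
   have nj: "E j \<noteq> {}" using ne by simp
   obtain K' where K': "E j = K'" "to_nat_on \<D> K' = j" using E_eq[OF nj] by (elim bexE conjE)
   obtain K where K: "E i = K" "to_nat_on \<D> K = i" using E_eq[OF ne(2)] by (elim bexE conjE)
   show ?thesis using K K' ne(1) by simp
  qed
  have UE: "(\<Union>i. E i) = \<Union>\<D>"
  proof (intro equalityI subsetI)
   fix x assume "x \<in> (\<Union>i. E i)"
   then obtain i where i: "x \<in> E i" by (elim UN_E)
   then have "E i \<noteq> {}" by auto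
   then show "x \<in> \<Union>\<D>" using i by (intro UnionI[OF E_D])
  next
   fix x assume "x \<in> \<Union>\<D>"
   then obtain K where K: "K \<in> \<D>" "x \<in> K" by (elim UnionE)
   have "E (to_nat_on \<D> K) = K" unfolding E_def using K(1) D(1) by simp
   then show "x \<in> (\<Union>i. E i)" using K(2) by (intro UN_I[of "to_nat_on \<D> K"]) simp_all
  qed
  have cubeE: "E i \<in> sets borel \<and> emeasure M (E i) \<le> ennreal c * emeasure lborel (interior (E i))" for i
  proof (cases "E i = {}")
   case False
   note Ei = E_D[OF False]
   obtain u v where uv: "E i = cbox u v" using D(2)[OF Ei] by blast
   then obtain n where "\<And>j. j \<in> Basis \<Longrightarrow> v \<bullet> j - u \<bullet> j = ((k *\<^sub>R One) \<bullet> j - (- k *\<^sub>R One) \<bullet> j)/2^n"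
    using D(4)[of u v] Ei by auto
   then have vu: "v \<bullet> j = u \<bullet> j + 2 * k / 2 ^ n" if "j \<in> Basis" for j using that by (simp add: diff_eq_eq add.commute)
   \<comment> \<open>The boxes arise by repeatedly halving a cube, so all their sides are
     equal.\<close>
   define r where "r = 2 * k / 2 ^ n"
   have r: "r > 0" using k by (simp add: r_def)
   have v: "v = u + r *\<^sub>R One" by (rule euclidean_eqI) (simp add: vu r_def inner_add_left)
   have "emeasure lborel (box u v) = ennreal (\<Prod>j\<in>Basis. (v - u) \<bullet> j)"
    using r by (intro emeasure_lborel_box) (simp add: v inner_add_left)
   also have "(\<Prod>j\<in>Basis. (v - u) \<bullet> j) = r ^ DIM('a)" by (simp add: v)
   finally show ?thesis using cube[OF r, of u] c by (simp add: uv v[symmetric] ennreal_mult')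
  qed simp
  have "emeasure M A \<le> emeasure M (\<Union>i. E i)"
  proof (rule emeasure_mono)
   show "A \<subseteq> (\<Union>i. E i)" unfolding UE by (rule D(5))
   show "(\<Union>i. E i) \<in> sets M" unfolding sets using cubeE by (intro sets.countable_UN) auto
  qed
  also have "\<dots> \<le> (\<Sum>i. emeasure M (E i))" using cubeE sets by (intro emeasure_subadditive_countably) auto
  also have "\<dots> \<le> (\<Sum>i. ennreal c * emeasure lborel (interior (E i)))" using cubeE by (intro suminf_le) auto
  also have "\<dots> = ennreal c * (\<Sum>i. emeasure lborel (interior (E i)))" by simp
  also have "(\<Sum>i. emeasure lborel (interior (E i))) = emeasure lborel (\<Union>i. interior (E i))"
  proof (rule suminf_emeasure)
   show "disjoint_family (\<lambda>i. interior (E i))" unfolding disjoint_family_on_def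
   proof (intro ballI impI)
    fix i j :: nat assume ij: "i \<noteq> j"
    show "interior (E i) \<inter> interior (E j) = {}"
    proof (cases "E i = {} \<or> E j = {}")
     case False
     then have ne: "E i \<noteq> {}" "E j \<noteq> {}" by simp_all
     have "E i \<noteq> E j"
     proof
      assume "E i = E j"
      then have "i = j" using ne(1) by (rule E_inj)
      then show False using ij by simp
     qed
     then show ?thesis using pairwiseD[OF D(3) E_D[OF ne(1)] E_D[OF ne(2)]] by simp
    qed auto
   qed
  qed auto
  also have "\<dots> \<le> emeasure lebesgue (\<Union>\<D>)"
  proof -
   have "emeasure lborel (\<Union>i. interior (E i)) = emeasure lebesgue (\<Union>i. interior (E i))" by simp
   also have "\<dots> \<le> emeasure lebesgue (\<Union>\<D>)"
   proof (rule emeasure_mono)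
    have "(\<Union>i. interior (E i)) \<subseteq> (\<Union>i. E i)" by (intro UN_mono interior_subset order_refl)
    then show "(\<Union>i. interior (E i)) \<subseteq> \<Union>\<D>" unfolding UE .
    show "\<Union>\<D> \<in> sets lebesgue" using D(6) by (rule fmeasurableD)
   qed
   finally show ?thesis .
  qed
  also have "\<dots> \<le> emeasure lborel A + ennreal e'"
  proof -
   have "emeasure lebesgue (\<Union>\<D>) = ennreal (measure lebesgue (\<Union>\<D>))" using D(6) by (simp add: emeasure_eq_measure2)
   also have "\<dots> \<le> ennreal (measure lebesgue A + e')" using D(7) by (rule ennreal_leI)
   also have "\<dots> = emeasure lebesgue A + ennreal e'" using Al e' by (simp add: emeasure_eq_measure2)
   finally show ?thesis using A by simp
  qed
  finally have "emeasure M A \<le> ennreal c * (emeasure lborel A + ennreal e')" by (simp add: mult_left_mono)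
  also have "\<dots> = ennreal c * emeasure lborel A + ennreal (c * e')" using c by (simp add: distrib_left ennreal_mult')
  also have "\<dots> \<le> ennreal c * emeasure lborel A + ennreal e"
  proof (intro add_left_mono ennreal_leI)
   show "c * e' \<le> e" using c e by (simp add: e'_def field_simps)
  qed
  finally show "emeasure M A \<le> ennreal c * emeasure lborel A + ennreal e" .
 qed
 define Q where "Q k = cbox (- real (Suc k) *\<^sub>R One) (real (Suc k) *\<^sub>R (One::'a))" for k
 have inc: "incseq (\<lambda>k. A \<inter> Q k)" unfolding incseq_Suc_iff Q_def by (auto simp: mem_box) (force intro: order_trans)+
 have "x \<in> (\<Union>k. Q k)" for x
 proof -
  obtain k where k: "norm x \<le> real k" using real_arch_simple by blast
  have "x \<in> Q k" unfolding Q_def mem_box using k Basis_le_norm[of _ x] by (fastforce simp: abs_le_iff)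
  then show ?thesis by blast
 qed
 then have U: "(\<Union>k. A \<inter> Q k) = A" by blast
 have Qb: "Q k \<in> sets borel" for k by (simp add: Q_def)
 have "emeasure M A = (SUP k. emeasure M (A \<inter> Q k))"
 proof -
  have "range (\<lambda>k. A \<inter> Q k) \<subseteq> sets M" unfolding sets using A Qb by (intro image_subsetI sets.Int)
  from SUP_emeasure_incseq[OF this inc] show ?thesis unfolding U by (rule sym)
 qed
 also have "\<dots> \<le> ennreal c * emeasure lborel A"
 proof (rule SUP_least)
  fix k
  have "emeasure M (A \<inter> Q k) \<le> ennreal c * emeasure lborel (A \<inter> Q k)"
   by (rule bounded_case[of _ "real (Suc k)"]) (use A Qb in \<open>auto simp: Q_def\<close>)
  also have "\<dots> \<le> ennreal c * emeasure lborel A" using A by (intro mult_left_mono emeasure_mono) auto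
  finally show "emeasure M (A \<inter> Q k) \<le> ennreal c * emeasure lborel A" .
 qed
 finally show ?thesis .
qed

text \<open>It suffices to test cubes of side r, whose diameter is at most n r with n = DIM('a). By
  \<open>lip\<close> the shifts t that carry a point of \<open>P\<close> into the cube lie in an
  interval of length 2 L n r, and for each such t the points carried there lie in a ball of radius n
  r, of mass at most C (n r)^(n - 1). The product is the stated constant times r^n.\<close>

lemma shadow_leI:
 fixes N :: "'a::euclidean_space measure"
 assumes fin: "finite_measure N" and sets: "sets N = sets borel"
  and P: "P \<in> sets borel" "AE x in N. x \<in> P" and C: "C \<ge> 0" and L: "L \<ge> 0" and h: "h \<ge> 0"
  and ahl: "\<And>p r. r > 0 \<Longrightarrow> emeasure N (cball p r) \<le> ennreal (C * r ^ (DIM('a) - 1))"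
  and lip: "\<And>x y s t. x \<in> P \<Longrightarrow> y \<in> P \<Longrightarrow> \<bar>s - t\<bar> \<le> L * norm ((x + s *\<^sub>R d) - (y + t *\<^sub>R d))"
 shows "shadow_le N d h (2 * L * C * real (DIM('a)) ^ DIM('a))"
proof -
 interpret N: finite_measure N by fact
 define T where "T = density lborel (indicator {0..h})"
 have T: "finite_measure T" using h unfolding T_def by (intro finite_measureI) (simp add: emeasure_density)
 interpret T: finite_measure T by fact
 interpret NT: pair_sigma_finite N T by unfold_locales
 have [measurable_cong]: "sets N = sets borel" "sets T = sets borel" using sets by (auto simp: T_def)
 define \<mu> where "\<mu> = distr (N \<Otimes>\<^sub>M T) borel (\<lambda>(x, t). x + t *\<^sub>R d)"
 have map[measurable]: "(\<lambda>(x, t). x + t *\<^sub>R d) \<in> measurable (N \<Otimes>\<^sub>M T) borel" by measurable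
 let ?n = "real (DIM('a))"
 let ?c = "2 * L * C * ?n ^ DIM('a)"
 have c: "?c \<ge> 0" using L C by simp
 have int: "(\<integral>\<^sup>+y. f y \<partial>\<mu>) = (\<integral>\<^sup>+x. (\<integral>\<^sup>+t. indicator {0..h} t * f (x + t *\<^sub>R d) \<partial>lborel) \<partial>N)"
  if [measurable]: "f \<in> borel_measurable borel" for f
 proof -
  have "(\<integral>\<^sup>+y. f y \<partial>\<mu>) = (\<integral>\<^sup>+p. f (case p of (x, t) \<Rightarrow> x + t *\<^sub>R d) \<partial>(N \<Otimes>\<^sub>M T))"
   unfolding \<mu>_def by (rule nn_integral_distr) measurable
  also have "\<dots> = (\<integral>\<^sup>+x. \<integral>\<^sup>+t. f (x + t *\<^sub>R d) \<partial>T \<partial>N)" by (subst T.nn_integral_fst[symmetric]) auto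
  also have "\<dots> = (\<integral>\<^sup>+x. (\<integral>\<^sup>+t. indicator {0..h} t * f (x + t *\<^sub>R d) \<partial>lborel) \<partial>N)"
   unfolding T_def by (intro nn_integral_cong nn_integral_density) auto
  finally show ?thesis .
 qed
 have cube: "emeasure \<mu> (cbox p (p + r *\<^sub>R One)) \<le> ennreal (?c * r ^ DIM('a))" if r: "r > 0" for p r
 proof -
  define Q where "Q = cbox p (p + r *\<^sub>R (One::'a))"
  have Q[measurable]: "Q \<in> sets borel" by (simp add: Q_def)
  have Qd: "norm (x - y) \<le> ?n * r" if "x \<in> Q" "y \<in> Q" for x y
  proof -
   have "norm (x - y) \<le> (\<Sum>i\<in>Basis. \<bar>(x - y) \<bullet> i\<bar>)" by (rule norm_le_l1)
   also have "\<dots> \<le> (\<Sum>i\<in>(Basis::'a set). r)"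
   proof (rule sum_mono)
    fix i :: 'a assume i: "i \<in> Basis"
    have "p \<bullet> i \<le> x \<bullet> i" "x \<bullet> i \<le> p \<bullet> i + r" "p \<bullet> i \<le> y \<bullet> i" "y \<bullet> i \<le> p \<bullet> i + r"
     using that i by (auto simp: Q_def mem_box inner_add_left)
    then show "\<bar>(x - y) \<bullet> i\<bar> \<le> r" by (simp add: inner_diff_left abs_le_iff)
   qed
   finally show ?thesis by simp
  qed
  have pQ: "p \<in> Q" using r by (simp add: Q_def mem_box inner_add_left)
  let ?R = "?n * r"
  have R: "?R > 0" using r by simp
  define S where "S t = emeasure N {x \<in> P. x + t *\<^sub>R d \<in> Q}" for t
  have "emeasure \<mu> Q = (\<integral>\<^sup>+y. indicator Q y \<partial>\<mu>)" by (simp add: \<mu>_def)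
  also have "\<dots> = (\<integral>\<^sup>+p. indicator Q (case p of (x, t) \<Rightarrow> x + t *\<^sub>R d) \<partial>(N \<Otimes>\<^sub>M T))"
   unfolding \<mu>_def by (rule nn_integral_distr) measurable
  also have "\<dots> = (\<integral>\<^sup>+t. \<integral>\<^sup>+x. indicator Q (x + t *\<^sub>R d) \<partial>N \<partial>T)" by (subst NT.nn_integral_snd[symmetric]) auto
  also have "\<dots> = (\<integral>\<^sup>+t. S t \<partial>T)"
  proof (rule nn_integral_cong)
   fix t
   have Sm: "{x \<in> P. x + t *\<^sub>R d \<in> Q} \<in> sets N"
   proof -
    have "{x \<in> P. x + t *\<^sub>R d \<in> Q} = P \<inter> (\<lambda>x. x + t *\<^sub>R d) -` Q \<inter> space borel" by auto
    also have "\<dots> \<in> sets borel" using P(1) measurable_sets[of "\<lambda>x. x + t *\<^sub>R d" borel borel Q]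
     by (auto simp: Int_assoc)
    finally show ?thesis using sets by simp
   qed
   have "(\<integral>\<^sup>+x. indicator Q (x + t *\<^sub>R d) \<partial>N) = (\<integral>\<^sup>+x. indicator {x \<in> P. x + t *\<^sub>R d \<in> Q} x \<partial>N)"
    using P(2) by (intro nn_integral_cong_AE) (auto elim!: eventually_mono simp: indicator_def)
   then show "(\<integral>\<^sup>+x. indicator Q (x + t *\<^sub>R d) \<partial>N) = S t" using Sm by (simp add: S_def)
  qed
  also have "\<dots> \<le> ennreal (?c * r ^ DIM('a))"
  proof (cases "\<exists>t0. \<exists>x\<in>P. x + t0 *\<^sub>R d \<in> Q")
   case False
   then have "S t = 0" for t
   proof -
    have "{x \<in> P. x + t *\<^sub>R d \<in> Q} = {}" using False by blast
    then show ?thesis unfolding S_def by (simp only: emeasure_empty)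
   qed
   then show ?thesis by simp
  next
   case True
   then obtain t0 x0 where x0: "x0 \<in> P" "x0 + t0 *\<^sub>R d \<in> Q" by blast
   have S_le: "S t \<le> ennreal (C * ?R ^ (DIM('a) - 1)) * indicator {t0 - L * ?R..t0 + L * ?R} t" for t
   proof (cases "{x \<in> P. x + t *\<^sub>R d \<in> Q} = {}")
    case True
    show ?thesis unfolding S_def True by simp
   next
    case False
    then obtain x where x: "x \<in> P" "x + t *\<^sub>R d \<in> Q" by blast
    have "\<bar>t - t0\<bar> \<le> L * norm ((x + t *\<^sub>R d) - (x0 + t0 *\<^sub>R d))" by (rule lip[OF x(1) x0(1)])
    also have "\<dots> \<le> L * ?R" using L Qd[OF x(2) x0(2)] by (rule mult_left_mono[rotated])
    finally have "t \<in> {t0 - L * ?R..t0 + L * ?R}" by (auto simp: abs_le_iff)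
    moreover have "S t \<le> emeasure N (cball (p - t *\<^sub>R d) ?R)" unfolding S_def
    proof (rule emeasure_mono)
     show "{x \<in> P. x + t *\<^sub>R d \<in> Q} \<subseteq> cball (p - t *\<^sub>R d) ?R"
     proof
      fix y assume "y \<in> {x \<in> P. x + t *\<^sub>R d \<in> Q}"
      then have "norm (p - (y + t *\<^sub>R d)) \<le> ?R" using Qd[OF pQ] by blast
      then show "y \<in> cball (p - t *\<^sub>R d) ?R" by (simp add: dist_norm algebra_simps)
     qed
    qed (use sets in simp)
    ultimately show ?thesis using ahl[OF R, of "p - t *\<^sub>R d"] by (auto intro: order_trans)
   qed
   have "(\<integral>\<^sup>+t. S t \<partial>T) \<le> (\<integral>\<^sup>+t. ennreal (C * ?R ^ (DIM('a) - 1)) * indicator {t0 - L * ?R..t0 + L * ?R} t \<partial>T)"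
    by (intro nn_integral_mono S_le)
   also have "\<dots> = (\<integral>\<^sup>+t. indicator {0..h} t * (ennreal (C * ?R ^ (DIM('a) - 1)) * indicator {t0 - L * ?R..t0 + L * ?R} t) \<partial>lborel)"
    unfolding T_def by (intro nn_integral_density) auto
   also have "\<dots> \<le> (\<integral>\<^sup>+t. ennreal (C * ?R ^ (DIM('a) - 1)) * indicator {t0 - L * ?R..t0 + L * ?R} t \<partial>lborel)"
    by (intro nn_integral_mono) (auto simp: indicator_def)
   also have "\<dots> = ennreal (C * ?R ^ (DIM('a) - 1)) * emeasure lborel {t0 - L * ?R..t0 + L * ?R}"
    by (rule nn_integral_cmult_indicator) simp
   also have "\<dots> = ennreal (C * ?R ^ (DIM('a) - 1) * (2 * L * ?R))"
    using L R C by (simp add: ennreal_mult'[symmetric] ennreal_mult''[symmetric] mult_ac)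
   also have "C * ?R ^ (DIM('a) - 1) * (2 * L * ?R) = 2 * L * C * (?R ^ (DIM('a) - 1) * ?R)" by simp
   also have "?R ^ (DIM('a) - 1) * ?R = ?R ^ DIM('a)" by (metis DIM_positive power_minus_mult)
   also have "2 * L * C * ?R ^ DIM('a) = ?c * r ^ DIM('a)" by (simp add: power_mult_distrib)
   finally show ?thesis .
  qed
  finally show ?thesis by (simp add: Q_def)
 qed
 have "emeasure \<mu> A \<le> ennreal ?c * emeasure lborel A" if "A \<in> sets borel" for A
  by (rule emeasure_le_of_cubes[OF _ c cube that]) (simp add: \<mu>_def)
 then have "(\<integral>\<^sup>+y. f y \<partial>\<mu>) \<le> ennreal ?c * (\<integral>\<^sup>+y. f y \<partial>lborel)" if "f \<in> borel_measurable borel" for f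
  using that by (intro nn_integral_le_of_emeasure_le) (auto simp: \<mu>_def)
 then show ?thesis unfolding shadow_le_def using int by simp
qed

lemma square_le_two_squares:
 fixes a b :: real
 shows "a\<^sup>2 \<le> 2 * b\<^sup>2 + 2 * (b - a)\<^sup>2"
proof -
 have "0 \<le> (a - 2 * b)\<^sup>2" by simp
 then show ?thesis by (simp add: power2_eq_square algebra_simps)
qed

text \<open>The line inequality holds for almost every base point only once the displacement is
  fixed. Going back from x + t d by rational q < t uses countably many displacements;
  \<open>sh\<close> transfers their common Lebesgue null set to almost every pair (x, t); letting q
  increase to t reaches x itself by continuity of \<phi>.\<close>

lemma trace_along_segment:
 fixes d :: "'a::euclidean_space"
 assumes \<Omega>: "open \<Omega>" "bounded \<Omega>" and sob: "sob \<Omega> u G" and d: "norm d = 1"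
  and cont: "continuous_on (closure \<Omega>) \<phi>" and u: "\<And>x. x \<in> \<Omega> \<Longrightarrow> u x = \<phi> x"
  and h: "h > 0" and sh: "shadow_le N d h c"
  and sets: "sets N = sets borel"
  and P: "AE x in N. x \<in> P" and in\<Omega>: "\<And>x t. x \<in> P \<Longrightarrow> 0 < t \<Longrightarrow> t \<le> h \<Longrightarrow> x + t *\<^sub>R d \<in> \<Omega>"
 shows "AE x in N. AE t in lborel. 0 < t \<and> t \<le> h \<longrightarrow>
   ennreal ((u (x + t *\<^sub>R d) - \<phi> x)\<^sup>2) \<le> ennreal t * (\<integral>\<^sup>+s. indicator {0..t} s * ennreal ((norm (G (x + s *\<^sub>R d)))\<^sup>2) \<partial>lborel)"
proof -
 have [measurable]: "u \<in> borel_measurable borel" "G \<in> borel_measurable borel" using sob by (auto simp: sob_def)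
 define bad where "bad q y \<longleftrightarrow> (\<forall>s\<in>{0..1}. y + s *\<^sub>R (- q *\<^sub>R d) \<in> \<Omega>) \<and>
   \<not> ennreal ((u (y + - q *\<^sub>R d) - u y)\<^sup>2) \<le> (\<integral>\<^sup>+s. indicator {0..1} s * ennreal ((G (y + s *\<^sub>R (- q *\<^sub>R d)) \<bullet> (- q *\<^sub>R d))\<^sup>2) \<partial>lborel)" for q y
 have "AE y in lborel. \<forall>q\<in>\<rat>. \<not> bad q y"
 proof (subst AE_ball_countable)
  show "countable (\<rat> :: real set)" by (rule countable_rat)
  show "\<forall>q\<in>\<rat>. AE y in lborel. \<not> bad q y"
  proof
   fix q :: real
   show "AE y in lborel. \<not> bad q y"
    using sob_line_inequality[OF \<Omega> sob, of "- q *\<^sub>R d"] by eventually_elim (auto simp: bad_def)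
  qed
 qed
 then obtain E where E: "{y \<in> space lborel. \<not> (\<forall>q\<in>\<rat>. \<not> bad q y)} \<subseteq> E" "emeasure lborel E = 0" "E \<in> sets lborel"
  by (rule AE_E)
 have Eb[measurable]: "E \<in> sets borel" using E(3) by simp
 have "(\<integral>\<^sup>+x. (\<integral>\<^sup>+t. indicator {0..h} t * indicator E (x + t *\<^sub>R d) \<partial>lborel) \<partial>N) \<le> ennreal c * (\<integral>\<^sup>+x. indicator E x \<partial>lborel)"
  by (rule shadow_leD[OF sh]) auto
 also have "\<dots> = 0" using E by simp
 finally have "(\<integral>\<^sup>+x. (\<integral>\<^sup>+t. indicator {0..h} t * indicator E (x + t *\<^sub>R d) \<partial>lborel) \<partial>N) = 0" by simp
 moreover have [measurable_cong]: "sets N = sets borel" by fact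
 have "(\<lambda>x. \<integral>\<^sup>+t. indicator {0..h} t * indicator E (x + t *\<^sub>R d) \<partial>lborel) \<in> borel_measurable N" by measurable
 \<comment> \<open>The null set of bad end points is met by almost no shift t from N-almost every
   x.\<close>
 ultimately have "AE x in N. (\<integral>\<^sup>+t. indicator {0..h} t * indicator E (x + t *\<^sub>R d) \<partial>lborel) = 0"
  by (simp add: nn_integral_0_iff_AE)
 then show ?thesis using P
 proof eventually_elim
  case (elim x)
  have "(\<lambda>t. indicator {0..h} t * indicator E (x + t *\<^sub>R d) :: ennreal) \<in> borel_measurable lborel" by measurable
  then have "AE t in lborel. indicator {0..h} t * indicator E (x + t *\<^sub>R d) = (0::ennreal)"
   using elim(1) by (simp only: nn_integral_0_iff_AE)
  then show ?case
  proof eventually_elim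
   case (elim t)
   show ?case
   proof
    assume t: "0 < t \<and> t \<le> h"
    then have "x + t *\<^sub>R d \<notin> E" using elim by (auto simp: indicator_def split: if_splits)
    then have good: "\<not> bad q (x + t *\<^sub>R d)" if "q \<in> \<rat>" for q using E(1) that by auto
    let ?g = "\<lambda>s. ennreal ((norm (G (x + s *\<^sub>R d)))\<^sup>2)"
    let ?B = "ennreal t * (\<integral>\<^sup>+s. indicator {0..t} s * ?g s \<partial>lborel)"
    have le: "ennreal ((u (x + (t - q) *\<^sub>R d) - u (x + t *\<^sub>R d))\<^sup>2) \<le> ?B" if q: "q \<in> \<rat>" "0 < q" "q < t" for q
    proof -
     have eq: "(x + t *\<^sub>R d) + s *\<^sub>R (- q *\<^sub>R d) = x + (t - s * q) *\<^sub>R d" for s by (simp add: algebra_simps)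
     have "x + (t - s * q) *\<^sub>R d \<in> \<Omega>" if "s \<in> {0..1}" for s
     proof (rule in\<Omega>[OF \<open>x \<in> P\<close>])
      have "s * q \<le> 1 * q" using that q by (intro mult_right_mono) auto
      then show "0 < t - s * q" using q(3) by linarith
      have "0 \<le> s * q" using that q by simp
      then show "t - s * q \<le> h" using t by simp
     qed
     then have "ennreal ((u (x + (t - 1 * q) *\<^sub>R d) - u (x + t *\<^sub>R d))\<^sup>2) \<le>
       (\<integral>\<^sup>+s. indicator {0..1} s * ennreal ((G (x + (t - s * q) *\<^sub>R d) \<bullet> (- q *\<^sub>R d))\<^sup>2) \<partial>lborel)"
      using good[OF q(1)] unfolding bad_def eq using eq[of 1] by (simp add: algebra_simps)
     also have "\<dots> \<le> (\<integral>\<^sup>+s. ennreal (q\<^sup>2) * (indicator {0..t} (t + (- q) * s) * ?g (t + (- q) * s)) \<partial>lborel)"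
     proof (rule nn_integral_mono)
      fix s :: real
      have "\<bar>G (x + (t - s * q) *\<^sub>R d) \<bullet> d\<bar> \<le> norm (G (x + (t - s * q) *\<^sub>R d))"
       using Cauchy_Schwarz_ineq2[of "G (x + (t - s * q) *\<^sub>R d)" d] d by simp
      then have "(G (x + (t - s * q) *\<^sub>R d) \<bullet> d)\<^sup>2 \<le> (norm (G (x + (t - s * q) *\<^sub>R d)))\<^sup>2"
       by (simp add: abs_le_square_iff[symmetric])
      then have "(G (x + (t - s * q) *\<^sub>R d) \<bullet> (- q *\<^sub>R d))\<^sup>2 \<le> q\<^sup>2 * (norm (G (x + (t - s * q) *\<^sub>R d)))\<^sup>2"
       by (simp add: power_mult_distrib mult_left_mono)
      then have 1: "ennreal ((G (x + (t - s * q) *\<^sub>R d) \<bullet> (- q *\<^sub>R d))\<^sup>2) \<le> ennreal (q\<^sup>2) * ?g (t + (- q) * s)"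
       by (simp add: ennreal_mult'[symmetric] ennreal_leI mult.commute)
      have 2: "t + (- q) * s \<in> {0..t}" if "s \<in> {0..1}"
      proof -
       have "s * q \<le> 1 * q" "0 \<le> s * q" using that q by (auto intro!: mult_right_mono mult_nonneg_nonneg)
       then have "s * q \<le> t" "0 \<le> s * q" using q(3) by linarith+
       then show ?thesis by (simp add: mult.commute)
      qed
      show "indicator {0..1} s * ennreal ((G (x + (t - s * q) *\<^sub>R d) \<bullet> (- q *\<^sub>R d))\<^sup>2) \<le>
        ennreal (q\<^sup>2) * (indicator {0..t} (t + (- q) * s) * ?g (t + (- q) * s))"
       using 1 2 by (cases "s \<in> {0..1}") auto
     qed
     also have "\<dots> = ennreal (q\<^sup>2) * (\<integral>\<^sup>+s. indicator {0..t} (t + (- q) * s) * ?g (t + (- q) * s) \<partial>lborel)"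
      by (rule nn_integral_cmult) measurable
     also have "\<dots> = ennreal q * (\<integral>\<^sup>+s. indicator {0..t} s * ?g s \<partial>lborel)"
      using nn_integral_real_affine[of "\<lambda>s. indicator {0..t} s * ?g s" "- q" t] q
      by (simp add: power2_eq_square ennreal_mult' mult.assoc)
     also have "\<dots> \<le> ?B" using q by (intro mult_right_mono ennreal_leI) auto
     finally show ?thesis by simp
    qed
    have "\<exists>q\<in>\<rat>. max 0 (t - 1 / real (Suc k)) < q \<and> q < t" for k
     using Rats_dense_in_real[of "max 0 (t - 1 / real (Suc k))" t] t by auto
    then obtain q where q: "\<And>k. q k \<in> \<rat>" "\<And>k. max 0 (t - 1 / real (Suc k)) < q k" "\<And>k. q k < t" by metis
    have qt: "q \<longlonglongrightarrow> t"
    proof (rule tendsto_sandwich[of "\<lambda>k. t - 1 / real (Suc k)" _ _ "\<lambda>_. t"])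
     have "(\<lambda>k. t - 1 / real (Suc k)) \<longlonglongrightarrow> t - 0" by (intro tendsto_intros LIMSEQ_Suc[OF lim_const_over_n])
     then show "(\<lambda>k. t - 1 / real (Suc k)) \<longlonglongrightarrow> t" by simp
     show "\<forall>\<^sub>F k in sequentially. t - 1 / real (Suc k) \<le> q k"
      using q(2) by (intro always_eventually allI) (metis less_imp_le max_less_iff_conj)
     show "\<forall>\<^sub>F k in sequentially. q k \<le> t" using q(3) by (intro always_eventually allI less_imp_le)
    qed simp
    have q0: "q k > 0" for k using q(2)[of k] by simp
    have in1: "x + (t - q k) *\<^sub>R d \<in> \<Omega>" for k by (rule in\<Omega>[OF \<open>x \<in> P\<close>]) (use q(3)[of k] q0[of k] t in auto)
    have "(\<lambda>k. x + (t - q k) *\<^sub>R d) \<longlonglongrightarrow> x + (t - t) *\<^sub>R d" by (intro tendsto_intros qt)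
    then have lim: "(\<lambda>k. x + (t - q k) *\<^sub>R d) \<longlonglongrightarrow> x" by simp
    have xcl: "x \<in> closure \<Omega>"
     unfolding closure_sequential using in1 lim by (intro exI[of _ "\<lambda>k. x + (t - q k) *\<^sub>R d"] conjI allI)
    have "(\<lambda>k. \<phi> (x + (t - q k) *\<^sub>R d)) \<longlonglongrightarrow> \<phi> x" using subsetD[OF closure_subset in1]
     by (intro continuous_on_tendsto_compose[OF cont lim xcl] always_eventually allI)
    then have "(\<lambda>k. u (x + (t - q k) *\<^sub>R d)) \<longlonglongrightarrow> \<phi> x" using u[OF in1] by simp
    then have "(\<lambda>k. ennreal ((u (x + (t - q k) *\<^sub>R d) - u (x + t *\<^sub>R d))\<^sup>2)) \<longlonglongrightarrow> ennreal ((\<phi> x - u (x + t *\<^sub>R d))\<^sup>2)"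
     by (intro tendsto_intros tendsto_ennrealI)
    then have "ennreal ((\<phi> x - u (x + t *\<^sub>R d))\<^sup>2) \<le> ?B" by (rule LIMSEQ_le_const2) (use le[OF q(1) q0 q(3)] in blast)
    then show "ennreal ((u (x + t *\<^sub>R d) - \<phi> x)\<^sup>2) \<le> ?B" by (simp add: power2_commute)
   qed
  qed
 qed
qed

text \<open>The segment inequality is averaged over t between h/2 and h and integrated against
  \<open>N\<close>. Dropping the lower half keeps x + t d in \<open>K\<close>, away from the
  boundary. The factor 2 / h of the average turns 2 c into 4 c / h and h^2 c into 2 h c, so a small
  h makes the energy term small at the expense of the other.\<close>

lemma trace_inequality_direction:
 fixes d :: "'a::euclidean_space"
 assumes \<Omega>: "open \<Omega>" "bounded \<Omega>" and sob: "sob \<Omega> u G" and d: "norm d = 1"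
  and cont: "continuous_on (closure \<Omega>) \<phi>" and u: "\<And>x. x \<in> \<Omega> \<Longrightarrow> u x = \<phi> x"
  and h: "h > 0" and sh: "shadow_le N d h c" and c: "c \<ge> 0"
  and sets: "sets N = sets borel"
  and P: "AE x in N. x \<in> P" and in\<Omega>: "\<And>x t. x \<in> P \<Longrightarrow> 0 < t \<Longrightarrow> t \<le> h \<Longrightarrow> x + t *\<^sub>R d \<in> \<Omega>"
  and K: "K \<in> sets borel" "\<And>x t. x \<in> P \<Longrightarrow> h / 2 \<le> t \<Longrightarrow> t \<le> h \<Longrightarrow> x + t *\<^sub>R d \<in> K"
 shows "(\<integral>\<^sup>+x. ennreal ((\<phi> x)\<^sup>2) \<partial>N) \<le> ennreal (4 * c / h) * (\<integral>\<^sup>+x. ennreal ((u x)\<^sup>2) * indicator K x \<partial>lborel) +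
   ennreal (2 * h * c) * (\<integral>\<^sup>+x. ennreal ((norm (G x))\<^sup>2) \<partial>lborel)"
proof -
 have [measurable]: "u \<in> borel_measurable borel" "G \<in> borel_measurable borel" using sob by (auto simp: sob_def)
 note K(1)[measurable]
 have [measurable_cong]: "sets N = sets borel" by fact
 let ?g = "\<lambda>x. ennreal ((norm (G x))\<^sup>2)"
 let ?v = "\<lambda>x. ennreal ((u x)\<^sup>2) * indicator K x"
 let ?I = "\<lambda>x. \<integral>\<^sup>+s. indicator {0..h} s * ?g (x + s *\<^sub>R d) \<partial>lborel"
 let ?J = "\<lambda>x. \<integral>\<^sup>+s. indicator {0..h} s * ?v (x + s *\<^sub>R d) \<partial>lborel"
 have seg: "AE x in N. AE t in lborel. 0 < t \<and> t \<le> h \<longrightarrow>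
   ennreal ((u (x + t *\<^sub>R d) - \<phi> x)\<^sup>2) \<le> ennreal t * (\<integral>\<^sup>+s. indicator {0..t} s * ?g (x + s *\<^sub>R d) \<partial>lborel)"
  by (rule trace_along_segment[OF \<Omega> sob d cont _ h sh sets P]) (fact u, fact in\<Omega>)
 have pt: "AE x in N. ennreal (h / 2) * ennreal ((\<phi> x)\<^sup>2) \<le> 2 * ?J x + ennreal (h\<^sup>2) * ?I x" using seg P
 proof eventually_elim
  case (elim x)
  have "ennreal (h / 2) * ennreal ((\<phi> x)\<^sup>2) = (\<integral>\<^sup>+t. ennreal ((\<phi> x)\<^sup>2) * indicator {h/2..h} t \<partial>lborel)"
   using h by (subst nn_integral_cmult_indicator) (auto simp: mult.commute)
  also have "\<dots> \<le> (\<integral>\<^sup>+t. 2 * (indicator {0..h} t * ?v (x + t *\<^sub>R d)) + (ennreal (2 * h) * ?I x) * indicator {h/2..h} t \<partial>lborel)"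
  proof (rule nn_integral_mono_AE)
   show "AE t in lborel. ennreal ((\<phi> x)\<^sup>2) * indicator {h/2..h} t \<le>
     2 * (indicator {0..h} t * ?v (x + t *\<^sub>R d)) + (ennreal (2 * h) * ?I x) * indicator {h/2..h} t" using elim(1)
   proof eventually_elim
    case (elim t)
    show ?case
    proof (cases "t \<in> {h/2..h}")
     case True
     then have t: "0 < t" "t \<le> h" "h / 2 \<le> t" using h by auto
     have xK: "x + t *\<^sub>R d \<in> K" by (rule K(2)[OF \<open>x \<in> P\<close> t(3,2)])
     have "ennreal ((\<phi> x)\<^sup>2) \<le> ennreal (2 * (u (x + t *\<^sub>R d))\<^sup>2 + 2 * (u (x + t *\<^sub>R d) - \<phi> x)\<^sup>2)"
      by (intro ennreal_leI square_le_two_squares)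
     also have "\<dots> = 2 * ennreal ((u (x + t *\<^sub>R d))\<^sup>2) + 2 * ennreal ((u (x + t *\<^sub>R d) - \<phi> x)\<^sup>2)"
      by (simp add: ennreal_mult')
     also have "\<dots> \<le> 2 * ennreal ((u (x + t *\<^sub>R d))\<^sup>2) + 2 * (ennreal h * ?I x)"
     proof (intro add_left_mono mult_left_mono)
      have "ennreal ((u (x + t *\<^sub>R d) - \<phi> x)\<^sup>2) \<le> ennreal t * (\<integral>\<^sup>+s. indicator {0..t} s * ?g (x + s *\<^sub>R d) \<partial>lborel)"
       using elim t by simp
      also have "\<dots> \<le> ennreal h * ?I x"
       using t by (intro mult_mono ennreal_leI nn_integral_mono) (auto simp: indicator_def)
      finally show "ennreal ((u (x + t *\<^sub>R d) - \<phi> x)\<^sup>2) \<le> ennreal h * ?I x" .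
     qed simp
     also have "\<dots> = 2 * ennreal ((u (x + t *\<^sub>R d))\<^sup>2) + ennreal (2 * h) * ?I x"
      by (simp add: ennreal_mult' mult.assoc)
     finally show ?thesis using t xK by simp
    qed simp
   qed
  qed
  also have "\<dots> = 2 * ?J x + (ennreal (2 * h) * ?I x) * ennreal (h / 2)"
   using h by (simp add: nn_integral_add nn_integral_cmult nn_integral_cmult_indicator)
  also have "(ennreal (2 * h) * ?I x) * ennreal (h / 2) = (ennreal (2 * h) * ennreal (h / 2)) * ?I x"
   by (simp add: mult_ac)
  also have "ennreal (2 * h) * ennreal (h / 2) = ennreal (h\<^sup>2)"
   using h by (simp add: ennreal_mult'[symmetric] power2_eq_square)
  finally show ?case .
 qed
 have "ennreal (2 / h) * (ennreal (h / 2) * ennreal ((\<phi> x)\<^sup>2)) = ennreal ((\<phi> x)\<^sup>2)" for x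
  using h by (simp add: mult.assoc[symmetric] ennreal_mult'[symmetric])
 note h2 = this
 have "AE x in N. ennreal ((\<phi> x)\<^sup>2) \<le> ennreal (2 / h) * (2 * ?J x + ennreal (h\<^sup>2) * ?I x)" using pt
 proof eventually_elim
  case (elim x)
  show ?case using mult_left_mono[OF elim, of "ennreal (2 / h)"] unfolding h2 by simp
 qed
 then have "(\<integral>\<^sup>+x. ennreal ((\<phi> x)\<^sup>2) \<partial>N) \<le> (\<integral>\<^sup>+x. ennreal (2 / h) * (2 * ?J x + ennreal (h\<^sup>2) * ?I x) \<partial>N)"
  by (rule nn_integral_mono_AE)
 also have "\<dots> = ennreal (2 / h) * (2 * (\<integral>\<^sup>+x. ?J x \<partial>N) + ennreal (h\<^sup>2) * (\<integral>\<^sup>+x. ?I x \<partial>N))"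
  by (simp add: nn_integral_cmult nn_integral_add)
 also have "\<dots> \<le> ennreal (2 / h) * (2 * (ennreal c * (\<integral>\<^sup>+x. ?v x \<partial>lborel)) + ennreal (h\<^sup>2) * (ennreal c * (\<integral>\<^sup>+x. ?g x \<partial>lborel)))"
  by (intro mult_left_mono add_mono shadow_leD[OF sh]) auto
 also have "\<dots> = (ennreal (2 / h) * 2 * ennreal c) * (\<integral>\<^sup>+x. ?v x \<partial>lborel) + (ennreal (2 / h) * ennreal (h\<^sup>2) * ennreal c) * (\<integral>\<^sup>+x. ?g x \<partial>lborel)"
  by (simp add: distrib_left mult.assoc)
 also have "ennreal (2 / h) * 2 * ennreal c = ennreal (4 * c / h)"
 proof -
  have "ennreal (2 / h) * 2 * ennreal c = ennreal (2 / h) * ennreal 2 * ennreal c" by simp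
  also have "ennreal (2 / h) * ennreal 2 = ennreal (2 / h * 2)" by (rule ennreal_mult[symmetric]) (use h in auto)
  also have "ennreal (2 / h * 2) * ennreal c = ennreal (2 / h * 2 * c)"
   by (rule ennreal_mult[symmetric]) (use h c in auto)
  finally show ?thesis by (simp add: mult.commute)
 qed
 also have "ennreal (2 / h) * ennreal (h\<^sup>2) * ennreal c = ennreal (2 * h * c)"
  using h c by (simp add: ennreal_mult'[symmetric] ennreal_mult''[symmetric] power2_eq_square)
 finally show ?thesis .
qed

section \<open>Poincare inequality on small cubes\<close>

text \<open>Expanding the square, the double integral of (u y - u x)^2 over \<open>Q\<close> equals
  2 (q U2 - U1^2). With y = x + z and z fixed, segments stay in \<open>Q\<close> by convexity, so
  the integral over x is at most |z|^2 times the energy on \<open>Q\<close>; integrating over the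
  cube of possible z contributes its volume (2 r)^n.\<close>

lemma poincare_convex:
 fixes Q :: "'a::euclidean_space set"
 assumes \<Omega>: "open \<Omega>" "bounded \<Omega>" and sob: "sob \<Omega> u G"
  and Q: "Q \<in> sets borel" "convex Q" "Q \<subseteq> \<Omega>" and r: "r > 0"
  and small: "\<And>x y. x \<in> Q \<Longrightarrow> y \<in> Q \<Longrightarrow> y - x \<in> cbox (- r *\<^sub>R One) (r *\<^sub>R One)"
  and big: "measure lborel Q \<ge> m" "m > 0"
 shows "m * (LINT x|lborel. indicator Q x * (u x)\<^sup>2) \<le> (LINT x|lborel. indicator Q x * u x)\<^sup>2 +
   (2 * r) ^ DIM('a) * (real (DIM('a)) * r)\<^sup>2 * (LINT x|lborel. indicator Q x * (norm (G x))\<^sup>2)"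
proof -
 have [measurable]: "u \<in> borel_measurable borel" "G \<in> borel_measurable borel" using sob by (auto simp: sob_def)
 note Q(1)[measurable]
 have \<Omega>b: "\<Omega> \<in> sets borel" using \<Omega> by simp
 have u1: "integrable lborel u" by (rule sob_integrable[OF sob \<Omega>b \<Omega>(2)])
 have u2: "integrable lborel (\<lambda>x. (u x)\<^sup>2)" and g2: "integrable lborel (\<lambda>x. (norm (G x))\<^sup>2)"
  using sob by (auto simp: sob_def)
 have Qfin: "emeasure lborel Q < \<infinity>" using bounded_subset[OF \<Omega>(2) Q(3)] by (rule emeasure_bounded_finite)
 define q where "q = measure lborel Q"
 have q: "q > 0" using big by (simp add: q_def)
 have i0: "integrable lborel (indicator Q :: 'a \<Rightarrow> real)" using Qfin Q(1) by (simp add: integrable_indicator_iff)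
 have i1: "integrable lborel (\<lambda>x. indicator Q x * u x)" using u1 integrable_mult_indicator[of Q lborel u] by simp
 have i2: "integrable lborel (\<lambda>x. indicator Q x * (u x)\<^sup>2)"
  using u2 integrable_mult_indicator[of Q lborel "\<lambda>x. (u x)\<^sup>2"] by simp
 have ig: "integrable lborel (\<lambda>x. indicator Q x * (norm (G x))\<^sup>2)"
  using g2 integrable_mult_indicator[of Q lborel "\<lambda>x. (norm (G x))\<^sup>2"] by simp
 define U1 where "U1 = (LINT x|lborel. indicator Q x * u x)"
 define U2 where "U2 = (LINT x|lborel. indicator Q x * (u x)\<^sup>2)"
 define GG where "GG = (LINT x|lborel. indicator Q x * (norm (G x))\<^sup>2)"
 have GG0: "GG \<ge> 0" unfolding GG_def by (intro LINT_nonneg) auto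
 let ?Z = "cbox (- r *\<^sub>R One) (r *\<^sub>R One) :: 'a set"
 let ?R = "real (DIM('a)) * r"
 let ?J = "\<lambda>x. LINT y|lborel. indicator Q y * (u y - u x)\<^sup>2"
 let ?q = "\<lambda>z x. indicator Q x * (indicator Q (z + x) * ennreal ((u (z + x) - u x)\<^sup>2))"
 let ?h = "\<lambda>z x s. ennreal (?R\<^sup>2) * (indicator Q (x + s *\<^sub>R z) * ennreal ((norm (G (x + s *\<^sub>R z)))\<^sup>2))"
 have sq: "(\<lambda>y. indicator Q y * (u y - u x)\<^sup>2) = (\<lambda>y. indicator Q y * (u y)\<^sup>2 - 2 * u x * (indicator Q y * u y) + (u x)\<^sup>2 * indicator Q y)" for x
  by (auto simp: power2_eq_square algebra_simps)
 have inner: "(?J x) = U2 - 2 * u x * U1 + (u x)\<^sup>2 * q" for x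
  using i0 i1 i2 Qfin Q(1) by (simp add: sq U1_def U2_def q_def)
 have inner_int: "integrable lborel (\<lambda>y. indicator Q y * (u y - u x)\<^sup>2)" for x using i0 i1 i2 by (simp add: sq)
 have outer_eq: "(\<lambda>x. indicator Q x * (?J x)) =
   (\<lambda>x. U2 * indicator Q x - 2 * U1 * (indicator Q x * u x) + q * (indicator Q x * (u x)\<^sup>2))"
  unfolding inner by (auto simp: algebra_simps)
 have outer_int: "integrable lborel (\<lambda>x. indicator Q x * (?J x))" unfolding outer_eq using i0 i1 i2 by simp
 have outer: "(LINT x|lborel. indicator Q x * (?J x)) = 2 * (q * U2 - U1\<^sup>2)"
 proof -
  have "(LINT x|lborel. U2 * indicator Q x - 2 * U1 * (indicator Q x * u x) + q * (indicator Q x * (u x)\<^sup>2))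
    = U2 * q - 2 * U1 * U1 + q * U2"
   using i0 i1 i2 Qfin Q(1) by (simp add: U1_def[symmetric] U2_def[symmetric] q_def[symmetric])
  then show ?thesis unfolding outer_eq by (simp add: power2_eq_square algebra_simps)
 qed
 have "ennreal (2 * (q * U2 - U1\<^sup>2)) = (\<integral>\<^sup>+x. ennreal (indicator Q x * (?J x)) \<partial>lborel)"
  unfolding outer[symmetric] using outer_int by (intro nn_integral_eq_integral[symmetric]) (auto intro!: LINT_nonneg)
 also have "\<dots> = (\<integral>\<^sup>+x. indicator Q x * (\<integral>\<^sup>+y. indicator Q y * ennreal ((u y - u x)\<^sup>2) \<partial>lborel) \<partial>lborel)"
 proof (rule nn_integral_cong)
  fix x
  have "ennreal (?J x) = (\<integral>\<^sup>+y. ennreal (indicator Q y * (u y - u x)\<^sup>2) \<partial>lborel)"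
   using inner_int by (intro nn_integral_eq_integral[symmetric]) auto
  also have "\<dots> = (\<integral>\<^sup>+y. indicator Q y * ennreal ((u y - u x)\<^sup>2) \<partial>lborel)"
   by (intro nn_integral_cong) (auto simp: indicator_def)
  finally show "ennreal (indicator Q x * (?J x)) = indicator Q x * (\<integral>\<^sup>+y. indicator Q y * ennreal ((u y - u x)\<^sup>2) \<partial>lborel)"
   by (auto simp: indicator_def)
 qed
 also have "\<dots> = (\<integral>\<^sup>+x. indicator Q x * (\<integral>\<^sup>+z. indicator Q (z + x) * ennreal ((u (z + x) - u x)\<^sup>2) \<partial>lborel) \<partial>lborel)"
  by (intro nn_integral_cong arg_cong2[of _ _ _ _ "(*)"] refl nn_integral_lborel_translate[symmetric]) measurable
 also have "\<dots> = (\<integral>\<^sup>+x. \<integral>\<^sup>+z. ?q z x \<partial>lborel \<partial>lborel)"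
  by (intro nn_integral_cong nn_integral_cmult[symmetric]) measurable
 also have "\<dots> = (\<integral>\<^sup>+z. \<integral>\<^sup>+x. ?q z x \<partial>lborel \<partial>lborel)" by (rule lborel_pair.Fubini') measurable
 also have "\<dots> \<le> (\<integral>\<^sup>+z. ennreal (?R\<^sup>2 * GG) * indicator ?Z z \<partial>lborel)"
 proof (rule nn_integral_mono)
  fix z :: 'a
  show "(\<integral>\<^sup>+x. ?q z x \<partial>lborel) \<le> ennreal (?R\<^sup>2 * GG) * indicator ?Z z"
  proof (cases "z \<in> ?Z")
   case False
   have "?q z x = 0" for x using small[of x "z + x"] False by (auto simp: indicator_def)
   then show ?thesis by (simp only: nn_integral_const) simp
  next
   case True
   have "norm z \<le> (\<Sum>i\<in>Basis. \<bar>z \<bullet> i\<bar>)" by (rule norm_le_l1)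
   also have "\<dots> \<le> (\<Sum>i\<in>(Basis::'a set). r)" using True by (intro sum_mono) (auto simp: mem_box abs_le_iff)
   finally have nz: "norm z \<le> ?R" by simp
   have "(\<integral>\<^sup>+x. ?q z x \<partial>lborel) \<le>
     (\<integral>\<^sup>+x. \<integral>\<^sup>+s. indicator {0..1} s * ?h z x s \<partial>lborel \<partial>lborel)"
   proof (rule nn_integral_mono_AE)
    show "AE x in lborel. ?q z x \<le>
     (\<integral>\<^sup>+s. indicator {0..1} s * ?h z x s \<partial>lborel)" using sob_line_inequality[OF \<Omega> sob, of z]
    proof eventually_elim
     case (elim x)
     show ?case
     proof (cases "x \<in> Q \<and> z + x \<in> Q")
      case True
      have seg: "x + s *\<^sub>R z \<in> Q" if "s \<in> {0..1}" for s
      proof -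
       have "(1 - s) *\<^sub>R x + s *\<^sub>R (z + x) \<in> Q" using True that by (intro convexD[OF Q(2)]) auto
       then show ?thesis by (simp add: algebra_simps)
      qed
      then have "ennreal ((u (x + z) - u x)\<^sup>2) \<le> (\<integral>\<^sup>+s. indicator {0..1} s * ennreal ((G (x + s *\<^sub>R z) \<bullet> z)\<^sup>2) \<partial>lborel)"
       using elim Q(3) by blast
      also have "\<dots> \<le> (\<integral>\<^sup>+s. indicator {0..1} s * ?h z x s \<partial>lborel)"
      proof (rule nn_integral_mono)
       fix s :: real
       have "\<bar>G (x + s *\<^sub>R z) \<bullet> z\<bar> \<le> norm (G (x + s *\<^sub>R z)) * norm z" by (rule Cauchy_Schwarz_ineq2)
       also have "\<dots> \<le> norm (G (x + s *\<^sub>R z)) * ?R" using nz by (intro mult_left_mono) auto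
       finally have "(G (x + s *\<^sub>R z) \<bullet> z)\<^sup>2 \<le> ?R\<^sup>2 * (norm (G (x + s *\<^sub>R z)))\<^sup>2"
        using power_mono[of "\<bar>G (x + s *\<^sub>R z) \<bullet> z\<bar>" _ 2] by (fastforce simp: power_mult_distrib mult.commute)
       then show "indicator {0..1} s * ennreal ((G (x + s *\<^sub>R z) \<bullet> z)\<^sup>2) \<le>
         indicator {0..1} s * ?h z x s"
        using seg[of s] by (auto simp: indicator_def ennreal_mult'[symmetric] intro!: ennreal_leI)
      qed
      finally show ?thesis using True by (simp add: add.commute)
     qed auto
    qed
   qed
   also have "\<dots> = (\<integral>\<^sup>+s. \<integral>\<^sup>+x. indicator {0..1} s * ?h z x s \<partial>lborel \<partial>lborel)"
    by (rule lborel_pair.Fubini'[symmetric]) measurable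
   also have "\<dots> = (\<integral>\<^sup>+s. indicator {0..1::real} s * (ennreal (?R\<^sup>2) * ennreal GG) \<partial>lborel)"
   proof (rule nn_integral_cong)
    fix s :: real
    have "(\<integral>\<^sup>+x. indicator Q (x + s *\<^sub>R z) * ennreal ((norm (G (x + s *\<^sub>R z)))\<^sup>2) \<partial>lborel) =
      (\<integral>\<^sup>+x. indicator Q x * ennreal ((norm (G x))\<^sup>2) \<partial>lborel)"
     by (rule nn_integral_lborel_translate[of "\<lambda>x. indicator Q x * ennreal ((norm (G x))\<^sup>2)"]) measurable
    also have "\<dots> = (\<integral>\<^sup>+x. ennreal (indicator Q x * (norm (G x))\<^sup>2) \<partial>lborel)"
     by (intro nn_integral_cong) (auto simp: indicator_def)
    also have "\<dots> = ennreal GG" unfolding GG_def using ig by (intro nn_integral_eq_integral) auto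
    finally show "(\<integral>\<^sup>+x. indicator {0..1} s * ?h z x s \<partial>lborel)
      = indicator {0..1::real} s * (ennreal (?R\<^sup>2) * ennreal GG)" by (simp add: nn_integral_cmult)
   qed
   also have "\<dots> = ennreal (?R\<^sup>2 * GG)" using GG0 by (simp add: nn_integral_multc ennreal_mult')
   finally show ?thesis using True by simp
  qed
 qed
 also have "\<dots> = ennreal (?R\<^sup>2 * GG) * emeasure lborel ?Z" by (rule nn_integral_cmult_indicator) simp
 also have "emeasure lborel ?Z = ennreal ((2 * r) ^ DIM('a))"
 proof -
  have "(\<Prod>i\<in>(Basis::'a set). (r *\<^sub>R One - (- r) *\<^sub>R One) \<bullet> i) = (\<Prod>i\<in>(Basis::'a set). 2 * r)"
   by (intro prod.cong refl) (simp add: inner_diff_left inner_add_left)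
  moreover have "emeasure lborel ?Z = ennreal (\<Prod>i\<in>(Basis::'a set). (r *\<^sub>R One - (- r) *\<^sub>R One) \<bullet> i)"
   using r by (intro emeasure_lborel_cbox) simp
  ultimately show ?thesis by simp
 qed
 finally have "ennreal (2 * (q * U2 - U1\<^sup>2)) \<le> ennreal (?R\<^sup>2 * GG * (2 * r) ^ DIM('a))"
  using GG0 r by (simp add: ennreal_mult'[symmetric] ennreal_mult''[symmetric])
 then have "2 * (q * U2 - U1\<^sup>2) \<le> ?R\<^sup>2 * GG * (2 * r) ^ DIM('a)" using GG0 r by (subst (asm) ennreal_le_iff) auto
 moreover have "0 \<le> ?R\<^sup>2 * GG * (2 * r) ^ DIM('a)" using GG0 r by simp
 \<comment> \<open>The factor 2 is given away.\<close>
 moreover have "2 * (a - b) \<le> X \<Longrightarrow> 0 \<le> X \<Longrightarrow> a \<le> b + X" for a b X :: real by simp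
 ultimately have "q * U2 \<le> U1\<^sup>2 + ?R\<^sup>2 * GG * (2 * r) ^ DIM('a)" by blast
 moreover have "m * U2 \<le> q * U2" using big by (intro mult_right_mono) (auto simp: q_def U2_def intro!: LINT_nonneg)
 ultimately show ?thesis by (simp add: U1_def U2_def GG_def mult_ac)
qed

text \<open>Grid cubes that meet the compact set \<open>K\<close> are finitely many and stay in
  \<Omega> when the mesh is fine; the Poincare inequality on each leaves one average, with factor 1
  / r^n.\<close>

lemma local_L2_by_averages:
 fixes \<Omega> :: "'a::euclidean_space set"
 assumes \<Omega>: "open \<Omega>" "bounded \<Omega>" and K: "compact K" "K \<subseteq> \<Omega>" and \<epsilon>: "\<epsilon> > 0"
 shows "\<exists>(n::nat) Q D. (\<forall>i<n. Q i \<in> sets borel \<and> Q i \<subseteq> \<Omega>) \<and> D \<ge> 0 \<and>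
   (\<forall>u G. sob \<Omega> u G \<longrightarrow> (LINT x|lborel. indicator K x * (u x)\<^sup>2) \<le>
    \<epsilon> * (LINT x|lborel. (norm (G x))\<^sup>2) + D * (\<Sum>i<n. (LINT x|lborel. indicator (Q i) x * u x)\<^sup>2))"
proof -
 let ?n = "real (DIM('a))"
 obtain \<delta> where \<delta>: "\<delta> > 0" "(\<Union>x\<in>K. ball x \<delta>) \<subseteq> \<Omega>"
  using compact_subset_open_imp_ball_epsilon_subset[OF K(1) \<Omega>(1) K(2)] by metis
 \<comment> \<open>The first bound keeps a cube that meets \<open>K\<close> within distance \<delta>
   of it, the second makes the Poincare constant \<open>2^n (n r)^2\<close> at most
   \<epsilon>.\<close>
 define r where "r = min (\<delta> / (2 * ?n)) (sqrt (\<epsilon> / (2 ^ DIM('a) * ?n\<^sup>2)))"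
 have n0: "?n > 0" by simp
 have r: "r > 0" using \<delta> \<epsilon> by (simp add: r_def)
 have rd: "?n * r < \<delta>"
 proof -
  have "?n * r \<le> ?n * (\<delta> / (2 * ?n))" by (intro mult_left_mono) (auto simp: r_def)
  then show ?thesis using \<delta> by simp
 qed
 have re: "2 ^ DIM('a) * (?n * r)\<^sup>2 \<le> \<epsilon>"
 proof -
  have "r\<^sup>2 \<le> (sqrt (\<epsilon> / (2 ^ DIM('a) * ?n\<^sup>2)))\<^sup>2" using r by (intro power_mono) (auto simp: r_def)
  also have "\<dots> = \<epsilon> / (2 ^ DIM('a) * ?n\<^sup>2)" using \<epsilon> by simp
  finally show ?thesis by (simp add: field_simps power_mult_distrib)
 qed
 \<comment> \<open>Half-open cubes partition the space, so their indicators sum to at most 1 and no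
   energy is counted twice.\<close>
 define C where "C k = {y::'a. \<forall>i\<in>Basis. real_of_int (k i) * r \<le> y \<bullet> i \<and> y \<bullet> i < (real_of_int (k i) + 1) * r}" for k :: "'a \<Rightarrow> int"
 define z where "z x = restrict (\<lambda>i. \<lfloor>x \<bullet> i / r\<rfloor>) Basis" for x :: 'a
 have C_iff: "y \<in> C k \<longleftrightarrow> (\<forall>i\<in>Basis. k i = \<lfloor>y \<bullet> i / r\<rfloor>)" for y k
  by (simp add: C_def eq_commute[of "k _"] floor_eq_iff pos_le_divide_eq[OF r] pos_divide_less_eq[OF r])
 have zC: "x \<in> C (z x)" for x by (simp add: C_iff z_def)
 have "bounded K" using K(1) by (rule compact_imp_bounded)
 then obtain R where R: "\<And>x. x \<in> K \<Longrightarrow> norm x \<le> R" by (auto simp: bounded_iff)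
 have "z ` K \<subseteq> PiE Basis (\<lambda>_. {\<lfloor>- R / r\<rfloor>..\<lfloor>R / r\<rfloor>})"
 proof
  fix k assume "k \<in> z ` K"
  then obtain x where x: "x \<in> K" "k = z x" by blast
  have "\<lfloor>x \<bullet> i / r\<rfloor> \<in> {\<lfloor>- R / r\<rfloor>..\<lfloor>R / r\<rfloor>}" if "i \<in> Basis" for i
  proof -
   have "\<bar>x \<bullet> i\<bar> \<le> R" using Basis_le_norm[OF that, of x] R[OF x(1)] by linarith
   then have "- R / r \<le> x \<bullet> i / r" "x \<bullet> i / r \<le> R / r"
    using r by (auto intro!: divide_right_mono simp del: divide_minus_left)
   then show ?thesis by (simp only: atLeastAtMost_iff floor_mono)
  qed
  then show "k \<in> PiE Basis (\<lambda>_. {\<lfloor>- R / r\<rfloor>..\<lfloor>R / r\<rfloor>})" unfolding x(2) z_def by auto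
 qed
 then have finz: "finite (z ` K)" by (rule finite_subset) (intro finite_PiE finite_Basis finite_atLeastAtMost_int)
 define n where "n = card (z ` K)"
 obtain h where h: "bij_betw h {..<n} (z ` K)"
  using ex_bij_betw_nat_finite[OF finz] by (auto simp: atLeast0LessThan n_def)
 have hK: "h i \<in> z ` K" if "i < n" for i using h that by (auto simp: bij_betw_def)
 define Q where "Q i = C (h i)" for i
 have Cb: "C k \<in> sets borel" for k
 proof -
  have "C k = (\<Inter>i\<in>Basis. {y. real_of_int (k i) * r \<le> y \<bullet> i} \<inter> {y. y \<bullet> i < (real_of_int (k i) + 1) * r})"
   by (auto simp: C_def)
  also have "\<dots> \<in> sets borel"
   by (intro sets.finite_INT sets.Int borel_closed borel_open closed_Collect_le open_Collect_less continuous_intros) auto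
  finally show ?thesis .
 qed
 have Cconv: "convex (C k)" for k
 proof -
  have "C k = (\<Inter>i\<in>Basis. {y. i \<bullet> y \<ge> real_of_int (k i) * r} \<inter> {y. i \<bullet> y < (real_of_int (k i) + 1) * r})"
   by (auto simp: C_def inner_commute)
  also have "convex \<dots>" by (intro convex_INT convex_Int convex_halfspace_ge convex_halfspace_lt)
  finally show ?thesis .
 qed
 have Cdiff: "\<bar>(y - x) \<bullet> i\<bar> \<le> r" if "x \<in> C k" "y \<in> C k" "i \<in> Basis" for x y k i
 proof -
  have "real_of_int (k i) * r \<le> x \<bullet> i" "x \<bullet> i < (real_of_int (k i) + 1) * r"
   "real_of_int (k i) * r \<le> y \<bullet> i" "y \<bullet> i < (real_of_int (k i) + 1) * r" using that by (auto simp: C_def)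
  then show ?thesis by (simp add: inner_diff_left algebra_simps abs_le_iff)
 qed
 have Csub: "C (z x) \<subseteq> \<Omega>" if x: "x \<in> K" for x
 proof
  fix y assume y: "y \<in> C (z x)"
  have "norm (y - x) \<le> (\<Sum>i\<in>Basis. \<bar>(y - x) \<bullet> i\<bar>)" by (rule norm_le_l1)
  also have "\<dots> \<le> (\<Sum>i\<in>(Basis::'a set). r)" using Cdiff[OF zC y] by (intro sum_mono) auto
  also have "\<dots> < \<delta>" using rd by simp
  finally have "y \<in> ball x \<delta>" by (simp add: dist_norm norm_minus_commute)
  then show "y \<in> \<Omega>" using \<delta>(2) x by blast
 qed
 have Qsub: "Q i \<subseteq> \<Omega>" if i: "i < n" for i
 proof -
  obtain x where x: "x \<in> K" "h i = z x" using hK[OF i] by blast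
  show ?thesis unfolding Q_def x(2) by (rule Csub[OF x(1)])
 qed
 have Qb: "Q i \<in> sets borel" for i by (simp add: Q_def Cb)
 have KQ: "K \<subseteq> (\<Union>i<n. Q i)"
 proof
  fix x assume "x \<in> K"
  then have "z x \<in> h ` {..<n}" using h by (simp add: bij_betw_def)
  then obtain i where "i < n" "z x = h i" by auto
  then show "x \<in> (\<Union>i<n. Q i)" using zC[of x] by (auto simp: Q_def)
 qed
 have disj: "i = j" if "y \<in> Q i" "y \<in> Q j" "i < n" "j < n" for i j y
 proof -
  have e: "h i \<in> extensional Basis" "h j \<in> extensional Basis"
   using hK[OF that(3)] hK[OF that(4)] by (auto simp: z_def)
  have "h i = h j" by (rule extensionalityI[OF e]) (use that in \<open>simp add: Q_def C_iff\<close>)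
  then show ?thesis using h that by (auto simp: bij_betw_def inj_on_def)
 qed
 have sum1: "(\<Sum>i<n. indicator (Q i) y :: real) \<le> 1" for y
 proof -
  let ?S = "{i \<in> {..<n}. y \<in> Q i}"
  have "(\<Sum>i<n. indicator (Q i) y :: real) = (\<Sum>i\<in>?S. 1)" by (rule sum.mono_neutral_cong_right) auto
  moreover have "card ?S \<le> Suc 0"
  proof (subst card_le_Suc0_iff_eq)
   show "\<forall>i\<in>?S. \<forall>j\<in>?S. i = j"
   proof (intro ballI)
    fix i j assume "i \<in> ?S" "j \<in> ?S"
    then show "i = j" by (intro disj[of y i j]) simp_all
   qed
  qed simp
  ultimately show ?thesis by simp
 qed
 have big: "measure lborel (C k) \<ge> r ^ DIM('a)" for k
 proof -
  let ?a = "\<Sum>i\<in>Basis. (real_of_int (k i) * r) *\<^sub>R i" and ?b = "\<Sum>i\<in>Basis. ((real_of_int (k i) + 1) * r) *\<^sub>R i :: 'a"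
  have sub: "box ?a ?b \<subseteq> C k" by (auto simp: C_def mem_box less_imp_le)
  have "C k \<subseteq> cbox ?a ?b" by (auto simp: C_def mem_box less_imp_le)
  then have "emeasure lborel (C k) < \<infinity>" by (intro emeasure_bounded_finite bounded_subset[OF bounded_cbox])
  then have fm: "C k \<in> fmeasurable lborel" using Cb by (intro fmeasurableI) auto
  have "r ^ DIM('a) = (\<Prod>i\<in>(Basis::'a set). r)" by simp
  also have "\<dots> = (\<Prod>i\<in>Basis. (?b - ?a) \<bullet> i)"
  proof (rule prod.cong[OF refl])
   fix i :: 'a assume i: "i \<in> Basis"
   have "?a \<bullet> i = real_of_int (k i) * r" "?b \<bullet> i = (real_of_int (k i) + 1) * r" using i by simp_all
   then show "r = (?b - ?a) \<bullet> i" by (simp only: inner_diff_left) (simp add: algebra_simps)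
  qed
  also have "\<dots> = measure lborel (box ?a ?b)"
  proof (rule measure_lborel_box[symmetric])
   fix i :: 'a assume i: "i \<in> Basis"
   have "?a \<bullet> i = real_of_int (k i) * r" "?b \<bullet> i = (real_of_int (k i) + 1) * r" using i by simp_all
   then show "?a \<bullet> i \<le> ?b \<bullet> i" using r by (simp only:) (simp add: algebra_simps)
  qed
  also have "\<dots> \<le> measure lborel (C k)" using sub fm by (intro measure_mono_fmeasurable) auto
  finally show ?thesis .
 qed
 have "(LINT x|lborel. indicator K x * (u x)\<^sup>2) \<le>
    \<epsilon> * (LINT x|lborel. (norm (G x))\<^sup>2) + (1 / r ^ DIM('a)) * (\<Sum>i<n. (LINT x|lborel. indicator (Q i) x * u x)\<^sup>2)"
  if sob: "sob \<Omega> u G" for u G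
 proof -
  let ?g = "\<lambda>i. LINT x|lborel. indicator (Q i) x * (norm (G x))\<^sup>2" and ?u = "\<lambda>i. LINT x|lborel. indicator (Q i) x * u x"
  have u2: "integrable lborel (\<lambda>x. (u x)\<^sup>2)" and g2: "integrable lborel (\<lambda>x. (norm (G x))\<^sup>2)"
   using sob by (auto simp: sob_def)
  have ind: "integrable lborel (\<lambda>x. indicator S x * f x)" if "S \<in> sets borel" "integrable lborel f" for S and f :: "'a \<Rightarrow> real"
   using integrable_mult_indicator[of S lborel f] that by simp
  have Kb: "K \<in> sets borel" using K(1) by (simp add: borel_compact)
  have cube: "(LINT x|lborel. indicator (Q i) x * (u x)\<^sup>2) \<le> (1 / r ^ DIM('a)) * (?u i)\<^sup>2
    + \<epsilon> * ?g i" if i: "i < n" for i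
  proof -
   have g0: "0 \<le> ?g i" by (intro LINT_nonneg) auto
   have "r ^ DIM('a) * (LINT x|lborel. indicator (Q i) x * (u x)\<^sup>2) \<le> (?u i)\<^sup>2 +
     (2 * r) ^ DIM('a) * (?n * r)\<^sup>2 * ?g i"
   proof (rule poincare_convex[OF \<Omega> sob Qb _ Qsub[OF i] r])
    show "convex (Q i)" by (simp add: Q_def Cconv)
    show "y - x \<in> cbox (- r *\<^sub>R One) (r *\<^sub>R One)" if "x \<in> Q i" "y \<in> Q i" for x y
    proof -
     have "- r \<le> (y - x) \<bullet> j \<and> (y - x) \<bullet> j \<le> r" if "j \<in> Basis" for j
      using Cdiff[of x "h i" y j] \<open>x \<in> Q i\<close> \<open>y \<in> Q i\<close> that unfolding Q_def by linarith
     then show ?thesis by (simp add: mem_box)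
    qed
    show "r ^ DIM('a) \<le> measure lborel (Q i)" by (simp add: Q_def big)
    show "0 < r ^ DIM('a)" using r by simp
   qed
   also have "(2 * r) ^ DIM('a) * (?n * r)\<^sup>2 = r ^ DIM('a) * (2 ^ DIM('a) * (?n * r)\<^sup>2)" by (simp add: power_mult_distrib)
   also have "\<dots> * ?g i \<le> r ^ DIM('a) * \<epsilon> * ?g i" using r re by (intro mult_right_mono mult_left_mono g0) auto
   finally show ?thesis using r by (simp add: field_simps)
  qed
  have "(LINT x|lborel. indicator K x * (u x)\<^sup>2) \<le> (LINT x|lborel. (\<Sum>i<n. indicator (Q i) x * (u x)\<^sup>2))"
  proof (rule integral_mono)
   show "integrable lborel (\<lambda>x. indicator K x * (u x)\<^sup>2)" by (rule ind[OF Kb u2])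
   show "integrable lborel (\<lambda>x. \<Sum>i<n. indicator (Q i) x * (u x)\<^sup>2)"
    by (intro Bochner_Integration.integrable_sum ind Qb u2)
   fix x
   show "indicator K x * (u x)\<^sup>2 \<le> (\<Sum>i<n. indicator (Q i) x * (u x)\<^sup>2)"
   proof (cases "x \<in> K")
    case True
    from subsetD[OF KQ this] obtain i where i: "i < n" "x \<in> Q i" by (elim UN_E) simp
    have "(u x)\<^sup>2 = indicator (Q i) x * (u x)\<^sup>2" using i by simp
    also have "\<dots> \<le> (\<Sum>i<n. indicator (Q i) x * (u x)\<^sup>2)" using i by (intro member_le_sum) auto
    finally show ?thesis using True by simp
   qed (simp add: sum_nonneg)
  qed
  also have "\<dots> = (\<Sum>i<n. LINT x|lborel. indicator (Q i) x * (u x)\<^sup>2)" by (intro LINT_sum ind Qb u2)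
  also have "\<dots> \<le> (\<Sum>i<n. (1 / r ^ DIM('a)) * (?u i)\<^sup>2
    + \<epsilon> * ?g i)" by (intro sum_mono cube) auto
  also have "\<dots> = (1 / r ^ DIM('a)) * (\<Sum>i<n. (?u i)\<^sup>2) +
    \<epsilon> * (\<Sum>i<n. LINT x|lborel. indicator (Q i) x * (norm (G x))\<^sup>2)" by (simp only: sum.distrib sum_distrib_left)
  also have "(\<Sum>i<n. LINT x|lborel. indicator (Q i) x * (norm (G x))\<^sup>2) = (LINT x|lborel. (\<Sum>i<n. indicator (Q i) x * (norm (G x))\<^sup>2))"
   by (intro LINT_sum[symmetric] ind Qb g2)
  also have "\<epsilon> * \<dots> \<le> \<epsilon> * (LINT x|lborel. (norm (G x))\<^sup>2)"
  proof (intro mult_left_mono integral_mono)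
   show "integrable lborel (\<lambda>x. \<Sum>i<n. indicator (Q i) x * (norm (G x))\<^sup>2)"
    by (intro Bochner_Integration.integrable_sum ind Qb g2)
   show "(\<Sum>i<n. indicator (Q i) x * (norm (G x))\<^sup>2) \<le> (norm (G x))\<^sup>2" for x
    using mult_right_mono[OF sum1[of x], of "(norm (G x))\<^sup>2"] by (simp add: sum_distrib_right)
  qed (use \<epsilon> g2 in auto)
  finally show ?thesis by simp
 qed
 note main = this
 show ?thesis
 proof (intro exI[of _ n] exI[of _ Q] exI[of _ "1 / r ^ DIM('a)"] conjI allI impI)
  show "0 \<le> 1 / r ^ DIM('a)" using r by simp
  show "Q i \<in> sets borel" for i by (rule Qb)
  show "Q i \<subseteq> \<Omega>" if "i < n" for i by (rule Qsub[OF that])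
  show "(LINT x|lborel. indicator K x * (u x)\<^sup>2) \<le>
    \<epsilon> * (LINT x|lborel. (norm (G x))\<^sup>2) + (1 / r ^ DIM('a)) * (\<Sum>i<n. (LINT x|lborel. indicator (Q i) x * u x)\<^sup>2)"
   if "sob \<Omega> u G" for u G by (rule main[OF that])
 qed
qed

section \<open>Surface measure and graphs\<close>

text \<open>Surface measure before restriction to a surface: all boundary pieces and densities then
  live on one Borel algebra, and \<open>surf\<close> is a restriction.\<close>

definition hmeas :: "'a::euclidean_space measure" where
 "hmeas = measure_of UNIV (sets borel) (hausdorff_surf)"

lemma sets_hmeas [simp, measurable_cong]: "sets hmeas = sets borel"
 by (simp add: hmeas_def) (metis sets.sigma_sets_eq space_borel)

lemma space_hmeas [simp]: "space hmeas = UNIV"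
 using sets_eq_imp_space_eq[OF sets_hmeas] by simp

lemma emeasure_hmeas:
 fixes A :: "'a::euclidean_space set"
 assumes "DIM('a) \<ge> 2" "A \<in> sets borel"
 shows "emeasure hmeas A = hausdorff_surf A"
proof -
 have s: "real (DIM('a)) - 1 > 0" using assms(1) by linarith
 note H = measure_space_hausdorff[OF s, where ?'a='a]
 show ?thesis unfolding hmeas_def
  by (rule emeasure_measure_of_sigma) (use H assms(2) in \<open>auto simp: measure_space_def\<close>)
qed

lemma surf_eq_restrict_hmeas:
 fixes S :: "'a::euclidean_space set"
 assumes "DIM('a) \<ge> 2" "S \<in> sets borel"
 shows "surf S = restrict_space hmeas S"
proof (rule measure_eqI)
 show "sets (surf S) = sets (restrict_space hmeas S)" by (simp add: sets_restrict_space)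
 fix A assume "A \<in> sets (surf S)"
 then have A: "A \<in> sets borel" "A \<subseteq> S" using sets_surf_eq[OF assms(2)] by auto
 show "emeasure (surf S) A = emeasure (restrict_space hmeas S) A"
  using A assms by (simp add: emeasure_surf emeasure_restrict_space emeasure_hmeas)
qed

text \<open>The shift along \<open>b\<close> leaves the other coordinates alone, and these control
  (x - y) \<bullet> b on the graph; so the b-coordinate of the displaced difference recovers s - t
  with constant 1 + L n. The bound W of the density multiplies the bound C of the area.\<close>

lemma shadow_le_graph:
 fixes G :: "'a::euclidean_space set"
 assumes dim: "DIM('a) \<ge> 2" and b: "b \<in> Basis" and \<sigma>: "\<bar>\<sigma>\<bar> = 1" and L: "L \<ge> 0" and C: "C \<ge> 0" and h: "h \<ge> 0"
  and G: "G \<in> sets borel" "bounded G"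
  and lip: "\<And>x y. x \<in> G \<Longrightarrow> y \<in> G \<Longrightarrow> \<bar>(x - y) \<bullet> b\<bar> \<le> L * (\<Sum>i\<in>Basis - {b}. \<bar>(x - y) \<bullet> i\<bar>)"
  and ahl: "\<And>p r. r > 0 \<Longrightarrow> hausdorff_surf (G \<inter> cball p r) \<le> ennreal (C * r ^ (DIM('a) - 1))"
  and v: "v \<in> borel_measurable borel" "\<And>x. x \<in> G \<Longrightarrow> v x \<le> W" and W: "W \<ge> 0"
 shows "shadow_le (density hmeas (\<lambda>x. ennreal (v x) * indicator G x)) (\<sigma> *\<^sub>R b) h
   (2 * (1 + L * real (DIM('a))) * (W * C) * real (DIM('a)) ^ DIM('a))"
proof (rule shadow_leI[where P = G])
 note [measurable] = v(1) G(1)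
 let ?N = "density hmeas (\<lambda>x. ennreal (v x) * indicator G x)"
 have le: "emeasure ?N (cball p r) \<le> ennreal (W * C * r ^ (DIM('a) - 1))" if r: "r > 0" for p r
 proof -
  have "emeasure ?N (cball p r) = (\<integral>\<^sup>+x. ennreal (v x) * indicator G x * indicator (cball p r) x \<partial>hmeas)"
   by (rule emeasure_density) auto
  also have "\<dots> \<le> (\<integral>\<^sup>+x. ennreal W * indicator (G \<inter> cball p r) x \<partial>hmeas)"
   using v(2) by (intro nn_integral_mono) (auto simp: indicator_def intro!: ennreal_leI)
  also have "\<dots> = ennreal W * emeasure hmeas (G \<inter> cball p r)" by (rule nn_integral_cmult_indicator) auto
  also have "\<dots> \<le> ennreal W * ennreal (C * r ^ (DIM('a) - 1))"
   using ahl[OF r, of p] by (intro mult_left_mono) (auto simp: emeasure_hmeas[OF dim])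
  also have "\<dots> = ennreal (W * C * r ^ (DIM('a) - 1))" using W by (simp add: ennreal_mult'[symmetric] mult.assoc)
  finally show ?thesis .
 qed
 then show "\<And>p r. r > 0 \<Longrightarrow> emeasure ?N (cball p r) \<le> ennreal (W * C * r ^ (DIM('a) - 1))" .
 show "finite_measure ?N"
 proof
  obtain R where "R > 0" "\<And>x. x \<in> G \<Longrightarrow> norm x \<le> R" using G(2) unfolding bounded_pos by blast
  then have R: "R > 0" "G \<subseteq> cball 0 R" by auto
  have "emeasure ?N (space ?N) = (\<integral>\<^sup>+x. ennreal (v x) * indicator G x * indicator UNIV x \<partial>hmeas)"
   by (simp add: emeasure_density)
  also have "\<dots> = (\<integral>\<^sup>+x. ennreal (v x) * indicator G x * indicator (cball 0 R) x \<partial>hmeas)"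
   using R(2) by (intro nn_integral_cong) (auto simp: indicator_def)
  also have "\<dots> = emeasure ?N (cball 0 R)" by (rule emeasure_density[symmetric]) auto
  also have "\<dots> < \<infinity>" using le[OF R(1), of 0] by (auto intro: le_less_trans)
  finally show "emeasure ?N (space ?N) \<noteq> \<infinity>" by simp
 qed
 show "AE x in ?N. x \<in> G" by (subst AE_density) (auto simp: indicator_def)
 fix x y s t assume xy: "x \<in> G" "y \<in> G"
 define p where "p = (x + s *\<^sub>R \<sigma> *\<^sub>R b) - (y + t *\<^sub>R \<sigma> *\<^sub>R b)"
 have pb: "p \<bullet> b = (x - y) \<bullet> b + (s - t) * \<sigma>"
  using b by (simp add: p_def inner_diff_left inner_add_left algebra_simps)
 have pi: "p \<bullet> i = (x - y) \<bullet> i" if "i \<in> Basis - {b}" for i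
  using b that by (auto simp: p_def inner_diff_left inner_add_left inner_not_same_Basis)
 have "\<bar>s - t\<bar> = \<bar>(s - t) * \<sigma>\<bar>" using \<sigma> by (simp add: abs_mult)
 also have "\<dots> \<le> \<bar>p \<bullet> b\<bar> + \<bar>(x - y) \<bullet> b\<bar>" unfolding pb by linarith
 also have "\<dots> \<le> norm p + L * (\<Sum>i\<in>Basis - {b}. \<bar>(x - y) \<bullet> i\<bar>)" using Basis_le_norm[OF b, of p] lip[OF xy] by linarith
 also have "(\<Sum>i\<in>Basis - {b}. \<bar>(x - y) \<bullet> i\<bar>) = (\<Sum>i\<in>Basis - {b}. \<bar>p \<bullet> i\<bar>)" by (intro sum.cong) (auto simp: pi)
 also have "\<dots> \<le> (\<Sum>i\<in>Basis. \<bar>p \<bullet> i\<bar>)" by (intro sum_mono2) auto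
 also have "\<dots> \<le> (\<Sum>i\<in>(Basis::'a set). norm p)" by (intro sum_mono Basis_le_norm)
 finally have "\<bar>s - t\<bar> \<le> norm p + L * (real (DIM('a)) * norm p)" using L by (simp add: mult_left_mono)
 then have "\<bar>s - t\<bar> \<le> (1 + L * real (DIM('a))) * norm p" by (simp add: algebra_simps)
 then show "\<bar>s - t\<bar> \<le> (1 + L * real (DIM('a))) * norm ((x + s *\<^sub>R \<sigma> *\<^sub>R b) - (y + t *\<^sub>R \<sigma> *\<^sub>R b))" unfolding p_def .
qed (use L C W h G in auto)

section \<open>The cuspidal domain\<close>

locale cusp =
 fixes e :: "'a::euclidean_space" and \<gamma> \<gamma>' :: "real \<Rightarrow> real"
 assumes dim: "DIM('a) \<ge> 2"
  and e: "e \<in> Basis"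
  and cont: "continuous_on {0..1} \<gamma>"
  and incr: "strict_mono_on {0..1} \<gamma>"
  and deriv: "\<And>t. t \<in> {0<..<1} \<Longrightarrow> (\<gamma> has_real_derivative \<gamma>' t) (at t)"
  and g0: "\<gamma> 0 = 0" and g1: "\<gamma> 1 = 1"
  and dincr: "strict_mono_on {0<..<1} \<gamma>'"
begin

definition pr :: "'a \<Rightarrow> 'a" where "pr x = x - (x \<bullet> e) *\<^sub>R e"

lemma e_e [simp]: "e \<bullet> e = 1" and norm_e [simp]: "norm e = 1"
 using e by auto

lemma pr_add [simp]: "pr (x + t *\<^sub>R e) = pr x"
 by (simp add: pr_def inner_add_left algebra_simps)

lemma norm_pr_square: "(norm (pr x))\<^sup>2 = (\<Sum>i\<in>Basis - {e}. (x \<bullet> i)\<^sup>2)"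
proof -
 have "(norm (pr x))\<^sup>2 = (\<Sum>i\<in>Basis. (pr x \<bullet> i)\<^sup>2)" by (rule norm_square_Basis)
 also have "\<dots> = (pr x \<bullet> e)\<^sup>2 + (\<Sum>i\<in>Basis - {e}. (pr x \<bullet> i)\<^sup>2)" using e by (simp add: sum.remove)
 also have "pr x \<bullet> e = 0" by (simp add: pr_def inner_diff_left)
 also have "(\<Sum>i\<in>Basis - {e}. (pr x \<bullet> i)\<^sup>2) = (\<Sum>i\<in>Basis - {e}. (x \<bullet> i)\<^sup>2)"
  using e by (intro sum.cong) (auto simp: pr_def inner_diff_left inner_not_same_Basis)
 finally show ?thesis by simp
qed

lemma norm_diff_2e: "(norm (x - 2 *\<^sub>R e))\<^sup>2 = (norm (pr x))\<^sup>2 + (x \<bullet> e - 2)\<^sup>2"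
proof -
 have "(norm (x - 2 *\<^sub>R e))\<^sup>2 = (\<Sum>i\<in>Basis. ((x - 2 *\<^sub>R e) \<bullet> i)\<^sup>2)" by (rule norm_square_Basis)
 also have "\<dots> = (x \<bullet> e - 2)\<^sup>2 + (\<Sum>i\<in>Basis - {e}. ((x - 2 *\<^sub>R e) \<bullet> i)\<^sup>2)" using e by (simp add: sum.remove inner_diff_left)
 also have "(\<Sum>i\<in>Basis - {e}. ((x - 2 *\<^sub>R e) \<bullet> i)\<^sup>2) = (\<Sum>i\<in>Basis - {e}. (x \<bullet> i)\<^sup>2)"
  using e by (intro sum.cong) (auto simp: inner_diff_left inner_not_same_Basis)
 finally show ?thesis by (simp add: norm_pr_square)
qed

lemma pr_diff_l1: "\<bar>norm (pr x) - norm (pr y)\<bar> \<le> (\<Sum>i\<in>Basis - {e}. \<bar>(x - y) \<bullet> i\<bar>)"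
proof -
 have "\<bar>norm (pr x) - norm (pr y)\<bar> \<le> norm (pr x - pr y)" by (rule norm_triangle_ineq3)
 also have "pr x - pr y = pr (x - y)" by (simp add: pr_def inner_diff_left algebra_simps)
 also have "norm (pr (x - y)) \<le> (\<Sum>i\<in>Basis. \<bar>pr (x - y) \<bullet> i\<bar>)" by (rule norm_le_l1)
 also have "\<dots> = \<bar>pr (x - y) \<bullet> e\<bar> + (\<Sum>i\<in>Basis - {e}. \<bar>pr (x - y) \<bullet> i\<bar>)" using e by (simp add: sum.remove)
 also have "pr (x - y) \<bullet> e = 0" by (simp add: pr_def inner_diff_left)
 also have "(\<Sum>i\<in>Basis - {e}. \<bar>pr (x - y) \<bullet> i\<bar>) = (\<Sum>i\<in>Basis - {e}. \<bar>(x - y) \<bullet> i\<bar>)"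
  using e by (intro sum.cong) (auto simp: pr_def inner_diff_left inner_not_same_Basis)
 finally show ?thesis by simp
qed

lemma continuous_on_pr [continuous_intros]: "continuous_on S pr"
 unfolding pr_def by (intro continuous_intros)

lemma coord_le_norm_pr: "i \<in> Basis - {e} \<Longrightarrow> \<bar>x \<bullet> i\<bar> \<le> norm (pr x)"
proof -
 assume i: "i \<in> Basis - {e}"
 have "pr x \<bullet> i = x \<bullet> i" using e i by (auto simp: pr_def inner_diff_left inner_not_same_Basis)
 then show ?thesis using Basis_le_norm[of i "pr x"] i by simp
qed

lemma \<gamma>_less: "\<lbrakk>0 \<le> s; s < t; t \<le> 1\<rbrakk> \<Longrightarrow> \<gamma> s < \<gamma> t"
 using incr by (auto simp: strict_mono_on_def)

lemma \<gamma>_le: "\<lbrakk>0 \<le> s; s \<le> t; t \<le> 1\<rbrakk> \<Longrightarrow> \<gamma> s \<le> \<gamma> t"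
 using \<gamma>_less[of s t] by (cases "s = t") auto

lemma \<gamma>_bounds: "\<lbrakk>0 \<le> t; t \<le> 1\<rbrakk> \<Longrightarrow> 0 \<le> \<gamma> t \<and> \<gamma> t \<le> 1"
 using \<gamma>_le[of 0 t] \<gamma>_le[of t 1] g0 g1 by simp

text \<open>Convexity of \<gamma> with denominators cleared: the mean value theorem on both
  intervals and monotonicity of \<gamma>'.\<close>

lemma slopes:
 assumes "0 \<le> x" "x < y" "y < z" "z \<le> 1"
 shows "(\<gamma> y - \<gamma> x) * (z - y) \<le> (\<gamma> z - \<gamma> y) * (y - x)"
proof -
 have mvt: "\<exists>\<xi>. s < \<xi> \<and> \<xi> < t \<and> \<gamma> t - \<gamma> s = (t - s) * \<gamma>' \<xi>" if st: "0 \<le> s" "s < t" "t \<le> 1" for s t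
 proof -
  have "\<exists>\<xi>>s. \<xi> < t \<and> \<gamma> t - \<gamma> s = (\<lambda>x h. \<gamma>' x * h) \<xi> (t - s)"
  proof (rule mvt[OF st(2)])
   show "continuous_on {s..t} \<gamma>" using st by (intro continuous_on_subset[OF cont]) auto
   show "(\<gamma> has_derivative (\<lambda>h. \<gamma>' x * h)) (at x)" if "s < x" "x < t" for x
    using deriv[of x] that st by (simp add: has_field_derivative_def)
  qed blast
  then show ?thesis by (auto simp: mult.commute)
 qed
 obtain \<xi> where \<xi>: "x < \<xi>" "\<xi> < y" "\<gamma> y - \<gamma> x = (y - x) * \<gamma>' \<xi>" using mvt[of x y] assms by auto
 obtain \<zeta> where \<zeta>: "y < \<zeta>" "\<zeta> < z" "\<gamma> z - \<gamma> y = (z - y) * \<gamma>' \<zeta>" using mvt[of y z] assms by auto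
 have "\<gamma>' \<xi> \<le> \<gamma>' \<zeta>" using dincr \<xi> \<zeta> assms by (intro less_imp_le) (auto simp: strict_mono_on_def)
 then have "(y - x) * (z - y) * \<gamma>' \<xi> \<le> (y - x) * (z - y) * \<gamma>' \<zeta>"
  using assms by (intro mult_left_mono mult_nonneg_nonneg) auto
 then show ?thesis by (simp add: \<xi>(3) \<zeta>(3) mult_ac)
qed

text \<open>The chord from 0 has slope \<gamma> x / x, which is at least \<gamma> x. Hence at radius
  \<gamma> x the profile rises with at least that slope, the degeneracy that the weight
  matches.\<close>

lemma slope_lower:
 assumes "0 < x" "x < y" "y \<le> 1"
 shows "\<gamma> x * (y - x) \<le> \<gamma> y - \<gamma> x"
proof -
 have "\<gamma> x * (y - x) \<le> (\<gamma> y - \<gamma> x) * x" using slopes[of 0 x y] assms g0 by simp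
 also have "\<dots> \<le> (\<gamma> y - \<gamma> x) * 1" using assms \<gamma>_less[of x y] by (intro mult_left_mono) auto
 finally show ?thesis by simp
qed

text \<open>Comparison with the chord to (1, 1). The bound is lost as s tends to 1, where \<gamma>'
  may be unbounded.\<close>

lemma slope_upper:
 assumes "0 \<le> x" "x < y" "y \<le> s" "s < 1"
 shows "\<gamma> y - \<gamma> x \<le> 1 / (1 - s) * (y - x)"
proof -
 have "(\<gamma> y - \<gamma> x) * (1 - y) \<le> (1 - \<gamma> y) * (y - x)" using slopes[of x y 1] assms g1 by simp
 also have "\<dots> \<le> 1 * (y - x)" using assms \<gamma>_bounds[of y] by (intro mult_right_mono) auto
 finally have 1: "(\<gamma> y - \<gamma> x) * (1 - y) \<le> y - x" by simp
 have "(\<gamma> y - \<gamma> x) * (1 - s) \<le> (\<gamma> y - \<gamma> x) * (1 - y)" using assms \<gamma>_less[of x y] by (intro mult_left_mono) auto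
 then show ?thesis using 1 assms by (simp add: field_simps)
qed

text \<open>\<gamma> is controlled on the unit interval only; clamping its argument makes it
  continuous everywhere.\<close>

definition g :: "real \<Rightarrow> real" where "g t = \<gamma> (max 0 (min 1 t))"

lemma g_eq: "0 \<le> t \<Longrightarrow> t \<le> 1 \<Longrightarrow> g t = \<gamma> t"
 by (simp add: g_def)

lemma continuous_on_g [continuous_intros]: "continuous_on S f \<Longrightarrow> continuous_on S (\<lambda>x. g (f x))"
 unfolding g_def by (rule continuous_on_compose2[OF cont]) (auto intro!: continuous_intros)

abbreviation \<Omega> :: "'a set" where "\<Omega> \<equiv> cusp_dom e \<gamma>"
abbreviation w :: "'a \<Rightarrow> real" where "w \<equiv> cusp_weight e \<gamma>"

lemma ball_iff: "x \<in> ball (2 *\<^sub>R e) (sqrt 2) \<longleftrightarrow> (norm (pr x))\<^sup>2 + (x \<bullet> e - 2)\<^sup>2 < 2"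
proof -
 have "x \<in> ball (2 *\<^sub>R e) (sqrt 2) \<longleftrightarrow> norm (x - 2 *\<^sub>R e) < sqrt 2" by (simp add: dist_norm norm_minus_commute)
 also have "\<dots> \<longleftrightarrow> (norm (x - 2 *\<^sub>R e))\<^sup>2 < 2" by (metis abs_norm_cancel real_sqrt_abs real_sqrt_less_iff)
 finally show ?thesis by (simp add: norm_diff_2e)
qed

text \<open>The section at height 1 lies in the ball, since |x'|^2 + 1 < 2; without it both pieces
  are open.\<close>

lemma \<Omega>_eq: "\<Omega> = {x. 0 < x \<bullet> e \<and> x \<bullet> e < 1 \<and> norm (pr x) < g (x \<bullet> e)} \<union> ball (2 *\<^sub>R e) (sqrt 2)"
proof -
 have "x \<in> ball (2 *\<^sub>R e) (sqrt 2)" if "x \<bullet> e = 1" "norm (pr x) < \<gamma> 1" for x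
 proof -
  have "(norm (pr x))\<^sup>2 < 1" using that g1 by (simp add: abs_square_less_1)
  then show ?thesis unfolding ball_iff using that by simp
 qed
 then show ?thesis unfolding cusp_dom_def pr_def[symmetric] by (auto simp: g_eq less_le)
qed

lemma open_\<Omega>: "open \<Omega>"
proof -
 have "{x. 0 < x \<bullet> e \<and> x \<bullet> e < 1 \<and> norm (pr x) < g (x \<bullet> e)} = {x. 0 < x \<bullet> e} \<inter> {x. x \<bullet> e < 1} \<inter> {x. norm (pr x) < g (x \<bullet> e)}"
  by auto
 also have "open \<dots>" by (intro open_Int open_Collect_less continuous_intros)
 finally show ?thesis unfolding \<Omega>_eq by (intro open_Un open_ball)
qed

definition Cc :: "'a set" where "Cc = {x. 0 \<le> x \<bullet> e \<and> x \<bullet> e \<le> 1 \<and> norm (pr x) = g (x \<bullet> e)}"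
definition Sp :: "'a set" where "Sp = sphere (2 *\<^sub>R e) (sqrt 2)"

lemma closed_Cc: "closed Cc"
proof -
 have "Cc = {x. 0 \<le> x \<bullet> e} \<inter> {x. x \<bullet> e \<le> 1} \<inter> {x. norm (pr x) = g (x \<bullet> e)}" by (auto simp: Cc_def)
 also have "closed \<dots>" by (intro closed_Int closed_Collect_le closed_Collect_eq continuous_intros)
 finally show ?thesis .
qed

lemma bounded_cone: "bounded {x. 0 \<le> x \<bullet> e \<and> x \<bullet> e \<le> 1 \<and> norm (pr x) \<le> g (x \<bullet> e)}"
 unfolding bounded_iff
proof (intro exI[of _ 2] ballI)
 fix x assume x: "x \<in> {x. 0 \<le> x \<bullet> e \<and> x \<bullet> e \<le> 1 \<and> norm (pr x) \<le> g (x \<bullet> e)}"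
 have "norm x = norm (pr x + (x \<bullet> e) *\<^sub>R e)" by (simp add: pr_def)
 also have "\<dots> \<le> norm (pr x) + \<bar>x \<bullet> e\<bar>" using norm_triangle_ineq[of "pr x" "(x \<bullet> e) *\<^sub>R e"] by simp
 also have "\<dots> \<le> 2" using x \<gamma>_bounds[of "x \<bullet> e"] by (auto simp: g_eq)
 finally show "norm x \<le> 2" .
qed

lemma compact_Cc: "compact Cc"
proof -
 have "Cc \<subseteq> {x. 0 \<le> x \<bullet> e \<and> x \<bullet> e \<le> 1 \<and> norm (pr x) \<le> g (x \<bullet> e)}" by (auto simp: Cc_def)
 then show ?thesis using closed_Cc bounded_subset[OF bounded_cone] by (simp add: compact_eq_bounded_closed)
qed

lemma bounded_\<Omega>: "bounded \<Omega>"
proof -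
 have "\<Omega> \<subseteq> {x. 0 \<le> x \<bullet> e \<and> x \<bullet> e \<le> 1 \<and> norm (pr x) \<le> g (x \<bullet> e)} \<union> ball (2 *\<^sub>R e) (sqrt 2)" unfolding \<Omega>_eq by auto
 then show ?thesis using bounded_cone by (meson bounded_Un bounded_ball bounded_subset)
qed

lemmas dom = open_\<Omega> bounded_\<Omega>

text \<open>An inclusion only: strict convexity gives \<gamma> a slope above 1 near the top, so
  there the lateral surface \<open>Cc\<close> runs inside the ball. The boundary measure on
  \<open>Cc\<close> is therefore cut by the indicator of the frontier.\<close>

lemma frontier_sub: "frontier \<Omega> \<subseteq> Cc \<union> Sp"
proof
 fix x assume x: "x \<in> frontier \<Omega>"
 let ?T = "{x. 0 \<le> x \<bullet> e} \<inter> {x. x \<bullet> e \<le> 1} \<inter> {x. norm (pr x) \<le> g (x \<bullet> e)}"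
 have "closed ?T" by (intro closed_Int closed_Collect_le continuous_intros)
 then have "closed (?T \<union> cball (2 *\<^sub>R e) (sqrt 2))" by (intro closed_Un closed_cball)
 moreover have "\<Omega> \<subseteq> ?T \<union> cball (2 *\<^sub>R e) (sqrt 2)" unfolding \<Omega>_eq by auto
 ultimately have "closure \<Omega> \<subseteq> ?T \<union> cball (2 *\<^sub>R e) (sqrt 2)" by (simp add: closure_minimal)
 then have 1: "x \<in> ?T \<union> cball (2 *\<^sub>R e) (sqrt 2)" using x by (auto simp: frontier_def)
 have 2: "x \<notin> \<Omega>" using x open_\<Omega> by (auto simp: frontier_def interior_open)
 show "x \<in> Cc \<union> Sp"
 proof (cases "x \<in> cball (2 *\<^sub>R e) (sqrt 2)")
  case True
  moreover have "x \<notin> ball (2 *\<^sub>R e) (sqrt 2)" using 2 by (auto simp: cusp_dom_def)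
  ultimately show ?thesis by (auto simp: Sp_def)
 next
  case False
  then have T: "0 \<le> x \<bullet> e" "x \<bullet> e \<le> 1" "norm (pr x) \<le> g (x \<bullet> e)" using 1 by auto
  have "norm (pr x) = g (x \<bullet> e)"
  proof (cases "x \<bullet> e = 0")
   case True
   then show ?thesis using T(3) g0 by (simp add: g_def)
  next
   case False
   then have "\<not> norm (pr x) < \<gamma> (x \<bullet> e)" using 2 T by (auto simp: cusp_dom_def pr_def)
   then show ?thesis using T by (simp add: g_eq)
  qed
  then show ?thesis using T by (simp add: Cc_def)
 qed
qed

text \<open>This includes radius 1, where the weight 1 of the remaining boundary agrees with
  |x'|.\<close>

lemma w_Cc: "x \<in> Cc \<Longrightarrow> w x = norm (pr x)"
 using \<gamma>_bounds[of "x \<bullet> e"] by (auto simp: Cc_def cusp_weight_def pr_def[symmetric] g_eq)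

lemma w_bounds: "0 \<le> w x" "w x \<le> 1"
 using \<gamma>_bounds[of "x \<bullet> e"] by (auto simp: cusp_weight_def)

lemma w_measurable [measurable]: "w \<in> borel_measurable borel"
proof -
 have eq: "w = (\<lambda>x. if x \<in> Cc \<inter> {x. g (x \<bullet> e) < 1} then g (x \<bullet> e) else 1)"
  by (rule ext) (auto simp: Cc_def cusp_weight_def pr_def[symmetric] g_eq)
 have "open {x. g (x \<bullet> e) < 1}" by (intro open_Collect_less continuous_intros)
 then have [measurable]: "Cc \<inter> {x. g (x \<bullet> e) < 1} \<in> sets borel" using closed_Cc by (intro sets.Int) auto
 have [measurable]: "(\<lambda>x. g (x \<bullet> e)) \<in> borel_measurable borel"
  by (intro borel_measurable_continuous_onI continuous_intros)
 show ?thesis unfolding eq by measurable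
qed

text \<open>Up to height 1 the profile grows strictly while x' is fixed. Beyond it |x'| \<le> 1 and
  the height is above 1 and at most 2, which lies in the ball.\<close>

lemma Cc_shift: "x \<in> Cc \<Longrightarrow> 0 < t \<Longrightarrow> t \<le> 1 \<Longrightarrow> x + t *\<^sub>R e \<in> \<Omega>"
proof -
 assume x: "x \<in> Cc" and t: "0 < t" "t \<le> 1"
 let ?s = "x \<bullet> e"
 have s: "0 \<le> ?s" "?s \<le> 1" "norm (pr x) = \<gamma> ?s" using x by (auto simp: Cc_def g_eq)
 have se: "(x + t *\<^sub>R e) \<bullet> e = ?s + t" by (simp add: inner_add_left)
 show ?thesis
 proof (cases "?s + t \<le> 1")
  case True
  then have "norm (pr (x + t *\<^sub>R e)) < \<gamma> (?s + t)" using s t \<gamma>_less[of ?s "?s + t"] by simp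
  then show ?thesis using True s t se unfolding cusp_dom_def pr_def[symmetric] by auto
 next
  case False
  have "(norm (pr x))\<^sup>2 \<le> 1" using s \<gamma>_bounds[of ?s] by (simp add: power_le_one)
  moreover have "(?s + t - 2)\<^sup>2 < 1"
  proof -
   have "\<bar>?s + t - 2\<bar> < 1" using False s t by auto
   then show ?thesis by (simp add: abs_square_less_1)
  qed
  ultimately have "x + t *\<^sub>R e \<in> ball (2 *\<^sub>R e) (sqrt 2)" unfolding ball_iff se by simp
  then show ?thesis by (auto simp: cusp_dom_def)
 qed
qed

text \<open>The pigeonhole constant: among n coordinates some square is at least 1/n of the squared
  norm.\<close>

definition \<kappa> :: real where "\<kappa> = 1 / sqrt (real (DIM('a)))"

lemma \<kappa>: "0 < \<kappa>" "\<kappa> \<le> 1" "\<kappa>\<^sup>2 * real (DIM('a)) = 1"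
 using dim by (auto simp: \<kappa>_def power_divide)

lemma large_coordinate:
 assumes "finite I" "card I \<le> DIM('a)" "S = (\<Sum>i\<in>I. (f i)\<^sup>2)" "S > 0"
 shows "\<exists>i\<in>I. \<kappa> * sqrt S \<le> \<bar>f i\<bar>"
proof (rule ccontr)
 assume "\<not> ?thesis"
 then have less: "\<And>i. i \<in> I \<Longrightarrow> \<bar>f i\<bar> < \<kappa> * sqrt S" by auto
 have "I \<noteq> {}" using assms by auto
 have "S < (\<Sum>i\<in>I. \<kappa>\<^sup>2 * S)" unfolding assms(3)[symmetric]
 proof -
  have "(\<Sum>i\<in>I. (f i)\<^sup>2) < (\<Sum>i\<in>I. \<kappa>\<^sup>2 * S)"
  proof (rule sum_strict_mono[OF assms(1) \<open>I \<noteq> {}\<close>])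
   fix i assume i: "i \<in> I"
   have "\<bar>f i\<bar>\<^sup>2 < (\<kappa> * sqrt S)\<^sup>2" using less[OF i] by (intro power_strict_mono) auto
   then show "(f i)\<^sup>2 < \<kappa>\<^sup>2 * S" using assms(4) by (simp add: power_mult_distrib)
  qed
  then show "S < (\<Sum>i\<in>I. \<kappa>\<^sup>2 * S)" by (simp add: assms(3))
 qed
 also have "\<dots> = (\<kappa>\<^sup>2 * real (card I)) * S" by simp
 also have "\<dots> \<le> (\<kappa>\<^sup>2 * real (DIM('a))) * S" using assms by (intro mult_right_mono mult_left_mono) auto
 finally show False by (simp add: \<kappa>)
qed

text \<open>Sectors in which the lateral surface and the sphere are Lipschitz graphs over \<open>b\<^sup>\<bottom>\<close>.\<close>

definition Csec :: "'a \<Rightarrow> real \<Rightarrow> 'a set" where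
 "Csec b \<sigma> = {x \<in> Cc. 0 < norm (pr x) \<and> norm (pr x) \<le> 1/2 \<and> \<kappa> * norm (pr x) \<le> \<sigma> * (x \<bullet> b)}"

definition Ssec :: "'a \<Rightarrow> real \<Rightarrow> 'a set" where
 "Ssec b \<sigma> = {x \<in> Sp. \<kappa> \<le> \<sigma> * ((x - 2 *\<^sub>R e) \<bullet> b)}"

lemma Sp_cover: "Sp \<subseteq> (\<Union>b\<in>Basis. \<Union>\<sigma>\<in>{1,-1}. Ssec b \<sigma>)"
proof
 fix x assume x: "x \<in> Sp"
 have "(\<Sum>i\<in>Basis. ((x - 2 *\<^sub>R e) \<bullet> i)\<^sup>2) = 2"
  using x unfolding norm_square_Basis[symmetric] by (simp add: Sp_def dist_norm norm_minus_commute)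
 then obtain i where i: "i \<in> Basis" "\<kappa> * sqrt 2 \<le> \<bar>(x - 2 *\<^sub>R e) \<bullet> i\<bar>"
  using large_coordinate[of Basis 2 "\<lambda>i. (x - 2 *\<^sub>R e) \<bullet> i"] by auto
 have "\<kappa> * 1 \<le> \<kappa> * sqrt 2" using \<kappa> by (intro mult_left_mono) auto
 then have "\<kappa> \<le> \<bar>(x - 2 *\<^sub>R e) \<bullet> i\<bar>" using i by simp
 then have "x \<in> Ssec i 1 \<or> x \<in> Ssec i (-1)" using x by (auto simp: Ssec_def abs_if split: if_splits)
 then show "x \<in> (\<Union>b\<in>Basis. \<Union>\<sigma>\<in>{1,-1}. Ssec b \<sigma>)" using i(1) by blast
qed

lemma Cc_cover: "x \<in> Cc \<Longrightarrow> 0 < norm (pr x) \<Longrightarrow> norm (pr x) \<le> 1/2 \<Longrightarrow> x \<in> (\<Union>b\<in>Basis - {e}. \<Union>\<sigma>\<in>{1,-1}. Csec b \<sigma>)"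
proof -
 assume x: "x \<in> Cc" "0 < norm (pr x)" "norm (pr x) \<le> 1/2"
 have "card (Basis - {e}) \<le> DIM('a)" by (intro card_mono) auto
 moreover have "0 < (norm (pr x))\<^sup>2" using x(2) by simp
 ultimately have "\<exists>i\<in>Basis - {e}. \<kappa> * sqrt ((norm (pr x))\<^sup>2) \<le> \<bar>x \<bullet> i\<bar>"
  by (intro large_coordinate[OF _ _ norm_pr_square]) auto
 then obtain i where i: "i \<in> Basis - {e}" "\<kappa> * sqrt ((norm (pr x))\<^sup>2) \<le> \<bar>x \<bullet> i\<bar>" by (elim bexE)
 then have "\<kappa> * norm (pr x) \<le> \<bar>x \<bullet> i\<bar>" by simp
 then have "x \<in> Csec i 1 \<or> x \<in> Csec i (-1)" using x by (auto simp: Csec_def abs_if split: if_splits)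
 then show ?thesis using i(1) by blast
qed

text \<open>Subtracting the two equations of the sphere expresses (X b - Y b)(X b + Y b) through the
  other coordinates. In the sector |X b + Y b| \<ge> 2 \<kappa>, and each factor |X i + Y i| on the
  other side is at most 4.\<close>

lemma Ssec_lip:
 assumes b: "b \<in> Basis" and \<sigma>: "\<sigma> \<in> {1,-1}" and x: "x \<in> Ssec b \<sigma>" and y: "y \<in> Ssec b \<sigma>"
 shows "\<bar>(x - y) \<bullet> b\<bar> \<le> (2 / \<kappa>) * (\<Sum>i\<in>Basis - {b}. \<bar>(x - y) \<bullet> i\<bar>)"
proof -
 define X where "X i = (x - 2 *\<^sub>R e) \<bullet> i" for i
 define Y where "Y i = (y - 2 *\<^sub>R e) \<bullet> i" for i
 have XY: "(x - y) \<bullet> i = X i - Y i" for i by (simp add: X_def Y_def inner_diff_left)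
 have n2: "norm (x - 2 *\<^sub>R e) = sqrt 2" "norm (y - 2 *\<^sub>R e) = sqrt 2"
  using x y by (auto simp: Ssec_def Sp_def dist_norm norm_minus_commute)
 have "(\<Sum>i\<in>Basis. (X i)\<^sup>2) = 2" "(\<Sum>i\<in>Basis. (Y i)\<^sup>2) = 2"
  unfolding X_def Y_def norm_square_Basis[symmetric] n2 by auto
 then have "(X b)\<^sup>2 + (\<Sum>i\<in>Basis - {b}. (X i)\<^sup>2) = (Y b)\<^sup>2 + (\<Sum>i\<in>Basis - {b}. (Y i)\<^sup>2)"
  using b by (simp add: sum.remove)
 then have eq: "(X b)\<^sup>2 - (Y b)\<^sup>2 = (\<Sum>i\<in>Basis - {b}. (Y i)\<^sup>2 - (X i)\<^sup>2)" by (simp add: sum_subtractf)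
 have bd: "\<bar>X i\<bar> \<le> sqrt 2" "\<bar>Y i\<bar> \<le> sqrt 2" if "i \<in> Basis" for i
  using Basis_le_norm[OF that] n2 by (auto simp: X_def Y_def) metis+
 have s2: "sqrt 2 \<le> 2" by (rule real_le_lsqrt) auto
 have "\<bar>X b - Y b\<bar> * (2 * \<kappa>) \<le> \<bar>X b - Y b\<bar> * \<bar>X b + Y b\<bar>"
  using x y \<sigma> by (intro mult_left_mono) (auto simp: Ssec_def X_def Y_def)
 also have "\<dots> = \<bar>(X b)\<^sup>2 - (Y b)\<^sup>2\<bar>" by (simp add: abs_mult[symmetric] power2_eq_square algebra_simps)
 also have "\<dots> \<le> (\<Sum>i\<in>Basis - {b}. \<bar>(Y i)\<^sup>2 - (X i)\<^sup>2\<bar>)" unfolding eq by (rule sum_abs)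
 also have "\<dots> \<le> (\<Sum>i\<in>Basis - {b}. 4 * \<bar>(x - y) \<bullet> i\<bar>)"
 proof (rule sum_mono)
  fix i assume i: "i \<in> Basis - {b}"
  have "\<bar>(Y i)\<^sup>2 - (X i)\<^sup>2\<bar> = \<bar>X i + Y i\<bar> * \<bar>X i - Y i\<bar>"
   by (simp add: abs_mult[symmetric] power2_eq_square algebra_simps abs_minus_commute)
  also have "\<dots> \<le> 4 * \<bar>X i - Y i\<bar>" using bd[of i] i s2 by (intro mult_right_mono) auto
  finally show "\<bar>(Y i)\<^sup>2 - (X i)\<^sup>2\<bar> \<le> 4 * \<bar>(x - y) \<bullet> i\<bar>" by (simp add: XY)
 qed
 finally have "\<bar>(x - y) \<bullet> b\<bar> * (2 * \<kappa>) \<le> 4 * (\<Sum>i\<in>Basis - {b}. \<bar>(x - y) \<bullet> i\<bar>)" by (simp add: XY sum_distrib_left)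
 then show ?thesis using \<kappa>(1) by (simp add: field_simps)
qed

text \<open>The height at which the radius is 1/2; below it \<open>slope_upper\<close> applies with
  a fixed constant.\<close>

definition s1 :: real where "s1 = (SOME s. 0 \<le> s \<and> s < 1 \<and> \<gamma> s = 1/2)"

lemma s1: "0 \<le> s1" "s1 < 1" "\<gamma> s1 = 1/2"
proof -
 have "\<exists>s\<ge>0. s \<le> 1 \<and> \<gamma> s = 1/2" by (rule IVT') (use cont g0 g1 in auto)
 then obtain s where "0 \<le> s" "s \<le> 1" "\<gamma> s = 1/2" by auto
 then have "\<exists>s. 0 \<le> s \<and> s < 1 \<and> \<gamma> s = 1/2" using g1 by (intro exI[of _ s]) (auto simp: less_le)
 from someI_ex[OF this] show "0 \<le> s1" "s1 < 1" "\<gamma> s1 = 1/2" by (auto simp: s1_def)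
qed

lemma g_lip: "\<lbrakk>0 \<le> s; s \<le> 1; 0 \<le> t; t \<le> 1; \<gamma> s \<le> 1/2; \<gamma> t \<le> 1/2\<rbrakk> \<Longrightarrow> \<bar>\<gamma> s - \<gamma> t\<bar> \<le> 1 / (1 - s1) * \<bar>s - t\<bar>"
proof (induction s t rule: linorder_wlog)
 case (le s t)
 have "t \<le> s1" using \<gamma>_less[of s1 t] s1 le by force
 then show ?case using slope_upper[of s t s1] \<gamma>_less[of s t] le s1 by (cases "s = t") auto
next
 case (sym s t)
 then show ?case by (simp add: abs_minus_commute)
qed

text \<open>1 / (1 - s1) is the Lipschitz constant of \<gamma> up to radius 1/2, the summand 1
  accounts for the remaining coordinates, and \<kappa> for the aperture of the sector.\<close>

definition Lc :: real where "Lc = (1 / (1 - s1) + 1) / \<kappa>"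

lemma Lc: "Lc \<ge> 0" using s1 \<kappa> by (simp add: Lc_def)

text \<open>The equations |x'|^2 = p^2 and |y'|^2 = q^2 are subtracted. Every term on the right is
  bounded with a factor p + q, and so is |x \<bullet> b + y \<bullet> b| from below, by \<kappa> (p
  + q); the factor cancels, and the constant does not deteriorate at the tip.\<close>

lemma Csec_lip:
 assumes b: "b \<in> Basis - {e}" and \<sigma>: "\<sigma> \<in> {1,-1}" and x: "x \<in> Csec b \<sigma>" and y: "y \<in> Csec b \<sigma>"
 shows "\<bar>(x - y) \<bullet> b\<bar> \<le> Lc * (\<Sum>i\<in>Basis - {b}. \<bar>(x - y) \<bullet> i\<bar>)"
proof -
 define M where "M = 1 / (1 - s1)"
 have M: "M \<ge> 0" using s1 by (simp add: M_def)
 define p where "p = norm (pr x)"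
 define q where "q = norm (pr y)"
 have xc: "x \<in> Cc" and yc: "y \<in> Cc" and p: "0 < p" "p \<le> 1/2" and q: "0 < q" "q \<le> 1/2"
  and xb: "\<kappa> * p \<le> \<sigma> * (x \<bullet> b)" and yb: "\<kappa> * q \<le> \<sigma> * (y \<bullet> b)" using x y by (auto simp: Csec_def p_def q_def)
 let ?S = "\<Sum>i\<in>Basis - {b}. \<bar>(x - y) \<bullet> i\<bar>"
 have eqp: "p\<^sup>2 = (x \<bullet> b)\<^sup>2 + (\<Sum>i\<in>Basis - {e} - {b}. (x \<bullet> i)\<^sup>2)" "q\<^sup>2 = (y \<bullet> b)\<^sup>2 + (\<Sum>i\<in>Basis - {e} - {b}. (y \<bullet> i)\<^sup>2)"
  unfolding p_def q_def norm_pr_square using b by (simp_all add: sum.remove)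
 then have eq: "(x \<bullet> b)\<^sup>2 - (y \<bullet> b)\<^sup>2 = (p\<^sup>2 - q\<^sup>2) + (\<Sum>i\<in>Basis - {e} - {b}. (y \<bullet> i)\<^sup>2 - (x \<bullet> i)\<^sup>2)"
  by (simp add: sum_subtractf)
 have pq: "\<bar>p - q\<bar> \<le> M * \<bar>(x - y) \<bullet> e\<bar>"
  using g_lip[of "x \<bullet> e" "y \<bullet> e"] xc yc p q by (auto simp: Cc_def g_eq p_def q_def M_def inner_diff_left)
 have 1: "\<bar>p\<^sup>2 - q\<^sup>2\<bar> \<le> (p + q) * (M * \<bar>(x - y) \<bullet> e\<bar>)"
 proof -
  have "\<bar>p\<^sup>2 - q\<^sup>2\<bar> = (p + q) * \<bar>p - q\<bar>" using p q
   by (simp add: power2_eq_square square_diff_square_factored abs_mult)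
  also have "\<dots> \<le> (p + q) * (M * \<bar>(x - y) \<bullet> e\<bar>)" using pq p q by (intro mult_left_mono) auto
  finally show ?thesis .
 qed
 have 2: "(\<Sum>i\<in>Basis - {e} - {b}. \<bar>(y \<bullet> i)\<^sup>2 - (x \<bullet> i)\<^sup>2\<bar>) \<le> (\<Sum>i\<in>Basis - {e} - {b}. (p + q) * \<bar>(x - y) \<bullet> i\<bar>)"
 proof (rule sum_mono)
  fix i assume i: "i \<in> Basis - {e} - {b}"
  have "\<bar>(y \<bullet> i)\<^sup>2 - (x \<bullet> i)\<^sup>2\<bar> = \<bar>x \<bullet> i + y \<bullet> i\<bar> * \<bar>x \<bullet> i - y \<bullet> i\<bar>"
   by (simp add: abs_mult[symmetric] power2_eq_square algebra_simps abs_minus_commute)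
  also have "\<dots> \<le> (p + q) * \<bar>x \<bullet> i - y \<bullet> i\<bar>"
   using coord_le_norm_pr[of i x] coord_le_norm_pr[of i y] i by (intro mult_right_mono) (auto simp: p_def q_def)
  finally show "\<bar>(y \<bullet> i)\<^sup>2 - (x \<bullet> i)\<^sup>2\<bar> \<le> (p + q) * \<bar>(x - y) \<bullet> i\<bar>" by (simp add: inner_diff_left)
 qed
 have Se: "\<bar>(x - y) \<bullet> e\<bar> + (\<Sum>i\<in>Basis - {e} - {b}. \<bar>(x - y) \<bullet> i\<bar>) = ?S"
 proof -
  have c: "Basis - {b} - {e} = Basis - {e} - {b}" by blast
  have m: "e \<in> Basis - {b}" using b e by blast
  have "?S = \<bar>(x - y) \<bullet> e\<bar> + (\<Sum>i\<in>Basis - {b} - {e}. \<bar>(x - y) \<bullet> i\<bar>)" by (rule sum.remove[OF _ m]) simp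
  then show ?thesis unfolding c by (rule sym)
 qed
 have "\<bar>(x - y) \<bullet> b\<bar> * (\<kappa> * (p + q)) \<le> \<bar>(x - y) \<bullet> b\<bar> * \<bar>x \<bullet> b + y \<bullet> b\<bar>"
  using xb yb \<sigma> by (intro mult_left_mono) (auto simp: algebra_simps)
 also have "\<dots> = \<bar>(x \<bullet> b)\<^sup>2 - (y \<bullet> b)\<^sup>2\<bar>" by (simp add: abs_mult[symmetric] power2_eq_square inner_diff_left algebra_simps)
 also have "\<dots> \<le> \<bar>p\<^sup>2 - q\<^sup>2\<bar> + (\<Sum>i\<in>Basis - {e} - {b}. \<bar>(y \<bullet> i)\<^sup>2 - (x \<bullet> i)\<^sup>2\<bar>)"
  unfolding eq by (rule order_trans[OF abs_triangle_ineq add_left_mono[OF sum_abs]])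
 also have "\<dots> \<le> (p + q) * (M * \<bar>(x - y) \<bullet> e\<bar>) + (\<Sum>i\<in>Basis - {e} - {b}. (p + q) * \<bar>(x - y) \<bullet> i\<bar>)"
  by (rule add_mono[OF 1 2])
 also have "\<dots> = (p + q) * (M * \<bar>(x - y) \<bullet> e\<bar> + (\<Sum>i\<in>Basis - {e} - {b}. \<bar>(x - y) \<bullet> i\<bar>))"
  by (simp add: sum_distrib_left distrib_left)
 also have "\<dots> \<le> (p + q) * ((M + 1) * ?S)"
 proof (rule mult_left_mono)
  have "0 \<le> (\<Sum>i\<in>Basis - {e} - {b}. \<bar>(x - y) \<bullet> i\<bar>)" by (intro sum_nonneg) simp
  then have "\<bar>(x - y) \<bullet> e\<bar> \<le> ?S" using Se by linarith
  from mult_left_mono[OF this M] have "M * \<bar>(x - y) \<bullet> e\<bar> \<le> M * ?S" .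
  moreover have "(\<Sum>i\<in>Basis - {e} - {b}. \<bar>(x - y) \<bullet> i\<bar>) \<le> ?S" using Se abs_ge_zero[of "(x - y) \<bullet> e"] by linarith
  ultimately show "M * \<bar>(x - y) \<bullet> e\<bar> + (\<Sum>i\<in>Basis - {e} - {b}. \<bar>(x - y) \<bullet> i\<bar>) \<le> (M + 1) * ?S"
   by (simp only: distrib_right mult_1)
 qed (use p q in auto)
 finally have "(p + q) * (\<bar>(x - y) \<bullet> b\<bar> * \<kappa>) \<le> (p + q) * ((M + 1) * ?S)" by (simp add: mult_ac)
 then have "\<bar>(x - y) \<bullet> b\<bar> * \<kappa> \<le> (M + 1) * ?S" using p q by (subst (asm) mult_le_cancel_left_pos) auto
 then show ?thesis using \<kappa>(1) by (simp add: Lc_def M_def[symmetric] pos_le_divide_eq)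
qed

definition slice :: "nat \<Rightarrow> 'a set" where
 "slice j = {x \<in> Cc. (1/2) ^ Suc j < norm (pr x) \<and> norm (pr x) \<le> (1/2) ^ j}"

text \<open>Where the radius exceeds h = (1/2)^(j + 1), \<gamma> has slope at least h by
  \<open>slope_lower\<close>; so the height is Lipschitz in the radius with constant 1 / h, and the
  radius is a norm of x'.\<close>

lemma slice_lip:
 assumes x: "x \<in> slice j" and y: "y \<in> slice j"
 shows "\<bar>(x - y) \<bullet> e\<bar> \<le> 2 ^ Suc j * (\<Sum>i\<in>Basis - {e}. \<bar>(x - y) \<bullet> i\<bar>)"
proof -
 define h where "h = (1/2::real) ^ Suc j"
 have h: "h > 0" "2 ^ Suc j = 1 / h" by (simp_all add: h_def power_one_over)
 have key: "\<bar>s - t\<bar> \<le> (1 / h) * \<bar>\<gamma> s - \<gamma> t\<bar>"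
  if "0 \<le> s" "s \<le> 1" "0 \<le> t" "t \<le> 1" "h < \<gamma> s" "h < \<gamma> t" for s t using that
 proof (induction s t rule: linorder_wlog)
  case (le s t)
  show ?case
  proof (cases "s = t")
   case False
   with le(1) have st: "s < t" by simp
   have "s \<noteq> 0" using le(6) g0 h(1) by (metis not_less_iff_gr_or_eq)
   then have s0: "0 < s" using le(2) by simp
   have "h * (t - s) \<le> \<gamma> s * (t - s)" using le(6) st by (intro mult_right_mono) simp_all
   also have "\<dots> \<le> \<gamma> t - \<gamma> s" by (rule slope_lower[of s t]) (use le(5) s0 st in simp_all)
   finally have "t - s \<le> (\<gamma> t - \<gamma> s) / h" using h(1) by (simp add: pos_le_divide_eq mult.commute)
   also have "\<dots> \<le> (1 / h) * \<bar>\<gamma> s - \<gamma> t\<bar>" using h(1) by (simp add: divide_right_mono)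
   finally show ?thesis using st by simp
  qed simp
 next
  case (sym s t)
  have "\<bar>t - s\<bar> \<le> 1 / h * \<bar>\<gamma> t - \<gamma> s\<bar>" by (rule sym(1)) (fact sym)+
  then show ?case by (simp only: abs_minus_commute)
 qed
 have n: "norm (pr x) = \<gamma> (x \<bullet> e)" "norm (pr y) = \<gamma> (y \<bullet> e)" using x y by (simp_all add: slice_def Cc_def g_eq)
 have l: "h < norm (pr x)" "h < norm (pr y)" and c: "0 \<le> x \<bullet> e" "x \<bullet> e \<le> 1" "0 \<le> y \<bullet> e" "y \<bullet> e \<le> 1"
  using x y unfolding slice_def Cc_def h_def mem_Collect_eq by blast+
 have "\<bar>x \<bullet> e - y \<bullet> e\<bar> \<le> (1 / h) * \<bar>\<gamma> (x \<bullet> e) - \<gamma> (y \<bullet> e)\<bar>" using l unfolding n by (intro key c)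
 with n have "\<bar>(x - y) \<bullet> e\<bar> \<le> 2 ^ Suc j * \<bar>norm (pr x) - norm (pr y)\<bar>" by (simp only: h(2) inner_diff_left)
 also have "\<dots> \<le> 2 ^ Suc j * (\<Sum>i\<in>Basis - {e}. \<bar>(x - y) \<bullet> i\<bar>)" by (intro mult_left_mono pr_diff_l1) auto
 finally show ?thesis .
qed

definition Kg :: "real \<Rightarrow> real" where
 "Kg L = hausdorff_normal (real (DIM('a)) - 1) * (2 * (1 + L) * real (DIM('a))) ^ (DIM('a) - 1)"

lemma Kg_nonneg: "L \<ge> 0 \<Longrightarrow> Kg L \<ge> 0"
 using hausdorff_normal_pos[of "real (DIM('a)) - 1"] dim by (simp add: Kg_def)

text \<open>Slice 0 is one graph over the plane orthogonal to \<open>e\<close>, with constant 2;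
  every other slice lies in at most 2 n sideways sectors.\<close>

definition Cs :: real where "Cs = Kg 2 + 2 * real (DIM('a)) * Kg Lc"

lemma Cs_nonneg: "Cs \<ge> 0" using Kg_nonneg[of 2] Kg_nonneg[OF Lc] by (simp add: Cs_def)

text \<open>The area bound has to be uniform in j, but the Lipschitz constant
  \<open>2^(j + 1)\<close> over the plane orthogonal to \<open>e\<close> is not. For j > 0 the
  radius is at most 1/2 and the sideways sectors serve, with constant \<open>Lc\<close>. Slice 0 has
  larger radii, beyond the reach of the sectors, but its vertical graph has constant 2.\<close>

lemma slice_ahlfors:
 assumes r: "r > 0"
 shows "hausdorff_surf (slice j \<inter> cball p r) \<le> ennreal (Cs * r ^ (DIM('a) - 1))"
proof -
 have sp: "real (DIM('a)) - 1 > 0" using dim by linarith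
 have rp: "r ^ (DIM('a) - 1) \<ge> 0" using r by simp
 show ?thesis
 proof (cases "j = 0")
  case True
  have "hausdorff_surf (slice j \<inter> cball p r) \<le> ennreal (Kg 2 * r ^ (DIM('a) - 1))"
   unfolding Kg_def by (rule hausdorff_graph_le[OF dim e _ r]) (use slice_lip[of _ j] True in auto)
  also have "\<dots> \<le> ennreal (Cs * r ^ (DIM('a) - 1))"
   using Kg_nonneg[OF Lc] rp by (intro ennreal_leI mult_right_mono) (auto simp: Cs_def)
  finally show ?thesis .
 next
  case False
  let ?I = "(Basis - {e}) \<times> {1, -1::real}"
  have "slice j \<inter> cball p r \<subseteq> (\<Union>k\<in>?I. Csec (fst k) (snd k) \<inter> cball p r)"
  proof
   fix x assume x: "x \<in> slice j \<inter> cball p r"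
   have "(1/2::real) ^ j \<le> (1/2) ^ 1" using False by (intro power_decreasing) auto
   then have "norm (pr x) \<le> 1/2" using x by (auto simp: slice_def)
   moreover have "0 < (1/2::real) ^ Suc j" by simp
   then have "0 < norm (pr x)" using x unfolding slice_def by (auto intro: less_trans simp del: power_Suc)
   ultimately have "x \<in> (\<Union>b\<in>Basis - {e}. \<Union>\<sigma>\<in>{1,-1}. Csec b \<sigma>)" using x by (intro Cc_cover) (auto simp: slice_def)
   then obtain b \<sigma> where "b \<in> Basis - {e}" "\<sigma> \<in> {1,-1}" "x \<in> Csec b \<sigma>" by (elim UN_E)
   then show "x \<in> (\<Union>k\<in>?I. Csec (fst k) (snd k) \<inter> cball p r)" using x by (intro UN_I[of "(b, \<sigma>)"]) auto
  qed
  then have "hausdorff_surf (slice j \<inter> cball p r) \<le> hausdorff_surf (\<Union>k\<in>?I. Csec (fst k) (snd k) \<inter> cball p r)"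
   by (rule hausdorff_mono)
  also have "\<dots> \<le> (\<Sum>k\<in>?I. hausdorff_surf (Csec (fst k) (snd k) \<inter> cball p r))" by (rule hausdorff_UN_le_sum[OF sp]) simp
  also have "\<dots> \<le> (\<Sum>k\<in>?I. ennreal (Kg Lc * r ^ (DIM('a) - 1)))"
  proof (rule sum_mono)
   fix k assume k: "k \<in> ?I"
   show "hausdorff_surf (Csec (fst k) (snd k) \<inter> cball p r) \<le> ennreal (Kg Lc * r ^ (DIM('a) - 1))"
   proof -
    have b: "fst k \<in> Basis - {e}" "snd k \<in> {1, -1}" using k by auto
    then have "fst k \<in> Basis" by simp
    from hausdorff_graph_le[OF dim this Lc r Csec_lip[OF b]] show ?thesis unfolding Kg_def .
   qed
  qed
  also have "\<dots> = ennreal (real (card ?I) * (Kg Lc * r ^ (DIM('a) - 1)))"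
   using Kg_nonneg[OF Lc] rp by (simp add: ennreal_mult' ennreal_of_nat_eq_real_of_nat)
  also have "\<dots> \<le> ennreal (Cs * r ^ (DIM('a) - 1))"
  proof (rule ennreal_leI)
   have "card ?I \<le> 2 * DIM('a)" using e by (simp add: card_cartesian_product card_Diff_singleton)
   then have "real (card ?I) * Kg Lc \<le> 2 * real (DIM('a)) * Kg Lc"
    using Kg_nonneg[OF Lc] by (intro mult_right_mono) linarith+
   then have "real (card ?I) * Kg Lc \<le> Cs" using Kg_nonneg[of 2] by (simp add: Cs_def)
   then show "real (card ?I) * (Kg Lc * r ^ (DIM('a) - 1)) \<le> Cs * r ^ (DIM('a) - 1)"
    unfolding mult.assoc[symmetric] using rp by (rule mult_right_mono)
  qed
  finally show ?thesis .
 qed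
qed

end

section \<open>Shadows of the boundary pieces and the trace estimate\<close>

context cusp
begin

definition cuspN :: "'a measure" where
 "cuspN = density hmeas (\<lambda>x. ennreal (w x) * indicator (frontier \<Omega> \<inter> Cc) x)"

text \<open>Indexed by a coordinate direction and a sign. Sectors may overlap, so the sum of these
  measures dominates the weighted surface measure on the spherical part of the frontier.\<close>

definition capN :: "'a \<times> real \<Rightarrow> 'a measure" where
 "capN k = density hmeas (\<lambda>x. ennreal (w x * indicator (frontier \<Omega>) x) * indicator (Ssec (fst k) (snd k)) x)"

lemma closed_frontier_\<Omega> [measurable]: "frontier \<Omega> \<in> sets borel" "Cc \<in> sets borel"
 using closed_Cc by auto

lemma norm_pr_measurable [measurable]: "(\<lambda>x. norm (pr x)) \<in> borel_measurable borel"
 by (intro borel_measurable_continuous_onI continuous_intros)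

lemma slice_measurable [measurable]: "slice j \<in> sets borel"
proof -
 have "slice j = Cc \<inter> {x \<in> space borel. (1/2) ^ Suc j < norm (pr x) \<and> norm (pr x) \<le> (1/2) ^ j}"
  by (auto simp: slice_def)
 also have "\<dots> \<in> sets borel" by measurable
 finally show ?thesis .
qed

lemma bounded_Cc: "bounded Cc"
 using compact_Cc by (rule compact_imp_bounded)

definition cC :: real where "cC = 2 * (1 + 2 * real (DIM('a))) * Cs * real (DIM('a)) ^ DIM('a)"
text \<open>The constant of \<open>shadow_le_graph\<close> for Lipschitz constant 2 / \<kappa> and
  density at most 1.\<close>

definition cS :: real where "cS = 2 * (1 + 2 / \<kappa> * real (DIM('a))) * (1 * Kg (2 / \<kappa>)) * real (DIM('a)) ^ DIM('a)"

lemma cC_nonneg: "cC \<ge> 0" using Cs_nonneg by (simp add: cC_def)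
lemma cS_nonneg: "cS \<ge> 0" using Kg_nonneg[of "2 / \<kappa>"] \<kappa> by (simp add: cS_def)

lemma slice_shadow:
 assumes "h \<ge> 0"
 shows "shadow_le (density hmeas (\<lambda>x. ennreal (w x) * indicator (slice j) x)) e h cC"
proof -
 let ?n = "real (DIM('a))"
 let ?c = "2 * (1 + 2 ^ Suc j * ?n) * ((1/2) ^ j * Cs) * ?n ^ DIM('a)"
 have A: "shadow_le (density hmeas (\<lambda>x. ennreal (w x) * indicator (slice j) x)) (1 *\<^sub>R e) h ?c"
 proof (rule shadow_le_graph[OF dim e _ _ Cs_nonneg assms])
  show "bounded (slice j)" by (rule bounded_subset[OF bounded_Cc]) (auto simp: slice_def)
  show "\<bar>(x - y) \<bullet> e\<bar> \<le> 2 ^ Suc j * (\<Sum>i\<in>Basis - {e}. \<bar>(x - y) \<bullet> i\<bar>)" if "x \<in> slice j" "y \<in> slice j" for x y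
   by (rule slice_lip[OF that])
  show "hausdorff_surf (slice j \<inter> cball p r) \<le> ennreal (Cs * r ^ (DIM('a) - 1))" if "0 < r" for p r
   by (rule slice_ahlfors[OF that])
  show "w x \<le> (1/2) ^ j" if "x \<in> slice j" for x using that w_Cc[of x] by (simp add: slice_def)
 qed (use w_measurable in auto)
 \<comment> \<open>The weight bound (1/2)^j absorbs the Lipschitz constant: (1 + 2^(j + 1) n)
   (1/2)^j \<le> 1 + 2 n for every j.\<close>
 have B: "?c \<le> cC"
 proof -
  have "(1 + 2 ^ Suc j * ?n) * (1/2) ^ j = (1/2) ^ j + 2 * ?n" by (simp add: power_one_over field_simps)
  also have "\<dots> \<le> 1 + 2 * ?n" by (simp add: power_le_one)
  finally have "(1 + 2 ^ Suc j * ?n) * (1/2) ^ j * (2 * Cs * ?n ^ DIM('a)) \<le> (1 + 2 * ?n) * (2 * Cs * ?n ^ DIM('a))"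
   using Cs_nonneg by (intro mult_right_mono) auto
  then show ?thesis by (simp only: cC_def mult_ac)
 qed
 show ?thesis unfolding shadow_le_def
  by (intro ballI order_trans[OF shadow_leD[OF A[unfolded scaleR_one]] mult_right_mono[OF ennreal_leI[OF B]]]) auto
qed

text \<open>The least n with (1/2)^n < |x'| is positive because |x'| \<le> 1; its predecessor is the
  index of the slice.\<close>

lemma slice_exists:
 assumes "x \<in> Cc" "norm (pr x) > 0"
 shows "\<exists>j. x \<in> slice j"
proof -
 have p: "norm (pr x) \<le> 1" using assms(1) \<gamma>_bounds[of "x \<bullet> e"] by (auto simp: Cc_def g_eq)
 define P where "P n \<longleftrightarrow> (1/2) ^ n < norm (pr x)" for n
 obtain n where "P n" using real_arch_pow_inv[OF assms(2), of "1/2"] by (auto simp: P_def)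
 then have L: "P (LEAST n. P n)" by (rule LeastI)
 have "(LEAST n. P n) \<noteq> 0"
 proof
  assume "(LEAST n. P n) = 0"
  then have "P 0" using L by simp
  then show False using p by (simp add: P_def)
 qed
 then obtain j where j: "(LEAST n. P n) = Suc j" by (cases "LEAST n. P n") auto
 have "\<not> P j" by (rule not_less_Least) (simp add: j)
 then show ?thesis using L assms(1) unfolding j by (auto simp: P_def slice_def)
qed

text \<open>The slices \<open>|x'| \<sim> 2\<^sup>-\<^sup>j\<close> cast disjoint shadows in direction \<open>e\<close>. On each, the weight
 \<open>2\<^sup>-\<^sup>j\<close> compensates the Lipschitz constant \<open>2\<^sup>j\<^sup>+\<^sup>1\<close> of the surface as a graph over
 \<open>e\<^sup>\<bottom>\<close>.\<close>

lemma cusp_shadow: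
 assumes h: "h \<ge> 0"
 shows "shadow_le cuspN e h cC"
 unfolding shadow_le_def
proof
 fix f :: "'a \<Rightarrow> ennreal" assume [measurable]: "f \<in> borel_measurable borel"
 define R where "R j = {y::'a. (1/2) ^ Suc j < norm (pr y) \<and> norm (pr y) \<le> (1/2) ^ j}" for j
 have [measurable]: "R j \<in> sets borel" for j
 proof -
  have "R j = {y \<in> space borel. (1/2) ^ Suc j < norm (pr y) \<and> norm (pr y) \<le> (1/2) ^ j}" by (simp add: R_def)
  also have "\<dots> \<in> sets borel" by measurable
  finally show ?thesis .
 qed
 have R_unique: "i = j" if "y \<in> R i" "y \<in> R j" for y i j
 proof (rule ccontr)
  have aux: False if "y \<in> R i" "y \<in> R j" "i < j" for i j
  proof -
   have "(1/2::real) ^ j \<le> (1/2) ^ Suc i" using that(3) by (intro power_decreasing) auto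
   with that(1,2) show False unfolding R_def mem_Collect_eq by linarith
  qed
  assume "i \<noteq> j"
  then show False using aux that by (metis linorder_neqE_nat)
 qed
 have R_sum: "(\<Sum>j. indicator (R j) y :: ennreal) \<le> 1" for y
 proof (cases "\<exists>i. y \<in> R i")
  case True
  then obtain i where i: "y \<in> R i" by blast
  have "(\<Sum>j. indicator (R j) y :: ennreal) = (\<Sum>j\<in>{i}. indicator (R j) y)"
   using R_unique[OF i] by (intro suminf_finite) (auto simp: indicator_def)
  then show ?thesis by (simp add: i)
 next
  case False
  then have "indicator (R j) y = (0::ennreal)" for j by (simp add: indicator_def)
  then show ?thesis by simp
 qed
 define I where "I f x = (\<integral>\<^sup>+t. indicator {0..h} t * f (x + t *\<^sub>R e) \<partial>lborel)" for f :: "'a \<Rightarrow> ennreal" and x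
 have Im[measurable]: "I f \<in> borel_measurable borel" if [measurable]: "f \<in> borel_measurable borel" for f
  unfolding I_def by measurable
 let ?fj = "\<lambda>j y. f y * indicator (R j) y"
 have "(\<integral>\<^sup>+x. I f x \<partial>cuspN) = (\<integral>\<^sup>+x. ennreal (w x) * indicator (frontier \<Omega> \<inter> Cc) x * I f x \<partial>hmeas)"
  unfolding cuspN_def by (rule nn_integral_density) measurable
 also have "\<dots> \<le> (\<integral>\<^sup>+x. (\<Sum>j. ennreal (w x) * indicator (slice j) x * I (?fj j) x) \<partial>hmeas)"
 proof (rule nn_integral_mono)
  fix x
  show "ennreal (w x) * indicator (frontier \<Omega> \<inter> Cc) x * I f x \<le> (\<Sum>j. ennreal (w x) * indicator (slice j) x * I (?fj j) x)"
  proof (cases "x \<in> Cc \<and> norm (pr x) > 0")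
   case True
   then obtain i where i: "x \<in> slice i" using slice_exists by blast
   \<comment> \<open>Moving along \<open>e\<close> does not change x', so the whole segment stays in
     one shell \<open>R i\<close>.\<close>
   have "x + t *\<^sub>R e \<in> R i" for t using i by (simp add: R_def slice_def)
   then have "I f x = I (?fj i) x" by (simp add: I_def)
   then have "ennreal (w x) * indicator (frontier \<Omega> \<inter> Cc) x * I f x \<le> ennreal (w x) * indicator (slice i) x * I (?fj i) x"
    using i by (intro mult_mono) (auto simp: indicator_def)
   also have "\<dots> \<le> (\<Sum>j. ennreal (w x) * indicator (slice j) x * I (?fj j) x)"
    using sum_le_suminf[of "\<lambda>j. ennreal (w x) * indicator (slice j) x * I (?fj j) x" "{i}"] by simp
   finally show ?thesis .
  next
   \<comment> \<open>The only point of \<open>Cc\<close> outside all slices is the tip, where the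
     weight vanishes.\<close>
   case False
   then have "ennreal (w x) * indicator (frontier \<Omega> \<inter> Cc) x = 0" using w_Cc[of x] by (auto simp: indicator_def)
   then show ?thesis by (simp only: mult_zero_left zero_le)
  qed
 qed
 also have "\<dots> = (\<Sum>j. \<integral>\<^sup>+x. ennreal (w x) * indicator (slice j) x * I (?fj j) x \<partial>hmeas)"
  by (rule nn_integral_suminf) measurable
 also have "\<dots> \<le> (\<Sum>j. ennreal cC * (\<integral>\<^sup>+y. ?fj j y \<partial>lborel))"
 proof (rule suminf_le)
  fix j
  have "(\<integral>\<^sup>+x. ennreal (w x) * indicator (slice j) x * I (?fj j) x \<partial>hmeas) =
    (\<integral>\<^sup>+x. I (?fj j) x \<partial>density hmeas (\<lambda>x. ennreal (w x) * indicator (slice j) x))"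
   by (rule nn_integral_density[symmetric]) measurable
  also have "\<dots> \<le> ennreal cC * (\<integral>\<^sup>+y. ?fj j y \<partial>lborel)"
   unfolding I_def by (rule shadow_leD[OF slice_shadow[OF h]]) measurable
  finally show "(\<integral>\<^sup>+x. ennreal (w x) * indicator (slice j) x * I (?fj j) x \<partial>hmeas) \<le> ennreal cC * (\<integral>\<^sup>+y. ?fj j y \<partial>lborel)" .
 qed auto
 also have "\<dots> = ennreal cC * (\<Sum>j. \<integral>\<^sup>+y. ?fj j y \<partial>lborel)" by simp
 also have "(\<Sum>j. \<integral>\<^sup>+y. ?fj j y \<partial>lborel) = (\<integral>\<^sup>+y. (\<Sum>j. ?fj j y) \<partial>lborel)"
  by (rule nn_integral_suminf[symmetric]) measurable
 also have "ennreal cC * \<dots> \<le> ennreal cC * (\<integral>\<^sup>+y. f y \<partial>lborel)"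
 proof (intro mult_left_mono nn_integral_mono)
  fix y
  have "(\<Sum>j. ?fj j y) = f y * (\<Sum>j. indicator (R j) y)" by simp
  also have "\<dots> \<le> f y * 1" by (intro mult_left_mono R_sum) simp
  finally show "(\<Sum>j. ?fj j y) \<le> f y" by simp
 qed simp
 finally show "(\<integral>\<^sup>+x. (\<integral>\<^sup>+t. indicator {0..h} t * f (x + t *\<^sub>R e) \<partial>lborel) \<partial>cuspN) \<le> ennreal cC * (\<integral>\<^sup>+x. f x \<partial>lborel)"
  by (simp add: I_def)
qed

lemma closed_Ssec: "closed (Ssec b \<sigma>)"
proof -
 have "Ssec b \<sigma> = Sp \<inter> {x. \<kappa> \<le> \<sigma> * ((x - 2 *\<^sub>R e) \<bullet> b)}" by (auto simp: Ssec_def)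
 also have "closed \<dots>" unfolding Sp_def by (intro closed_Int closed_sphere closed_Collect_le continuous_intros)
 finally show ?thesis .
qed

lemma compact_Ssec: "compact (Ssec b \<sigma>)"
proof -
 have "Ssec b \<sigma> \<subseteq> sphere (2 *\<^sub>R e) (sqrt 2)" by (auto simp: Ssec_def Sp_def)
 then show ?thesis using closed_Ssec bounded_subset[OF bounded_sphere] by (simp add: compact_eq_bounded_closed)
qed

lemma Ssec_measurable [measurable]: "Ssec b \<sigma> \<in> sets borel"
 using closed_Ssec by auto

lemma cap_shadow:
 assumes k: "b \<in> Basis" "\<sigma> \<in> {1,-1}" and h: "h \<ge> 0"
 shows "shadow_le (capN (b, \<sigma>)) ((- \<sigma>) *\<^sub>R b) h cS"
 unfolding capN_def cS_def fst_conv snd_conv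
proof (rule shadow_le_graph[OF dim k(1) _ _ _ h])
 show "bounded (Ssec b \<sigma>)" using compact_Ssec by (rule compact_imp_bounded)
 show "\<bar>(x - y) \<bullet> b\<bar> \<le> 2 / \<kappa> * (\<Sum>i\<in>Basis - {b}. \<bar>(x - y) \<bullet> i\<bar>)" if "x \<in> Ssec b \<sigma>" "y \<in> Ssec b \<sigma>" for x y
  by (rule Ssec_lip[OF k that])
 show "hausdorff_surf (Ssec b \<sigma> \<inter> cball p r) \<le> ennreal (Kg (2 / \<kappa>) * r ^ (DIM('a) - 1))" if "0 < r" for p r
  unfolding Kg_def by (rule hausdorff_graph_le[OF dim k(1) _ that]) (use \<kappa> Ssec_lip[OF k] in auto)
 show "w x * indicator (frontier \<Omega>) x \<le> 1" for x using w_bounds[of x] by (auto simp: indicator_def)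
 show "(\<lambda>x. w x * indicator (frontier \<Omega>) x) \<in> borel_measurable borel" by measurable
 show "0 \<le> Kg (2 / \<kappa>)" using \<kappa> by (intro Kg_nonneg) simp
qed (use k \<kappa> in auto)

text \<open>With y = x - 2 e, |y - t \<sigma> b|^2 = 2 - 2 t \<sigma> (y \<bullet> b) + t^2 \<le> 2
  - 2 t \<kappa> + t \<kappa>, which is below 2; this dictates t \<le> \<kappa>.\<close>

lemma Ssec_shift:
 assumes "b \<in> Basis" "\<sigma> \<in> {1,-1}" "x \<in> Ssec b \<sigma>" "0 < t" "t \<le> \<kappa>"
 shows "x + t *\<^sub>R ((- \<sigma>) *\<^sub>R b) \<in> \<Omega>"
proof -
 let ?y = "x - 2 *\<^sub>R e"
 have n: "?y \<bullet> ?y = 2" using assms(3) by (simp add: Ssec_def Sp_def dist_norm norm_minus_commute dot_square_norm)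
 have b: "b \<bullet> b = 1" "\<sigma> * \<sigma> = 1" using assms by auto
 have "(norm (?y + t *\<^sub>R ((- \<sigma>) *\<^sub>R b)))\<^sup>2 = 2 - 2 * t * (\<sigma> * (?y \<bullet> b)) + t\<^sup>2"
 proof -
  have ex: "(norm (z + s *\<^sub>R b))\<^sup>2 = z \<bullet> z + 2 * s * (z \<bullet> b) + s\<^sup>2 * (b \<bullet> b)" for z s
   unfolding power2_norm_eq_inner inner_add_left inner_add_right inner_scaleR_left inner_scaleR_right
   by (simp add: inner_commute[of b z] power2_eq_square distrib_left)
  have "t *\<^sub>R ((- \<sigma>) *\<^sub>R b) = (- (t * \<sigma>)) *\<^sub>R b" by simp
  then have "(norm (?y + t *\<^sub>R ((- \<sigma>) *\<^sub>R b)))\<^sup>2 = ?y \<bullet> ?y + 2 * (- (t * \<sigma>)) * (?y \<bullet> b) + (- (t * \<sigma>))\<^sup>2 * (b \<bullet> b)"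
   by (simp only: ex)
  moreover have "(- (t * \<sigma>))\<^sup>2 = t\<^sup>2" using b(2) by (simp add: power2_eq_square mult_ac)
  ultimately show ?thesis unfolding n b by simp
 qed
 also have "\<dots> < 2"
 proof -
  have "t * \<kappa> \<le> t * (\<sigma> * (?y \<bullet> b))" using assms by (intro mult_left_mono) (auto simp: Ssec_def)
  moreover have "t\<^sup>2 \<le> t * \<kappa>" using assms by (simp add: power2_eq_square)
  moreover have "0 < t * \<kappa>" using assms \<kappa> by simp
  ultimately show ?thesis by linarith
 qed
 finally have "norm (?y + t *\<^sub>R ((- \<sigma>) *\<^sub>R b)) < sqrt 2" by (simp add: real_less_rsqrt)
 moreover have "?y + t *\<^sub>R ((- \<sigma>) *\<^sub>R b) = (x + t *\<^sub>R ((- \<sigma>) *\<^sub>R b)) - 2 *\<^sub>R e" by simp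
 ultimately have "x + t *\<^sub>R ((- \<sigma>) *\<^sub>R b) \<in> ball (2 *\<^sub>R e) (sqrt 2)"
  by (simp only: mem_ball dist_norm norm_minus_commute)
 then show ?thesis by (simp add: cusp_dom_def)
qed

lemma compact_shift:
 assumes "compact P"
 shows "compact ((\<lambda>(x, t). x + t *\<^sub>R (d::'a)) ` (P \<times> {a..b::real}))"
 by (rule compact_continuous_image[OF _ compact_Times[OF assms compact_Icc]])
  (auto simp: case_prod_unfold intro!: continuous_intros)

lemma nn_integral_surf:
 fixes f :: "'a \<Rightarrow> ennreal"
 shows "(\<integral>\<^sup>+x. f x \<partial>surf (frontier \<Omega>)) = (\<integral>\<^sup>+x. f x * indicator (frontier \<Omega>) x \<partial>hmeas)"
 unfolding surf_eq_restrict_hmeas[OF dim closed_frontier_\<Omega>(1)] by (rule nn_integral_restrict_space) simp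

text \<open>Summing the directional inequalities gives the energy the coefficient 2 h c, which a
  short segment length h makes at most \<epsilon>; the price is a coefficient of order 1 / h for the
  square integral over a compact set inside \<Omega>.\<close>

lemma trace_estimate:
 assumes \<epsilon>: "\<epsilon> > 0"
 shows "\<exists>K D. compact K \<and> K \<subseteq> \<Omega> \<and> D \<ge> 0 \<and> (\<forall>u G \<phi>. sob \<Omega> u G \<longrightarrow> continuous_on (closure \<Omega>) \<phi> \<longrightarrow> (\<forall>x\<in>\<Omega>. u x = \<phi> x) \<longrightarrow>
   (\<integral>\<^sup>+x. ennreal (w x * (\<phi> x)\<^sup>2) \<partial>surf (frontier \<Omega>)) \<le>
    ennreal D * (\<integral>\<^sup>+x. ennreal ((u x)\<^sup>2) * indicator K x \<partial>lborel) + ennreal \<epsilon> * (\<integral>\<^sup>+x. ennreal ((norm (G x))\<^sup>2) \<partial>lborel))"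
proof -
 let ?I = "(Basis :: 'a set) \<times> {1,-1::real}"
 define m where "m = real (card ?I)"
 define c where "c = cC + m * cS"
 have c: "c \<ge> 0" using cC_nonneg cS_nonneg by (simp add: c_def m_def)
 \<comment> \<open>h \<le> \<kappa> keeps the segments from the sphere inside \<Omega>, \<kappa>
   \<le> 1 those from the lateral surface, and the second bound gives 2 h c \<le> \<epsilon>; c + 1
   avoids division by zero.\<close>
 define h where "h = min \<kappa> (\<epsilon> / (2 * (c + 1)))"
 have h: "0 < h" "h \<le> \<kappa>" "h \<le> 1" using \<kappa> \<epsilon> c by (auto simp: h_def min_le_iff_disj)
 have hc: "2 * h * c \<le> \<epsilon>"
 proof -
  have "2 * h * c \<le> 2 * (\<epsilon> / (2 * (c + 1))) * (c + 1)" using c h by (intro mult_mono) (auto simp: h_def)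
  moreover have "2 * (\<epsilon> / (2 * (c + 1))) * (c + 1) = \<epsilon>" using c by (simp add: field_simps)
  ultimately show ?thesis by linarith
 qed
 \<comment> \<open>The far halves of the segments, swept from the compact boundary pieces, are again
   compact.\<close>
 define K0 where "K0 = (\<lambda>(x, t). x + t *\<^sub>R e) ` (Cc \<times> {h/2..h})"
 define K1 where "K1 k = (\<lambda>(x, t). x + t *\<^sub>R ((- snd k) *\<^sub>R fst k)) ` (Ssec (fst k) (snd k) \<times> {h/2..h})" for k :: "'a \<times> real"
 define K where "K = K0 \<union> (\<Union>k\<in>?I. K1 k)"
 have cK01: "compact K0" "compact (K1 k)" for k
  unfolding K0_def K1_def by (rule compact_shift[OF compact_Cc] compact_shift[OF compact_Ssec])+
 then have cK: "compact K0" "\<And>k. compact (K1 k)" "compact K" unfolding K_def by (auto intro!: compact_Un compact_UN)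
 have [measurable]: "K0 \<in> sets borel" "\<And>k. K1 k \<in> sets borel" "K \<in> sets borel" using cK by (auto simp: borel_compact)
 have K\<Omega>: "K \<subseteq> \<Omega>"
 proof -
  have "K0 \<subseteq> \<Omega>" unfolding K0_def using h Cc_shift by auto
  moreover have "K1 k \<subseteq> \<Omega>" if "k \<in> ?I" for k
   unfolding K1_def using h Ssec_shift[of "fst k" "snd k"] that by (auto simp del: scaleR_minus_left scaleR_scaleR)
  ultimately show ?thesis unfolding K_def by blast
 qed
 define D where "D = 4 * cC / h + m * (4 * cS / h)"
 have D: "D \<ge> 0" using cC_nonneg cS_nonneg h by (simp add: D_def m_def)
 have "(\<integral>\<^sup>+x. ennreal (w x * (\<phi> x)\<^sup>2) \<partial>surf (frontier \<Omega>)) \<le>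
    ennreal D * (\<integral>\<^sup>+x. ennreal ((u x)\<^sup>2) * indicator K x \<partial>lborel) + ennreal \<epsilon> * (\<integral>\<^sup>+x. ennreal ((norm (G x))\<^sup>2) \<partial>lborel)"
  if sob: "sob \<Omega> u G" and co: "continuous_on (closure \<Omega>) \<phi>" and eq: "\<forall>x\<in>\<Omega>. u x = \<phi> x" for u G \<phi>
 proof -
  have [measurable]: "u \<in> borel_measurable borel" using sob by (simp add: sob_def)
  \<comment> \<open>\<phi> is arbitrary off the closure; cutting it there makes it Borel without
    changing it on \<Omega> or on the frontier.\<close>
  define f where "f x = (if x \<in> closure \<Omega> then \<phi> x else 0)" for x
  have [measurable]: "f \<in> borel_measurable borel"
   unfolding f_def by (rule borel_measurable_continuous_on_if) (use co in auto)
  have fc: "continuous_on (closure \<Omega>) f" using co by (rule continuous_on_eq) (simp add: f_def)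
  have fu: "u x = f x" if "x \<in> \<Omega>" for x using eq that closure_subset by (auto simp: f_def)
  let ?U = "\<integral>\<^sup>+x. ennreal ((u x)\<^sup>2) * indicator K x \<partial>lborel" and ?V = "\<integral>\<^sup>+x. ennreal ((norm (G x))\<^sup>2) \<partial>lborel"
  have mono: "(\<integral>\<^sup>+x. ennreal ((u x)\<^sup>2) * indicator K' x \<partial>lborel) \<le> ?U" if "K' \<subseteq> K" for K'
   using that by (intro nn_integral_mono mult_left_mono) (auto simp: indicator_def)
  have 0: "(\<integral>\<^sup>+x. ennreal ((f x)\<^sup>2) \<partial>cuspN) \<le> ennreal (4 * cC / h) * ?U + ennreal (2 * h * cC) * ?V"
  proof -
   have "(\<integral>\<^sup>+x. ennreal ((f x)\<^sup>2) \<partial>cuspN) \<le> ennreal (4 * cC / h) * (\<integral>\<^sup>+x. ennreal ((u x)\<^sup>2) * indicator K0 x \<partial>lborel) + ennreal (2 * h * cC) * ?V"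
   proof (rule trace_inequality_direction[OF dom sob norm_e fc fu h(1) cusp_shadow cC_nonneg, where P = Cc])
    show "sets cuspN = sets borel" by (simp add: cuspN_def)
    show "AE x in cuspN. x \<in> Cc" unfolding cuspN_def by (subst AE_density) (auto simp: indicator_def)
    show "x + t *\<^sub>R e \<in> \<Omega>" if "x \<in> Cc" "0 < t" "t \<le> h" for x t using Cc_shift that h by auto
    show "x + t *\<^sub>R e \<in> K0" if "x \<in> Cc" "h / 2 \<le> t" "t \<le> h" for x t
     unfolding K0_def using that by (intro image_eqI[of _ _ "(x, t)"]) auto
   qed (use h in auto)
   also have "\<dots> \<le> ennreal (4 * cC / h) * ?U + ennreal (2 * h * cC) * ?V"
    by (intro add_right_mono mult_left_mono mono) (auto simp: K_def)
   finally show ?thesis .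
  qed
  have 1: "(\<integral>\<^sup>+x. ennreal ((f x)\<^sup>2) \<partial>capN k) \<le> ennreal (4 * cS / h) * ?U + ennreal (2 * h * cS) * ?V" if k: "k \<in> ?I" for k
  proof -
   obtain b \<sigma> where k': "k = (b, \<sigma>)" "b \<in> Basis" "\<sigma> \<in> {1,-1}" using k by (elim SigmaE)
   have nd: "norm ((- \<sigma>) *\<^sub>R b) = 1" using k' by auto
   have "(\<integral>\<^sup>+x. ennreal ((f x)\<^sup>2) \<partial>capN k) \<le> ennreal (4 * cS / h) * (\<integral>\<^sup>+x. ennreal ((u x)\<^sup>2) * indicator (K1 k) x \<partial>lborel) + ennreal (2 * h * cS) * ?V"
    unfolding k'(1)
   proof (rule trace_inequality_direction[OF dom sob nd fc fu h(1) cap_shadow[OF k'(2,3)] cS_nonneg, where P = "Ssec b \<sigma>"])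
    show "sets (capN (b, \<sigma>)) = sets borel" by (simp add: capN_def)
    show "AE x in capN (b, \<sigma>). x \<in> Ssec b \<sigma>" unfolding capN_def by (subst AE_density) (auto simp: indicator_def)
    show "x + t *\<^sub>R ((- \<sigma>) *\<^sub>R b) \<in> \<Omega>" if "x \<in> Ssec b \<sigma>" "0 < t" "t \<le> h" for x t
     using Ssec_shift[OF k'(2,3) that(1,2)] that h by simp
    show "x + t *\<^sub>R ((- \<sigma>) *\<^sub>R b) \<in> K1 (b, \<sigma>)" if "x \<in> Ssec b \<sigma>" "h / 2 \<le> t" "t \<le> h" for x t
     unfolding K1_def using that by (intro image_eqI[of _ _ "(x, t)"]) auto
   qed (use h in auto)
   also have "\<dots> \<le> ennreal (4 * cS / h) * ?U + ennreal (2 * h * cS) * ?V"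
    using k by (intro add_right_mono mult_left_mono mono) (auto simp: K_def)
   finally show ?thesis .
  qed
  let ?t = "\<lambda>x. \<Sum>k\<in>?I. ennreal (w x * indicator (frontier \<Omega>) x) * indicator (Ssec (fst k) (snd k)) x * ennreal ((f x)\<^sup>2)"
  have "(\<integral>\<^sup>+x. ennreal (w x * (\<phi> x)\<^sup>2) \<partial>surf (frontier \<Omega>)) = (\<integral>\<^sup>+x. ennreal (w x * (\<phi> x)\<^sup>2) * indicator (frontier \<Omega>) x \<partial>hmeas)"
   by (rule nn_integral_surf)
  also have "\<dots> \<le> (\<integral>\<^sup>+x. ennreal (w x) * indicator (frontier \<Omega> \<inter> Cc) x * ennreal ((f x)\<^sup>2) +
    ?t x \<partial>hmeas)"
  proof (rule nn_integral_mono)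
   fix x
   show "ennreal (w x * (\<phi> x)\<^sup>2) * indicator (frontier \<Omega>) x \<le> ennreal (w x) * indicator (frontier \<Omega> \<inter> Cc) x * ennreal ((f x)\<^sup>2) +
    ?t x"
   proof (cases "x \<in> frontier \<Omega>")
    case True
    then have "x \<in> closure \<Omega>" by (simp add: frontier_def)
    then have fx: "ennreal (w x * (\<phi> x)\<^sup>2) = ennreal (w x) * ennreal ((f x)\<^sup>2)" using w_bounds by (simp add: f_def ennreal_mult')
    consider "x \<in> Cc" | "x \<in> Sp" using frontier_sub True by blast
    then show ?thesis
    proof cases
     case 1
     then show ?thesis using True fx by (simp add: add_increasing2)
    next
     case 2
     then obtain b \<sigma> where k: "b \<in> Basis" "\<sigma> \<in> {1,-1}" "x \<in> Ssec b \<sigma>" using subsetD[OF Sp_cover 2] by (elim UN_E)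
     have "ennreal (w x) * ennreal ((f x)\<^sup>2) = ennreal (w x * indicator (frontier \<Omega>) x) * indicator (Ssec (fst (b, \<sigma>)) (snd (b, \<sigma>))) x * ennreal ((f x)\<^sup>2)"
      using k True by simp
     also have "\<dots> \<le> ?t x" by (rule member_le_sum) (use k in auto)
     finally show ?thesis using True fx by (simp add: add_increasing)
    qed
   qed simp
  qed
  also have "\<dots> = (\<integral>\<^sup>+x. ennreal (w x) * indicator (frontier \<Omega> \<inter> Cc) x * ennreal ((f x)\<^sup>2) \<partial>hmeas) +
    (\<integral>\<^sup>+x. ?t x \<partial>hmeas)" by (rule nn_integral_add) measurable
  also have "(\<integral>\<^sup>+x. ennreal (w x) * indicator (frontier \<Omega> \<inter> Cc) x * ennreal ((f x)\<^sup>2) \<partial>hmeas) = (\<integral>\<^sup>+x. ennreal ((f x)\<^sup>2) \<partial>cuspN)"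
   unfolding cuspN_def by (rule nn_integral_density[symmetric]) measurable
  also have "(\<integral>\<^sup>+x. ?t x \<partial>hmeas) =
    (\<Sum>k\<in>?I. \<integral>\<^sup>+x. ennreal (w x * indicator (frontier \<Omega>) x) * indicator (Ssec (fst k) (snd k)) x * ennreal ((f x)\<^sup>2) \<partial>hmeas)"
   by (rule nn_integral_sum) measurable
  also have "\<dots> = (\<Sum>k\<in>?I. \<integral>\<^sup>+x. ennreal ((f x)\<^sup>2) \<partial>capN k)"
   unfolding capN_def by (intro sum.cong refl nn_integral_density[symmetric]) measurable
  also have "(\<integral>\<^sup>+x. ennreal ((f x)\<^sup>2) \<partial>cuspN) + \<dots> \<le> (ennreal (4 * cC / h) * ?U + ennreal (2 * h * cC) * ?V) +
    (\<Sum>k\<in>?I. ennreal (4 * cS / h) * ?U + ennreal (2 * h * cS) * ?V)" by (intro add_mono 0 sum_mono 1)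
  also have "\<dots> = (ennreal (4 * cC / h) + of_nat (card ?I) * ennreal (4 * cS / h)) * ?U + (ennreal (2 * h * cC) + of_nat (card ?I) * ennreal (2 * h * cS)) * ?V"
   by (simp only: sum_constant distrib_left distrib_right mult.assoc add_ac)
  also have "ennreal (4 * cC / h) + of_nat (card ?I) * ennreal (4 * cS / h) = ennreal D"
   unfolding D_def m_def using cC_nonneg cS_nonneg h
   by (simp add: ennreal_of_nat_eq_real_of_nat ennreal_mult'[symmetric] ennreal_plus[symmetric] del: ennreal_plus)
  also have "ennreal (2 * h * cC) + of_nat (card ?I) * ennreal (2 * h * cS) = ennreal (2 * h * c)"
   unfolding c_def m_def using cC_nonneg cS_nonneg h
   by (simp add: ennreal_of_nat_eq_real_of_nat ennreal_mult'[symmetric] ennreal_plus[symmetric] algebra_simps del: ennreal_plus)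
  also have "ennreal D * ?U + ennreal (2 * h * c) * ?V \<le> ennreal D * ?U + ennreal \<epsilon> * ?V"
   by (intro add_left_mono mult_right_mono ennreal_leI hc) simp
  finally show ?thesis .
 qed
 then show ?thesis using cK(3) K\<Omega> D by (intro exI[of _ K] exI[of _ D] conjI allI impI)
qed

end

section \<open>Closure of smooth elements\<close>

lemma squeeze_zero:
 fixes f g :: "nat \<Rightarrow> real"
 assumes "g \<longlonglongrightarrow> 0" "\<And>k. 0 \<le> f k" "\<And>k. f k \<le> g k"
 shows "f \<longlonglongrightarrow> 0"
 by (rule tendsto_sandwich[OF _ _ tendsto_const assms(1)]) (simp_all add: assms)

context psd_form begin

lemma square_add_le:
 assumes "x \<in> H" "y \<in> H"
 shows "f (x + y) (x + y) \<le> 2 * f x x + 2 * f y y"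
 using nonneg[OF H_diff[OF assms]] by (simp add: square_add[OF assms] square_diff[OF assms])

lemma square_diff_le:
 assumes "x \<in> H" "y \<in> H" "z \<in> H"
 shows "f (x - z) (x - z) \<le> 2 * f (x - y) (x - y) + 2 * f (y - z) (y - z)"
 using square_add_le[OF H_diff[OF assms(1,2)] H_diff[OF assms(2,3)]] by simp

end

text \<open>\<open>V\<close> is complete for \<open>a\<close> and \<open>b\<close> jointly, and on
  \<open>C\<close> the form \<open>b\<close> is dominated by \<open>a\<close>. The domination passes
  to the closure of \<open>C\<close>, where Cauchy sequences for \<open>a\<close> alone therefore
  converge.\<close>

locale form_closure = a: psd_form V a + b: psd_form V b
 for V :: "'v::real_vector set" and a b :: "'v \<Rightarrow> 'v \<Rightarrow> real" +
 fixes C :: "'v set" and K :: real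
 assumes C_sub: "subspace C" and C_V: "C \<subseteq> V"
  and C_le: "x \<in> C \<Longrightarrow> b x x \<le> K * a x x" and K_nonneg: "K \<ge> 0"
  and V_complete: "\<lbrakk>\<And>k. X k \<in> V;
    \<And>\<epsilon>. \<epsilon> > 0 \<Longrightarrow> \<exists>N. \<forall>k\<ge>N. \<forall>l\<ge>N. a (X k - X l) (X k - X l) < \<epsilon>;
    \<And>\<epsilon>. \<epsilon> > 0 \<Longrightarrow> \<exists>N. \<forall>k\<ge>N. \<forall>l\<ge>N. b (X k - X l) (X k - X l) < \<epsilon>\<rbrakk>
   \<Longrightarrow> \<exists>x\<in>V. (\<lambda>k. a (X k - x) (X k - x)) \<longlonglongrightarrow> 0 \<and> (\<lambda>k. b (X k - x) (X k - x)) \<longlonglongrightarrow> 0"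
begin

definition approx :: "(nat \<Rightarrow> 'v) \<Rightarrow> 'v \<Rightarrow> bool" where
 "approx X x \<longleftrightarrow> (\<lambda>k. a (X k - x) (X k - x)) \<longlonglongrightarrow> 0 \<and> (\<lambda>k. b (X k - x) (X k - x)) \<longlonglongrightarrow> 0"

definition clos :: "'v set" where
 "clos = {x \<in> V. \<exists>X. (\<forall>k. X k \<in> C) \<and> approx X x}"

lemma clos_V: "x \<in> clos \<Longrightarrow> x \<in> V"
 by (simp add: clos_def)

lemma closE:
 assumes "x \<in> clos"
 obtains X where "\<And>k. X k \<in> C" "\<And>k. X k \<in> V" "x \<in> V" "approx X x" using assms C_V unfolding clos_def by blast

lemma C_clos: "x \<in> C \<Longrightarrow> x \<in> clos"
 using C_V by (auto simp: clos_def approx_def a.zero_left b.zero_left a.H_0 intro!: exI[of _ "\<lambda>_. x"])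

lemma subspace_clos: "subspace clos"
proof (rule subspaceI)
 show "0 \<in> clos" by (rule C_clos[OF subspace_0[OF C_sub]])
next
 fix x y assume "x \<in> clos" "y \<in> clos"
 obtain X where X: "\<And>k. X k \<in> C" "\<And>k. X k \<in> V" "x \<in> V" "approx X x" using \<open>x \<in> clos\<close> by (rule closE) (rule that; blast)
 obtain Y where Y: "\<And>k. Y k \<in> C" "\<And>k. Y k \<in> V" "y \<in> V" "approx Y y" using \<open>y \<in> clos\<close> by (rule closE) (rule that; blast)
 have *: "(\<lambda>k. f (X k + Y k - (x + y)) (X k + Y k - (x + y))) \<longlonglongrightarrow> 0"
  if f: "psd_form V f" and lx: "(\<lambda>k. f (X k - x) (X k - x)) \<longlonglongrightarrow> 0" and ly: "(\<lambda>k. f (Y k - y) (Y k - y)) \<longlonglongrightarrow> 0" for f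
 proof -
  interpret f: psd_form V f by (rule f)
  have e: "X k + Y k - (x + y) = (X k - x) + (Y k - y)" for k by simp
  have "(\<lambda>k. 2 * f (X k - x) (X k - x) + 2 * f (Y k - y) (Y k - y)) \<longlonglongrightarrow> 2 * 0 + 2 * 0" by (intro tendsto_intros lx ly)
  then have l: "(\<lambda>k. 2 * f (X k - x) (X k - x) + 2 * f (Y k - y) (Y k - y)) \<longlonglongrightarrow> 0" by simp
  show ?thesis unfolding e by (rule squeeze_zero[OF l f.nonneg f.square_add_le]) (intro f.H_add f.H_diff X Y)+
 qed
 have "approx (\<lambda>k. X k + Y k) (x + y)"
  using X(4) Y(4) *[OF a.psd_form_axioms] *[OF b.psd_form_axioms] by (simp add: approx_def)
 then show "x + y \<in> clos" unfolding clos_def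
  using X(1,3) Y(1,3) by (auto intro!: exI[of _ "\<lambda>k. X k + Y k"] a.H_add subspace_add[OF C_sub])
next
 fix c x assume "x \<in> clos"
 then obtain X where X: "\<And>k. X k \<in> C" "\<And>k. X k \<in> V" "x \<in> V" "approx X x" by (rule closE) (rule that; blast)
 have e: "c *\<^sub>R X k - c *\<^sub>R x = c *\<^sub>R (X k - x)" for k by (simp add: scaleR_diff_right)
 have "approx (\<lambda>k. c *\<^sub>R X k) (c *\<^sub>R x)"
  using X(4) unfolding approx_def e a.square_scale[OF a.H_diff[OF X(2,3)]] b.square_scale[OF b.H_diff[OF X(2,3)]]
  by (auto intro: tendsto_mult_right_zero)
 then show "c *\<^sub>R x \<in> clos" unfolding clos_def
  using X(1,3) by (auto intro!: exI[of _ "\<lambda>k. c *\<^sub>R X k"] a.H_scale subspace_scale[OF C_sub])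
qed

text \<open>Diagonal choice: the k-th term is replaced by an element of \<open>C\<close> within 1 /
  (k + 1) for both forms.\<close>

lemma clos_closed:
 assumes Y: "\<And>k. Y k \<in> clos" and x: "x \<in> V" and lim: "approx Y x"
 shows "x \<in> clos"
proof -
 have YV: "Y k \<in> V" for k using Y clos_V by blast
 have "\<exists>c. c \<in> C \<and> a (c - Y k) (c - Y k) < inverse (real (Suc k)) \<and> b (c - Y k) (c - Y k) < inverse (real (Suc k))" (is "\<exists>c. ?P k c") for k
 proof -
  obtain X where X: "\<And>l. X l \<in> C" "approx X (Y k)" using Y[of k] by (rule closE) (rule that; blast)
  have "\<forall>\<^sub>F l in sequentially. a (X l - Y k) (X l - Y k) < inverse (real (Suc k)) \<and> b (X l - Y k) (X l - Y k) < inverse (real (Suc k))"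
   using X(2) unfolding approx_def by (intro eventually_conj order_tendstoD(2)[where y = 0]) auto
  then obtain l where "a (X l - Y k) (X l - Y k) < inverse (real (Suc k)) \<and> b (X l - Y k) (X l - Y k) < inverse (real (Suc k))"
   by (auto simp: eventually_sequentially)
  then show ?thesis using X(1)[of l] by (intro exI[of _ "X l"]) simp
 qed
 then have "\<forall>k. \<exists>c. ?P k c" by (rule allI)
 from choice[OF this] obtain X where "\<forall>k. ?P k (X k)" by (elim exE)
 then have X: "\<And>k. X k \<in> C" "\<And>k. a (X k - Y k) (X k - Y k) < inverse (real (Suc k))"
  "\<And>k. b (X k - Y k) (X k - Y k) < inverse (real (Suc k))" by simp_all
 have XV: "X k \<in> V" for k using X(1) C_V by blast
 have *: "(\<lambda>k. f (X k - x) (X k - x)) \<longlonglongrightarrow> 0"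
  if f: "psd_form V f" and l: "(\<lambda>k. f (Y k - x) (Y k - x)) \<longlonglongrightarrow> 0" and s: "\<And>k. f (X k - Y k) (X k - Y k) < inverse (real (Suc k))" for f
 proof -
  interpret f: psd_form V f by (rule f)
  have lim0: "(\<lambda>k. 2 * inverse (real (Suc k)) + 2 * f (Y k - x) (Y k - x)) \<longlonglongrightarrow> 2 * 0 + 2 * 0"
   by (intro tendsto_intros l LIMSEQ_inverse_real_of_nat)
  have le: "f (X k - x) (X k - x) \<le> 2 * inverse (real (Suc k)) + 2 * f (Y k - x) (Y k - x)" for k
   using f.square_diff_le[OF XV YV x, of k k] s[of k] by linarith
  show ?thesis by (rule squeeze_zero[OF _ f.nonneg[OF f.H_diff[OF XV x]] le]) (use lim0 in simp)
 qed
 have "approx X x" using lim *[OF a.psd_form_axioms _ X(2)] *[OF b.psd_form_axioms _ X(3)] by (simp add: approx_def)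
 then show ?thesis unfolding clos_def using X(1) x by auto
qed

lemma clos_le:
 assumes "x \<in> clos"
 shows "b x x \<le> K * a x x"
proof -
 obtain X where X: "\<And>k. X k \<in> C" "\<And>k. X k \<in> V" "x \<in> V" "approx X x" using assms by (rule closE) (rule that; blast)
 have la: "(\<lambda>k. a (X k) (X k)) \<longlonglongrightarrow> a x x" and lb: "(\<lambda>k. b (X k) (X k)) \<longlonglongrightarrow> b x x"
  using X(2-4) a.tendsto_square b.tendsto_square by (auto simp: approx_def)
 show ?thesis by (rule LIMSEQ_le[OF lb tendsto_mult_left[OF la]]) (use C_le X(1) in auto)
qed

text \<open>Both sides are continuous along approximating sequences, the functionals because they
  are a-bounded.\<close>

lemma clos_compact:
 fixes l :: "nat \<Rightarrow> 'v \<Rightarrow> real"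
 assumes lin: "\<And>i x y. \<lbrakk>i < n; x \<in> V; y \<in> V\<rbrakk> \<Longrightarrow> l i (x - y) = l i x - l i y"
  and bd: "\<And>i x. \<lbrakk>i < n; x \<in> V\<rbrakk> \<Longrightarrow> (l i x)\<^sup>2 \<le> D * a x x"
  and C: "\<And>x. x \<in> C \<Longrightarrow> b x x \<le> \<epsilon> * a x x + (\<Sum>i<n. (l i x)\<^sup>2)"
  and x: "x \<in> clos"
 shows "b x x \<le> \<epsilon> * a x x + (\<Sum>i<n. (l i x)\<^sup>2)"
proof -
 obtain X where X: "\<And>k. X k \<in> C" "\<And>k. X k \<in> V" "x \<in> V" "approx X x" using x by (rule closE) (rule that; blast)
 have la: "(\<lambda>k. a (X k) (X k)) \<longlonglongrightarrow> a x x" and lb: "(\<lambda>k. b (X k) (X k)) \<longlonglongrightarrow> b x x"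
  using X(2-4) a.tendsto_square b.tendsto_square by (auto simp: approx_def)
 have ll: "(\<lambda>k. l i (X k)) \<longlonglongrightarrow> l i x" if i: "i < n" for i
 proof -
  have l0: "(\<lambda>k. D * a (X k - x) (X k - x)) \<longlonglongrightarrow> 0" using X(4) by (auto simp: approx_def intro: tendsto_mult_right_zero)
  have le: "(l i (X k) - l i x)\<^sup>2 \<le> D * a (X k - x) (X k - x)" for k
   using bd[OF i a.H_diff[OF X(2,3)], of k] lin[OF i X(2,3), of k] by simp
  have "(\<lambda>k. (l i (X k) - l i x)\<^sup>2) \<longlonglongrightarrow> 0" by (rule squeeze_zero[OF l0 _ le]) simp
  then have "(\<lambda>k. l i (X k) - l i x) \<longlonglongrightarrow> 0" by simp
  then show ?thesis by (simp add: LIM_zero_iff)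
 qed
 show ?thesis
 proof (rule LIMSEQ_le[OF lb])
  show "(\<lambda>k. \<epsilon> * a (X k) (X k) + (\<Sum>i<n. (l i (X k))\<^sup>2)) \<longlonglongrightarrow> \<epsilon> * a x x + (\<Sum>i<n. (l i x)\<^sup>2)"
   by (intro tendsto_intros la ll) simp
 qed (use C X(1) in auto)
qed

lemma clos_complete:
 assumes X: "\<And>k. X k \<in> clos" and ca: "\<And>\<epsilon>. \<epsilon> > 0 \<Longrightarrow> \<exists>N. \<forall>k\<ge>N. \<forall>l\<ge>N. a (X k - X l) (X k - X l) < \<epsilon>"
 shows "\<exists>x\<in>clos. (\<lambda>k. a (X k - x) (X k - x)) \<longlonglongrightarrow> 0"
proof -
 have cb: "\<exists>N. \<forall>k\<ge>N. \<forall>l\<ge>N. b (X k - X l) (X k - X l) < \<epsilon>" if \<epsilon>: "\<epsilon> > 0" for \<epsilon>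
 proof -
  obtain N where N: "\<forall>k\<ge>N. \<forall>l\<ge>N. a (X k - X l) (X k - X l) < \<epsilon> / (K + 1)"
   using ca[of "\<epsilon> / (K + 1)"] \<epsilon> K_nonneg by auto
  have "b (X k - X l) (X k - X l) < \<epsilon>" if "k \<ge> N" "l \<ge> N" for k l
  proof -
   let ?d = "X k - X l"
   have d: "?d \<in> clos" by (intro subspace_diff[OF subspace_clos] X)
   have "b ?d ?d \<le> (K + 1) * a ?d ?d" using clos_le[OF d] a.nonneg[OF clos_V[OF d]] by (simp add: distrib_right)
   also have "\<dots> < (K + 1) * (\<epsilon> / (K + 1))" using N that K_nonneg by (intro mult_strict_left_mono) auto
   finally show ?thesis using K_nonneg by simp
  qed
  then show ?thesis by blast
 qed
 obtain x where x: "x \<in> V" "approx X x" using V_complete[of X, OF clos_V[OF X] ca cb] unfolding approx_def by blast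
 then have "x \<in> clos" by (rule clos_closed[OF X])
 then show ?thesis using x(2) by (auto simp: approx_def)
qed

end

section \<open>Square integrable functions as a vector space with a semidefinite form\<close>

instantiation "fun" :: (type, real_vector) real_vector
begin

definition scaleR_fun :: "real \<Rightarrow> ('a \<Rightarrow> 'b) \<Rightarrow> 'a \<Rightarrow> 'b" where
 "scaleR_fun c f = (\<lambda>x. c *\<^sub>R f x)"

instance by standard (auto simp: scaleR_fun_def fun_eq_iff algebra_simps scaleR_add_left scaleR_add_right)

end

definition L2 :: "'a measure \<Rightarrow> ('a \<Rightarrow> 'b::euclidean_space) set" where
 "L2 M = {f \<in> borel_measurable M. integrable M (\<lambda>x. (norm (f x))\<^sup>2)}"

definition L2_inner :: "'a measure \<Rightarrow> ('a \<Rightarrow> 'b::euclidean_space) \<Rightarrow> ('a \<Rightarrow> 'b) \<Rightarrow> real" where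
 "L2_inner M f g = (LINT x|M. f x \<bullet> g x)"

lemma L2_measurable [measurable_dest]: "f \<in> L2 M \<Longrightarrow> f \<in> borel_measurable M"
 by (simp add: L2_def)

lemma L2_integrable_inner:
 assumes f: "f \<in> L2 M" and g: "g \<in> L2 M"
 shows "integrable M (\<lambda>x. f x \<bullet> g x)"
proof (rule integrable_dominated)
 show "integrable M (\<lambda>x. (norm (f x))\<^sup>2 + (norm (g x))\<^sup>2)" using f g by (auto simp: L2_def)
 have "\<bar>f x \<bullet> g x\<bar> \<le> (norm (f x))\<^sup>2 + (norm (g x))\<^sup>2" for x
 proof -
  have "\<bar>f x \<bullet> g x\<bar> \<le> norm (f x) * norm (g x)" by (rule Cauchy_Schwarz_ineq2)
  moreover have "0 \<le> (norm (f x) - norm (g x))\<^sup>2" by simp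
  then have "2 * (norm (f x) * norm (g x)) \<le> (norm (f x))\<^sup>2 + (norm (g x))\<^sup>2"
   by (simp add: power2_eq_square algebra_simps)
  moreover have "0 \<le> norm (f x) * norm (g x)" by simp
  ultimately show ?thesis by linarith
 qed
 then show "AE x in M. norm (f x \<bullet> g x) \<le> norm ((norm (f x))\<^sup>2 + (norm (g x))\<^sup>2)" by simp
qed (use f g in measurable)

lemma psd_form_L2: "psd_form (L2 M :: ('a \<Rightarrow> 'b::euclidean_space) set) (L2_inner M)"
proof
 show "subspace (L2 M :: ('a \<Rightarrow> 'b) set)"
 proof (rule subspaceI)
  show "(0 :: 'a \<Rightarrow> 'b) \<in> L2 M" by (simp add: L2_def zero_fun_def)
 next
  fix f g :: "'a \<Rightarrow> 'b" assume fg: "f \<in> L2 M" "g \<in> L2 M"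
  have e: "(norm (f x + g x))\<^sup>2 = (norm (f x))\<^sup>2 + 2 * (f x \<bullet> g x) + (norm (g x))\<^sup>2" for x
   by (simp add: power2_norm_eq_inner inner_add_left inner_add_right inner_commute)
  have "integrable M (\<lambda>x. (norm (f x))\<^sup>2 + 2 * (f x \<bullet> g x) + (norm (g x))\<^sup>2)"
   using fg L2_integrable_inner[OF fg] by (auto simp: L2_def)
  then show "f + g \<in> L2 M" using fg by (auto simp: L2_def plus_fun_def e)
 next
  fix c and f :: "'a \<Rightarrow> 'b" assume "f \<in> L2 M"
  then show "c *\<^sub>R f \<in> L2 M" by (auto simp: L2_def scaleR_fun_def power_mult_distrib)
 qed
next
 fix f g h :: "'a \<Rightarrow> 'b" assume "f \<in> L2 M" "g \<in> L2 M" "h \<in> L2 M"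
 then show "L2_inner M (f + g) h = L2_inner M f h + L2_inner M g h"
  by (simp add: L2_inner_def plus_fun_def inner_add_left L2_integrable_inner)
qed (auto simp: L2_inner_def scaleR_fun_def inner_commute)

interpretation L2: psd_form "L2 M" "L2_inner M" for M by (rule psd_form_L2)

lemma L2_inner_self:
 assumes "f \<in> L2 M"
 shows "ennreal (L2_inner M f f) = (\<integral>\<^sup>+x. ennreal ((norm (f x))\<^sup>2) \<partial>M)"
 using assms by (simp add: L2_inner_def L2_def dot_square_norm nn_integral_eq_integral)

lemma L2_inner_self_diff:
 assumes "f \<in> L2 M" "g \<in> L2 M"
 shows "ennreal (L2_inner M (f - g) (f - g)) = (\<integral>\<^sup>+x. ennreal ((norm (f x - g x))\<^sup>2) \<partial>M)"
 using L2_inner_self[OF L2.H_diff[OF assms]] by simp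

lemma L2_null_iff:
 assumes "f \<in> L2 M"
 shows "L2_inner M f f = 0 \<longleftrightarrow> (AE x in M. f x = 0)"
 using assms integral_nonneg_eq_0_iff_AE[of M "\<lambda>x. (norm (f x))\<^sup>2"] by (simp add: L2_inner_def L2_def dot_square_norm)

lemma tendsto_L2_iff:
 assumes "\<And>k. F k \<in> L2 M" "f \<in> L2 M"
 shows "(\<lambda>k. \<integral>\<^sup>+x. ennreal ((norm (F k x - f x))\<^sup>2) \<partial>M) \<longlonglongrightarrow> 0 \<longleftrightarrow> (\<lambda>k. L2_inner M (F k - f) (F k - f)) \<longlonglongrightarrow> 0"
proof -
 have n: "L2_inner M (F k - f) (F k - f) \<ge> 0" for k by (intro L2.nonneg L2.H_diff assms)
 show ?thesis unfolding L2_inner_self_diff[OF assms, symmetric]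
  using tendsto_ennreal_iff[of "\<lambda>k. L2_inner M (F k - f) (F k - f)" sequentially 0] n
  by (simp add: ennreal_0[symmetric] del: ennreal_0)
qed

lemma L2_of_tendsto:
 assumes F: "\<And>k. F k \<in> L2 M" and [measurable]: "f \<in> borel_measurable M"
  and lim: "(\<lambda>k. \<integral>\<^sup>+x. ennreal ((norm (F k x - f x))\<^sup>2) \<partial>M) \<longlonglongrightarrow> 0"
 shows "f \<in> L2 M"
proof -
 have "\<forall>\<^sub>F k in sequentially. (\<integral>\<^sup>+x. ennreal ((norm (F k x - f x))\<^sup>2) \<partial>M) < 1"
  by (rule order_tendstoD(2)[OF lim]) simp
 then obtain k where k: "(\<integral>\<^sup>+x. ennreal ((norm (F k x - f x))\<^sup>2) \<partial>M) < 1" by (auto simp: eventually_sequentially)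
 have [measurable]: "F k \<in> borel_measurable M" using F by (rule L2_measurable)
 have "(\<lambda>x. F k x - f x) \<in> L2 M" unfolding L2_def
  using k by (auto intro!: integrableI_bounded order.strict_trans[OF k])
 then have "F k - (\<lambda>x. F k x - f x) \<in> L2 M" by (intro L2.H_diff F)
 then show ?thesis by (simp add: fun_diff_def)
qed

lemma L2_inner_complete:
 assumes F: "\<And>k. F k \<in> L2 M"
  and c: "\<And>\<epsilon>. \<epsilon> > 0 \<Longrightarrow> \<exists>N. \<forall>k\<ge>N. \<forall>l\<ge>N. L2_inner M (F k - F l) (F k - F l) < \<epsilon>"
 shows "\<exists>f\<in>L2 M. (\<lambda>k. L2_inner M (F k - f) (F k - f)) \<longlonglongrightarrow> 0"
proof -
 have "\<exists>N. \<forall>k\<ge>N. \<forall>l\<ge>N. (\<integral>\<^sup>+x. ennreal ((norm (F k x - F l x))\<^sup>2) \<partial>M) \<le> ennreal \<epsilon>" if "\<epsilon> > 0" for \<epsilon>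
  using c[OF that] unfolding L2_inner_self_diff[OF F F, symmetric] by (meson ennreal_leI less_imp_le)
 then obtain f where f: "f \<in> borel_measurable M" "(\<lambda>k. \<integral>\<^sup>+x. ennreal ((norm (F k x - f x))\<^sup>2) \<partial>M) \<longlonglongrightarrow> 0"
  using L2_complete[of F M, OF L2_measurable[OF F]] by blast
 have "f \<in> L2 M" by (rule L2_of_tendsto[OF F f])
 then show ?thesis using f(2) tendsto_L2_iff[OF F \<open>f \<in> L2 M\<close>] by (intro bexI[of _ f]) simp_all
qed

lemma L2_inner_distr:
 assumes R: "R \<in> M \<rightarrow>\<^sub>M M" "distr M M R = M" and f: "f \<in> L2 M" and g: "g \<in> L2 M"
 shows "L2_inner M (\<lambda>x. f (R x)) (\<lambda>x. g (R x)) = L2_inner M f g"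
proof -
 have "L2_inner M f g = (LINT x|distr M M R. f x \<bullet> g x)" by (simp add: R L2_inner_def)
 also have "\<dots> = (LINT x|M. f (R x) \<bullet> g (R x))" by (intro integral_distr R borel_measurable_inner L2_measurable f g)
 finally show ?thesis by (simp add: L2_inner_def)
qed

lemma L2_distr:
 assumes R: "R \<in> M \<rightarrow>\<^sub>M M" "distr M M R = M" and f: "f \<in> L2 M"
 shows "(\<lambda>x. f (R x)) \<in> L2 M"
proof -
 have "integrable (distr M M R) (\<lambda>x. (norm (f x))\<^sup>2)" using f R by (simp add: L2_def)
 then have "integrable M (\<lambda>x. (norm (f (R x)))\<^sup>2)" by (rule integrable_distr[OF R(1)])
 moreover have "(\<lambda>x. f (R x)) \<in> borel_measurable M" by (rule measurable_compose[OF R(1) L2_measurable[OF f]])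
 ultimately show ?thesis by (simp add: L2_def)
qed

lemma distr_restrict_space:
 assumes R: "R \<in> M \<rightarrow>\<^sub>M M" "distr M M R = M" and RR: "\<And>x. R (R x) = x" and S: "R ` S \<subseteq> S" and SM: "S \<inter> space M \<in> sets M"
 shows "R \<in> restrict_space M S \<rightarrow>\<^sub>M restrict_space M S" (is ?A)
  and "distr (restrict_space M S) (restrict_space M S) R = restrict_space M S" (is ?B)
proof -
 \<comment> \<open>An involution that maps \<open>S\<close> into itself also maps the complement
   into itself.\<close>
 have RS: "R x \<in> S \<longleftrightarrow> x \<in> S" for x using S RR by (metis image_subset_iff)
 have sp: "R x \<in> space M" if "x \<in> space M" for x by (rule measurable_space[OF R(1) that])
 show A: ?A
  by (rule measurable_restrict_space2) (use S sp in \<open>auto intro!: measurable_restrict_space1 R simp: space_restrict_space\<close>)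
 show ?B
 proof (rule measure_eqI)
  fix A assume "A \<in> sets (distr (restrict_space M S) (restrict_space M S) R)"
  then have A': "A \<in> sets (restrict_space M S)" by simp
  then have AM: "A \<in> sets M" "A \<subseteq> S" using SM by (auto simp: sets_restrict_space_iff)
  have "R -` A \<inter> space (restrict_space M S) = R -` A \<inter> space M" using AM RS by (auto simp: space_restrict_space)
  then have "emeasure (distr (restrict_space M S) (restrict_space M S) R) A = emeasure (restrict_space M S) (R -` A \<inter> space M)"
   using A' A by (simp add: emeasure_distr)
  also have "\<dots> = emeasure M (R -` A \<inter> space M)" using AM RS SM by (intro emeasure_restrict_space) auto
  also have "\<dots> = emeasure (distr M M R) A" by (rule emeasure_distr[symmetric, OF R(1) AM(1)])
  also have "\<dots> = emeasure (restrict_space M S) A" using AM SM R by (simp add: emeasure_restrict_space)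
  finally show "emeasure (distr (restrict_space M S) (restrict_space M S) R) A = emeasure (restrict_space M S) A" .
 qed simp
qed

lemma distr_density_invariant:
 fixes w :: "'a \<Rightarrow> ennreal"
 assumes R: "R \<in> M \<rightarrow>\<^sub>M M" "distr M M R = M" and w: "w \<in> borel_measurable M" "\<And>x. x \<in> space M \<Longrightarrow> w (R x) = w x"
 shows "R \<in> density M w \<rightarrow>\<^sub>M density M w" (is ?A) and "distr (density M w) (density M w) R = density M w" (is ?B)
proof -
 show A: ?A using R(1) by (simp cong: measurable_cong_sets)
 show ?B
 proof (rule measure_eqI)
  fix A assume "A \<in> sets (distr (density M w) (density M w) R)"
  then have AM: "A \<in> sets M" by simp
  then have "emeasure (distr (density M w) (density M w) R) A = emeasure (density M w) (R -` A \<inter> space M)"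
   using A by (simp add: emeasure_distr)
  also have "\<dots> = (\<integral>\<^sup>+x. w x * indicator (R -` A \<inter> space M) x \<partial>M)"
   using w AM R by (intro emeasure_density measurable_sets) auto
  also have "\<dots> = (\<integral>\<^sup>+x. w (R x) * indicator A (R x) \<partial>M)"
   using w by (intro nn_integral_cong) (auto simp: indicator_def)
  also have "\<dots> = (\<integral>\<^sup>+x. w x * indicator A x \<partial>distr M M R)" using w AM R by (intro nn_integral_distr[symmetric]) auto
  also have "\<dots> = emeasure (density M w) A" using w AM R by (simp add: emeasure_density)
  finally show "emeasure (distr (density M w) (density M w) R) A = emeasure (density M w) A" .
 qed simp
qed

section \<open>Classical derivatives as weak gradients\<close>

lemma integrable_bounded_compact_support:
 fixes f :: "'a::euclidean_space \<Rightarrow> real"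
 assumes "f \<in> borel_measurable borel" "S \<in> sets borel" "bounded S" "\<And>x. \<bar>f x\<bar> \<le> B * indicator S x"
 shows "integrable lborel f"
proof (rule integrable_dominated)
 show "integrable lborel (\<lambda>x. B * indicator S x)"
  using assms(2) emeasure_bounded_finite[OF assms(3)] by (intro integrable_mult_right integrable_real_indicator) auto
 have "norm (f x) \<le> norm (B * indicator S x)" for x using assms(4)[of x] by simp
 then show "AE x in lborel. norm (f x) \<le> norm (B * indicator S x)" by simp
qed (use assms(1) in simp)

text \<open>Difference quotients integrate to zero by translation invariance. The mean value theorem
  bounds them by the bound of the derivative on a fixed compact set, and dominated convergence leads
  to the derivative.\<close>

lemma integral_partial_derivative:
 fixes \<psi> :: "'a::euclidean_space \<Rightarrow> real"
 assumes der: "\<And>x. (\<psi> has_derivative \<psi>' x) (at x)" and cont: "continuous_on UNIV (\<lambda>x. \<psi>' x b)"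
  and S: "compact S" "\<And>x. x \<notin> S \<Longrightarrow> \<psi> x = 0" "\<And>x. x \<notin> S \<Longrightarrow> \<psi>' x b = 0"
 shows "(LINT x|lborel. \<psi>' x b) = 0"
proof -
 have c\<psi>: "continuous_on UNIV \<psi>" by (intro continuous_at_imp_continuous_on ballI has_derivative_continuous[OF der])
 have [measurable]: "\<psi> \<in> borel_measurable borel" "(\<lambda>x. \<psi>' x b) \<in> borel_measurable borel"
  using c\<psi> cont by (auto intro: borel_measurable_continuous_onI)
 obtain B where B: "B \<ge> 0" "\<And>x. \<bar>\<psi>' x b\<bar> \<le> B" using continuous_compact_support_bounded[OF cont S(1,3)] by blast
 obtain A where A: "A \<ge> 0" "\<And>x. \<bar>\<psi> x\<bar> \<le> A" using continuous_compact_support_bounded[OF c\<psi> S(1,2)] by blast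
 \<comment> \<open>\<open>S\<close> swept backwards by the unit segment along \<open>b\<close>:
   outside it all difference quotients with step at most 1 vanish.\<close>
 define S' where "S' = (\<lambda>(x, t). x + t *\<^sub>R (- b)) ` (S \<times> {0..1::real})"
 have cS': "compact S'" unfolding S'_def by (rule compact_continuous_image[OF _ compact_Times[OF S(1) compact_Icc]])
   (auto simp: case_prod_unfold intro!: continuous_intros)
 have S': "x + t *\<^sub>R b \<notin> S" if "x \<notin> S'" "0 \<le> t" "t \<le> 1" for x t
 proof
  assume "x + t *\<^sub>R b \<in> S"
  then have "x \<in> S'" unfolding S'_def using that by (intro image_eqI[of _ _ "(x + t *\<^sub>R b, t)"]) auto
  then show False using that by simp
 qed
 have line: "((\<lambda>t. \<psi> (x + t *\<^sub>R b)) has_real_derivative \<psi>' (x + t *\<^sub>R b) b) (at t)" for x t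
 proof -
  have "((\<lambda>t. x + t *\<^sub>R b) has_derivative (\<lambda>h. h *\<^sub>R b)) (at t)" by (auto intro!: derivative_eq_intros)
  from has_derivative_compose[OF this der]
  have "((\<lambda>t. \<psi> (x + t *\<^sub>R b)) has_derivative (\<lambda>h. \<psi>' (x + t *\<^sub>R b) (h *\<^sub>R b))) (at t)" .
  moreover have "\<psi>' (x + t *\<^sub>R b) (h *\<^sub>R b) = \<psi>' (x + t *\<^sub>R b) b * h" for h
   using linear_cmul[OF has_derivative_linear[OF der]] by simp
  ultimately show ?thesis by (simp add: has_field_derivative_def)
 qed
 define h where "h k = inverse (real (Suc k))" for k
 have h: "0 < h k" "h k \<le> 1" for k by (simp_all add: h_def inverse_le_1_iff)
 define q where "q k x = (\<psi> (x + h k *\<^sub>R b) - \<psi> x) / h k" for k x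
 have [measurable]: "q k \<in> borel_measurable borel" for k unfolding q_def by measurable
 have "(\<lambda>k. LINT x|lborel. q k x) \<longlonglongrightarrow> (LINT x|lborel. \<psi>' x b)"
 proof (rule integral_dominated_convergence)
  show "integrable lborel (\<lambda>x. B * indicator S' x)" using cS' emeasure_compact_finite[OF cS']
   by (intro integrable_mult_right integrable_real_indicator) (auto simp: borel_compact)
  show "AE x in lborel. (\<lambda>k. q k x) \<longlonglongrightarrow> \<psi>' x b"
  proof (rule AE_I2)
   fix x
   have "((\<lambda>t. (\<psi> (x + t *\<^sub>R b) - \<psi> x) / t) \<longlongrightarrow> \<psi>' x b) (at 0)" using line[of x 0] by (simp add: DERIV_def)
   moreover have "filterlim h (at 0) sequentially"
    unfolding h_def by (intro filterlim_atI LIMSEQ_inverse_real_of_nat) simp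
   ultimately show "(\<lambda>k. q k x) \<longlonglongrightarrow> \<psi>' x b" unfolding q_def by (rule filterlim_compose)
  qed
  show "AE x in lborel. norm (q k x) \<le> B * indicator S' x" for k
  proof (rule AE_I2)
   fix x
   show "norm (q k x) \<le> B * indicator S' x"
   proof (cases "x \<in> S'")
    case True
    obtain z where "\<psi> (x + h k *\<^sub>R b) - \<psi> (x + 0 *\<^sub>R b) = (h k - 0) * \<psi>' (x + z *\<^sub>R b) b"
     using MVT2[OF h(1)[of k], of "\<lambda>t. \<psi> (x + t *\<^sub>R b)" "\<lambda>t. \<psi>' (x + t *\<^sub>R b) b"] line by auto
    then have "q k x = \<psi>' (x + z *\<^sub>R b) b" using h[of k] by (simp add: q_def)
    then show ?thesis using B(2) True by simp
   next
    case False
    have "\<psi> (x + h k *\<^sub>R b) = 0" "\<psi> x = 0"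
     using S(2)[OF S'[OF False, of "h k"]] S(2)[OF S'[OF False, of 0]] h[of k] by auto
    then show ?thesis using False by (simp add: q_def)
   qed
  qed
 qed measurable
 moreover have "(LINT x|lborel. q k x) = 0" for k
 proof -
  have i: "integrable lborel \<psi>" by (rule integrable_bounded_compact_support[of _ S A])
    (use S A in \<open>auto simp: borel_compact compact_imp_bounded indicator_def\<close>)
  then show ?thesis unfolding q_def
   using integral_lborel_translate[of \<psi> "h k *\<^sub>R b"] by (simp add: Bochner_Integration.integral_diff)
 qed
 ultimately show ?thesis by (simp add: LIMSEQ_const_iff)
qed

text \<open>The partial derivatives of the compactly supported product f \<phi> integrate to zero,
  and the product rule splits them into the two sides of the identity.\<close>

lemma weak_grad_C1:
 fixes f :: "'a::euclidean_space \<Rightarrow> real"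
 assumes \<Omega>: "open \<Omega>" "bounded \<Omega>" and der: "\<And>x. (f has_derivative (\<lambda>h. g x \<bullet> h)) (at x)"
  and cg: "continuous_on UNIV g"
 shows "weak_grad \<Omega> f g"
proof -
 have cf: "continuous_on UNIV f" by (intro continuous_at_imp_continuous_on ballI has_derivative_continuous[OF der])
 have [measurable]: "f \<in> borel_measurable borel" "g \<in> borel_measurable borel" "\<Omega> \<in> sets borel"
  using cf cg \<Omega> by (auto intro: borel_measurable_continuous_onI)
 define f' where "f' x = indicator \<Omega> x * f x" for x
 define g' where "g' x = indicator \<Omega> x *\<^sub>R g x" for x
 have [measurable]: "f' \<in> borel_measurable borel" "g' \<in> borel_measurable borel" unfolding f'_def g'_def by measurable
 have bd: "integrable lborel (\<lambda>x. indicator \<Omega> x * F x)" if c: "continuous_on UNIV F" for F :: "'a \<Rightarrow> real"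
 proof -
  have "compact (F ` closure \<Omega>)"
   using \<Omega> c by (intro compact_continuous_image continuous_on_subset[OF c]) (auto simp: compact_closure)
  then have "bounded (F ` closure \<Omega>)" by (rule compact_imp_bounded)
  then obtain B where B: "\<And>x. x \<in> closure \<Omega> \<Longrightarrow> \<bar>F x\<bar> \<le> B" unfolding bounded_iff by auto
  have [measurable]: "F \<in> borel_measurable borel" using c by (rule borel_measurable_continuous_onI)
  show ?thesis by (rule integrable_bounded_compact_support[of _ \<Omega> B])
    (use \<Omega> B closure_subset[of \<Omega>] in \<open>auto simp: indicator_def\<close>)
 qed
 have "sob \<Omega> f' g'" unfolding sob_def
 proof (intro conjI allI impI ballI)
  have e: "(f' x)\<^sup>2 = indicator \<Omega> x * (f x)\<^sup>2" "(norm (g' x))\<^sup>2 = indicator \<Omega> x * (norm (g x))\<^sup>2" for x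
   by (auto simp: f'_def g'_def indicator_def)
  show "integrable lborel (\<lambda>x. (f' x)\<^sup>2)" "integrable lborel (\<lambda>x. (norm (g' x))\<^sup>2)"
   unfolding e by (intro bd continuous_intros cf cg)+
  fix \<phi> b assume \<phi>: "test_fun \<Omega> \<phi>" and b: "b \<in> (Basis :: 'a set)"
  obtain S where S: "compact S" "S \<subseteq> \<Omega>" "\<And>x. x \<notin> S \<Longrightarrow> \<phi> x = 0"
   "\<And>x b. x \<notin> S \<Longrightarrow> pd \<phi> b x = 0" using test_funD[OF \<phi>] by metis
  have sm: "smooth_fun \<phi>" using \<phi> by (simp add: test_fun_def)
  let ?\<psi>' = "\<lambda>x h. f x * pd \<phi> h x + (g x \<bullet> h) * \<phi> x"
  have c1: "continuous_on UNIV (\<lambda>x. f x * pd \<phi> b x)" and c2: "continuous_on UNIV (\<lambda>x. (g x \<bullet> b) * \<phi> x)"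
   by (intro continuous_intros cf cg smooth_fun_continuous[OF sm] smooth_fun_deriv_continuous[OF sm b])+
  have z: "(LINT x|lborel. ?\<psi>' x b) = 0"
  proof (rule integral_partial_derivative[of "\<lambda>x. f x * \<phi> x" ?\<psi>'])
   show "((\<lambda>x. f x * \<phi> x) has_derivative ?\<psi>' x) (at x)" for x
    by (rule has_derivative_mult[OF der smooth_fun_has_derivative[OF sm]])
   show "continuous_on UNIV (\<lambda>x. ?\<psi>' x b)" by (intro continuous_on_add c1 c2)
  qed (use S in auto)
  have e1: "f' x * pd \<phi> b x = indicator \<Omega> x * (f x * pd \<phi> b x)"
   and e2: "(g' x \<bullet> b) * \<phi> x = indicator \<Omega> x * ((g x \<bullet> b) * \<phi> x)"
   and e3: "f' x * pd \<phi> b x + (g' x \<bullet> b) * \<phi> x = ?\<psi>' x b" for x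
   using S(2) S(3)[of x] S(4)[of x b] by (cases "x \<in> S"; auto simp: f'_def g'_def indicator_def)+
  have "(LINT x|lborel. f' x * pd \<phi> b x) + (LINT x|lborel. (g' x \<bullet> b) * \<phi> x) = (LINT x|lborel. ?\<psi>' x b)"
   unfolding e3[symmetric] by (rule Bochner_Integration.integral_add[symmetric]) (simp_all only: e1 e2 bd c1 c2)
  then show "(LINT x|lborel. f' x * pd \<phi> b x) = - (LINT x|lborel. (g' x \<bullet> b) * \<phi> x)" using z by simp
 qed (auto simp: f'_def g'_def)
 then show ?thesis by (subst weak_grad_iff_sob[where u' = f' and G' = g'])
   (auto simp: f'_def g'_def AE_lebesgue_on_iff intro!: borel_imp_measurable_lebesgue_on)
qed

lemma bounded_L2:
 assumes "finite_measure M" and [measurable]: "f \<in> borel_measurable M" and B: "\<And>x. x \<in> space M \<Longrightarrow> norm (f x) \<le> B"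
 shows "f \<in> L2 M"
proof -
 interpret finite_measure M by fact
 have "integrable M (\<lambda>x. (norm (f x))\<^sup>2)"
  by (rule integrable_const_bound[where B = "B\<^sup>2"]) (auto intro!: AE_I2 power_mono B)
 then show ?thesis by (simp add: L2_def)
qed

lemma sq_int_iff: "sq_int \<Omega> u \<longleftrightarrow> u \<in> L2 (leb \<Omega>)"
 by (simp add: sq_int_def L2_def)

lemma sq_int_components_iff:
 fixes G :: "'a::euclidean_space \<Rightarrow> 'a"
 shows "(\<forall>b\<in>Basis. sq_int \<Omega> (\<lambda>x. G x \<bullet> b)) \<longleftrightarrow> G \<in> L2 (leb \<Omega>)"
proof
 assume A: "\<forall>b\<in>Basis. sq_int \<Omega> (\<lambda>x. G x \<bullet> b)"
 have "integrable (leb \<Omega>) (\<lambda>x. \<Sum>b\<in>Basis. (G x \<bullet> b)\<^sup>2)"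
  using A by (intro Bochner_Integration.integrable_sum) (simp add: sq_int_def)
 moreover have "G \<in> borel_measurable (leb \<Omega>)"
  using A by (subst borel_measurable_euclidean_space) (simp add: sq_int_def)
 ultimately show "G \<in> L2 (leb \<Omega>)" by (simp add: L2_def norm_square_Basis)
next
 assume G: "G \<in> L2 (leb \<Omega>)"
 show "\<forall>b\<in>Basis. sq_int \<Omega> (\<lambda>x. G x \<bullet> b)"
 proof
  fix b :: 'a assume b: "b \<in> Basis"
  have m: "G \<in> borel_measurable (leb \<Omega>)" by (rule L2_measurable[OF G])
  have "integrable (leb \<Omega>) (\<lambda>x. (G x \<bullet> b)\<^sup>2)"
  proof (rule integrable_dominated)
   show "integrable (leb \<Omega>) (\<lambda>x. (norm (G x))\<^sup>2)" using G by (simp add: L2_def)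
   have "\<bar>G x \<bullet> b\<bar>\<^sup>2 \<le> (norm (G x))\<^sup>2" for x using Basis_le_norm[OF b, of "G x"] by (intro power_mono) auto
   then show "AE x in leb \<Omega>. norm ((G x \<bullet> b)\<^sup>2) \<le> norm ((norm (G x))\<^sup>2)" by simp
  qed (use m in measurable)
  moreover have "(\<lambda>x. G x \<bullet> b) \<in> borel_measurable (leb \<Omega>)" using m by measurable
  ultimately show "sq_int \<Omega> (\<lambda>x. G x \<bullet> b)" by (simp add: sq_int_def)
 qed
qed

text \<open>Both sides of the integration by parts become pairings with fixed functions, square
  integrable when \<Omega> is bounded, so linear combinations and L2 limits pass through.\<close>

lemma weak_grad_iff_L2:
 "weak_grad \<Omega> u G \<longleftrightarrow> u \<in> L2 (leb \<Omega>) \<and> G \<in> L2 (leb \<Omega>) \<and>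
   (\<forall>\<phi>. test_fun \<Omega> \<phi> \<longrightarrow> (\<forall>b\<in>Basis. L2_inner (leb \<Omega>) u (pd \<phi> b) =
    - L2_inner (leb \<Omega>) G (\<lambda>x. \<phi> x *\<^sub>R b)))"
 unfolding weak_grad_def sq_int_components_iff L2_inner_def by (simp add: sq_int_iff mult.commute)

context
 fixes \<Omega> :: "'a::euclidean_space set"
 assumes \<Omega>: "open \<Omega>" "bounded \<Omega>"
begin

lemma finite_measure_lebesgue_on_bounded: "finite_measure (leb \<Omega>)"
 using \<Omega> by (intro finite_measure_lebesgue_on bounded_set_imp_lmeasurable) auto

lemma test_fun_L2:
 assumes "test_fun \<Omega> \<phi>" "b \<in> Basis"
 shows "(pd \<phi> b) \<in> L2 (leb \<Omega>)" "(\<lambda>x. \<phi> x *\<^sub>R b) \<in> L2 (leb \<Omega>)"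
proof -
 obtain B where "\<And>x. \<bar>pd \<phi> b x\<bar> \<le> B" using test_fun_bounded(2)[OF assms] by blast
 then show "(pd \<phi> b) \<in> L2 (leb \<Omega>)" using test_fun_measurable(2)[OF assms]
  by (intro bounded_L2[of _ _ B] finite_measure_lebesgue_on_bounded) (auto intro: borel_imp_measurable_lebesgue_on)
 obtain B where "\<And>x. \<bar>\<phi> x\<bar> \<le> B" using test_fun_bounded(1)[OF assms(1)] by blast
 moreover have "(\<lambda>x. \<phi> x *\<^sub>R b) \<in> borel_measurable borel" using test_fun_measurable(1)[OF assms(1)] by measurable
 ultimately show "(\<lambda>x. \<phi> x *\<^sub>R b) \<in> L2 (leb \<Omega>)"
  using assms(2) by (intro bounded_L2[of _ _ B] finite_measure_lebesgue_on_bounded) (auto intro: borel_imp_measurable_lebesgue_on)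
qed

lemma weak_grad_add: "weak_grad \<Omega> u G \<Longrightarrow> weak_grad \<Omega> v H \<Longrightarrow> weak_grad \<Omega> (u + v) (G + H)"
 unfolding weak_grad_iff_L2 by (simp add: L2.H_add L2.add_left test_fun_L2)

lemma weak_grad_scaleR: "weak_grad \<Omega> u G \<Longrightarrow> weak_grad \<Omega> (c *\<^sub>R u) (c *\<^sub>R G)"
 unfolding weak_grad_iff_L2 by (simp add: L2.H_scale L2.scale_left test_fun_L2)

lemma weak_grad_zero: "weak_grad \<Omega> 0 0"
 unfolding weak_grad_iff_L2 by (simp add: L2.H_0 L2.zero_left test_fun_L2)

lemma weak_grad_limit:
 assumes w: "\<And>k. weak_grad \<Omega> (U k) (GU k)" and u: "u \<in> L2 (leb \<Omega>)" "G \<in> L2 (leb \<Omega>)"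
  and lim: "(\<lambda>k. L2_inner (leb \<Omega>) (U k - u) (U k - u)) \<longlonglongrightarrow> 0"
   "(\<lambda>k. L2_inner (leb \<Omega>) (GU k - G) (GU k - G)) \<longlonglongrightarrow> 0"
 shows "weak_grad \<Omega> u G"
 unfolding weak_grad_iff_L2
proof (intro conjI allI impI ballI u)
 fix \<phi> b assume \<phi>: "test_fun \<Omega> \<phi>" "b \<in> (Basis :: 'a set)"
 have UG: "U k \<in> L2 (leb \<Omega>)" "GU k \<in> L2 (leb \<Omega>)" for k using w[of k] by (simp_all add: weak_grad_iff_L2)
 have 1: "(\<lambda>k. L2_inner (leb \<Omega>) (U k) (pd \<phi> b)) \<longlonglongrightarrow> L2_inner (leb \<Omega>) u (pd \<phi> b)"
  by (rule L2.tendsto_pair[OF UG(1) u(1) test_fun_L2(1)[OF \<phi>] lim(1)])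
 have 2: "(\<lambda>k. - L2_inner (leb \<Omega>) (GU k) (\<lambda>x. \<phi> x *\<^sub>R b)) \<longlonglongrightarrow> - L2_inner (leb \<Omega>) G (\<lambda>x. \<phi> x *\<^sub>R b)"
  by (rule tendsto_minus[OF L2.tendsto_pair[OF UG(2) u(2) test_fun_L2(2)[OF \<phi>] lim(2)]])
 have "L2_inner (leb \<Omega>) (U k) (pd \<phi> b) = - L2_inner (leb \<Omega>) (GU k) (\<lambda>x. \<phi> x *\<^sub>R b)" for k
  using w[of k] \<phi> by (simp add: weak_grad_iff_L2)
 then show "L2_inner (leb \<Omega>) u (pd \<phi> b) = - L2_inner (leb \<Omega>) G (\<lambda>x. \<phi> x *\<^sub>R b)" using LIMSEQ_unique[OF 1] 2 by simp
qed

text \<open>The representative is \<phi> itself cut to \<Omega>, not merely equal to it almost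
  everywhere: the trace inequality takes pointwise limits at the boundary.\<close>

lemma continuous_weak_grad_sob:
 assumes w: "weak_grad \<Omega> \<phi> G" and c: "continuous_on (closure \<Omega>) \<phi>"
 obtains G' where "sob \<Omega> (\<lambda>x. indicator \<Omega> x * \<phi> x) G'"
  "(LINT x|lborel. (norm (G' x))\<^sup>2) = L2_inner (leb \<Omega>) G G"
proof -
 have b: "\<Omega> \<in> sets borel" using \<Omega> by simp
 have mG: "(\<lambda>x. G x \<bullet> i) \<in> borel_measurable (leb \<Omega>)" if "i \<in> Basis" for i by (rule weak_grad_measurable(2)[OF w that])
 obtain G' where G': "G' \<in> borel_measurable borel" "\<And>x. x \<notin> \<Omega> \<Longrightarrow> G' x = 0" "AE x in leb \<Omega>. G x = G' x"
  using borel_representative_vec[of \<Omega> G, OF b mG] by metis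
 have m: "(\<lambda>x. indicator \<Omega> x * \<phi> x) \<in> borel_measurable borel"
 proof -
  have "(\<lambda>x. if x \<in> \<Omega> then \<phi> x else 0) \<in> borel_measurable borel"
   by (rule borel_measurable_continuous_on_if) (use b continuous_on_subset[OF c closure_subset] in auto)
  moreover have "(\<lambda>x. if x \<in> \<Omega> then \<phi> x else 0) = (\<lambda>x. indicator \<Omega> x * \<phi> x)" by (auto simp: fun_eq_iff indicator_def)
  ultimately show ?thesis by simp
 qed
 have "AE x in leb \<Omega>. \<phi> x = indicator \<Omega> x * \<phi> x" by (rule AE_I2) simp
 then have s: "sob \<Omega> (\<lambda>x. indicator \<Omega> x * \<phi> x) G'"
  using weak_grad_iff_sob[of \<Omega> "\<lambda>x. indicator \<Omega> x * \<phi> x" \<phi> G' G] b m G' weak_grad_measurable[OF w] w by simp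
 have "(LINT x|lborel. (norm (G' x))\<^sup>2) = (LINT x|leb \<Omega>. (norm (G' x))\<^sup>2)"
  using G' b by (intro integral_lebesgue_on_eq_lborel(1)[symmetric]) auto
 also have "\<dots> = (LINT x|leb \<Omega>. (norm (G x))\<^sup>2)"
 proof (rule integral_cong_AE)
  show "(\<lambda>x. (norm (G x))\<^sup>2) \<in> borel_measurable (leb \<Omega>)" using w by (auto simp: weak_grad_iff_L2 L2_def)
  show "(\<lambda>x. (norm (G' x))\<^sup>2) \<in> borel_measurable (leb \<Omega>)"
   using G'(1) by (intro borel_imp_measurable_lebesgue_on) measurable
  show "AE x in leb \<Omega>. (norm (G' x))\<^sup>2 = (norm (G x))\<^sup>2" using G'(3) by eventually_elim simp
 qed
 finally show thesis using s that by (simp add: L2_inner_def dot_square_norm)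
qed

end

section \<open>The weighted boundary measure and trace bounds for continuous functions\<close>

context cusp
begin

abbreviation M :: "'a measure" where "M \<equiv> leb \<Omega>"

definition N :: "'a measure" where
 "N = density (surf (frontier \<Omega>)) (\<lambda>x. ennreal (w x))"

lemma frontier_borel [measurable]: "frontier \<Omega> \<in> sets borel"
 by simp

lemma sets_N [measurable_cong]: "sets N = sets (restrict_space borel (frontier \<Omega>))"
 and space_N: "space N = frontier \<Omega>" by (simp_all add: N_def)

lemma w_surf: "w \<in> borel_measurable (surf (frontier \<Omega>))"
 unfolding measurable_cong_sets[OF sets_surf refl] by (rule measurable_restrict_space1[OF w_measurable])

lemma measurable_N_iff: "f \<in> borel_measurable N \<longleftrightarrow> f \<in> borel_measurable (surf (frontier \<Omega>))"
 by (simp add: N_def)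

lemma nn_integral_N:
 assumes "f \<in> borel_measurable N"
 shows "(\<integral>\<^sup>+x. ennreal (f x) \<partial>N) = (\<integral>\<^sup>+x. ennreal (w x * f x) \<partial>surf (frontier \<Omega>))"
proof -
 have "(\<lambda>x. ennreal (f x)) \<in> borel_measurable (surf (frontier \<Omega>))"
  using assms unfolding measurable_N_iff by measurable
 moreover have "(\<lambda>x. ennreal (w x)) \<in> borel_measurable (surf (frontier \<Omega>))" using w_surf by measurable
 ultimately show ?thesis unfolding N_def by (subst nn_integral_density) (simp_all add: ennreal_mult' w_bounds)
qed

lemma integral_N:
 assumes "f \<in> borel_measurable N"
 shows "(LINT x|N. f x) = (LINT x|surf (frontier \<Omega>). w x * f x)"
 using assms w_surf unfolding N_def by (subst integral_density) (auto simp: w_bounds)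

lemma continuous_measurable_N:
 assumes "continuous_on (closure \<Omega>) \<phi>"
 shows "(\<phi> :: 'a \<Rightarrow> real) \<in> borel_measurable N"
proof -
 have "continuous_on (frontier \<Omega>) \<phi>" by (rule continuous_on_subset[OF assms]) (simp add: frontier_def)
 from borel_measurable_continuous_on_restrict[OF this] show ?thesis unfolding measurable_cong_sets[OF sets_N refl] .
qed

abbreviation cut :: "('a \<Rightarrow> real) \<Rightarrow> 'a \<Rightarrow> real" where
 "cut \<phi> x \<equiv> indicator \<Omega> x * \<phi> x"

lemma trace_bound:
 assumes \<epsilon>: "\<epsilon> > 0"
 shows "\<exists>K D. compact K \<and> K \<subseteq> \<Omega> \<and> D \<ge> 0 \<and>
  (\<forall>\<phi> G. continuous_on (closure \<Omega>) \<phi> \<longrightarrow> sob \<Omega> (cut \<phi>) G \<longrightarrow>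
    (\<integral>\<^sup>+x. ennreal ((\<phi> x)\<^sup>2) \<partial>N) \<le> ennreal (D * (LINT x|lborel. indicator K x * (cut \<phi> x)\<^sup>2) + \<epsilon> * (LINT x|lborel. (norm (G x))\<^sup>2)))"
proof -
 obtain K D where K: "compact K" "K \<subseteq> \<Omega>" and D: "D \<ge> 0" and
  tr: "\<forall>u G \<phi>. sob \<Omega> u G \<longrightarrow> continuous_on (closure \<Omega>) \<phi> \<longrightarrow> (\<forall>x\<in>\<Omega>. u x = \<phi> x) \<longrightarrow>
   (\<integral>\<^sup>+x. ennreal (w x * (\<phi> x)\<^sup>2) \<partial>surf (frontier \<Omega>)) \<le>
    ennreal D * (\<integral>\<^sup>+x. ennreal ((u x)\<^sup>2) * indicator K x \<partial>lborel) + ennreal \<epsilon> * (\<integral>\<^sup>+x. ennreal ((norm (G x))\<^sup>2) \<partial>lborel)"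
  using trace_estimate[OF \<epsilon>] by (elim exE conjE)
 have "(\<integral>\<^sup>+x. ennreal ((\<phi> x)\<^sup>2) \<partial>N) \<le> ennreal (D * (LINT x|lborel. indicator K x * (cut \<phi> x)\<^sup>2) + \<epsilon> * (LINT x|lborel. (norm (G x))\<^sup>2))"
  if c: "continuous_on (closure \<Omega>) \<phi>" and s: "sob \<Omega> (cut \<phi>) G" for \<phi> G
 proof -
  define u where "u x = indicator \<Omega> x * \<phi> x" for x
  have s': "sob \<Omega> u G" using s by (simp add: u_def[abs_def])
  have iu: "integrable lborel (\<lambda>x. (u x)\<^sup>2)" and iG: "integrable lborel (\<lambda>x. (norm (G x))\<^sup>2)"
   using s' by (auto simp: sob_def)
  have iK: "integrable lborel (\<lambda>x. indicator K x * (u x)\<^sup>2)"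
   using integrable_mult_indicator[of K lborel, OF _ iu] K(1) by (simp add: borel_compact)
  have "(\<integral>\<^sup>+x. ennreal ((\<phi> x)\<^sup>2) \<partial>N) = (\<integral>\<^sup>+x. ennreal (w x * (\<phi> x)\<^sup>2) \<partial>surf (frontier \<Omega>))"
   by (intro nn_integral_N borel_measurable_power continuous_measurable_N[OF c])
  also have "\<dots> \<le> ennreal D * (\<integral>\<^sup>+x. ennreal ((u x)\<^sup>2) * indicator K x \<partial>lborel) + ennreal \<epsilon> * (\<integral>\<^sup>+x. ennreal ((norm (G x))\<^sup>2) \<partial>lborel)"
   by (intro tr[rule_format] s' c) (simp add: u_def)
  also have "(\<integral>\<^sup>+x. ennreal ((u x)\<^sup>2) * indicator K x \<partial>lborel) = (\<integral>\<^sup>+x. ennreal (indicator K x * (u x)\<^sup>2) \<partial>lborel)"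
   by (intro nn_integral_cong) (simp add: indicator_def)
  also have "\<dots> = ennreal (LINT x|lborel. indicator K x * (u x)\<^sup>2)" by (rule nn_integral_eq_integral[OF iK]) simp
  also have "(\<integral>\<^sup>+x. ennreal ((norm (G x))\<^sup>2) \<partial>lborel) = ennreal (LINT x|lborel. (norm (G x))\<^sup>2)"
   by (rule nn_integral_eq_integral[OF iG]) simp
  also have "ennreal D * ennreal (LINT x|lborel. indicator K x * (u x)\<^sup>2) + ennreal \<epsilon> * ennreal (LINT x|lborel. (norm (G x))\<^sup>2) =
    ennreal (D * (LINT x|lborel. indicator K x * (u x)\<^sup>2) + \<epsilon> * (LINT x|lborel. (norm (G x))\<^sup>2))"
   using D \<epsilon> by (simp add: ennreal_mult'[symmetric] ennreal_plus[symmetric] LINT_nonneg del: ennreal_plus)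
  finally show ?thesis by (simp add: u_def)
 qed
 then show ?thesis using K D by (intro exI[of _ K] exI[of _ D] conjI allI impI)
qed

text \<open>The trace bound for the constant function 1 has a finite right side.\<close>

lemma finite_measure_N: "finite_measure N"
proof
 have "weak_grad \<Omega> (\<lambda>_. 1) (\<lambda>_. 0)" by (rule weak_grad_C1[OF dom]) (auto intro!: derivative_eq_intros)
 then obtain G where s: "sob \<Omega> (\<lambda>x. indicator \<Omega> x * 1) G"
  by (rule continuous_weak_grad_sob[OF dom]) (rule continuous_on_const)
 obtain K D where KD: "\<forall>\<phi> G. continuous_on (closure \<Omega>) \<phi> \<longrightarrow> sob \<Omega> (cut \<phi>) G \<longrightarrow>
    (\<integral>\<^sup>+x. ennreal ((\<phi> x)\<^sup>2) \<partial>N) \<le> ennreal (D * (LINT x|lborel. indicator K x * (cut \<phi> x)\<^sup>2) + 1 * (LINT x|lborel. (norm (G x))\<^sup>2))"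
  using trace_bound[OF zero_less_one] by (elim exE conjE)
 have "emeasure N (space N) = (\<integral>\<^sup>+x. ennreal (1\<^sup>2) \<partial>N)" by simp
 also have "\<dots> < \<infinity>"
  unfolding infinity_ennreal_def by (rule le_less_trans[OF KD[rule_format, OF continuous_on_const s] ennreal_less_top])
 finally have "emeasure N (space N) \<noteq> \<infinity>" by simp
 then show "emeasure N (space N) \<noteq> \<infinity>" .
qed

lemma continuous_L2_N:
 assumes "continuous_on (closure \<Omega>) \<phi>"
 shows "(\<phi> :: 'a \<Rightarrow> real) \<in> L2 N"
proof -
 have "compact (\<phi> ` closure \<Omega>)" using assms bounded_\<Omega> by (intro compact_continuous_image) (simp_all add: compact_closure)
 then have "bounded (\<phi> ` closure \<Omega>)" by (rule compact_imp_bounded)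
 then obtain B where "\<And>x. x \<in> closure \<Omega> \<Longrightarrow> norm (\<phi> x) \<le> B" unfolding bounded_iff by auto
 then show ?thesis
  by (intro bounded_L2[OF finite_measure_N continuous_measurable_N[OF assms], of B]) (auto simp: space_N frontier_def)
qed

lemma L2_inner_indicator:
 fixes \<phi> :: "'a \<Rightarrow> real"
 assumes m: "(cut \<phi>) \<in> borel_measurable borel" and Q: "Q \<in> sets borel"
 shows "L2_inner M (indicator Q) \<phi> = (LINT x|lborel. indicator Q x * (cut \<phi> x))"
  and "L2_inner M \<phi> \<phi> = (LINT x|lborel. (cut \<phi> x)\<^sup>2)"
proof -
 have b: "\<Omega> \<in> sets borel" using open_\<Omega> by simp
 have "L2_inner M (indicator Q) \<phi> = (LINT x|M. indicator Q x * (cut \<phi> x))"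
  unfolding L2_inner_def by (rule LINT_cong) auto
 also have "\<dots> = (LINT x|lborel. indicator Q x * (cut \<phi> x))"
  by (rule integral_lebesgue_on_eq_lborel(1)[OF b]) (use m Q in \<open>auto intro!: borel_measurable_times\<close>)
 finally show "L2_inner M (indicator Q) \<phi> = (LINT x|lborel. indicator Q x * (cut \<phi> x))" .
 have "L2_inner M \<phi> \<phi> = (LINT x|M. (cut \<phi> x)\<^sup>2)"
  unfolding L2_inner_def by (rule LINT_cong) (auto simp: power2_eq_square)
 also have "\<dots> = (LINT x|lborel. (cut \<phi> x)\<^sup>2)" by (rule integral_lebesgue_on_eq_lborel(1)[OF b]) (use m in auto)
 finally show "L2_inner M \<phi> \<phi> = (LINT x|lborel. (cut \<phi> x)\<^sup>2)" .
qed

lemma indicator_L2: "Q \<in> sets borel \<Longrightarrow> (indicator Q :: 'a \<Rightarrow> real) \<in> L2 M"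
 by (rule bounded_L2[OF finite_measure_lebesgue_on_bounded[OF dom], of _ 1])
  (auto intro!: borel_imp_measurable_lebesgue_on simp: indicator_def)

lemma smooth_trace_bound:
 assumes \<epsilon>: "\<epsilon> > 0"
 shows "\<exists>D\<ge>0. \<forall>\<phi> G. weak_grad \<Omega> \<phi> G \<longrightarrow> continuous_on (closure \<Omega>) \<phi> \<longrightarrow>
  L2_inner N \<phi> \<phi> \<le> D * L2_inner M \<phi> \<phi> + \<epsilon> * L2_inner M G G"
proof -
 obtain K D where K: "compact K" and D: "D \<ge> 0" and
  tr: "\<forall>\<phi> G. continuous_on (closure \<Omega>) \<phi> \<longrightarrow> sob \<Omega> (cut \<phi>) G \<longrightarrow>
    (\<integral>\<^sup>+x. ennreal ((\<phi> x)\<^sup>2) \<partial>N) \<le> ennreal (D * (LINT x|lborel. indicator K x * (cut \<phi> x)\<^sup>2) + \<epsilon> * (LINT x|lborel. (norm (G x))\<^sup>2))"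
  using trace_bound[OF \<epsilon>] by (elim exE conjE)
 have "L2_inner N \<phi> \<phi> \<le> D * L2_inner M \<phi> \<phi> + \<epsilon> * L2_inner M G G"
  if wg: "weak_grad \<Omega> \<phi> G" and c: "continuous_on (closure \<Omega>) \<phi>" for \<phi> G
 proof -
  obtain G' where G': "sob \<Omega> (cut \<phi>) G'" "(LINT x|lborel. (norm (G' x))\<^sup>2) = L2_inner M G G"
   by (rule continuous_weak_grad_sob[OF dom wg c])
  have i: "integrable lborel (\<lambda>x. (cut \<phi> x)\<^sup>2)" and m: "(cut \<phi>) \<in> borel_measurable borel"
   using G'(1) unfolding sob_def by blast+
  let ?k = "LINT x|lborel. indicator K x * (cut \<phi> x)\<^sup>2"
  have "?k \<le> (LINT x|lborel. (cut \<phi> x)\<^sup>2)" using integrable_mult_indicator[of K lborel, OF _ i] K i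
   by (intro integral_mono) (auto simp: borel_compact indicator_def)
  also have "\<dots> = L2_inner M \<phi> \<phi>" by (rule L2_inner_indicator(2)[OF m sets.empty_sets, symmetric])
  finally have le: "D * ?k \<le> D * L2_inner M \<phi> \<phi>" using D by (rule mult_left_mono)
  have n: "0 \<le> D * ?k + \<epsilon> * (LINT x|lborel. (norm (G' x))\<^sup>2)"
   using D \<epsilon> by (intro add_nonneg_nonneg mult_nonneg_nonneg LINT_nonneg) auto
  have eN: "ennreal (L2_inner N \<phi> \<phi>) = (\<integral>\<^sup>+x. ennreal ((\<phi> x)\<^sup>2) \<partial>N)"
   using L2_inner_self[OF continuous_L2_N[OF c]] by simp
  have "L2_inner N \<phi> \<phi> \<le> D * ?k + \<epsilon> * (LINT x|lborel. (norm (G' x))\<^sup>2)"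
   using tr[rule_format, OF c G'(1)] unfolding eN[symmetric] ennreal_le_iff[OF n] .
  then show ?thesis using le unfolding G'(2) by linarith
 qed
 with D show ?thesis by blast
qed

text \<open>Half of \<epsilon> goes to the trace bound and half to the Poincare step, where the
  square integral over \<open>K\<close>, multiplied by the large constant \<open>D\<close>, is
  replaced by averages.\<close>

lemma smooth_trace_compact:
 assumes \<epsilon>: "\<epsilon> > 0"
 shows "\<exists>(n::nat) (Q :: nat \<Rightarrow> 'a set) D. D \<ge> 0 \<and> (\<forall>i<n. Q i \<in> sets borel) \<and>
  (\<forall>\<phi> G. weak_grad \<Omega> \<phi> G \<longrightarrow> continuous_on (closure \<Omega>) \<phi> \<longrightarrow>
  L2_inner N \<phi> \<phi> \<le> \<epsilon> * L2_inner M G G + D * (\<Sum>i<n. (L2_inner M (indicator (Q i)) \<phi>)\<^sup>2))"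
proof -
 have \<epsilon>2: "\<epsilon> / 2 > 0" using \<epsilon> by simp
 obtain K D where K: "compact K" "K \<subseteq> \<Omega>" and D: "D \<ge> 0" and
  tr: "\<forall>\<phi> G. continuous_on (closure \<Omega>) \<phi> \<longrightarrow> sob \<Omega> (cut \<phi>) G \<longrightarrow>
    (\<integral>\<^sup>+x. ennreal ((\<phi> x)\<^sup>2) \<partial>N) \<le> ennreal (D * (LINT x|lborel. indicator K x * (cut \<phi> x)\<^sup>2) + \<epsilon> / 2 * (LINT x|lborel. (norm (G x))\<^sup>2))"
  using trace_bound[OF \<epsilon>2] by (elim exE conjE)
 \<comment> \<open>Multiplied by the factor \<open>D\<close> of the trace bound it leaves at most
   \<epsilon> / 2; \<open>D\<close> may be 0.\<close>
 define \<delta> where "\<delta> = \<epsilon> / (2 * (D + 1))"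
 have \<delta>: "\<delta> > 0" and D\<delta>: "D * \<delta> \<le> \<epsilon> / 2" using \<epsilon> D by (auto simp: \<delta>_def field_simps)
 obtain n :: nat and Q D' where Q: "\<forall>i<n. Q i \<in> sets borel \<and> Q i \<subseteq> \<Omega>" and D': "D' \<ge> 0" and
  av: "\<forall>u G. sob \<Omega> u G \<longrightarrow> (LINT x|lborel. indicator K x * (u x)\<^sup>2) \<le>
    \<delta> * (LINT x|lborel. (norm (G x))\<^sup>2) + D' * (\<Sum>i<n. (LINT x|lborel. indicator (Q i) x * u x)\<^sup>2)"
  using local_L2_by_averages[OF dom K \<delta>] by (elim exE conjE)
 have "L2_inner N \<phi> \<phi> \<le> \<epsilon> * L2_inner M G G + (D * D') * (\<Sum>i<n. (L2_inner M (indicator (Q i)) \<phi>)\<^sup>2)"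
  if wg: "weak_grad \<Omega> \<phi> G" and c: "continuous_on (closure \<Omega>) \<phi>" for \<phi> G
 proof -
  obtain G' where G': "sob \<Omega> (cut \<phi>) G'" "(LINT x|lborel. (norm (G' x))\<^sup>2) = L2_inner M G G"
   by (rule continuous_weak_grad_sob[OF dom wg c])
  have m: "(cut \<phi>) \<in> borel_measurable borel" using G'(1) unfolding sob_def by blast
  let ?k = "LINT x|lborel. indicator K x * (cut \<phi> x)\<^sup>2" and ?g = "L2_inner M G G"
  let ?s = "\<Sum>i<n. (L2_inner M (indicator (Q i)) \<phi>)\<^sup>2"
  have g: "?g \<ge> 0" using wg by (simp add: L2.nonneg weak_grad_iff_L2)
  have se: "?s = (\<Sum>i<n. (LINT x|lborel. indicator (Q i) x * (cut \<phi> x))\<^sup>2)"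
   using Q by (intro sum.cong refl arg_cong[where f = "\<lambda>r. r\<^sup>2"] L2_inner_indicator(1)[OF m]) auto
  have k: "?k \<le> \<delta> * ?g + D' * ?s" unfolding se G'(2)[symmetric] by (rule av[rule_format, OF G'(1)])
  have n: "0 \<le> D * ?k + \<epsilon> / 2 * (LINT x|lborel. (norm (G' x))\<^sup>2)"
   using D \<epsilon> by (intro add_nonneg_nonneg mult_nonneg_nonneg LINT_nonneg) auto
  have eN: "ennreal (L2_inner N \<phi> \<phi>) = (\<integral>\<^sup>+x. ennreal ((\<phi> x)\<^sup>2) \<partial>N)"
   using L2_inner_self[OF continuous_L2_N[OF c]] by simp
  have "L2_inner N \<phi> \<phi> \<le> D * ?k + \<epsilon> / 2 * (LINT x|lborel. (norm (G' x))\<^sup>2)"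
   using tr[rule_format, OF c G'(1)] unfolding eN[symmetric] ennreal_le_iff[OF n] .
  also have "\<dots> \<le> D * (\<delta> * ?g + D' * ?s) + \<epsilon> / 2 * ?g" unfolding G'(2) by (intro add_right_mono mult_left_mono k D)
  also have "\<dots> = (D * \<delta>) * ?g + \<epsilon> / 2 * ?g + (D * D') * ?s" by (simp add: distrib_left mult.assoc)
  also have "\<dots> \<le> \<epsilon> / 2 * ?g + \<epsilon> / 2 * ?g + (D * D') * ?s" using D\<delta> g by (intro add_right_mono mult_right_mono)
  finally show ?thesis by simp
 qed
 then show ?thesis using D D' Q by (intro exI[of _ n] exI[of _ Q] exI[of _ "D * D'"] conjI allI impI) auto
qed

end

section \<open>Triples of function, weak gradient and trace, and the closed form domain\<close>

context cusp
begin

text \<open>A triple is a function, its weak gradient and its trace; the latter two are unique only almost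
 everywhere, so the forms below are merely semidefinite on the diagonal.\<close>

definition triples :: "(('a \<Rightarrow> real) \<times> ('a \<Rightarrow> 'a) \<times> ('a \<Rightarrow> real)) set" where
 "triples = {p. weak_grad \<Omega> (fst p) (fst (snd p)) \<and> snd (snd p) \<in> L2 N}"

text \<open>The approximants that \<open>has_trace\<close> admits: functions with a weak gradient
  and continuous up to the boundary, each being its own trace.\<close>

definition smooth_triples :: "(('a \<Rightarrow> real) \<times> ('a \<Rightarrow> 'a) \<times> ('a \<Rightarrow> real)) set" where
 "smooth_triples = {p. weak_grad \<Omega> (fst p) (fst (snd p)) \<and> continuous_on (closure \<Omega>) (fst p) \<and> snd (snd p) = fst p}"

definition energy :: "('a \<Rightarrow> real) \<times> ('a \<Rightarrow> 'a) \<times> ('a \<Rightarrow> real) \<Rightarrow> ('a \<Rightarrow> real) \<times> ('a \<Rightarrow> 'a) \<times> ('a \<Rightarrow> real) \<Rightarrow> real" where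
 "energy p q = L2_inner M (fst (snd p)) (fst (snd q)) + L2_inner M (fst p) (fst q)"

definition bdry :: "('a \<Rightarrow> real) \<times> ('a \<Rightarrow> 'a) \<times> ('a \<Rightarrow> real) \<Rightarrow> ('a \<Rightarrow> real) \<times> ('a \<Rightarrow> 'a) \<times> ('a \<Rightarrow> real) \<Rightarrow> real" where
 "bdry p q = L2_inner N (snd (snd p)) (snd (snd q))"

lemma triplesD:
 assumes "p \<in> triples"
 shows "fst p \<in> L2 M" "fst (snd p) \<in> L2 M" "snd (snd p) \<in> L2 N" "weak_grad \<Omega> (fst p) (fst (snd p))"
 using assms by (simp_all add: triples_def weak_grad_iff_L2)

lemma subspace_triples: "subspace triples"
 by (rule subspaceI)
  (auto simp: triples_def weak_grad_zero[OF dom] weak_grad_add[OF dom]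
   weak_grad_scaleR[OF dom] L2.H_0 L2.H_add L2.H_scale)

lemma continuous_on_fun_arith:
 fixes f g :: "'a \<Rightarrow> real"
 assumes "continuous_on S f" "continuous_on S g"
 shows "continuous_on S (f + g)" "continuous_on S (c *\<^sub>R f)" "continuous_on S (0 :: 'a \<Rightarrow> real)"
 using assms by (auto simp: plus_fun_def zero_fun_def scaleR_fun_def intro!: continuous_intros)

lemma subspace_smooth_triples: "subspace smooth_triples"
 by (rule subspaceI)
  (auto simp: smooth_triples_def weak_grad_zero[OF dom] weak_grad_add[OF dom]
   weak_grad_scaleR[OF dom] continuous_on_fun_arith intro!: continuous_on_add)

lemma smooth_triples_subset: "smooth_triples \<subseteq> triples"
 by (auto simp: smooth_triples_def triples_def continuous_L2_N)

lemma psd_form_energy: "psd_form triples energy"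
proof
 fix x y z assume "x \<in> triples" "y \<in> triples" "z \<in> triples"
 then show "energy (x + y) z = energy x z + energy y z" by (simp add: energy_def L2.add_left triplesD)
next
 fix x z c assume "x \<in> triples" "z \<in> triples"
 then show "energy (c *\<^sub>R x) z = c * energy x z" by (simp add: energy_def L2.scale_left triplesD distrib_left)
next
 fix x y assume "x \<in> triples" "y \<in> triples"
 then show "energy x y = energy y x" by (auto simp: energy_def triplesD intro!: arg_cong2[where f = "(+)"] L2.sym)
next
 fix x assume "x \<in> triples"
 then show "0 \<le> energy x x" by (simp add: energy_def L2.nonneg triplesD)
qed (rule subspace_triples)

lemma psd_form_bdry: "psd_form triples bdry"
proof
 fix x y z assume "x \<in> triples" "y \<in> triples" "z \<in> triples"
 then show "bdry (x + y) z = bdry x z + bdry y z" by (simp add: bdry_def L2.add_left triplesD)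
next
 fix x z c assume "x \<in> triples" "z \<in> triples"
 then show "bdry (c *\<^sub>R x) z = c * bdry x z" by (simp add: bdry_def L2.scale_left triplesD)
next
 fix x y assume "x \<in> triples" "y \<in> triples"
 then show "bdry x y = bdry y x" by (auto simp: bdry_def triplesD intro!: L2.sym)
next
 fix x assume "x \<in> triples"
 then show "0 \<le> bdry x x" by (simp add: bdry_def L2.nonneg triplesD)
qed (rule subspace_triples)

lemma energy_ge:
 assumes "p \<in> triples"
 shows "L2_inner M (fst p) (fst p) \<le> energy p p" "L2_inner M (fst (snd p)) (fst (snd p)) \<le> energy p p"
 using triplesD[OF assms] by (simp_all add: energy_def L2.nonneg)

text \<open>Each component converges in its own L2 space, and the limits of functions and gradients
  remain related because weak differentiation is closed.\<close>

lemma triples_complete: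
 assumes X: "\<And>k. X k \<in> triples"
  and ca: "\<And>\<epsilon>. \<epsilon> > 0 \<Longrightarrow> \<exists>N. \<forall>k\<ge>N. \<forall>l\<ge>N. energy (X k - X l) (X k - X l) < \<epsilon>"
  and cb: "\<And>\<epsilon>. \<epsilon> > 0 \<Longrightarrow> \<exists>N. \<forall>k\<ge>N. \<forall>l\<ge>N. bdry (X k - X l) (X k - X l) < \<epsilon>"
 shows "\<exists>x\<in>triples. (\<lambda>k. energy (X k - x) (X k - x)) \<longlonglongrightarrow> 0 \<and> (\<lambda>k. bdry (X k - x) (X k - x)) \<longlonglongrightarrow> 0"
proof -
 have XX: "X k - X l \<in> triples" for k l by (rule subspace_diff[OF subspace_triples X X])
 have "\<exists>u\<in>L2 M. (\<lambda>k. L2_inner M (fst (X k) - u) (fst (X k) - u)) \<longlonglongrightarrow> 0"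
 proof (rule L2_inner_complete)
  show "\<exists>N. \<forall>k\<ge>N. \<forall>l\<ge>N. L2_inner M (fst (X k) - fst (X l)) (fst (X k) - fst (X l)) < \<epsilon>" if "\<epsilon> > 0" for \<epsilon>
   using ca[OF that] le_less_trans[OF energy_ge(1)[OF XX]] by (fastforce simp: fst_diff)
 qed (rule triplesD(1)[OF X])
 then obtain u where u: "u \<in> L2 M" "(\<lambda>k. L2_inner M (fst (X k) - u) (fst (X k) - u)) \<longlonglongrightarrow> 0" by (elim bexE)
 have "\<exists>G\<in>L2 M. (\<lambda>k. L2_inner M (fst (snd (X k)) - G) (fst (snd (X k)) - G)) \<longlonglongrightarrow> 0"
 proof (rule L2_inner_complete)
  show "\<exists>N. \<forall>k\<ge>N. \<forall>l\<ge>N. L2_inner M (fst (snd (X k)) - fst (snd (X l))) (fst (snd (X k)) - fst (snd (X l))) < \<epsilon>" if "\<epsilon> > 0" for \<epsilon>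
   using ca[OF that] le_less_trans[OF energy_ge(2)[OF XX]] by (fastforce simp: fst_diff snd_diff)
 qed (rule triplesD(2)[OF X])
 then obtain G where G: "G \<in> L2 M" "(\<lambda>k. L2_inner M (fst (snd (X k)) - G) (fst (snd (X k)) - G)) \<longlonglongrightarrow> 0" by (elim bexE)
 have "\<exists>T\<in>L2 N. (\<lambda>k. L2_inner N (snd (snd (X k)) - T) (snd (snd (X k)) - T)) \<longlonglongrightarrow> 0"
 proof (rule L2_inner_complete)
  show "\<exists>N'. \<forall>k\<ge>N'. \<forall>l\<ge>N'. L2_inner N (snd (snd (X k)) - snd (snd (X l))) (snd (snd (X k)) - snd (snd (X l))) < \<epsilon>" if "\<epsilon> > 0" for \<epsilon>
   using cb[OF that] by (simp add: bdry_def)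
 qed (rule triplesD(3)[OF X])
 then obtain T where T: "T \<in> L2 N" "(\<lambda>k. L2_inner N (snd (snd (X k)) - T) (snd (snd (X k)) - T)) \<longlonglongrightarrow> 0" by (elim bexE)
 have "weak_grad \<Omega> u G" by (rule weak_grad_limit[OF dom triplesD(4)[OF X] u(1) G(1) u(2) G(2)])
 moreover have "(\<lambda>k. energy (X k - (u, G, T)) (X k - (u, G, T))) \<longlonglongrightarrow> 0"
  using tendsto_add[OF G(2) u(2)] by (simp add: energy_def)
 ultimately show ?thesis using T by (intro bexI[of _ "(u, G, T)"]) (simp_all add: triples_def bdry_def)
qed

text \<open>Chosen once, so that a single term can be passed as locale parameter.\<close>

definition trace_const :: real where
 "trace_const = (SOME K. K \<ge> 0 \<and> (\<forall>p\<in>smooth_triples. bdry p p \<le> K * energy p p))"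

lemma trace_const: "trace_const \<ge> 0" "p \<in> smooth_triples \<Longrightarrow> bdry p p \<le> trace_const * energy p p"
proof -
 obtain D where D: "D \<ge> 0" "\<forall>\<phi> G. weak_grad \<Omega> \<phi> G \<longrightarrow> continuous_on (closure \<Omega>) \<phi> \<longrightarrow>
  L2_inner N \<phi> \<phi> \<le> D * L2_inner M \<phi> \<phi> + 1 * L2_inner M G G" using smooth_trace_bound[OF zero_less_one] by blast
 have "bdry p p \<le> (D + 1) * energy p p" if p: "p \<in> smooth_triples" for p
 proof -
  have pt: "p \<in> triples" using p smooth_triples_subset by blast
  let ?u = "L2_inner M (fst p) (fst p)" and ?g = "L2_inner M (fst (snd p)) (fst (snd p))"
  have n: "0 \<le> ?u" "0 \<le> ?g" using triplesD[OF pt] by (simp_all add: L2.nonneg)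
  have "bdry p p \<le> D * ?u + 1 * ?g"
   using p D(2)[rule_format, of "fst p" "fst (snd p)"] by (simp add: smooth_triples_def bdry_def)
  also have "\<dots> \<le> (D + 1) * energy p p"
   using n mult_nonneg_nonneg[OF D(1) n(2)] by (simp add: energy_def distrib_left distrib_right)
  finally show ?thesis .
 qed
 then have "\<exists>K. K \<ge> 0 \<and> (\<forall>p\<in>smooth_triples. bdry p p \<le> K * energy p p)" using D(1) by (intro exI[of _ "D + 1"]) simp
 from someI_ex[OF this] show "trace_const \<ge> 0" "p \<in> smooth_triples \<Longrightarrow> bdry p p \<le> trace_const * energy p p"
  unfolding trace_const_def by blast+
qed

sublocale cl: form_closure triples energy bdry smooth_triples trace_const
proof (rule form_closure.intro[OF psd_form_energy psd_form_bdry form_closure_axioms.intro])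
 show "\<exists>x\<in>triples. (\<lambda>k. energy (X k - x) (X k - x)) \<longlonglongrightarrow> 0 \<and> (\<lambda>k. bdry (X k - x) (X k - x)) \<longlonglongrightarrow> 0"
  if "\<And>k. X k \<in> triples"
   "\<And>\<epsilon>. \<epsilon> > 0 \<Longrightarrow> \<exists>N. \<forall>k\<ge>N. \<forall>l\<ge>N. energy (X k - X l) (X k - X l) < \<epsilon>"
   "\<And>\<epsilon>. \<epsilon> > 0 \<Longrightarrow> \<exists>N. \<forall>k\<ge>N. \<forall>l\<ge>N. bdry (X k - X l) (X k - X l) < \<epsilon>" for X by (rule triples_complete[OF that])
qed ((rule subspace_smooth_triples smooth_triples_subset trace_const; assumption?)+)

text \<open>Closure and \<open>has_trace\<close> differ in two points. The gradients of the
  approximants in \<open>has_trace\<close> converge to some weak gradient of u, which uniqueness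
  identifies with G; and T is only measurable there, its square integrability following from its
  being a limit of functions in L2.\<close>

lemma clos_iff: "(u, G, T) \<in> cl.clos \<longleftrightarrow> weak_grad \<Omega> u G \<and> has_trace \<Omega> w u T"
proof
 assume "(u, G, T) \<in> cl.clos"
 then have "\<exists>X. (\<forall>k. X k \<in> smooth_triples) \<and> cl.approx X (u, G, T)" and uGT: "(u, G, T) \<in> triples"
  by (simp_all add: cl.clos_def)
 then obtain X where X: "\<forall>k. X k \<in> smooth_triples" "cl.approx X (u, G, T)" by blast
 have Xt: "X k \<in> triples" for k using X(1) smooth_triples_subset by blast
 have d: "X k - (u, G, T) \<in> triples" for k by (rule subspace_diff[OF subspace_triples Xt uGT])
 have L: "u \<in> L2 M" "G \<in> L2 M" "T \<in> L2 N" "weak_grad \<Omega> u G" using triplesD[OF uGT] by simp_all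
 have lim: "(\<lambda>k. energy (X k - (u, G, T)) (X k - (u, G, T))) \<longlonglongrightarrow> 0"
  "(\<lambda>k. bdry (X k - (u, G, T)) (X k - (u, G, T))) \<longlonglongrightarrow> 0" using X(2) by (simp_all add: cl.approx_def)
 have 1: "(\<lambda>k. L2_inner M (fst (X k) - u) (fst (X k) - u)) \<longlonglongrightarrow> 0"
 proof (rule squeeze_zero[OF lim(1)])
  fix k show "0 \<le> L2_inner M (fst (X k) - u) (fst (X k) - u)" by (intro L2.nonneg L2.H_diff triplesD(1)[OF Xt] L)
  show "L2_inner M (fst (X k) - u) (fst (X k) - u) \<le> energy (X k - (u, G, T)) (X k - (u, G, T))"
   using energy_ge(1)[OF d[of k]] by simp
 qed
 have 2: "(\<lambda>k. L2_inner M (fst (snd (X k)) - G) (fst (snd (X k)) - G)) \<longlonglongrightarrow> 0"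
 proof (rule squeeze_zero[OF lim(1)])
  fix k show "0 \<le> L2_inner M (fst (snd (X k)) - G) (fst (snd (X k)) - G)" by (intro L2.nonneg L2.H_diff triplesD(2)[OF Xt] L)
  show "L2_inner M (fst (snd (X k)) - G) (fst (snd (X k)) - G) \<le> energy (X k - (u, G, T)) (X k - (u, G, T))"
   using energy_ge(2)[OF d[of k]] by simp
 qed
 have 3: "(\<lambda>k. L2_inner N (snd (snd (X k)) - T) (snd (snd (X k)) - T)) \<longlonglongrightarrow> 0" using lim(2) by (simp add: bdry_def)
 have e: "snd (snd (X k)) = fst (X k)" for k using X(1) by (simp add: smooth_triples_def)
 have mN: "(\<lambda>x. (norm (fst (X k) x - T x))\<^sup>2) \<in> borel_measurable N" for k
 proof -
  have "(\<lambda>x. fst (X k) x - T x) \<in> borel_measurable N"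
   by (intro borel_measurable_diff L2_measurable[OF L(3)] L2_measurable[OF triplesD(3)[OF Xt, unfolded e]])
  then show ?thesis by measurable
 qed
 have "has_trace \<Omega> w u T" unfolding has_trace_def
 proof (intro conjI exI[of _ "\<lambda>k. fst (X k)"] exI[of _ "\<lambda>k. fst (snd (X k))"] exI[of _ G] allI)
  show "T \<in> borel_measurable (surf (frontier \<Omega>))" using L2_measurable[OF L(3)] unfolding measurable_N_iff .
  show "weak_grad \<Omega> (fst (X k)) (fst (snd (X k)))" "continuous_on (closure \<Omega>) (fst (X k))" for k
   using X(1) by (simp_all add: smooth_triples_def)
  show "(\<lambda>k. \<integral>\<^sup>+ x. ennreal ((fst (X k) x - u x)\<^sup>2) \<partial>M) \<longlonglongrightarrow> 0"
   using 1 tendsto_L2_iff[of "\<lambda>k. fst (X k)" M u, OF triplesD(1)[OF Xt] L(1)] by simp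
  show "(\<lambda>k. \<integral>\<^sup>+ x. ennreal ((norm (fst (snd (X k)) x - G x))\<^sup>2) \<partial>M) \<longlonglongrightarrow> 0"
   using 2 tendsto_L2_iff[of "\<lambda>k. fst (snd (X k))" M G, OF triplesD(2)[OF Xt] L(2)] by simp
  have "(\<lambda>k. \<integral>\<^sup>+ x. ennreal ((norm (fst (X k) x - T x))\<^sup>2) \<partial>N) \<longlonglongrightarrow> 0"
   using 3 tendsto_L2_iff[of "\<lambda>k. fst (X k)" N T, OF triplesD(3)[OF Xt, unfolded e] L(3)] by (simp add: e)
  then show "(\<lambda>k. \<integral>\<^sup>+ x. ennreal (w x * (fst (X k) x - T x)\<^sup>2) \<partial>surf (frontier \<Omega>)) \<longlonglongrightarrow> 0"
   unfolding nn_integral_N[OF mN] by simp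
 qed (rule L(4))
 then show "weak_grad \<Omega> u G \<and> has_trace \<Omega> w u T" using L(4) by simp
next
 assume A: "weak_grad \<Omega> u G \<and> has_trace \<Omega> w u T"
 then have wg: "weak_grad \<Omega> u G" and T: "T \<in> borel_measurable N" by (simp_all add: has_trace_def measurable_N_iff)
 obtain \<phi> G\<phi> Gu where Gu: "weak_grad \<Omega> u Gu" and
  \<phi>: "\<forall>k. weak_grad \<Omega> (\<phi> k) (G\<phi> k) \<and> continuous_on (closure \<Omega>) (\<phi> k)" and
  l1: "(\<lambda>k. \<integral>\<^sup>+ x. ennreal ((\<phi> k x - u x)\<^sup>2) \<partial>M) \<longlonglongrightarrow> 0" and
  l2: "(\<lambda>k. \<integral>\<^sup>+ x. ennreal ((norm (G\<phi> k x - Gu x))\<^sup>2) \<partial>M) \<longlonglongrightarrow> 0" and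
  l3: "(\<lambda>k. \<integral>\<^sup>+ x. ennreal (w x * (\<phi> k x - T x)\<^sup>2) \<partial>surf (frontier \<Omega>)) \<longlonglongrightarrow> 0"
  using A unfolding has_trace_def by (elim exE conjE)
 have L: "u \<in> L2 M" "G \<in> L2 M" "\<phi> k \<in> L2 M" "G\<phi> k \<in> L2 M" "\<phi> k \<in> L2 N" for k
  using wg \<phi> by (simp_all add: weak_grad_iff_L2 continuous_L2_N)
 have "AE x in M. Gu x = G x" by (rule weak_grad_unique[OF dom Gu wg]) simp
 then have "(\<integral>\<^sup>+ x. ennreal ((norm (G\<phi> k x - Gu x))\<^sup>2) \<partial>M) = (\<integral>\<^sup>+ x. ennreal ((norm (G\<phi> k x - G x))\<^sup>2) \<partial>M)" for k
  by (intro nn_integral_cong_AE) (auto elim: eventually_mono)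
 with l2 have "(\<lambda>k. \<integral>\<^sup>+ x. ennreal ((norm (G\<phi> k x - G x))\<^sup>2) \<partial>M) \<longlonglongrightarrow> 0" by simp
 then have 2: "(\<lambda>k. L2_inner M (G\<phi> k - G) (G\<phi> k - G)) \<longlonglongrightarrow> 0" by (simp add: tendsto_L2_iff L)
 have 1: "(\<lambda>k. L2_inner M (\<phi> k - u) (\<phi> k - u)) \<longlonglongrightarrow> 0" using l1 tendsto_L2_iff[of \<phi> M u, OF L(3) L(1)] by simp
 have mN: "(\<lambda>x. (\<phi> k x - T x)\<^sup>2) \<in> borel_measurable N" for k
  by (intro borel_measurable_power borel_measurable_diff L2_measurable[OF L(5)] T)
 have l3': "(\<lambda>k. \<integral>\<^sup>+ x. ennreal ((norm (\<phi> k x - T x))\<^sup>2) \<partial>N) \<longlonglongrightarrow> 0"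
  using l3 unfolding nn_integral_N[OF mN, symmetric] by simp
 have TL: "T \<in> L2 N" by (rule L2_of_tendsto[OF L(5) T l3'])
 have 3: "(\<lambda>k. L2_inner N (\<phi> k - T) (\<phi> k - T)) \<longlonglongrightarrow> 0" using l3' tendsto_L2_iff[of \<phi> N T, OF L(5) TL] by simp
 have "cl.approx (\<lambda>k. (\<phi> k, G\<phi> k, \<phi> k)) (u, G, T)"
  using tendsto_add[OF 2 1] 3 by (simp add: cl.approx_def energy_def bdry_def)
 moreover have "(\<phi> k, G\<phi> k, \<phi> k) \<in> smooth_triples" for k using \<phi> by (simp add: smooth_triples_def)
 ultimately show "(u, G, T) \<in> cl.clos"
  using wg TL unfolding cl.clos_def by (auto simp: triples_def intro!: exI[of _ "\<lambda>k. (\<phi> k, G\<phi> k, \<phi> k)"])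
qed

lemma clos_compact_form:
 assumes \<epsilon>: "\<epsilon> > 0"
 shows "\<exists>(n::nat) l D. (\<forall>i<n. \<forall>x\<in>cl.clos. \<forall>y\<in>cl.clos. l i (x + y) = l i x + l i y) \<and>
     (\<forall>i<n. \<forall>x\<in>cl.clos. \<forall>c. l i (c *\<^sub>R x) = c * l i x) \<and> (\<forall>i<n. \<forall>x\<in>cl.clos. (l i x)\<^sup>2 \<le> D * energy x x) \<and>
     (\<forall>x\<in>cl.clos. bdry x x \<le> \<epsilon> * energy x x + (\<Sum>i<n. (l i x)\<^sup>2))"
proof -
 obtain n :: nat and Q :: "nat \<Rightarrow> 'a set" and D where D: "D \<ge> 0" and Q: "\<forall>i<n. Q i \<in> sets borel" and
  tr: "\<forall>\<phi> G. weak_grad \<Omega> \<phi> G \<longrightarrow> continuous_on (closure \<Omega>) \<phi> \<longrightarrow>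
  L2_inner N \<phi> \<phi> \<le> \<epsilon> * L2_inner M G G + D * (\<Sum>i<n. (L2_inner M (indicator (Q i)) \<phi>)\<^sup>2)"
  using smooth_trace_compact[OF \<epsilon>] by (elim exE conjE)
 \<comment> \<open>Integrals over the cubes; the square root of \<open>D\<close> turns the sum of
   squares into \<open>D\<close> times the sum of their squares.\<close>
 define l where "l i p = sqrt D * L2_inner M (indicator (Q i)) (fst p)" for i and p :: "('a \<Rightarrow> real) \<times> ('a \<Rightarrow> 'a) \<times> ('a \<Rightarrow> real)"
 let ?c = "\<lambda>i. D * L2_inner M (indicator (Q i)) (indicator (Q i) :: 'a \<Rightarrow> real)"
 define D' where "D' = (\<Sum>i<n. ?c i)"
 have iL: "(indicator (Q i) :: 'a \<Rightarrow> real) \<in> L2 M" if "i < n" for i using Q that by (intro indicator_L2) simp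
 have c0: "?c i \<ge> 0" if "i < n" for i using D by (intro mult_nonneg_nonneg L2.nonneg iL that)
 have cD: "?c i \<le> D'" if "i < n" for i unfolding D'_def using that c0 by (intro member_le_sum) auto
 have add: "l i (x + y) = l i x + l i y" and diff: "l i (x - y) = l i x - l i y" and sc: "l i (r *\<^sub>R x) = r * l i x"
  if "i < n" "x \<in> triples" "y \<in> triples" for i x y r
  using L2.add_right[OF triplesD(1)[OF that(2)] triplesD(1)[OF that(3)] iL[OF that(1)]]
   L2.diff_right[OF triplesD(1)[OF that(2)] triplesD(1)[OF that(3)] iL[OF that(1)]]
   L2.scale_right[OF triplesD(1)[OF that(2)] iL[OF that(1)], of r]
  by (simp_all add: l_def distrib_left right_diff_distrib mult.left_commute)
 have bd: "(l i x)\<^sup>2 \<le> D' * energy x x" if i: "i < n" and x: "x \<in> triples" for i x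
 proof -
  have "(l i x)\<^sup>2 = D * (L2_inner M (indicator (Q i)) (fst x))\<^sup>2" using D by (simp add: l_def power_mult_distrib)
  also have "\<dots> \<le> D * (L2_inner M (indicator (Q i)) (indicator (Q i) :: 'a \<Rightarrow> real) * L2_inner M (fst x) (fst x))"
   by (intro mult_left_mono L2.cauchy_schwarz iL[OF i] triplesD(1)[OF x] D)
  also have "\<dots> = ?c i * L2_inner M (fst x) (fst x)" by simp
  also have "\<dots> \<le> ?c i * energy x x" by (intro mult_left_mono energy_ge(1)[OF x] c0[OF i])
  also have "\<dots> \<le> D' * energy x x" by (intro mult_right_mono cD[OF i] cl.a.nonneg x)
  finally show ?thesis .
 qed
 have C: "bdry x x \<le> \<epsilon> * energy x x + (\<Sum>i<n. (l i x)\<^sup>2)" if x: "x \<in> smooth_triples" for x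
 proof -
  have xt: "x \<in> triples" using x smooth_triples_subset by blast
  have s: "(\<Sum>i<n. (l i x)\<^sup>2) = D * (\<Sum>i<n. (L2_inner M (indicator (Q i)) (fst x))\<^sup>2)"
   using D by (simp add: l_def power_mult_distrib sum_distrib_left)
  have "bdry x x \<le> \<epsilon> * L2_inner M (fst (snd x)) (fst (snd x)) + (\<Sum>i<n. (l i x)\<^sup>2)"
   using x tr[rule_format, of "fst x" "fst (snd x)"] unfolding s by (simp add: smooth_triples_def bdry_def)
  also have "\<dots> \<le> \<epsilon> * energy x x + (\<Sum>i<n. (l i x)\<^sup>2)"
   using \<epsilon> by (intro add_right_mono mult_left_mono energy_ge(2)[OF xt]) simp
  finally show ?thesis .
 qed
 have main: "bdry x x \<le> \<epsilon> * energy x x + (\<Sum>i<n. (l i x)\<^sup>2)" if x: "x \<in> cl.clos" for x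
  by (rule cl.clos_compact[where D = D', OF diff bd C x])
 show ?thesis
 proof (intro exI[of _ n] exI[of _ l] exI[of _ D'] conjI allI impI ballI)
  show "l i (x + y) = l i x + l i y" if "i < n" "x \<in> cl.clos" "y \<in> cl.clos" for i x y
   by (rule add[OF that(1) cl.clos_V[OF that(2)] cl.clos_V[OF that(3)]])
  show "l i (c *\<^sub>R x) = c * l i x" if "i < n" "x \<in> cl.clos" for i x c
   by (rule sc[OF that(1) cl.clos_V[OF that(2)] cl.clos_V[OF that(2)]])
  show "(l i x)\<^sup>2 \<le> D' * energy x x" if "i < n" "x \<in> cl.clos" for i x by (rule bd[OF that(1) cl.clos_V[OF that(2)]])
  show "bdry x x \<le> \<epsilon> * energy x x + (\<Sum>i<n. (l i x)\<^sup>2)" if "x \<in> cl.clos" for x by (rule main[OF that])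
 qed
qed

end

section \<open>Reflection orthogonal to the axis\<close>

context cusp
begin

text \<open>A second coordinate direction, available because n \<ge> 2; reflecting in it preserves
  x_n and |x'|.\<close>

definition b0 :: 'a where "b0 = (SOME b. b \<in> Basis \<and> b \<noteq> e)"

lemma b0: "b0 \<in> Basis" "b0 \<noteq> e" "b0 \<bullet> b0 = 1" "b0 \<bullet> e = 0" "e \<bullet> b0 = 0" "norm b0 = 1"
proof -
 have "\<exists>b. b \<in> Basis \<and> b \<noteq> e"
 proof (rule ccontr)
  assume "\<not> ?thesis"
  then have "(Basis :: 'a set) \<subseteq> {e}" by blast
  then have "card (Basis :: 'a set) \<le> 1" using card_mono[of "{e}" "Basis :: 'a set"] by simp
  then show False using dim by simp
 qed
 from someI_ex[OF this] show b: "b0 \<in> Basis" "b0 \<noteq> e" by (simp_all add: b0_def)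
 show "b0 \<bullet> b0 = 1" "b0 \<bullet> e = 0" "e \<bullet> b0 = 0" "norm b0 = 1"
  using b e inner_not_same_Basis[of b0 e] inner_not_same_Basis[of e b0] by auto
qed

definition R :: "'a \<Rightarrow> 'a" where "R x = x - (2 * (x \<bullet> b0)) *\<^sub>R b0"

lemma linear_R: "linear R"
 by (rule linearI) (simp_all add: R_def inner_add_left algebra_simps)

lemma R_R [simp]: "R (R x) = x"
 by (simp add: R_def inner_diff_left b0)

lemma R_inner [simp]: "R x \<bullet> R y = x \<bullet> y"
 by (simp add: R_def inner_diff_left inner_diff_right b0 inner_commute[of b0 y])

lemma norm_R [simp]: "norm (R x) = norm x"
 by (simp add: norm_eq_sqrt_inner)

lemma R_Basis: "i \<in> Basis \<Longrightarrow> R i = (if i = b0 then -1 else 1) *\<^sub>R i"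
 using b0 by (auto simp: R_def inner_not_same_Basis scaleR_2 algebra_simps)

lemma R_inner_Basis: "i \<in> Basis \<Longrightarrow> R x \<bullet> i = (if i = b0 then -1 else 1) * (x \<bullet> i)"
 using R_inner[of x "R i"] unfolding R_R by (simp add: R_Basis)

lemma R_e [simp]: "R x \<bullet> e = x \<bullet> e"
 using R_inner_Basis[OF e] b0(2) by simp

lemma R_b0 [simp]: "R x \<bullet> b0 = - (x \<bullet> b0)"
 using R_inner_Basis[OF b0(1)] by simp

lemma continuous_R: "continuous_on S R"
 unfolding R_def by (intro continuous_intros)

lemma R_measurable [measurable]: "R \<in> borel \<rightarrow>\<^sub>M borel"
 by (rule borel_measurable_continuous_onI[OF continuous_R])

lemma pr_R: "norm (pr (R x)) = norm (pr x)"
proof -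
 have "pr (R x) = R (pr x)" by (simp add: pr_def R_def inner_diff_left b0 algebra_simps)
 then show ?thesis by simp
qed

lemma R_\<Omega>: "R ` \<Omega> \<subseteq> \<Omega>"
 by (auto simp only: \<Omega>_eq ball_iff pr_R R_e image_subset_iff mem_Collect_eq Un_iff)

lemma R_closure: "R ` closure \<Omega> \<subseteq> closure \<Omega>"
 using R_\<Omega> closure_subset by (intro image_closure_subset continuous_R closed_closure) blast

lemma R_frontier: "R ` frontier \<Omega> \<subseteq> frontier \<Omega>"
proof
 fix y assume "y \<in> R ` frontier \<Omega>"
 then obtain x where x: "y = R x" "x \<in> closure \<Omega>" "x \<notin> \<Omega>" by (auto simp: frontier_def interior_open[OF open_\<Omega>])
 have "R x \<notin> \<Omega>"
 proof
  assume "R x \<in> \<Omega>"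
  then have "R (R x) \<in> \<Omega>" using R_\<Omega> by blast
  then show False using x(3) by simp
 qed
 moreover have "R x \<in> closure \<Omega>" using R_closure x(2) by blast
 ultimately show "y \<in> frontier \<Omega>" using x(1) by (simp add: frontier_def interior_open[OF open_\<Omega>])
qed

lemma w_R: "w (R x) = w x"
 using pr_R[of x] by (simp add: cusp_weight_def pr_def)

text \<open>In coordinates \<open>R\<close> is diagonal with entries of modulus 1, so the density in
  the affine change of variables is 1.\<close>

lemma lebesgue_R: "R \<in> lebesgue \<rightarrow>\<^sub>M lebesgue" "distr lebesgue lebesgue R = (lebesgue :: 'a measure)"
proof -
 let ?c = "\<lambda>i::'a. if i = b0 then -1 else 1 :: real"
 have R_eq: "R = (\<lambda>x. 0 + (\<Sum>j\<in>Basis. (?c j * (x \<bullet> j)) *\<^sub>R j))"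
 proof
  fix x
  have "R x = (\<Sum>j\<in>Basis. (R x \<bullet> j) *\<^sub>R j)" by (rule euclidean_representation[symmetric])
  also have "\<dots> = (\<Sum>j\<in>Basis. (?c j * (x \<bullet> j)) *\<^sub>R j)" by (rule sum.cong[OF refl]) (simp only: R_inner_Basis)
  finally show "R x = 0 + (\<Sum>j\<in>Basis. (?c j * (x \<bullet> j)) *\<^sub>R j)" by simp
 qed
 have c: "?c j \<noteq> 0" for j by simp
 show m: "R \<in> lebesgue \<rightarrow>\<^sub>M lebesgue" unfolding R_eq by (rule lebesgue_affine_measurable) (rule c)
 have "lebesgue = density (distr lebesgue lebesgue R) (\<lambda>_. (\<Prod>j\<in>Basis. \<bar>?c j\<bar>))"
  unfolding R_eq by (rule lebesgue_affine_euclidean) (rule c)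
 also have "(\<Prod>j\<in>Basis. \<bar>?c j\<bar>) = 1" by (intro prod.neutral) simp
 finally show "distr lebesgue lebesgue R = (lebesgue :: 'a measure)" by (simp add: density_1)
qed

text \<open>\<open>R\<close> is an isometry and its own inverse, so the fact that isometries do not
  increase Hausdorff measure applies in both directions.\<close>

lemma hmeas_R: "R \<in> hmeas \<rightarrow>\<^sub>M hmeas" "distr hmeas hmeas R = (hmeas :: 'a measure)"
proof -
 show m: "R \<in> hmeas \<rightarrow>\<^sub>M hmeas" using R_measurable by (simp cong: measurable_cong_sets)
 show "distr hmeas hmeas R = (hmeas :: 'a measure)"
 proof (rule measure_eqI)
  fix A assume "A \<in> sets (distr hmeas hmeas R)"
  then have A: "A \<in> sets borel" by simp
  have RA: "R -` A \<in> sets borel" using measurable_sets[OF R_measurable A] by simp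
  have s: "real DIM('a) - 1 > 0" using dim by simp
  have iso: "dist (R x) (R y) = dist x y" for x y
   using norm_R[of "x - y"] linear_diff[OF linear_R, of x y] by (simp add: dist_norm)
  have im: "R ` A = R -` A" by (auto simp: image_iff) (metis R_R)
  have "hausdorff_surf (R -` A) \<le> hausdorff_surf A"
   unfolding im[symmetric] by (rule hausdorff_image_isometry[OF s iso])
  moreover have "A = R ` (R -` A)" by (auto simp: image_iff) (metis R_R)
  then have "hausdorff_surf A \<le> hausdorff_surf (R -` A)" using hausdorff_image_isometry[OF s iso, of "R -` A"] by simp
  ultimately show "emeasure (distr hmeas hmeas R) A = emeasure hmeas A"
   using A RA m by (simp add: emeasure_distr emeasure_hmeas[OF dim])
 qed simp
qed

lemma M_R: "R \<in> M \<rightarrow>\<^sub>M M" "distr M M R = M"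
 by (rule distr_restrict_space[OF lebesgue_R R_R R_\<Omega>]; use open_\<Omega> in simp)+

lemma N_R: "R \<in> N \<rightarrow>\<^sub>M N" "distr N N R = N"
proof -
 have s: "surf (frontier \<Omega>) = restrict_space hmeas (frontier \<Omega>)" by (rule surf_eq_restrict_hmeas[OF dim frontier_borel])
 have 1: "R \<in> surf (frontier \<Omega>) \<rightarrow>\<^sub>M surf (frontier \<Omega>)" "distr (surf (frontier \<Omega>)) (surf (frontier \<Omega>)) R = surf (frontier \<Omega>)"
  unfolding s by (rule distr_restrict_space[OF hmeas_R R_R R_frontier]; simp)+
 have w: "(\<lambda>x. ennreal (w x)) \<in> borel_measurable (surf (frontier \<Omega>))" using w_surf by measurable
 show "R \<in> N \<rightarrow>\<^sub>M N" "distr N N R = N" unfolding N_def by (rule distr_density_invariant[OF 1 w]; simp add: w_R)+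
qed

text \<open>Chain rule: since \<open>R\<close> is linear and symmetric, the gradient of u composed
  with \<open>R\<close> is the gradient of u at the reflected point, itself reflected.\<close>

definition refl :: "('a \<Rightarrow> real) \<times> ('a \<Rightarrow> 'a) \<times> ('a \<Rightarrow> real) \<Rightarrow> ('a \<Rightarrow> real) \<times> ('a \<Rightarrow> 'a) \<times> ('a \<Rightarrow> real)" where
 "refl p = (\<lambda>x. fst p (R x), \<lambda>x. R (fst (snd p) (R x)), \<lambda>x. snd (snd p) (R x))"

lemma refl_refl [simp]: "refl (refl p) = p"
 by (simp add: refl_def)

lemma refl_add: "refl (p + q) = refl p + refl q"
 by (simp add: refl_def plus_fun_def plus_prod_def linear_add[OF linear_R])

lemma refl_scaleR: "refl (c *\<^sub>R p) = c *\<^sub>R refl p"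
 by (simp add: refl_def scaleR_fun_def scaleR_prod_def linear_cmul[OF linear_R])

lemma refl_diff: "refl (p - q) = refl p - refl q"
 using refl_add[of "p - q" q] by (simp add: algebra_simps)

lemma R_L2:
 assumes "G \<in> L2 M"
 shows "(\<lambda>x. R (G (R x))) \<in> L2 M"
proof -
 have "(\<lambda>x. G (R x)) \<in> L2 M" by (rule L2_distr[OF M_R assms])
 then show ?thesis using measurable_compose[OF L2_measurable R_measurable, of "\<lambda>x. G (R x)" M] by (simp add: L2_def)
qed

lemma L2_inner_R:
 assumes "G \<in> L2 M" "H \<in> L2 M"
 shows "L2_inner M (\<lambda>x. R (G (R x))) (\<lambda>x. R (H (R x))) = L2_inner M G H"
 using L2_inner_distr[OF M_R assms] by (simp add: L2_inner_def)

text \<open>A change of variables moves the reflection to the test function. The sign of the i-th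
  coordinate enters twice, from the derivative of the reflected test function and from
  \<open>R i\<close>, and cancels.\<close>

lemma weak_grad_R:
 assumes w: "weak_grad \<Omega> u G"
 shows "weak_grad \<Omega> (\<lambda>x. u (R x)) (\<lambda>x. R (G (R x)))"
 unfolding weak_grad_iff_L2
proof (intro conjI allI impI ballI)
 have L: "u \<in> L2 M" "G \<in> L2 M" using w by (simp_all add: weak_grad_iff_L2)
 show "(\<lambda>x. u (R x)) \<in> L2 M" by (rule L2_distr[OF M_R L(1)])
 show "(\<lambda>x. R (G (R x))) \<in> L2 M" by (rule R_L2[OF L(2)])
 fix \<phi> i assume \<phi>: "test_fun \<Omega> \<phi>" and i: "i \<in> (Basis :: 'a set)"
 let ?c = "if i = b0 then -1 else 1 :: real"
 let ?\<psi> = "\<lambda>x. \<phi> (R x)"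
 have cc: "?c * ?c = 1" by simp
 have \<psi>: "test_fun \<Omega> ?\<psi>" and d: "pd ?\<psi> i x = ?c * pd \<phi> i (R x)" for x
  using test_fun_reflect[OF \<phi> linear_R R_Basis R_R R_\<Omega>] i by blast+
 note TL = test_fun_L2[OF dom]
 have Ri: "R i = ?c *\<^sub>R i" by (rule R_Basis[OF i])
 have "L2_inner M (\<lambda>x. u (R x)) (pd \<phi> i) = L2_inner M (\<lambda>x. u (R x)) (\<lambda>x. (\<lambda>y. pd \<phi> i (R y)) (R x))" by simp
 also have "(\<lambda>y. pd \<phi> i (R y)) = ?c *\<^sub>R (pd ?\<psi> i)" using cc by (auto simp: fun_eq_iff d scaleR_fun_def)
 also have "L2_inner M (\<lambda>x. u (R x)) (\<lambda>x. (?c *\<^sub>R (pd ?\<psi> i)) (R x)) =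
   L2_inner M u (?c *\<^sub>R (pd ?\<psi> i))" by (rule L2_inner_distr[OF M_R L(1) L2.H_scale[OF TL(1)[OF \<psi> i]]])
 also have "\<dots> = ?c * L2_inner M u (pd ?\<psi> i)" by (rule L2.scale_right[OF TL(1)[OF \<psi> i] L(1)])
 also have "L2_inner M u (pd ?\<psi> i) = - L2_inner M G (\<lambda>x. ?\<psi> x *\<^sub>R i)" using w \<psi> i by (simp add: weak_grad_iff_L2)
 also have "L2_inner M G (\<lambda>x. ?\<psi> x *\<^sub>R i) = L2_inner M (\<lambda>x. R (G (R x))) (\<lambda>x. R (?\<psi> (R x) *\<^sub>R i))"
  by (rule L2_inner_R[OF L(2) TL(2)[OF \<psi> i], symmetric])
 also have "(\<lambda>x. R (?\<psi> (R x) *\<^sub>R i)) = ?c *\<^sub>R (\<lambda>x. \<phi> x *\<^sub>R i)"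
  by (simp add: fun_eq_iff scaleR_fun_def linear_cmul[OF linear_R] Ri)
 also have "L2_inner M (\<lambda>x. R (G (R x))) (?c *\<^sub>R (\<lambda>x. \<phi> x *\<^sub>R i)) = ?c * L2_inner M (\<lambda>x. R (G (R x))) (\<lambda>x. \<phi> x *\<^sub>R i)"
  by (rule L2.scale_right[OF TL(2)[OF \<phi> i] R_L2[OF L(2)]])
 finally show "L2_inner M (\<lambda>x. u (R x)) (pd \<phi> i) = - L2_inner M (\<lambda>x. R (G (R x))) (\<lambda>x. \<phi> x *\<^sub>R i)" using cc by auto
qed

lemma refl_triples: "p \<in> triples \<Longrightarrow> refl p \<in> triples"
 by (simp add: triples_def refl_def weak_grad_R L2_distr[OF N_R])

lemma refl_smooth_triples:
 assumes "p \<in> smooth_triples"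
 shows "refl p \<in> smooth_triples"
proof -
 have "continuous_on (closure \<Omega>) (\<lambda>x. fst p (R x))"
  using assms R_closure by (intro continuous_on_compose2[OF _ continuous_R, of "closure \<Omega>"]) (auto simp: smooth_triples_def)
 then show ?thesis using assms by (simp add: smooth_triples_def refl_def weak_grad_R)
qed

lemma energy_refl: "p \<in> triples \<Longrightarrow> q \<in> triples \<Longrightarrow> energy (refl p) (refl q) = energy p q"
 by (simp add: energy_def refl_def L2_inner_R L2_inner_distr[OF M_R] triplesD)

lemma bdry_refl: "p \<in> triples \<Longrightarrow> q \<in> triples \<Longrightarrow> bdry (refl p) (refl q) = bdry p q"
 by (simp add: bdry_def refl_def L2_inner_distr[OF N_R] triplesD)

lemma refl_clos:
 assumes "p \<in> cl.clos"
 shows "refl p \<in> cl.clos"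
proof -
 have "\<exists>X. (\<forall>k. X k \<in> smooth_triples) \<and> cl.approx X p" and pt: "p \<in> triples"
  using assms by (simp_all add: cl.clos_def)
 then obtain X where X: "\<forall>k. X k \<in> smooth_triples" "cl.approx X p" by blast
 have d: "X k - p \<in> triples" for k
  using X(1) smooth_triples_subset by (intro subspace_diff[OF subspace_triples _ pt]) blast
 have "cl.approx (\<lambda>k. refl (X k)) (refl p)"
  using X(2) by (simp add: cl.approx_def refl_diff[symmetric] energy_refl bdry_refl d)
 then show ?thesis unfolding cl.clos_def
  using X(1) refl_triples[OF pt] by (intro CollectI conjI exI[of _ "\<lambda>k. refl (X k)"] allI refl_smooth_triples) simp_all
qed

definition mean :: "('a \<Rightarrow> real) \<times> ('a \<Rightarrow> 'a) \<times> ('a \<Rightarrow> real) \<Rightarrow> real" where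
 "mean p = L2_inner N (\<lambda>_. 1) (snd (snd p))"

lemma one_L2_N: "(\<lambda>_. 1 :: real) \<in> L2 N"
 by (rule continuous_L2_N) simp

lemma mean_refl: "p \<in> triples \<Longrightarrow> mean (refl p) = mean p"
 using L2_inner_distr[OF N_R one_L2_N triplesD(3), of p] by (simp add: mean_def refl_def)

end

section \<open>Odd functions with independent traces\<close>

context cusp
begin

text \<open>The factor x \<bullet> b0 is odd under the reflection and the powers of x_n are even, so
  linear combinations are x \<bullet> b0 times arbitrary polynomials in x_n.\<close>

definition odd_triple :: "nat \<Rightarrow> ('a \<Rightarrow> real) \<times> ('a \<Rightarrow> 'a) \<times> ('a \<Rightarrow> real)" where
 "odd_triple i = (\<lambda>x. (x \<bullet> b0) * (x \<bullet> e) ^ i,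
   \<lambda>x. (x \<bullet> e) ^ i *\<^sub>R b0 + (real i * (x \<bullet> e) ^ (i - 1) * (x \<bullet> b0)) *\<^sub>R e,
   \<lambda>x. (x \<bullet> b0) * (x \<bullet> e) ^ i)"

lemma odd_triple_smooth: "odd_triple i \<in> smooth_triples"
proof -
 have "weak_grad \<Omega> (\<lambda>x. (x \<bullet> b0) * (x \<bullet> e) ^ i) (\<lambda>x. (x \<bullet> e) ^ i *\<^sub>R b0 + (real i * (x \<bullet> e) ^ (i - 1) * (x \<bullet> b0)) *\<^sub>R e)"
 proof (rule weak_grad_C1[OF dom])
  show "((\<lambda>x. (x \<bullet> b0) * (x \<bullet> e) ^ i) has_derivative
    (\<lambda>h. ((x \<bullet> e) ^ i *\<^sub>R b0 + (real i * (x \<bullet> e) ^ (i - 1) * (x \<bullet> b0)) *\<^sub>R e) \<bullet> h)) (at x)" for x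
   by (auto intro!: derivative_eq_intros simp: fun_eq_iff inner_add_left inner_commute[of _ b0] inner_commute[of _ e])
 qed (intro continuous_intros)
 then show ?thesis by (auto simp: smooth_triples_def odd_triple_def intro!: continuous_intros)
qed

lemma refl_odd_triple: "refl (odd_triple i) = - odd_triple i"
proof -
 have "R (a *\<^sub>R b0 - c *\<^sub>R e) = - (a *\<^sub>R b0) - c *\<^sub>R e" for a c
  by (simp add: linear_diff[OF linear_R] linear_cmul[OF linear_R] R_Basis[OF b0(1)] R_Basis[OF e] b0(2)[symmetric])
 then show ?thesis by (simp add: refl_def odd_triple_def fun_eq_iff uminus_prod_def)
qed

text \<open>Over the unit disc the upper cap of the sphere is the graph of \<open>s\<close> and
  belongs to the frontier. Unit segments issuing from its points with the required nonvanishing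
  cover a nonempty open set, which is impossible from a set of zero surface measure.\<close>

lemma top_cap_positive:
 assumes q: "q \<noteq> 0"
 shows "hausdorff_surf {x \<in> frontier \<Omega>. x \<bullet> e > 2 \<and> x \<bullet> b0 \<noteq> 0 \<and> poly q (x \<bullet> e) \<noteq> 0} > 0"
proof -
 define s where "s y = 2 + sqrt (2 - (norm (pr y))\<^sup>2)" for y
 \<comment> \<open>Over the disc the cap has height \<open>s y\<close> between 3 and 7/2, so a point
   of height between 7/2 and 4 lies at most 1 above it.\<close>
 define U where "U = ({y. 7/2 < y \<bullet> e} \<inter> {y. y \<bullet> e < 4}) \<inter> ({y. 0 < y \<bullet> b0} \<inter> {y. norm (pr y) < 1}) \<inter> {y. poly q (s y) \<noteq> 0}"
 have "continuous_on UNIV s" unfolding s_def by (intro continuous_intros)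
 then have "open U" unfolding U_def
  by (intro open_Int open_Collect_less open_Collect_neq continuous_intros continuous_on_compose2[OF continuous_on_poly[OF continuous_on_id]]) auto
 moreover have "U \<noteq> {}"
 proof -
  let ?f = "\<lambda>r::real. 2 + sqrt (2 - r\<^sup>2)"
  \<comment> \<open>The height of the cap takes infinitely many values, whereas \<open>q\<close> has
    finitely many roots.\<close>
  have "inj_on ?f {0<..<1}"
  proof (rule inj_onI)
   fix r t :: real assume rt: "r \<in> {0<..<1}" "t \<in> {0<..<1}" "?f r = ?f t"
   then have "r\<^sup>2 = t\<^sup>2" by simp
   then show "r = t" using rt(1,2) by (simp add: power2_eq_iff_nonneg)
  qed
  then have "infinite (?f ` {0<..<1})" by (subst finite_image_iff) simp_all
  then have "\<not> ?f ` {0<..<1} \<subseteq> {t. poly q t = 0}" using poly_roots_finite[OF q] by (metis finite_subset)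
  then obtain t where t: "t \<in> ?f ` {0<..<1}" "poly q t \<noteq> 0" by blast
  from t(1) obtain r where "t = ?f r" "r \<in> {0<..<1}" by (rule imageE)
  with t(2) have r: "0 < r" "r < 1" "poly q (?f r) \<noteq> 0" by simp_all
  let ?y = "r *\<^sub>R b0 + (15/4) *\<^sub>R e"
  have "pr ?y = r *\<^sub>R b0" by (simp add: pr_def inner_add_left b0)
  then have "?y \<in> U" using r by (simp add: U_def s_def inner_add_left b0)
  then show ?thesis by blast
 qed
 ultimately show ?thesis
 proof (rule hausdorff_pos_of_shadow[OF dim e])
  fix y assume y: "y \<in> U"
  define x where "x = pr y + s y *\<^sub>R e"
  have pe: "pr y \<bullet> e = 0" by (simp add: pr_def inner_diff_left)
  have n: "norm (pr y) < 1" using y by (simp add: U_def)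
  then have n2: "(norm (pr y))\<^sup>2 < 1" by (simp add: power_less_one_iff abs_square_less_1)
  have s3: "3 < s y" using n2 by (simp add: s_def real_less_rsqrt)
  have "sqrt (2 - (norm (pr y))\<^sup>2) \<le> 3/2"
  proof (rule real_le_lsqrt)
   have "(3/2::real)\<^sup>2 = 9/4" by (simp add: power_divide)
   then show "2 - (norm (pr y))\<^sup>2 \<le> (3/2)\<^sup>2" using zero_le_power2[of "norm (pr y)"] by linarith
  qed simp_all
  then have s4: "s y \<le> 7/2" by (simp add: s_def)
  have xe: "x \<bullet> e = s y" by (simp add: x_def inner_add_left pe)
  have prx: "pr x = pr y" by (simp add: x_def) (simp add: pr_def inner_diff_left)
  have xb: "x \<bullet> b0 = y \<bullet> b0" by (simp add: x_def pr_def inner_add_left inner_diff_left b0)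
  have sq: "(norm (pr x))\<^sup>2 + (x \<bullet> e - 2)\<^sup>2 = 2" using n2 by (simp add: prx xe s_def)
  have nx: "norm (x - 2 *\<^sub>R e) = sqrt 2" using norm_diff_2e[of x] sq by (metis norm_ge_zero real_sqrt_unique)
  have "x \<in> closure (ball (2 *\<^sub>R e) (sqrt 2))" using nx by (simp add: dist_norm norm_minus_commute)
  then have "x \<in> closure \<Omega>" using closure_mono[of "ball (2 *\<^sub>R e) (sqrt 2)" \<Omega>] by (auto simp: cusp_dom_def)
  moreover have "x \<notin> \<Omega>" unfolding \<Omega>_eq using s3 sq by (simp add: xe ball_iff del: mem_ball)
  ultimately have "x \<in> frontier \<Omega>" by (simp add: frontier_def interior_open[OF open_\<Omega>])
  then have "x \<in> {x \<in> frontier \<Omega>. x \<bullet> e > 2 \<and> x \<bullet> b0 \<noteq> 0 \<and> poly q (x \<bullet> e) \<noteq> 0}" using y s3 by (simp add: xe xb U_def)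
  moreover have "y = x + (y \<bullet> e - s y) *\<^sub>R e" by (simp add: x_def pr_def algebra_simps)
  moreover have "y \<bullet> e - s y \<in> {0..1}" using y s3 s4 by (simp add: U_def)
  ultimately show "\<exists>x\<in>{x \<in> frontier \<Omega>. x \<bullet> e > 2 \<and> x \<bullet> b0 \<noteq> 0 \<and> poly q (x \<bullet> e) \<noteq> 0}. \<exists>t\<in>{0..1}. y = x + t *\<^sub>R e"
   by blast
 qed
qed

text \<open>The combination has trace x \<bullet> b0 times a nonzero polynomial in x_n. Above height
  2 the weight is 1, so vanishing N-almost everywhere means vanishing almost everywhere on the cap,
  against \<open>top_cap_positive\<close>.\<close>

lemma odd_triples_independent:
 assumes z: "bdry (\<Sum>i<n. c i *\<^sub>R odd_triple i) (\<Sum>i<n. c i *\<^sub>R odd_triple i) = 0" and i: "i < n"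
 shows "c i = 0"
proof (rule ccontr)
 assume ci: "c i \<noteq> 0"
 define q where "q = (\<Sum>i<n. monom (c i) i)"
 define f where "f x = (x \<bullet> b0) * poly q (x \<bullet> e)" for x
 have "coeff q i = c i" using i by (simp add: q_def coeff_sum if_distrib sum.delta cong: if_cong)
 then have q: "q \<noteq> 0" using ci by auto
 have s: "snd (snd (\<Sum>i<n. c i *\<^sub>R odd_triple i)) = f"
 proof -
  have "snd (snd (\<Sum>i<m. c i *\<^sub>R odd_triple i)) = (\<lambda>x. (x \<bullet> b0) * (\<Sum>i<m. c i * (x \<bullet> e) ^ i))" for m
  proof (induction m)
   case (Suc m)
   then show ?case by (simp add: fun_eq_iff odd_triple_def scaleR_fun_def distrib_left)
  qed (simp add: zero_fun_def)
  then show ?thesis by (simp add: f_def[abs_def] q_def poly_sum poly_monom)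
 qed
 have cf: "continuous_on UNIV f" unfolding f_def by (intro continuous_intros)
 have fL: "f \<in> L2 N" by (rule continuous_L2_N[OF continuous_on_subset[OF cf]]) simp
 have "AE x in N. f x = 0" using z L2_null_iff[OF fL] by (simp add: bdry_def s)
 then have "AE x in surf (frontier \<Omega>). 0 < ennreal (w x) \<longrightarrow> f x = 0"
  unfolding N_def using w_surf by (subst (asm) AE_density) auto
 then have ae: "AE x in surf (frontier \<Omega>). \<not> (x \<bullet> e > 2 \<and> f x \<noteq> 0)" by eventually_elim (auto simp: cusp_weight_def)
 let ?A = "{x \<in> frontier \<Omega>. x \<bullet> e > 2 \<and> f x \<noteq> 0}"
 have "emeasure (surf (frontier \<Omega>)) ?A = 0" using emeasure_eq_0_AE[OF ae] by simp
 moreover have "?A \<in> sets borel"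
 proof -
  have "?A = frontier \<Omega> \<inter> ({x. 2 < x \<bullet> e} \<inter> {x. f x \<noteq> 0})" by auto
  also have "\<dots> \<in> sets borel"
   by (intro sets.Int frontier_borel borel_open open_Collect_less open_Collect_neq continuous_intros cf)
  finally show ?thesis .
 qed
 ultimately have "hausdorff_surf ?A = 0" using emeasure_surf[OF dim frontier_borel, of ?A] by auto
 moreover have "?A = {x \<in> frontier \<Omega>. x \<bullet> e > 2 \<and> x \<bullet> b0 \<noteq> 0 \<and> poly q (x \<bullet> e) \<noteq> 0}" by (auto simp: f_def)
 ultimately show False using top_cap_positive[OF q] by simp
qed

end

lemma psd_form_subset:
 assumes "psd_form V f" "subspace W" "W \<subseteq> V"
 shows "psd_form W f"
proof -
 interpret psd_form V f by fact
 show ?thesis by (rule psd_form.intro) (use assms(2,3) in \<open>auto intro: add_left scale_left sym nonneg\<close>)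
qed

section \<open>Eigenpairs as eigenvectors of the pair of forms\<close>

context cusp
begin

sublocale sp: compact_forms cl.clos energy bdry refl mean trace_const
proof (rule compact_forms.intro)
 have sub: "cl.clos \<subseteq> triples" using cl.clos_V by (rule subsetI)
 show "psd_form cl.clos energy" by (rule psd_form_subset[OF psd_form_energy cl.subspace_clos sub])
 show "psd_form cl.clos bdry" by (rule psd_form_subset[OF psd_form_bdry cl.subspace_clos sub])
 show "compact_forms_axioms cl.clos energy bdry refl mean trace_const"
 proof (rule compact_forms_axioms.intro)
  show "\<exists>x\<in>cl.clos. (\<lambda>k. energy (X k - x) (X k - x)) \<longlonglongrightarrow> 0"
   if "\<And>k. X k \<in> cl.clos" "\<And>\<epsilon>. \<epsilon> > 0 \<Longrightarrow> \<exists>N. \<forall>k\<ge>N. \<forall>l\<ge>N. energy (X k - X l) (X k - X l) < \<epsilon>" for X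
   by (rule cl.clos_complete[OF that])
  show "energy (refl x) (refl y) = energy x y" if "x \<in> cl.clos" "y \<in> cl.clos" for x y
   using that cl.clos_V by (intro energy_refl)
  show "bdry (refl x) (refl y) = bdry x y" if "x \<in> cl.clos" "y \<in> cl.clos" for x y
   using that cl.clos_V by (intro bdry_refl)
  show "mean (refl x) = mean x" if "x \<in> cl.clos" for x using that cl.clos_V by (intro mean_refl)
  show "mean (x + y) = mean x + mean y" if "x \<in> cl.clos" "y \<in> cl.clos" for x y
   using L2.add_right[OF triplesD(3)[OF cl.clos_V[OF that(1)]] triplesD(3)[OF cl.clos_V[OF that(2)]] one_L2_N]
   by (simp add: mean_def)
  show "mean (c *\<^sub>R x) = c * mean x" if "x \<in> cl.clos" for c x
   using L2.scale_right[OF triplesD(3)[OF cl.clos_V[OF that]] one_L2_N] by (simp add: mean_def)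
  show "\<exists>g. (\<forall>i<n. g i \<in> cl.clos \<and> refl (g i) = - g i) \<and>
     (\<forall>c. bdry (\<Sum>i<n. c i *\<^sub>R g i) (\<Sum>i<n. c i *\<^sub>R g i) = 0 \<longrightarrow> (\<forall>i<(n::nat). c i = 0))" for n
   by (intro exI[of _ odd_triple] conjI allI impI cl.C_clos odd_triple_smooth refl_odd_triple)
    (rule odd_triples_independent)
 qed ((rule cl.clos_le clos_compact_form refl_clos refl_add refl_scaleR refl_refl; assumption?)+)
qed

text \<open>By uniqueness of weak gradients G vanishes together with u, so u alone detects the null
  vectors of the energy.\<close>

lemma energy_null_iff:
 assumes p: "(u, G, T) \<in> triples"
 shows "energy (u, G, T) (u, G, T) = 0 \<longleftrightarrow> (AE x in M. u x = 0)"
proof -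
 have L: "u \<in> L2 M" "G \<in> L2 M" "weak_grad \<Omega> u G" using triplesD[OF p] by simp_all
 have n: "0 \<le> L2_inner M u u" "0 \<le> L2_inner M G G" by (intro L2.nonneg L)+
 have G0: "AE x in M. G x = 0" if "AE x in M. u x = 0"
 proof -
  have "AE x in M. G x = (0 :: 'a \<Rightarrow> 'a) x"
   by (rule weak_grad_unique[OF dom L(3) weak_grad_zero[OF dom]]) (use that in simp)
  then show ?thesis by simp
 qed
 show ?thesis
 proof
  assume "energy (u, G, T) (u, G, T) = 0"
  then have "L2_inner M u u = 0" using n by (simp add: energy_def add_nonneg_eq_0_iff)
  then show "AE x in M. u x = 0" unfolding L2_null_iff[OF L(1)] .
 next
  assume A: "AE x in M. u x = 0"
  have "L2_inner M u u = 0" unfolding L2_null_iff[OF L(1)] by (rule A)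
  moreover have "L2_inner M G G = 0" unfolding L2_null_iff[OF L(2)] by (rule G0[OF A])
  ultimately show "energy (u, G, T) (u, G, T) = 0" by (simp add: energy_def)
 qed
qed

text \<open>By \<open>clos_iff\<close> the triples quantified in \<open>eigenpair\<close> are the
  vectors of the form domain, and by \<open>energy_null_iff\<close> nonvanishing of u is
  nonvanishing of the energy.\<close>

lemma eigenpair_iff:
 "eigenpair \<Omega> w l u \<longleftrightarrow> (\<exists>G T. (u, G, T) \<in> sp.eigenspace l \<and> energy (u, G, T) (u, G, T) \<noteq> 0)"
proof -
 have m: "mean (u, G, T) = (LINT x|surf (frontier \<Omega>). T x * w x)" if "(u, G, T) \<in> cl.clos" for G T
  using L2_measurable[OF triplesD(3)[OF cl.clos_V[OF that]]] by (simp add: mean_def L2_inner_def integral_N mult.commute)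
 have b: "bdry (u, G, T) (v, G', T') = (LINT x|surf (frontier \<Omega>). T x * T' x * w x)"
  if "(u, G, T) \<in> cl.clos" "(v, G', T') \<in> cl.clos" for G T v G' T'
 proof -
  have "(\<lambda>x. T x * T' x) \<in> borel_measurable N"
   using L2_measurable[OF triplesD(3)[OF cl.clos_V[OF that(1)]]] L2_measurable[OF triplesD(3)[OF cl.clos_V[OF that(2)]]]
   by simp
  then show ?thesis by (simp add: bdry_def L2_inner_def integral_N mult.commute)
 qed
 have a: "energy (u, G, T) (v, G', T') = (LINT x|M. G x \<bullet> G' x) + (LINT x|M. u x * v x)" for G T v G' T'
  by (simp add: energy_def L2_inner_def)
 have es: "(u, G, T) \<in> sp.eigenspace l \<longleftrightarrow> weak_grad \<Omega> u G \<and> has_trace \<Omega> w u T \<and>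
   (LINT x|surf (frontier \<Omega>). T x * w x) = 0 \<and>
   (\<forall>v G' T'. weak_grad \<Omega> v G' \<and> has_trace \<Omega> w v T' \<longrightarrow>
     (LINT x|M. G x \<bullet> G' x) + (LINT x|M. u x * v x) = l * (LINT x|surf (frontier \<Omega>). T x * T' x * w x))" for G T
 proof (cases "(u, G, T) \<in> cl.clos")
  case True
  have "(u, G, T) \<in> sp.eigenspace l \<longleftrightarrow> mean (u, G, T) = 0 \<and>
   (\<forall>v G' T'. (v, G', T') \<in> cl.clos \<longrightarrow> energy (u, G, T) (v, G', T') = l * bdry (u, G, T) (v, G', T'))"
   using True by (simp add: sp.eigenspace_def split_paired_Ball_Sigma Ball_def)
  also have "\<dots> \<longleftrightarrow> (LINT x|surf (frontier \<Omega>). T x * w x) = 0 \<and>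
   (\<forall>v G' T'. (v, G', T') \<in> cl.clos \<longrightarrow>
     (LINT x|M. G x \<bullet> G' x) + (LINT x|M. u x * v x) = l * (LINT x|surf (frontier \<Omega>). T x * T' x * w x))"
   using m[OF True] by (simp add: a b[OF True])
  finally show ?thesis using True[unfolded clos_iff] by (simp add: clos_iff)
 next
  case False
  then show ?thesis by (auto simp: sp.eigenspace_def clos_iff)
 qed
 have nz: "energy (u, G, T) (u, G, T) \<noteq> 0 \<longleftrightarrow> \<not> (AE x in M. u x = 0)" if "(u, G, T) \<in> sp.eigenspace l" for G T
 proof -
  have "(u, G, T) \<in> triples" using that by (intro cl.clos_V) (simp add: sp.eigenspace_def)
  from energy_null_iff[OF this] show ?thesis by blast
 qed
 have "(\<exists>G T. (u, G, T) \<in> sp.eigenspace l \<and> energy (u, G, T) (u, G, T) \<noteq> 0) \<longleftrightarrow>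
   \<not> (AE x in M. u x = 0) \<and> (\<exists>G T. (u, G, T) \<in> sp.eigenspace l)" using nz by blast
 then show ?thesis unfolding es eigenpair_def sobolev12_def by blast
qed

lemma fst_sum_scaleR: "fst (\<Sum>i<n. c i *\<^sub>R P i) = (\<lambda>x. \<Sum>i<n. c i * fst (P i) x)"
 for P :: "nat \<Rightarrow> ('a \<Rightarrow> real) \<times> ('a \<Rightarrow> 'a) \<times> ('a \<Rightarrow> real)" by (induction n) (simp_all add: fun_eq_iff scaleR_fun_def)

text \<open>Linear independence almost everywhere is independence modulo energy-null vectors. In one
  direction gradients and traces are chosen for the given eigenfunctions; in the other, independence
  forces every member to be non-null, so that each one is an eigenpair.\<close>

lemma multiplicity_iff:
 "(\<exists>U. (\<forall>i<n. eigenpair \<Omega> w \<mu> (U i)) \<and> lin_indep_ae \<Omega> n U) \<longleftrightarrow>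
  (\<exists>U. (\<forall>i<n. U i \<in> sp.eigenspace \<mu>) \<and>
   (\<forall>c. energy (\<Sum>i<n. c i *\<^sub>R U i) (\<Sum>i<n. c i *\<^sub>R U i) = 0 \<longrightarrow> (\<forall>i<n. c i = 0)))"
proof -
 have key: "energy (\<Sum>i<n. c i *\<^sub>R P i) (\<Sum>i<n. c i *\<^sub>R P i) = 0 \<longleftrightarrow> (AE x in M. (\<Sum>i<n. c i * fst (P i) x) = 0)"
  if "\<forall>i<n. P i \<in> sp.eigenspace \<mu>" for P c
 proof -
  let ?p = "\<Sum>i<n. c i *\<^sub>R P i"
  have "?p \<in> cl.clos" using that
   by (intro subspace_sum[OF cl.subspace_clos] subspace_scale[OF cl.subspace_clos]) (simp add: sp.eigenspace_def)
  then have "(fst ?p, fst (snd ?p), snd (snd ?p)) \<in> triples" unfolding prod.collapse by (rule cl.clos_V)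
  from energy_null_iff[OF this] show ?thesis unfolding prod.collapse unfolding fst_sum_scaleR .
 qed
 show ?thesis
 proof
  assume "\<exists>U. (\<forall>i<n. eigenpair \<Omega> w \<mu> (U i)) \<and> lin_indep_ae \<Omega> n U"
  then obtain U where U: "\<forall>i<n. eigenpair \<Omega> w \<mu> (U i)" "lin_indep_ae \<Omega> n U" by blast
  have "\<forall>i. \<exists>p. i < n \<longrightarrow> p \<in> sp.eigenspace \<mu> \<and> fst p = U i"
  proof
   fix i show "\<exists>p. i < n \<longrightarrow> p \<in> sp.eigenspace \<mu> \<and> fst p = U i"
   proof (cases "i < n")
    case True
    then obtain G T where "(U i, G, T) \<in> sp.eigenspace \<mu>" using U(1) unfolding eigenpair_iff by blast
    then show ?thesis by (intro exI[of _ "(U i, G, T)"]) simp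
   qed simp
  qed
  from choice[OF this] obtain P where P: "\<forall>i. i < n \<longrightarrow> P i \<in> sp.eigenspace \<mu> \<and> fst (P i) = U i" ..
  have "\<forall>i<n. c i = 0" if z: "energy (\<Sum>i<n. c i *\<^sub>R P i) (\<Sum>i<n. c i *\<^sub>R P i) = 0" for c
  proof -
   have "AE x in M. (\<Sum>i<n. c i * fst (P i) x) = 0" using z key[of P c] P by simp
   moreover have "(\<Sum>i<n. c i * fst (P i) x) = (\<Sum>i<n. c i * U i x)" for x using P by (intro sum.cong) auto
   ultimately show ?thesis using U(2) by (simp add: lin_indep_ae_def)
  qed
  then show "\<exists>U. (\<forall>i<n. U i \<in> sp.eigenspace \<mu>) \<and>
    (\<forall>c. energy (\<Sum>i<n. c i *\<^sub>R U i) (\<Sum>i<n. c i *\<^sub>R U i) = 0 \<longrightarrow> (\<forall>i<n. c i = 0))" using P by (intro exI[of _ P]) simp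
 next
  assume "\<exists>U. (\<forall>i<n. U i \<in> sp.eigenspace \<mu>) \<and>
    (\<forall>c. energy (\<Sum>i<n. c i *\<^sub>R U i) (\<Sum>i<n. c i *\<^sub>R U i) = 0 \<longrightarrow> (\<forall>i<n. c i = 0))"
  then obtain P where P: "\<forall>i<n. P i \<in> sp.eigenspace \<mu>"
   and ind: "\<forall>c. energy (\<Sum>i<n. c i *\<^sub>R P i) (\<Sum>i<n. c i *\<^sub>R P i) = 0 \<longrightarrow> (\<forall>i<n. c i = 0)" by blast
  have "eigenpair \<Omega> w \<mu> (fst (P j))" if j: "j < n" for j
  proof -
   have "(\<Sum>i<n. (if i = j then 1 else 0) *\<^sub>R P i) = (\<Sum>i<n. if i = j then P i else 0)" by (intro sum.cong refl) simp
   also have "\<dots> = P j" using j by (simp add: sum.delta)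
   finally have "energy (P j) (P j) \<noteq> 0" using ind[rule_format, of "\<lambda>i. if i = j then 1 else 0" j] j by auto
   then show ?thesis unfolding eigenpair_iff
    using P j by (intro exI[of _ "fst (snd (P j))"] exI[of _ "snd (snd (P j))"]) simp
  qed
  moreover have "lin_indep_ae \<Omega> n (\<lambda>i. fst (P i))" using ind key[OF P] by (simp add: lin_indep_ae_def)
  ultimately show "\<exists>U. (\<forall>i<n. eigenpair \<Omega> w \<mu> (U i)) \<and> lin_indep_ae \<Omega> n U" by (intro exI[of _ "\<lambda>i. fst (P i)"]) simp
 qed
qed

lemma spectrum_eq: "{l. \<exists>u. eigenpair \<Omega> w l u} = {l. \<exists>p\<in>sp.eigenspace l. energy p p \<noteq> 0}"
proof -
 have "(\<exists>u. eigenpair \<Omega> w l u) \<longleftrightarrow> (\<exists>p\<in>sp.eigenspace l. energy p p \<noteq> 0)" for l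
  unfolding eigenpair_iff by (simp add: Bex_def split_paired_Ex)
 then show ?thesis by simp
qed

end

theorem theorem3p5:
  fixes e :: "'a::euclidean_space" and \<gamma> \<gamma>' :: "real \<Rightarrow> real"
  assumes dim: "DIM('a) \<ge> 2"
    and e: "e \<in> Basis"
    and cont: "continuous_on {0..1} \<gamma>"
    and incr: "strict_mono_on {0..1} \<gamma>"
    and deriv: "\<And>t. t \<in> {0<..<1} \<Longrightarrow> (\<gamma> has_real_derivative \<gamma>' t) (at t)"
    and g0: "\<gamma> 0 = 0" and g1: "\<gamma> 1 = 1"
    and dincr: "strict_mono_on {0<..<1} \<gamma>'"
    and dlim: "(\<gamma>' \<longlongrightarrow> 0) (at_right 0)"
  shows "\<exists>lam :: nat \<Rightarrow> real.
     0 < lam 0 \<and> mono lam \<and> filterlim lam at_top sequentially \<and>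
     {l. \<exists>u. eigenpair (cusp_dom e \<gamma>) (cusp_weight e \<gamma>) l u} = range lam \<and>
     (\<forall>\<mu> (m::nat). (\<exists>U. (\<forall>i<m. eigenpair (cusp_dom e \<gamma>) (cusp_weight e \<gamma>) \<mu> (U i))
                          \<and> lin_indep_ae (cusp_dom e \<gamma>) m U)
                  \<longleftrightarrow> m \<le> card {k. lam k = \<mu>})"
proof -
  interpret cusp e \<gamma> \<gamma>' by (rule cusp.intro) (fact dim e cont incr deriv g0 g1 dincr)+
  show ?thesis unfolding spectrum_eq multiplicity_iff by (rule sp.discrete_spectrum)
qed


end
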